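(* Let $W$ be a $d$-dimensional Brownian motion on its canonical space $(\Omega,\mathcal{F},\mathbb{P})$. Let $f$ be a locally bounded Lipschitz function from $\mathbb{R}^n$ to $\mathbb{R}^n$ and let $g$ be a locally bounded Lipschitz function from $\mathbb{R}^n$ to $M_{n\times d}(\mathbb{R})$. Consider the stochastic differential equation (on $\mathbb{R}^n$) $$X_t^x=x+\int_0^tf(X^x_u)\,du+\int_0^tg(X^x_u)\cdot dW_u .$$ Then the mappings $\widetilde T_t$ on $\mathbb{R}^n\times\Omega$ defined by $$\widetilde T_t(x,\omega)=\left(X^x_t(\omega),\theta_t(\omega)\right)$$ define a continuous-time dynamical system on $\mathbb{R}^n\times\Omega$, in the sense that there exists a null set $\mathcal{N}\subset\Omega$ such that for all $\omega\in\Omega\setminus\mathcal{N}$, for all $x\in\mathbb{R}^n$ and for all $s,t\in\mathbb{R}^+$ we have $$\widetilde T_t\circ\widetilde T_s(x,\omega)=\widetilde T_s\circ\widetilde T_t(x,\omega)=\widetilde T_{s+t}(x,\omega).$$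
   Context: Canonical space: $\Omega=C_0(\mathbb{R}^+;\mathbb{R}^d)$ is the space of continuous functions on $\mathbb{R}^+$ with values in $\mathbb{R}^d$ which vanish at $0$, equipped with the topology of uniform convergence on compact sets; $\mathcal{F}$ is the Borel $\sigma$-field of $\Omega$; $\mathbb{P}$ is the Wiener measure, i.e. the law of a $d$-dimensional Brownian motion on $\Omega$; and the canonical Brownian motion is $W_t(\omega)=\omega(t)$. For $s\in\mathbb{R}^+$ the shift $\theta_s:\Omega\to\Omega$ is defined by $\theta_s(\omega)(t)=\omega(t+s)-\omega(s)$. $M_{n\times d}(\mathbb{R})$ is the space of real $n\times d$ matrices. The equation is shorthand for $(X_t^x)^i=x^i+\int_0^tf(X^x_u)^i\,du+\sum_{j=1}^d\int_0^tg(X^x_u)^i_j\,dW^j_u$ for $i=1,\dots,n$. It admits a solution $X^x$, which is unique in the sense that any other process on $(\Omega,\mathcal{F},\mathbb{P})$ satisfying the same equation is almost surely identical to $X^x$; $X^x$ denotes this solution. A continuous-time dynamical system on a measurable space $(E,\mathcal{E})$ is a one-parameter family $(\widetilde T_t)_{t\in\mathbb{R}^+}$ of measurable functions on $E$ such that $\widetilde T_s\circ\widetilde T_t=\widetilde T_{s+t}$ for all $s,t$; here this relation is understood in the sense stated in the claim.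
   Formalization: Each solution X^x is determined only up to a null set depending on x, and for arbitrary versions the claim fails; what is proved is that versions of the solutions X^x can be chosen so that the mappings form a measurable dynamical system off a single null set. *)

theory Defs
  imports "HOL-Probability.Probability"
begin

section \<open>Canonical space\<close>

text \<open>
  Time is \<^typ>\<open>real\<close>, restricted to \<open>t \<ge> 0\<close>. Paths are total functions, so their values at
  negative times are fixed to be \<open>0\<close>; thus two elements of the space are equal iff they agree on
  \<open>[0, \<infinity>)\<close>.
\<close>

definition path_space :: "(real \<Rightarrow> real ^ 'd) set" where
  "path_space = {\<omega>. continuous_on {0..} \<omega> \<and> \<omega> 0 = 0 \<and> (\<forall>t<0. \<omega> t = 0)}"

definition ucc_open :: "(real \<Rightarrow> real ^ 'd) set \<Rightarrow> bool" where
  "ucc_open U \<longleftrightarrow> U \<subseteq> path_space \<and>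
     (\<forall>\<omega>\<in>U. \<exists>K e. compact K \<and> K \<subseteq> {0..} \<and> e > 0 \<and>
        {\<eta> \<in> path_space. \<forall>t\<in>K. dist (\<eta> t) (\<omega> t) < e} \<subseteq> U)"

lemma istopology_ucc_open: "istopology (ucc_open :: (real \<Rightarrow> real ^ 'd) set \<Rightarrow> bool)"
  unfolding istopology_def
proof (intro conjI allI impI)
  fix S T :: "(real \<Rightarrow> real ^ 'd) set"
  assume S: "ucc_open S" and T: "ucc_open T"
  show "ucc_open (S \<inter> T)"
    unfolding ucc_open_def
  proof (intro conjI ballI)
    show "S \<inter> T \<subseteq> path_space"
      using S by (auto simp: ucc_open_def)
  next
    fix \<omega> assume "\<omega> \<in> S \<inter> T"
    then have "\<omega> \<in> S" "\<omega> \<in> T" by auto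
    then obtain K e K' e' where
      K: "compact K" "K \<subseteq> {0..}" "e > 0"
         "{\<eta> \<in> path_space. \<forall>t\<in>K. dist (\<eta> t) (\<omega> t) < e} \<subseteq> S" and
      K': "compact K'" "K' \<subseteq> {0..}" "e' > 0"
         "{\<eta> \<in> path_space. \<forall>t\<in>K'. dist (\<eta> t) (\<omega> t) < e'} \<subseteq> T"
      using S T unfolding ucc_open_def by meson
    have "{\<eta> \<in> path_space. \<forall>t\<in>K \<union> K'. dist (\<eta> t) (\<omega> t) < min e e'} \<subseteq> S \<inter> T"
      using K(4) K'(4) by auto
    moreover have "compact (K \<union> K')" "K \<union> K' \<subseteq> {0..}" "min e e' > 0"
      using K K' by auto
    ultimately show "\<exists>K e. compact K \<and> K \<subseteq> {0..} \<and> e > 0 \<and>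
        {\<eta> \<in> path_space. \<forall>t\<in>K. dist (\<eta> t) (\<omega> t) < e} \<subseteq> S \<inter> T"
      by blast
  qed
next
  fix \<U> :: "(real \<Rightarrow> real ^ 'd) set set"
  assume U: "\<forall>U\<in>\<U>. ucc_open U"
  show "ucc_open (\<Union>\<U>)"
    unfolding ucc_open_def
  proof (intro conjI ballI)
    show "\<Union>\<U> \<subseteq> path_space"
      using U by (auto simp: ucc_open_def)
  next
    fix \<omega> assume "\<omega> \<in> \<Union>\<U>"
    then obtain V where V: "V \<in> \<U>" "\<omega> \<in> V" by blast
    then obtain K e where "compact K" "K \<subseteq> {0..}" "e > 0"
      "{\<eta> \<in> path_space. \<forall>t\<in>K. dist (\<eta> t) (\<omega> t) < e} \<subseteq> V"
      using U unfolding ucc_open_def by meson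
    with V show "\<exists>K e. compact K \<and> K \<subseteq> {0..} \<and> e > 0 \<and>
        {\<eta> \<in> path_space. \<forall>t\<in>K. dist (\<eta> t) (\<omega> t) < e} \<subseteq> \<Union>\<U>"
      by blast
  qed
qed

definition path_topology :: "(real \<Rightarrow> real ^ 'd) topology" where
  "path_topology = topology ucc_open"

lemma openin_path_topology: "openin path_topology U \<longleftrightarrow> ucc_open U"
  by (simp add: path_topology_def istopology_ucc_open)

lemma topspace_path_topology: "topspace path_topology = path_space"
proof -
  have "ucc_open path_space"
    unfolding ucc_open_def by (auto intro!: exI[of _ "{}"] exI[of _ "1::real"])
  then show ?thesis
    unfolding topspace_def openin_path_topology by (auto simp: ucc_open_def)
qed

definition path_borel :: "(real \<Rightarrow> real ^ 'd) measure" where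
  "path_borel = sigma path_space {U. openin path_topology U}"

definition path_shift :: "real \<Rightarrow> (real \<Rightarrow> real ^ 'd) \<Rightarrow> (real \<Rightarrow> real ^ 'd)" where
  "path_shift s \<omega> = (\<lambda>t. if t < 0 then 0 else \<omega> (t + s) - \<omega> s)"

lemma path_shift_in_path_space:
  assumes "\<omega> \<in> path_space" "s \<ge> 0"
  shows "path_shift s \<omega> \<in> path_space"
proof -
  have "continuous_on {0..} (\<lambda>t. \<omega> (t + s) - \<omega> s)"
    using assms by (auto simp: path_space_def
        intro!: continuous_intros continuous_on_compose2[of "{0..}" \<omega>])
  then have "continuous_on {0..} (path_shift s \<omega>)"
    by (rule continuous_on_eq) (auto simp: path_shift_def)
  then show ?thesis
    by (auto simp: path_space_def path_shift_def)
qed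


section \<open>Brownian motion and Wiener measure\<close>

definition brownian_motion :: "'a measure \<Rightarrow> (real \<Rightarrow> 'a \<Rightarrow> real ^ 'd) \<Rightarrow> bool" where
  "brownian_motion M B \<longleftrightarrow>
     prob_space M \<and>
     (\<forall>t\<ge>0. B t \<in> borel_measurable M) \<and>
     (AE \<omega> in M. B 0 \<omega> = 0) \<and>
     (AE \<omega> in M. continuous_on {0..} (\<lambda>t. B t \<omega>)) \<and>
     (\<forall>s t. 0 \<le> s \<longrightarrow> s < t \<longrightarrow>
        distributed M lborel (\<lambda>\<omega>. B t \<omega> - B s \<omega>)
          (\<lambda>y. ennreal (\<Prod>j\<in>UNIV. normal_density 0 (sqrt (t - s)) (y $ j)))) \<and>
     (\<forall>(k :: nat) \<tau>. 0 \<le> \<tau> 0 \<longrightarrow> (\<forall>i<k. \<tau> i < \<tau> (Suc i)) \<longrightarrow>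
        prob_space.indep_vars M (\<lambda>_. borel) (\<lambda>i \<omega>. B (\<tau> (Suc i)) \<omega> - B (\<tau> i) \<omega>) {..<k})"

text \<open>
  The Wiener measure is characterised as the Borel probability measure on the path space under
  which the coordinate process is a Brownian motion.
\<close>

definition wiener_measure :: "(real \<Rightarrow> real ^ 'd) measure \<Rightarrow> bool" where
  "wiener_measure P \<longleftrightarrow>
     space P = path_space \<and> sets P = sets path_borel \<and> brownian_motion P (\<lambda>t \<omega>. \<omega> t)"

text \<open>
  The Brownian filtration \<open>\<sigma>(W\<^sub>s, s \<le> t)\<close>, augmented by the measurable null sets, so that
  each \<open>brownian_filtration P t\<close> is a sub-\<open>\<sigma>\<close>-field of the (uncompleted) \<open>\<sigma>\<close>-field of \<open>P\<close>.
  Only its \<open>\<sigma>\<close>-fields are used, not the (zero) measure put on them by \<^const>\<open>sigma\<close>.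
\<close>

definition brownian_filtration ::
  "(real \<Rightarrow> real ^ 'd) measure \<Rightarrow> real \<Rightarrow> (real \<Rightarrow> real ^ 'd) measure" where
  "brownian_filtration P t =
     sigma (space P)
       ({{\<omega> \<in> space P. \<omega> s \<in> A} | s A. 0 \<le> s \<and> s \<le> t \<and> A \<in> sets borel} \<union> null_sets P)"


section \<open>Ito integral\<close>

text \<open>
  In this section \<open>F\<close> is a filtration, given by its \<open>\<sigma>\<close>-fields, and \<open>B\<close> a real-valued process.
  A step process \<open>\<Sum>i<m. \<xi> i * 1\<^bsub>(\<tau> i, \<tau> (i+1)]\<^esub>\<close> is represented by the triple \<open>m\<close>, \<open>\<tau>\<close>, \<open>\<xi>\<close>.
\<close>

definition step_process ::
  "(real \<Rightarrow> 'a measure) \<Rightarrow> 'a set \<Rightarrow> nat \<Rightarrow> (nat \<Rightarrow> real) \<Rightarrow> (nat \<Rightarrow> 'a \<Rightarrow> real) \<Rightarrow> bool" where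
  "step_process F \<Omega> m \<tau> \<xi> \<longleftrightarrow>
     0 \<le> \<tau> 0 \<and> (\<forall>i<m. \<tau> i < \<tau> (Suc i)) \<and>
     (\<forall>i<m. \<xi> i \<in> borel_measurable (F (\<tau> i)) \<and> (\<exists>C. \<forall>\<omega>\<in>\<Omega>. \<bar>\<xi> i \<omega>\<bar> \<le> C))"

definition step_value ::
  "nat \<Rightarrow> (nat \<Rightarrow> real) \<Rightarrow> (nat \<Rightarrow> 'a \<Rightarrow> real) \<Rightarrow> real \<Rightarrow> 'a \<Rightarrow> real" where
  "step_value m \<tau> \<xi> u \<omega> = (\<Sum>i<m. \<xi> i \<omega> * indicator {\<tau> i <.. \<tau> (Suc i)} u)"

definition step_integral ::
  "(real \<Rightarrow> 'a \<Rightarrow> real) \<Rightarrow> nat \<Rightarrow> (nat \<Rightarrow> real) \<Rightarrow> (nat \<Rightarrow> 'a \<Rightarrow> real) \<Rightarrow> real \<Rightarrow> 'a \<Rightarrow> real" where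
  "step_integral B m \<tau> \<xi> t \<omega> =
     (\<Sum>i<m. \<xi> i \<omega> * (B (min (\<tau> (Suc i)) t) \<omega> - B (min (\<tau> i) t) \<omega>))"

definition progressively_measurable ::
  "(real \<Rightarrow> 'a measure) \<Rightarrow> (real \<Rightarrow> 'a \<Rightarrow> real) \<Rightarrow> bool" where
  "progressively_measurable F H \<longleftrightarrow>
     (\<forall>t\<ge>0. (\<lambda>(u, \<omega>). H u \<omega>) \<in> borel_measurable (restrict_space borel {0..t} \<Otimes>\<^sub>M F t))"

text \<open>
  \<open>ito_integral P F B H I\<close>: the process \<open>I\<close> is a continuous version of \<open>\<integral>H dB\<close>. This is the
  usual extension by continuity in probability from step processes to progressively measurable
  integrands with \<open>\<integral>\<^sub>0\<^sup>t H\<^sup>2 du < \<infinity>\<close> almost surely for all \<open>t\<close> (which the approximation property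
  forces). The limit is only required at each fixed time; as \<open>I\<close> has continuous paths this
  determines it up to indistinguishability.
\<close>

definition ito_integral ::
  "'a measure \<Rightarrow> (real \<Rightarrow> 'a measure) \<Rightarrow> (real \<Rightarrow> 'a \<Rightarrow> real) \<Rightarrow>
   (real \<Rightarrow> 'a \<Rightarrow> real) \<Rightarrow> (real \<Rightarrow> 'a \<Rightarrow> real) \<Rightarrow> bool" where
  "ito_integral P F B H I \<longleftrightarrow>
     progressively_measurable F H \<and>
     (\<forall>t\<ge>0. I t \<in> borel_measurable (F t)) \<and>
     (\<forall>\<omega>\<in>space P. continuous_on {0..} (\<lambda>t. I t \<omega>)) \<and>
     (\<exists>m \<tau> \<xi>.
        (\<forall>k. step_process F (space P) (m k) (\<tau> k) (\<xi> k)) \<and>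
        (\<forall>t\<ge>0. \<forall>e>0.
           (\<lambda>k::nat. measure P {\<omega> \<in> space P.
              (\<integral>\<^sup>+u\<in>{0..t}. ennreal ((step_value (m k) (\<tau> k) (\<xi> k) u \<omega> - H u \<omega>)\<^sup>2) \<partial>lborel)
                > ennreal e}) \<longlonglongrightarrow> 0 \<and>
           (\<lambda>k. measure P {\<omega> \<in> space P.
              \<bar>step_integral B (m k) (\<tau> k) (\<xi> k) t \<omega> - I t \<omega>\<bar> > e}) \<longlonglongrightarrow> 0))"


section \<open>The stochastic differential equation\<close>

definition locally_bounded :: "('a::metric_space \<Rightarrow> 'b::metric_space) \<Rightarrow> bool" where
  "locally_bounded h \<longleftrightarrow> (\<forall>x. \<exists>e>0. bounded (h ` ball x e))"

text \<open>
  \<open>X t \<omega>\<close> is a solution started at \<open>x\<close> of \<open>dX = f(X) dt + g(X) dW\<close>, driven by the coordinate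
  process; \<open>J i j\<close> is the integral of \<open>g(X)\<^sup>i\<^sub>j\<close> against \<open>W\<^sup>j\<close>. The type \<open>real ^ 'd ^ 'n\<close> is that of
  matrices with rows indexed by \<open>'n\<close> and columns indexed by \<open>'d\<close>.
\<close>

definition sde_solution ::
  "(real \<Rightarrow> real ^ 'd) measure \<Rightarrow> (real ^ 'n \<Rightarrow> real ^ 'n) \<Rightarrow> (real ^ 'n \<Rightarrow> real ^ 'd ^ 'n) \<Rightarrow>
   real ^ 'n \<Rightarrow> (real \<Rightarrow> (real \<Rightarrow> real ^ 'd) \<Rightarrow> real ^ 'n) \<Rightarrow> bool" where
  "sde_solution P f g x X \<longleftrightarrow>
     (\<forall>t\<ge>0. X t \<in> borel_measurable (brownian_filtration P t)) \<and>
     (\<forall>\<omega>\<in>space P. continuous_on {0..} (\<lambda>t. X t \<omega>)) \<and>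
     (\<exists>J. (\<forall>i j. ito_integral P (brownian_filtration P) (\<lambda>t \<omega>. \<omega> t $ j)
                   (\<lambda>u \<omega>. g (X u \<omega>) $ i $ j) (J i j)) \<and>
          (AE \<omega> in P. \<forall>t\<ge>0. \<forall>i.
             X t \<omega> $ i = x $ i + integral {0..t} (\<lambda>u. f (X u \<omega>) $ i) + (\<Sum>j\<in>UNIV. J i j t \<omega>)))"

definition flow_map ::
  "(real ^ 'n \<Rightarrow> real \<Rightarrow> (real \<Rightarrow> real ^ 'd) \<Rightarrow> real ^ 'n) \<Rightarrow> real \<Rightarrow>
   (real ^ 'n) \<times> (real \<Rightarrow> real ^ 'd) \<Rightarrow> (real ^ 'n) \<times> (real \<Rightarrow> real ^ 'd)" where
  "flow_map X t = (\<lambda>(x, \<omega>). (X x t \<omega>, path_shift t \<omega>))"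

end

theory Submission
  imports Defs
begin

text \<open>
  The flow is built without the classical theory of stochastic integration, as the limit of Euler
  schemes with steps \<open>2 ^ - k\<close> started at an arbitrary time \<open>s\<close> from an arbitrary point \<open>x\<close> and run
  for a time \<open>t\<close>. Moment estimates for the schemes and for their refinements, combined with a
  chaining argument over dyadic nets in \<open>(s, t, x)\<close>, show that almost surely the schemes
  converge geometrically fast, uniformly on compact sets of \<open>(s, t, x)\<close>. As \<open>s\<close> is among the
  parameters, the set of paths with this property is invariant under all shifts. On it the scheme
  started at \<open>s\<close> along \<open>\<omega>\<close> is the one started at \<open>0\<close> along \<open>\<theta>\<^sub>s \<omega>\<close>, the schemes started at dyadic
  times concatenate, and continuity extends the resulting cocycle property to all \<open>s\<close> and \<open>t\<close>:
  a single null set serves for all \<open>x\<close>, \<open>s\<close>, \<open>t\<close>.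

  Uniqueness follows from a Gronwall argument: on the event where two solutions stay bounded, Ito
  integrals are limits in probability of left-point Riemann sums, to which the elementary
  isometry for step processes applies.
\<close>

section \<open>Wiener measure\<close>

text \<open>The obstacle is the order of quantifiers. Uniqueness of solutions gives the cocycle
  identity almost surely for each fixed s, t and x, with an exceptional set that depends on all
  three. That each shift preserves null sets does not help, since uncountably many shifts occur, and
  the inner starting point is random. All exceptional events are therefore gathered into the failure
  of a countable family of estimates at dyadic parameters, from which everything else follows path
  by path. This explains the high moments: level j of a net has about 2^(j (n + 2)) points, and a
  sum over the net is affordable once the moments decay faster than this. The regularity of a scheme
  in its parameters degrades like a power of 1/h. This does no harm, because the net may be much
  finer than the mesh while its size remains a power of 1/h. The stochastic integrals of the
  solution are themselves limits of schemes, for an enlarged equation, and so come with continuous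
  adapted versions.\<close>

locale wiener =
  fixes P :: "(real \<Rightarrow> real ^ 'd) measure"
  assumes wiener: "wiener_measure P"
begin

abbreviation F where "F \<equiv> brownian_filtration P"

lemma space_P: "space P = path_space" and sets_P: "sets P = sets path_borel"
  and brownian: "brownian_motion P (\<lambda>t \<omega>. \<omega> t)"
  using wiener by (auto simp: wiener_measure_def)

sublocale prob_space P
  using brownian by (simp add: brownian_motion_def)

lemma eval_measurable [measurable]: "t \<ge> 0 \<Longrightarrow> (\<lambda>\<omega>. \<omega> t) \<in> borel_measurable P"
  using brownian by (auto simp: brownian_motion_def)

lemma space_F [simp]: "space (F t) = space P"
  unfolding brownian_filtration_def
  by (intro space_measure_of) (auto dest: sets.sets_into_space)

lemma eval_sets: "0 \<le> s \<Longrightarrow> A \<in> sets borel \<Longrightarrow> {\<omega> \<in> space P. \<omega> s \<in> A} \<in> sets P"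
  using measurable_sets[OF eval_measurable, of s A] by (simp add: vimage_def Int_def conj_commute)

lemma increment_measurable: "0 \<le> a \<Longrightarrow> a \<le> b \<Longrightarrow> (\<lambda>\<omega>. \<omega> b - \<omega> a) \<in> borel_measurable P"
  by (intro borel_measurable_diff eval_measurable) auto

lemma F_gen_subset:
  "{{\<omega> \<in> space P. \<omega> s \<in> A} | s A. 0 \<le> s \<and> s \<le> t \<and> A \<in> sets borel} \<union> null_sets P \<subseteq> sets P"
  by (auto intro: eval_sets)

lemma sets_F: "sets (F t) = sigma_sets (space P)
  ({{\<omega> \<in> space P. \<omega> s \<in> A} | s A. 0 \<le> s \<and> s \<le> t \<and> A \<in> sets borel} \<union> null_sets P)"
  unfolding brownian_filtration_def
  by (intro sets_measure_of) (auto dest: sets.sets_into_space)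

lemma sets_F_subset: "sets (F t) \<subseteq> sets P"
  unfolding sets_F using F_gen_subset by (rule sets.sigma_sets_subset)

lemma F_mono: "s \<le> t \<Longrightarrow> sets (F s) \<subseteq> sets (F t)"
  unfolding sets_F
proof (intro sigma_sets_mono' Un_mono subset_refl subsetI)
  fix B assume "s \<le> t" "B \<in> {{\<omega> \<in> space P. \<omega> u \<in> A} | u A. 0 \<le> u \<and> u \<le> s \<and> A \<in> sets borel}"
  then obtain u A where "B = {\<omega> \<in> space P. \<omega> u \<in> A}" "0 \<le> u" "u \<le> t" "A \<in> sets borel" by auto
  then show "B \<in> {{\<omega> \<in> space P. \<omega> u \<in> A} | u A. 0 \<le> u \<and> u \<le> t \<and> A \<in> sets borel}" by blast
qed

lemma null_sets_F: "N \<in> null_sets P \<Longrightarrow> N \<in> sets (F t)"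
  unfolding sets_F by (rule sigma_sets.Basic) auto

lemma measurable_F_mono: "X \<in> measurable (F s) N \<Longrightarrow> s \<le> t \<Longrightarrow> X \<in> measurable (F t) N"
  by (auto simp: measurable_def dest: F_mono)

lemma measurable_F_P: "X \<in> measurable (F s) N \<Longrightarrow> X \<in> measurable P N"
  using sets_F_subset by (auto simp: measurable_def)

lemma eval_F: "0 \<le> s \<Longrightarrow> s \<le> t \<Longrightarrow> (\<lambda>\<omega>. \<omega> s) \<in> borel_measurable (F t)"
proof (rule measurableI)
  fix A :: "(real ^ 'd) set" assume "0 \<le> s" "s \<le> t" "A \<in> sets borel"
  moreover have "(\<lambda>\<omega>. \<omega> s) -` A \<inter> space (F t) = {\<omega> \<in> space P. \<omega> s \<in> A}" by auto
  ultimately show "(\<lambda>\<omega>. \<omega> s) -` A \<inter> space (F t) \<in> sets (F t)"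
    unfolding sets_F by (intro sigma_sets.Basic) blast
qed simp

text \<open>The shift is continuous for uniform convergence on compacts, so preimages of the
  generating open sets are again open.\<close>

lemma shift_measurable [measurable]:
  assumes "s \<ge> 0"
  shows "path_shift s \<in> measurable P P"
proof -
  have cong: "measurable P P = measurable P path_borel"
    by (rule measurable_cong_sets) (simp_all add: sets_P)
  have pb: "path_borel = sigma path_space {U. openin (path_topology :: (real \<Rightarrow> real^'d) topology) U}"
    "{U. openin (path_topology :: (real \<Rightarrow> real^'d) topology) U} \<subseteq> Pow path_space"
    by (auto simp: path_borel_def openin_path_topology ucc_open_def)
  show ?thesis
    unfolding cong pb(1)
  proof (rule measurable_measure_of[OF pb(2)])
    show "path_shift s \<in> space P \<rightarrow> path_space"
      using assms by (auto simp: space_P path_shift_in_path_space)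
    fix U :: "(real \<Rightarrow> real^'d) set" assume "U \<in> {U. openin path_topology U}"
    then have U: "ucc_open U" by (simp add: openin_path_topology)
    have "ucc_open (path_shift s -` U \<inter> path_space)"
      unfolding ucc_open_def
    proof (intro conjI ballI)
      fix \<omega> assume w: "\<omega> \<in> path_shift s -` U \<inter> path_space"
      then have "path_shift s \<omega> \<in> U" by simp
      then obtain K e where K: "compact K" "K \<subseteq> {0..}" "e > 0"
        "{\<eta> \<in> path_space. \<forall>t\<in>K. dist (\<eta> t) (path_shift s \<omega> t) < e} \<subseteq> U"
        using U unfolding ucc_open_def by blast
      \<comment> \<open>A shifted path at \<open>t\<close> involves the path at \<open>t + s\<close>
        and at \<open>s\<close>, hence the extra point \<open>s\<close> and the radius
        \<open>e / 2\<close>.\<close>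
      define K' where "K' = insert s ((\<lambda>t. t + s) ` K)"
      have "{\<eta> \<in> path_space. \<forall>t\<in>K'. dist (\<eta> t) (\<omega> t) < e / 2} \<subseteq> path_shift s -` U \<inter> path_space"
      proof safe
        fix \<eta> assume e: "\<eta> \<in> path_space" "\<forall>t\<in>K'. dist (\<eta> t) (\<omega> t) < e / 2"
        have "dist (path_shift s \<eta> t) (path_shift s \<omega> t) < e" if "t \<in> K" for t
        proof -
          have "dist (\<eta> (t + s)) (\<omega> (t + s)) < e / 2" "dist (\<eta> s) (\<omega> s) < e / 2"
            using e(2) that by (auto simp: K'_def)
          moreover have "dist (\<eta> (t+s) - \<eta> s) (\<omega> (t+s) - \<omega> s) \<le> dist (\<eta> (t + s)) (\<omega> (t + s)) + dist (\<eta> s) (\<omega> s)"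
            using norm_triangle_ineq4[of "\<eta> (t+s) - \<omega> (t+s)" "\<eta> s - \<omega> s"] by (simp add: dist_norm algebra_simps)
          ultimately show ?thesis
            using K(2) that \<open>e > 0\<close> by (auto simp: path_shift_def)
        qed
        then show "\<eta> \<in> path_shift s -` U"
          using K(4) path_shift_in_path_space[OF e(1) assms] by blast
      qed
      moreover have "compact K'" "K' \<subseteq> {0..}" "e / 2 > 0"
        using K assms unfolding K'_def
        by (auto intro!: compact_insert compact_continuous_image continuous_intros)
      ultimately show "\<exists>K e. compact K \<and> K \<subseteq> {0..} \<and> e > 0 \<and>
        {\<eta> \<in> path_space. \<forall>t\<in>K. dist (\<eta> t) (\<omega> t) < e} \<subseteq> path_shift s -` U \<inter> path_space" by blast
    qed auto
    then show "path_shift s -` U \<inter> space P \<in> sets P"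
      unfolding sets_P space_P pb(1) sets_measure_of[OF pb(2)]
      by (intro sigma_sets.Basic) (simp add: openin_path_topology)
  qed
qed

section \<open>Independence of increments from the past\<close>

text \<open>\<open>brownian_motion\<close> speaks only of successive increments along an increasing
  sequence of times. The times of the cylinder are therefore sorted: positions at these times are
  partial sums of the increments before \<open>a\<close>, because paths start at 0, and the
  increment from \<open>a\<close> to \<open>b\<close> is the last one.\<close>

lemma indep_cylinder:
  assumes S: "finite S" "S \<subseteq> {0..a}" "\<And>s. C s \<in> sets borel" and ab: "0 \<le> a" "a < b" "D \<in> sets borel"
  shows "prob ({\<omega>\<in>space P. \<forall>s\<in>S. \<omega> s \<in> C s} \<inter> {\<omega>\<in>space P. \<omega> b - \<omega> a \<in> D}) =
    prob {\<omega>\<in>space P. \<forall>s\<in>S. \<omega> s \<in> C s} * prob {\<omega>\<in>space P. \<omega> b - \<omega> a \<in> D}"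
proof -
  \<comment> \<open>Time 0 turns positions into sums of increments; time \<open>a\<close> makes the
    last increment start at \<open>a\<close>.\<close>
  define S' where "S' = insert 0 (insert a S)"
  define L where "L = sorted_list_of_set S'"
  have fin: "finite S'" using S by (simp add: S'_def)
  have L: "set L = S'" "sorted L" "distinct L" "length L = card S'"
    unfolding L_def using fin by auto
  define \<tau> where "\<tau> = (\<lambda>i. (L @ [b]) ! i)"
  define k where "k = length L"
  have "L \<noteq> []" using L(1) by (auto simp: S'_def)
  then have k: "k \<ge> 1" by (cases L) (auto simp: k_def)
  have srt: "sorted_wrt (<) (L @ [b])"
    using L(2,3) strict_sorted_iff[of L] S(2) ab by (auto simp: sorted_wrt_append L(1) S'_def)
  have \<tau>_less: "\<tau> i < \<tau> j" if "i < j" "j \<le> k" for i j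
    unfolding \<tau>_def using sorted_wrt_nth_less[OF srt that(1)] that by (simp add: k_def)
  have ex\<tau>: "\<exists>i<k. \<tau> i = s" if "s \<in> S'" for s
    using that L(1) unfolding \<tau>_def k_def by (metis in_set_conv_nth nth_append)
  have \<tau>S: "\<tau> i \<in> S'" if "i < k" for i
    using that L(1) unfolding \<tau>_def k_def by (metis nth_append nth_mem)
  have ge0: "s \<ge> 0" "s \<le> a" if "s \<in> S'" for s using that S(2) ab by (auto simp: S'_def)
  have \<tau>0: "\<tau> 0 = 0"
  proof -
    obtain i where i: "i < k" "\<tau> i = 0" using ex\<tau>[of 0] by (auto simp: S'_def)
    with \<tau>_less[of 0 i] ge0(1)[OF \<tau>S[of 0]] k show ?thesis by (cases "i = 0") auto
  qed
  have \<tau>k: "\<tau> k = b" by (simp add: \<tau>_def k_def)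
  have \<tau>k1: "\<tau> (k - 1) = a"
  proof -
    obtain i where i: "i < k" "\<tau> i = a" using ex\<tau>[of a] by (auto simp: S'_def)
    have "\<tau> (k - 1) \<le> \<tau> i" using ge0(2)[OF \<tau>S[of "k - 1"]] k i by simp
    with \<tau>_less[of i "k - 1"] i have "\<not> i < k - 1" by auto
    with i have "i = k - 1" by simp
    then show ?thesis using i by simp
  qed
  define X where "X = (\<lambda>i (\<omega>::real \<Rightarrow> real^'d). \<omega> (\<tau> (Suc i)) - \<omega> (\<tau> i))"
  have "indep_vars (\<lambda>_. borel) X {..<k}"
    using brownian \<tau>_less \<tau>0 unfolding brownian_motion_def X_def by auto
  then have ind: "indep_var (PiM {..<k-1} (\<lambda>_. borel)) (\<lambda>\<omega>. restrict (\<lambda>i. X i \<omega>) {..<k-1})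
     (PiM {k-1} (\<lambda>_. borel)) (\<lambda>\<omega>. restrict (\<lambda>i. X i \<omega>) {k-1})"
    by (rule indep_var_restrict) (use k in auto)
  obtain m where m: "\<And>s. s \<in> S \<Longrightarrow> m s < k \<and> \<tau> (m s) = s"
    using ex\<tau> by (metis S'_def insertCI)
  define A where "A = {x \<in> space (PiM {..<k-1} (\<lambda>_. borel)). \<forall>s\<in>S. (\<Sum>i<m s. x i :: real^'d) \<in> C s}"
  define B where "B = {x \<in> space (PiM {k-1} (\<lambda>_. borel)). (x (k-1) :: real^'d) \<in> D}"
  have Am: "A \<in> sets (PiM {..<k-1} (\<lambda>_. borel))"
    unfolding A_def
  proof (intro sets.sets_Collect_finite_All S(1))
    fix s assume s: "s \<in> S"
    have "(\<lambda>x. \<Sum>i<m s. x i) \<in> borel_measurable (PiM {..<k-1} (\<lambda>_. borel :: (real^'d) measure))"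
      using m[OF s] by (intro borel_measurable_sum measurable_component_singleton) auto
    from measurable_sets[OF this S(3)[of s]]
    have "(\<lambda>x. \<Sum>i<m s. x i) -` C s \<inter> space (PiM {..<k-1} (\<lambda>_. borel)) \<in> sets (PiM {..<k-1} (\<lambda>_. borel))" .
    also have "(\<lambda>x. \<Sum>i<m s. x i) -` C s \<inter> space (PiM {..<k-1} (\<lambda>_. borel)) =
        {x \<in> space (PiM {..<k-1} (\<lambda>_. borel)). (\<Sum>i<m s. x i) \<in> C s}" by blast
    finally show "{x \<in> space (PiM {..<k-1} (\<lambda>_. borel)). (\<Sum>i<m s. x i :: real^'d) \<in> C s} \<in> sets (PiM {..<k-1} (\<lambda>_. borel))" .
  qed
  have Bm: "B \<in> sets (PiM {k-1} (\<lambda>_. borel))"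
    unfolding B_def using ab(3)
    using measurable_sets[OF measurable_component_singleton[of "k - 1" "{k - 1}" "\<lambda>_. borel :: (real^'d) measure"], of D]
    by (simp add: vimage_def Int_def conj_commute)
  have tele: "(\<Sum>i<j. X i \<omega>) = \<omega> (\<tau> j)" if "\<omega> \<in> space P" for j \<omega>
    using that sum_lessThan_telescope[of "\<lambda>i. \<omega> (\<tau> i)" j] by (simp add: X_def \<tau>0 space_P path_space_def)
  have e1: "(\<lambda>\<omega>. restrict (\<lambda>i. X i \<omega>) {..<k-1}) -` A \<inter> space P = {\<omega>\<in>space P. \<forall>s\<in>S. \<omega> s \<in> C s}" (is "?L = _")
  proof -
    have "(\<Sum>i<m s. restrict (\<lambda>i. X i \<omega>) {..<k-1} i) = \<omega> s" if "s \<in> S" "\<omega> \<in> space P" for s \<omega>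
    proof -
      have "(\<Sum>i<m s. restrict (\<lambda>i. X i \<omega>) {..<k-1} i) = (\<Sum>i<m s. X i \<omega>)"
        using m[OF that(1)] by (intro sum.cong) auto
      then show ?thesis using tele[OF that(2)] m[OF that(1)] by simp
    qed
    then show ?thesis by (auto simp: A_def space_PiM)
  qed
  have e2: "(\<lambda>\<omega>. restrict (\<lambda>i. X i \<omega>) {k-1}) -` B \<inter> space P = {\<omega>\<in>space P. \<omega> b - \<omega> a \<in> D}"
    using k \<tau>k \<tau>k1 by (auto simp: B_def X_def space_PiM)
  show ?thesis
    using indep_varD[OF ind Am Bm] unfolding e1[symmetric] e2[symmetric]
    by (simp add: vimage_def Int_def conj_ac)
qed

text \<open>A \<pi>-system argument. \<open>G\<close> consists of the events that agree almost
  surely with a cylinder, so that it is stable under intersections and yet contains the null sets by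
  which the filtration is augmented.\<close>

lemma indep_set_increment:
  assumes ab: "0 \<le> a" "a < b"
  shows "indep_set (sets (F a)) {(\<lambda>\<omega>. \<omega> b - \<omega> a) -` D \<inter> space P | D. D \<in> sets borel}"
proof -
  define G where "G = {A \<in> sets P. \<exists>S C. finite S \<and> S \<subseteq> {0..a} \<and> (\<forall>s. C s \<in> sets borel) \<and>
     (AE \<omega> in P. \<omega> \<in> A \<longleftrightarrow> (\<forall>s\<in>S. \<omega> s \<in> C s))}"
  define H where "H = {(\<lambda>\<omega>. \<omega> b - \<omega> a) -` D \<inter> space P | D. D \<in> sets borel}"
  have meas: "(\<lambda>\<omega>. \<omega> b - \<omega> a) \<in> borel_measurable P" using ab by (intro increment_measurable) auto
  have cyl: "{\<omega>\<in>space P. \<forall>s\<in>S. \<omega> s \<in> C s} \<in> sets P" if "finite S" "S \<subseteq> {0..a}" "\<forall>s. C s \<in> sets borel" for S C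
    using that by (intro sets.sets_Collect_finite_All eval_sets) auto
  have "indep_set G H"
  proof (rule indep_setI)
    show "G \<subseteq> events" by (auto simp: G_def)
    show "H \<subseteq> events" using meas by (auto simp: H_def)
    fix A B assume A: "A \<in> G" and B: "B \<in> H"
    from A obtain S C where SC: "finite S" "S \<subseteq> {0..a}" "\<forall>s. C s \<in> sets borel"
      "AE \<omega> in P. \<omega> \<in> A \<longleftrightarrow> (\<forall>s\<in>S. \<omega> s \<in> C s)" and Am: "A \<in> sets P"
      by (auto simp: G_def)
    from B obtain D where D: "D \<in> sets borel" "B = (\<lambda>\<omega>. \<omega> b - \<omega> a) -` D \<inter> space P" by (auto simp: H_def)
    have D2: "B = {\<omega>\<in>space P. \<omega> b - \<omega> a \<in> D}" using D(2) by auto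
    have Bm: "B \<in> sets P" using meas D by auto
    let ?A = "{\<omega>\<in>space P. \<forall>s\<in>S. \<omega> s \<in> C s}"
    have "prob A = prob ?A"
      using SC cyl[OF SC(1-3)] Am by (intro finite_measure_eq_AE) auto
    moreover have "prob (A \<inter> B) = prob (?A \<inter> B)"
      using SC cyl[OF SC(1-3)] Am Bm by (intro finite_measure_eq_AE) (auto intro: sets.Int)
    ultimately show "prob (A \<inter> B) = prob A * prob B"
      using indep_cylinder[of S a C b D] SC ab D(1) unfolding D2 by simp
  qed
  moreover have "Int_stable G"
  proof (rule Int_stableI)
    fix A B assume "A \<in> G" "B \<in> G"
    then obtain S C S' C' where SC: "finite S" "S \<subseteq> {0..a}" "\<forall>s. C s \<in> sets borel"
      "AE \<omega> in P. \<omega> \<in> A \<longleftrightarrow> (\<forall>s\<in>S. \<omega> s \<in> C s)" "A \<in> sets P"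
      and SC': "finite S'" "S' \<subseteq> {0..a}" "\<forall>s. C' s \<in> sets borel"
      "AE \<omega> in P. \<omega> \<in> B \<longleftrightarrow> (\<forall>s\<in>S'. \<omega> s \<in> C' s)" "B \<in> sets P"
      by (auto simp: G_def)
    define C'' where "C'' = (\<lambda>s. (if s \<in> S then C s else UNIV) \<inter> (if s \<in> S' then C' s else UNIV))"
    have "AE \<omega> in P. \<omega> \<in> A \<inter> B \<longleftrightarrow> (\<forall>s\<in>S \<union> S'. \<omega> s \<in> C'' s)"
      using SC(4) SC'(4) by eventually_elim (auto simp: C''_def)
    moreover have "\<forall>s. C'' s \<in> sets borel" using SC SC' by (auto simp: C''_def)
    ultimately show "A \<inter> B \<in> G"
      using SC SC' unfolding G_def by (intro CollectI conjI exI[of _ "S \<union> S'"] exI[of _ C'']) auto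
  qed
  moreover have "Int_stable H"
  proof (rule Int_stableI)
    fix A B assume "A \<in> H" "B \<in> H"
    then obtain D D' where "D \<in> sets borel" "D' \<in> sets borel" "A = (\<lambda>\<omega>. \<omega> b - \<omega> a) -` D \<inter> space P"
      "B = (\<lambda>\<omega>. \<omega> b - \<omega> a) -` D' \<inter> space P" by (auto simp: H_def)
    then show "A \<inter> B \<in> H" unfolding H_def by (intro CollectI exI[of _ "D \<inter> D'"]) auto
  qed
  ultimately have "indep_set (sigma_sets (space P) G) (sigma_sets (space P) H)"
    by (rule indep_set_sigma_sets)
  moreover have "sets (F a) \<subseteq> sigma_sets (space P) G"
    unfolding sets_F
  proof (rule sigma_sets_mono', safe)
    fix s A assume "0 \<le> s" "s \<le> a" "(A :: (real^'d) set) \<in> sets borel"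
    then show "{\<omega> \<in> space P. \<omega> s \<in> A} \<in> G"
      unfolding G_def by (intro CollectI conjI exI[of _ "{s}"] exI[of _ "\<lambda>_. A"] eval_sets) auto
  next
    fix N assume "N \<in> null_sets P"
    then show "N \<in> G"
      \<comment> \<open>A null set agrees almost surely with the empty cylinder, whose constraint at
        time 0 is the empty set.\<close>
      unfolding G_def using AE_not_in[of N P] ab
      by (intro CollectI conjI exI[of _ "{0}"] exI[of _ "\<lambda>_. {}"]) auto
  qed
  moreover have "H \<subseteq> sigma_sets (space P) H" by blast
  ultimately have "indep_set (sets (F a)) H"
    unfolding indep_sets2_eq by blast
  then show ?thesis by (simp add: H_def)
qed

text \<open>The case \<open>a = b\<close> is separate because \<open>brownian_motion\<close>
  describes proper increments only; there the second variable is constant and generates the trivial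
  \<sigma>-algebra.\<close>

lemma indep_increment:
  fixes \<phi> :: "real^'d \<Rightarrow> real"
  assumes ab: "0 \<le> a" "a \<le> b" and U: "U \<in> borel_measurable (F a)" and V: "\<phi> \<in> borel_measurable borel"
  shows "indep_var borel U borel (\<lambda>\<omega>. \<phi> (\<omega> b - \<omega> a))"
proof (cases "a = b")
  case True
  have "indep_var borel U borel (\<lambda>\<omega>. \<phi> 0)"
    unfolding indep_var_eq
  proof (intro conjI indep_setI)
    show "U \<in> borel_measurable P" by (rule measurable_F_P[OF U])
    then show "sigma_sets (space P) {U -` A \<inter> space P |A. A \<in> sets borel} \<subseteq> sets P"
      by (intro sets.sigma_sets_subset) auto
    have *: "B \<in> {{}, space P}" if "B \<in> sigma_sets (space P) {(\<lambda>\<omega>. \<phi> 0) -` A \<inter> space P |A. A \<in> sets borel}" for B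
      using that
    proof induction
      case (Basic a)
      then obtain A where "a = (\<lambda>\<omega>. \<phi> 0) -` A \<inter> space P" by blast
      then show ?case by (cases "\<phi> 0 \<in> A") auto
    next
      case (Union a)
      then have "\<And>i. a i \<in> {{}, space P}" by blast
      then show ?case by blast
    qed auto
    then show "sigma_sets (space P) {(\<lambda>\<omega>. \<phi> 0) -` A \<inter> space P |A. A \<in> sets borel} \<subseteq> sets P" by blast
    fix A B assume "A \<in> sigma_sets (space P) {U -` A \<inter> space P |A. A \<in> sets borel}"
      and B: "B \<in> sigma_sets (space P) {(\<lambda>\<omega>. \<phi> 0) -` A \<inter> space P |A. A \<in> sets borel}"
    with \<open>sigma_sets (space P) {U -` A \<inter> space P |A. A \<in> sets borel} \<subseteq> sets P\<close> have "A \<in> sets P" by blast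
    with *[OF B] show "prob (A \<inter> B) = prob A * prob B" by (auto simp: prob_space)
  qed auto
  then show ?thesis using True by simp
next
  case False
  with ab have ab': "a < b" by simp
  have meas: "(\<lambda>\<omega>. \<omega> b - \<omega> a) \<in> borel_measurable P" using ab by (intro increment_measurable) auto
  let ?H = "{(\<lambda>\<omega>. \<omega> b - \<omega> a) -` D \<inter> space P | D. D \<in> sets borel}"
  have "sigma_sets (space P) {(\<lambda>\<omega>. \<phi> (\<omega> b - \<omega> a)) -` A \<inter> space P |A. A \<in> sets borel} \<subseteq> ?H"
  proof
    have sa: "sigma_algebra (space P) ?H"
      using sets.sigma_algebra_axioms[of "vimage_algebra (space P) (\<lambda>\<omega>. \<omega> b - \<omega> a) borel"]
      by (simp add: sets_vimage_algebra2)
    fix B assume "B \<in> sigma_sets (space P) {(\<lambda>\<omega>. \<phi> (\<omega> b - \<omega> a)) -` A \<inter> space P |A. A \<in> sets borel}"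
    moreover have "{(\<lambda>\<omega>. \<phi> (\<omega> b - \<omega> a)) -` A \<inter> space P |A. A \<in> sets borel} \<subseteq> ?H"
    proof safe
      fix A :: "real set" assume A: "A \<in> sets borel"
      have "(\<lambda>\<omega>. \<phi> (\<omega> b - \<omega> a)) -` A \<inter> space P = (\<lambda>\<omega>. \<omega> b - \<omega> a) -` (\<phi> -` A) \<inter> space P" by auto
      moreover have "\<phi> -` A \<in> sets borel" using measurable_sets[OF V A] by simp
      ultimately show "\<exists>D. (\<lambda>\<omega>. \<phi> (\<omega> b - \<omega> a)) -` A \<inter> space P = (\<lambda>\<omega>. \<omega> b - \<omega> a) -` D \<inter> space P \<and> D \<in> sets borel" by blast
    qed
    ultimately show "B \<in> ?H" using sigma_algebra.sigma_sets_subset[OF sa] by blast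
  qed
  moreover have "sigma_sets (space P) {U -` A \<inter> space P |A. A \<in> sets borel} \<subseteq> sets (F a)"
    using U sets.sigma_sets_subset[of "{U -` A \<inter> space P |A. A \<in> sets borel}" "F a"] by (auto simp: measurable_def)
  moreover have "(\<lambda>\<omega>. \<phi> (\<omega> b - \<omega> a)) \<in> borel_measurable P"
    using measurable_compose[OF meas V] .
  moreover have "?H \<subseteq> sets P" using measurable_sets[OF meas] by blast
  ultimately show ?thesis
    unfolding indep_var_eq using measurable_F_P[OF U] sets_F_subset[of a]
    by (intro conjI indep_setI indep_setD[OF indep_set_increment[OF ab(1) ab']])
      (assumption | erule subsetD[rotated] | erule subset_trans)+
qed

text \<open>Stands in for conditioning on \<open>F a\<close>: the martingale arguments below rest on
  this factorisation instead of conditional expectations.\<close>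

lemma expectation_mult_increment:
  fixes \<phi> :: "real^'d \<Rightarrow> real"
  assumes ab: "0 \<le> a" "a \<le> b" and U: "U \<in> borel_measurable (F a)" "integrable P U"
    and V: "\<phi> \<in> borel_measurable borel" "integrable P (\<lambda>\<omega>. \<phi> (\<omega> b - \<omega> a))"
  shows "integrable P (\<lambda>\<omega>. U \<omega> * \<phi> (\<omega> b - \<omega> a))"
    "expectation (\<lambda>\<omega>. U \<omega> * \<phi> (\<omega> b - \<omega> a)) = expectation U * expectation (\<lambda>\<omega>. \<phi> (\<omega> b - \<omega> a))"
  using indep_var_integrable[OF indep_increment[OF ab U(1) V(1)] U(2) V(2)]
    indep_var_lebesgue_integral[OF indep_increment[OF ab U(1) V(1)] U(2) V(2)] by auto

section \<open>Gaussian moments of the increments\<close>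

text \<open>The joint density is a product, so by Tonelli the other coordinates integrate to
  1.\<close>

lemma increment_distributed:
  assumes "0 \<le> a" "a < b"
  shows "distributed P lborel (\<lambda>\<omega>. (\<omega> b - \<omega> a) $ j) (normal_density 0 (sqrt (b - a)))"
proof -
  let ?\<phi> = "\<lambda>y::real. ennreal (normal_density 0 (sqrt (b - a)) y)"
  have D: "distributed P lborel (\<lambda>\<omega>. \<omega> b - \<omega> a)
          (\<lambda>y. ennreal (\<Prod>j\<in>UNIV. normal_density 0 (sqrt (b - a)) (y $ j)))"
    using brownian assms by (auto simp: brownian_motion_def)
  have one: "(\<integral>\<^sup>+y. ?\<phi> y \<partial>lborel) = 1"
    using prob_space.emeasure_space_1[OF prob_space_normal_density, of "sqrt (b-a)" 0] assms
    by (simp add: emeasure_density)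
  have "emeasure (distr P lborel (\<lambda>\<omega>. (\<omega> b - \<omega> a) $ j)) A = emeasure (density lborel ?\<phi>) A" if A: "A \<in> sets borel" for A
  proof -
    have "(\<lambda>\<omega>. (\<omega> b - \<omega> a)) \<in> borel_measurable P" using assms by (intro increment_measurable) auto
    then have meas: "(\<lambda>\<omega>. (\<omega> b - \<omega> a) $ j) \<in> borel_measurable P" by (rule measurable_compose[OF _ borel_measurable_nth])
    have nth: "{y::real^'d. y $ j \<in> A} \<in> sets borel"
      using measurable_sets[OF borel_measurable_continuous_onI[OF continuous_on_component[OF continuous_on_id]] A, of j]
      by (simp add: vimage_def)
    have "emeasure (distr P lborel (\<lambda>\<omega>. (\<omega> b - \<omega> a) $ j)) A = emeasure P {\<omega> \<in> space P. (\<omega> b - \<omega> a) $ j \<in> A}"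
      using A meas by (subst emeasure_distr) (simp_all add: vimage_def Int_def conj_commute del: vector_minus_component)
    also have "\<dots> = emeasure P ((\<lambda>\<omega>. \<omega> b - \<omega> a) -` {y. y $ j \<in> A} \<inter> space P)"
      by (intro arg_cong[where f="emeasure P"]) auto
    also have "\<dots> = (\<integral>\<^sup>+y. ennreal (\<Prod>j\<in>UNIV. normal_density 0 (sqrt (b - a)) (y $ j)) * indicator {y::real^'d. y $ j \<in> A} y \<partial>lborel)"
      using nth by (intro distributed_emeasure[OF D]) simp
    \<comment> \<open>The event constrains coordinate \<open>j\<close> alone; writing it as a factor
      1 in the other coordinates makes the integrand a product.\<close>
    also have "\<dots> = (\<integral>\<^sup>+y. (\<Prod>i\<in>UNIV. ?\<phi> (y $ i) * (if i = j then indicator A (y $ i) else 1)) \<partial>(lborel :: (real^'d) measure))"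
    proof (intro nn_integral_cong)
      fix y :: "real^'d"
      have "(\<Prod>i\<in>UNIV. if i = j then indicator A (y $ i) else 1 :: ennreal) = indicator {y. y $ j \<in> A} y"
        by (simp add: indicator_def)
      moreover have "ennreal (\<Prod>i\<in>UNIV. normal_density 0 (sqrt (b - a)) (y $ i)) = (\<Prod>i\<in>UNIV. ?\<phi> (y $ i))"
        by (intro prod_ennreal[symmetric]) simp
      ultimately show "ennreal (\<Prod>i\<in>UNIV. normal_density 0 (sqrt (b - a)) (y $ i)) * indicator {y. y $ j \<in> A} y =
        (\<Prod>i\<in>UNIV. ?\<phi> (y $ i) * (if i = j then indicator A (y $ i) else 1))"
        by (simp only: prod.distrib)
    qed
    also have "\<dots> = (\<integral>\<^sup>+y. (\<Prod>e\<in>Basis. ?\<phi> (y \<bullet> e) * (if e = axis j 1 then indicator A (y \<bullet> e) else 1)) \<partial>(lborel :: (real^'d) measure))"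
    proof (intro nn_integral_cong)
      fix y :: "real^'d"
      have B: "Basis = (\<lambda>i. axis i (1::real)) ` (UNIV :: 'd set)" by (auto simp: Basis_vec_def)
      have inj: "inj (\<lambda>i::'d. axis i (1::real))" by (auto simp: inj_on_def axis_eq_axis)
      show "(\<Prod>i\<in>UNIV. ?\<phi> (y $ i) * (if i = j then indicator A (y $ i) else 1)) =
        (\<Prod>e\<in>Basis. ?\<phi> (y \<bullet> e) * (if e = axis j 1 then indicator A (y \<bullet> e) else 1))"
        unfolding B by (subst prod.reindex[OF inj]) (auto simp: inner_axis axis_eq_axis intro!: prod.cong)
    qed
    also have "\<dots> = (\<Prod>e\<in>(Basis :: (real^'d) set). (\<integral>\<^sup>+y. ?\<phi> y * (if e = axis j 1 then indicator A y else 1) \<partial>lborel))"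
      using A by (intro nn_integral_lborel_prod) auto
    also have "\<dots> = (\<Prod>e\<in>(Basis :: (real^'d) set). if e = axis j 1 then (\<integral>\<^sup>+y. ?\<phi> y * indicator A y \<partial>lborel) else 1)"
      by (rule prod.cong[OF refl]) (simp add: one)
    also have "\<dots> = (\<integral>\<^sup>+y. ?\<phi> y * indicator A y \<partial>lborel)"
      by (subst prod.delta) (auto simp: axis_in_Basis_iff)
    also have "\<dots> = emeasure (density lborel ?\<phi>) A"
      using A by (simp add: emeasure_density)
    finally show ?thesis .
  qed
  then have "distr P lborel (\<lambda>\<omega>. (\<omega> b - \<omega> a) $ j) = density lborel ?\<phi>"
    by (intro measure_eqI) auto
  moreover have "(\<lambda>\<omega>. (\<omega> b - \<omega> a) $ j) \<in> borel_measurable P"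
    using assms by (intro measurable_compose[OF increment_measurable borel_measurable_nth]) auto
  ultimately show ?thesis by (auto simp: distributed_def)
qed

lemma increment_moment_integrable:
  assumes "0 \<le> a" "a \<le> b"
  shows "integrable P (\<lambda>\<omega>. ((\<omega> b - \<omega> a) $ j) ^ k)"
proof (cases "a = b")
  case False
  with assms have "a < b" by simp
  from distributed_integrable[OF increment_distributed[OF assms(1) this], of "\<lambda>y. y ^ k" j]
    integrable_normal_moment[of "sqrt (b - a)" 0 k] \<open>a < b\<close>
  show ?thesis by simp
qed simp

lemma increment_mean_zero:
  assumes "0 \<le> a" "a \<le> b"
  shows "expectation (\<lambda>\<omega>. (\<omega> b - \<omega> a) $ j) = 0"
proof (cases "a = b")
  case False
  with assms have "a < b" by simp
  from distributed_integral[OF increment_distributed[OF assms(1) this], of "\<lambda>y. y" j]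
    integral_normal_moment_nz_1[of "sqrt (b - a)" 0] \<open>a < b\<close>
  show ?thesis by simp
qed simp

lemma increment_moment_even:
  assumes "0 \<le> a" "a \<le> b" "k > 0"
  shows "expectation (\<lambda>\<omega>. ((\<omega> b - \<omega> a) $ j) ^ (2 * k)) = fact (2 * k) / (2 ^ k * fact k) * (b - a) ^ k"
proof (cases "a = b")
  case False
  with assms have "a < b" by simp
  from distributed_integral[OF increment_distributed[OF assms(1) this], of "\<lambda>y. y ^ (2 * k)" j]
    integral_normal_moment_even[of "sqrt (b - a)" 0 k] \<open>a < b\<close>
  show ?thesis by (simp add: power_divide field_simps)
qed (use assms in \<open>simp add: zero_power\<close>)

end

section \<open>Moment estimates\<close>

text \<open>A crude Young inequality: each factor is at most the corresponding power of the larger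
  of \<open>a\<close> and \<open>b\<close>.\<close>

lemma power_mult_le_add_powers:
  fixes a b :: real
  assumes "0 \<le> a" "0 \<le> b"
  shows "a ^ i * b ^ j \<le> a ^ (i + j) + b ^ (i + j)"
proof (cases "a \<le> b")
  case True
  then have "a ^ i * b ^ j \<le> b ^ i * b ^ j" using assms by (intro mult_right_mono power_mono) auto
  then show ?thesis using assms by (simp add: power_add add_increasing)
next
  case False
  then have "a ^ i * b ^ j \<le> a ^ i * a ^ j" using assms by (intro mult_left_mono power_mono) auto
  then show ?thesis using assms by (simp add: power_add add_increasing2)
qed

lemma power_add_le:
  fixes a b :: real
  assumes "0 \<le> a" "0 \<le> b"
  shows "(a + b) ^ p \<le> 2 ^ p * (a ^ p + b ^ p)"
proof -
  have "(a + b) ^ p \<le> (2 * max a b) ^ p" using assms by (intro power_mono) auto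
  also have "\<dots> = 2 ^ p * max a b ^ p" by (simp add: power_mult_distrib)
  also have "max a b ^ p \<le> a ^ p + b ^ p" using assms by (auto simp: max_def)
  finally show ?thesis by simp
qed

lemma norm_power_add_le:
  fixes v w :: "'a::real_normed_vector"
  shows "norm (v + w) ^ p \<le> 2 ^ p * (norm v ^ p + norm w ^ p)"
  using power_mono[OF norm_triangle_ineq[of v w], of p] power_add_le[of "norm v" "norm w" p] by simp

text \<open>The first-order term is kept since it vanishes in mean for martingale increments.\<close>

lemma norm_power_add_expansion:
  assumes "q \<ge> 1"
  shows "\<exists>C\<ge>0. \<forall>v w :: 'a::real_inner.
    norm (v + w) ^ (2 * q) \<le> norm v ^ (2 * q) + 2 * real q * norm v ^ (2 * q - 2) * (v \<bullet> w)
      + C * (norm v ^ (2 * q - 2) * (norm w)\<^sup>2 + norm w ^ (2 * q))"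
  using assms
proof (induction q rule: dec_induct)
  case base
  have "norm (v + w) ^ 2 = norm v ^ 2 + 2 * (v \<bullet> w) + norm w ^ 2" for v w :: 'a
    by (simp add: power2_norm_eq_inner inner_add_left inner_add_right inner_commute)
  then show ?case by (intro exI[of _ 1]) simp
next
  case (step q)
  then obtain C where C: "C \<ge> 0" "\<And>v w :: 'a. norm (v + w) ^ (2 * q) \<le> norm v ^ (2 * q) + 2 * real q * norm v ^ (2 * q - 2) * (v \<bullet> w)
      + C * (norm v ^ (2 * q - 2) * (norm w)\<^sup>2 + norm w ^ (2 * q))" by blast
  \<comment> \<open>Multiplying the bound for \<open>q\<close> by \<open>norm (v + w) ^ 2\<close>
    produces cross terms, all dominated by the error form \<open>E\<close> of the next exponent. The
    1 is for \<open>norm v ^ (2 * q) * norm w ^ 2\<close>, the \<open>6 * real q\<close> for the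
    products with the first-order term (\<open>T1\<close>), the \<open>8 * C\<close> for those with
    the error term (\<open>T2\<close>).\<close>
  define D where "D = 1 + 6 * real q + 8 * C"
  show ?case
  proof (intro exI[of _ D] conjI allI)
    show "0 \<le> D" using C(1) by (simp add: D_def)
    fix v w :: 'a
    define a b s where "a = norm v" and "b = norm w" and "s = v \<bullet> w"
    have ab: "a \<ge> 0" "b \<ge> 0" "\<bar>s\<bar> \<le> a * b" by (auto simp: a_def b_def s_def Cauchy_Schwarz_ineq2)
    obtain m where m: "q = Suc m" using step.hyps by (metis Suc_le_D One_nat_def)
    define E where "E = a ^ (2 * q) * b^2 + b ^ (2 * q + 2)"
    have sq: "norm (v + w) ^ 2 = a^2 + 2 * s + b^2"
      by (simp add: a_def b_def s_def power2_norm_eq_inner inner_add_left inner_add_right inner_commute)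
    have sq2: "norm (v + w) ^ 2 \<le> 2 * a^2 + 2 * b^2"
    proof -
      have "norm (v + w) ^ 2 \<le> (a + b)^2" unfolding a_def b_def by (intro power_mono norm_triangle_ineq) simp
      also have "\<dots> \<le> 2 * a^2 + 2 * b^2" using sum_squares_bound[of a b] by (simp add: power2_sum)
      finally show ?thesis .
    qed
    have E1: "a ^ (2 * m + 1) * b ^ 3 \<le> E"
    proof -
      have "b^2 * (a ^ (2 * m + 1) * b ^ 1) \<le> b^2 * (a ^ (2 * m + 2) + b ^ (2 * m + 2))"
        using power_mult_le_add_powers[OF ab(1,2), of "2*m+1" 1] by (intro mult_left_mono) auto
      then show ?thesis by (simp add: E_def m algebra_simps power_add power2_eq_square power3_eq_cube)
    qed
    have E2: "a ^ (2 * m) * b ^ 4 \<le> E"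
    proof -
      have "b^2 * (a ^ (2 * m) * b ^ 2) \<le> b^2 * (a ^ (2 * m + 2) + b ^ (2 * m + 2))"
        using power_mult_le_add_powers[OF ab(1,2), of "2*m" 2] by (intro mult_left_mono) auto
      then show ?thesis by (simp add: E_def m algebra_simps power_add power2_eq_square power4_eq_xxxx)
    qed
    have E3: "b ^ (2 * q) * a ^ 2 \<le> E"
    proof -
      have "b^2 * (a ^ 2 * b ^ (2 * m)) \<le> b^2 * (a ^ (2 * m + 2) + b ^ (2 * m + 2))"
        using power_mult_le_add_powers[OF ab(1,2), of 2 "2*m"] by (intro mult_left_mono) (auto simp: add.commute)
      then show ?thesis by (simp add: E_def m algebra_simps power_add power2_eq_square)
    qed
    have E0: "a ^ (2 * q) * b^2 \<le> E" "b ^ (2 * q + 2) \<le> E" using ab by (auto simp: E_def)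
    have T1: "2 * real q * a ^ (2 * m) * s * (a^2 + 2 * s + b^2)
        \<le> 2 * real q * a ^ (2 * q) * s + 4 * real q * E + 2 * real q * E"
    proof -
      have "a ^ (2 * m) * s * (2 * s) \<le> 2 * E"
      proof -
        have "s * s \<le> (a * b) * (a * b)" using abs_mult_self_eq[of s] mult_mono[OF ab(3) ab(3)] ab by simp
        then have "a ^ (2 * m) * (s * s) \<le> a ^ (2 * m) * ((a * b) * (a * b))" using ab by (intro mult_left_mono) auto
        also have "\<dots> = a ^ (2 * q) * b^2" by (simp add: m power2_eq_square algebra_simps)
        finally show ?thesis using E0 by simp
      qed
      moreover have "a ^ (2 * m) * s * b^2 \<le> E"
      proof -
        have "a ^ (2 * m) * s * b^2 \<le> a ^ (2 * m) * (a * b) * b^2" using ab by (intro mult_left_mono mult_right_mono) auto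
        also have "\<dots> = a ^ (2 * m + 1) * b ^ 3" by (simp add: power3_eq_cube power2_eq_square)
        finally show ?thesis using E1 by simp
      qed
      moreover have "a ^ (2 * m) * s * a^2 = a ^ (2 * q) * s" by (simp add: m power2_eq_square)
      ultimately have "a ^ (2 * m) * s * (a^2 + 2 * s + b^2) \<le> a ^ (2 * q) * s + 2 * E + E"
        unfolding distrib_left by linarith
      then have "2 * real q * (a ^ (2 * m) * s * (a^2 + 2 * s + b^2)) \<le> 2 * real q * (a ^ (2 * q) * s + 2 * E + E)"
        by (intro mult_left_mono) auto
      then show ?thesis by (simp add: algebra_simps)
    qed
    have T2: "C * (a ^ (2 * m) * b^2 + b ^ (2 * q)) * norm (v + w) ^ 2 \<le> 8 * C * E" if "C \<ge> 0"
    proof -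
      have "(a ^ (2 * m) * b^2 + b ^ (2 * q)) * norm (v + w) ^ 2 \<le> (a ^ (2 * m) * b^2 + b ^ (2 * q)) * (2 * a^2 + 2 * b^2)"
        using sq2 ab by (intro mult_left_mono) auto
      also have "\<dots> = 2 * (a ^ (2 * q) * b^2) + 2 * (a ^ (2 * m) * b ^ 4) + 2 * (b ^ (2 * q) * a^2) + 2 * b ^ (2 * q + 2)"
        by (simp add: m algebra_simps power2_eq_square power4_eq_xxxx)
      also have "\<dots> \<le> 8 * E" using E0 E2 E3 by simp
      finally show ?thesis using mult_left_mono[OF _ that] by (simp add: mult.assoc mult.left_commute)
    qed
    have "norm (v + w) ^ (2 * Suc q) = norm (v + w) ^ (2 * q) * norm (v + w) ^ 2"
      by (simp add: power2_eq_square)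
    also have "\<dots> \<le> (a ^ (2 * q) + 2 * real q * a ^ (2 * m) * s + C * (a ^ (2 * m) * b^2 + b ^ (2 * q))) * norm (v + w) ^ 2"
      using C(2)[of v w] by (intro mult_right_mono) (auto simp: a_def b_def s_def m)
    also have "\<dots> = a ^ (2 * q) * (a^2 + 2 * s + b^2) + 2 * real q * a ^ (2 * m) * s * (a^2 + 2 * s + b^2)
        + C * (a ^ (2 * m) * b^2 + b ^ (2 * q)) * norm (v + w) ^ 2"
      by (simp add: distrib_right sq)
    also have "\<dots> \<le> a ^ (2 * q) * (a^2 + 2 * s + b^2) + (2 * real q * a ^ (2 * q) * s + 4 * real q * E + 2 * real q * E)
       + 8 * C * E" using T1 T2[OF C(1)] by linarith
    also have "\<dots> = a ^ (2 * q) * a^2 + 2 * real (Suc q) * a ^ (2 * q) * s + (a ^ (2 * q) * b^2 + (6 * real q + 8 * C) * E)"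
      by (simp add: algebra_simps)
    also have "\<dots> \<le> a ^ (2 * q) * a^2 + 2 * real (Suc q) * a ^ (2 * q) * s + D * E"
      using E0(1) unfolding D_def by (simp add: distrib_right)
    finally show "norm (v + w) ^ (2 * Suc q) \<le> norm v ^ (2 * Suc q) + 2 * real (Suc q) * norm v ^ (2 * Suc q - 2) * (v \<bullet> w)
      + D * (norm v ^ (2 * Suc q - 2) * (norm w)\<^sup>2 + norm w ^ (2 * Suc q))"
      by (simp add: a_def b_def s_def E_def power2_eq_square algebra_simps)
  qed
qed

text \<open>The norm of a matrix is here the Frobenius norm, so Cauchy-Schwarz applies row by
  row.\<close>

lemma norm_matrix_vector_mult_le:
  fixes A :: "real^'d^'n"
  shows "norm (A *v x) \<le> norm A * norm x"
proof -
  have "norm (A *v x) = L2_set (\<lambda>i. norm ((A *v x) $ i)) UNIV" by (simp add: norm_vec_def)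
  also have "\<dots> \<le> L2_set (\<lambda>i. norm (A $ i) * norm x) UNIV"
    by (intro L2_set_mono) (auto simp: matrix_mult_dot Cauchy_Schwarz_ineq2)
  also have "\<dots> = norm A * norm x" by (simp add: L2_set_left_distrib norm_vec_def)
  finally show ?thesis .
qed

lemma continuous_on_matrix_vector_mult [continuous_intros]:
  fixes A :: "'a::topological_space \<Rightarrow> real^'d^'n"
  assumes "continuous_on S A" "continuous_on S x"
  shows "continuous_on S (\<lambda>t. A t *v x t)"
  unfolding matrix_vector_mult_def using assms by (intro continuous_intros)

lemma borel_measurable_matrix_vector_mult [measurable]:
  fixes A :: "'a \<Rightarrow> real^'d^'n"
  assumes "A \<in> borel_measurable M" "x \<in> borel_measurable M"
  shows "(\<lambda>t. A t *v x t) \<in> borel_measurable M"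
  using assms by (rule borel_measurable_continuous_Pair) (intro continuous_intros)

lemma norm_power_le_sum_components:
  fixes w :: "real^'d"
  shows "norm w ^ (2 * q) \<le> real CARD('d) ^ (2 * q) * (\<Sum>j\<in>UNIV. (w $ j) ^ (2 * q))"
proof -
  define m where "m = Max (range (\<lambda>j. \<bar>w $ j\<bar>))"
  have "m \<in> range (\<lambda>j. \<bar>w $ j\<bar>)" unfolding m_def by (intro Max_in) auto
  then obtain j where j: "m = \<bar>w $ j\<bar>" by auto
  have "norm w \<le> (\<Sum>j\<in>UNIV. \<bar>w $ j\<bar>)" by (rule norm_le_l1_cart)
  also have "\<dots> \<le> (\<Sum>j\<in>(UNIV::'d set). m)" unfolding m_def by (intro sum_mono Max_ge) auto
  finally have "norm w ^ (2 * q) \<le> (real CARD('d) * m) ^ (2 * q)" by (intro power_mono) auto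
  also have "\<dots> = real CARD('d) ^ (2 * q) * (w $ j) ^ (2 * q)"
    by (simp add: power_mult_distrib j power_mult)
  also have "\<dots> \<le> real CARD('d) ^ (2 * q) * (\<Sum>j\<in>UNIV. (w $ j) ^ (2 * q))"
    by (intro mult_left_mono member_le_sum) (auto simp: power_mult)
  finally show ?thesis .
qed

context wiener
begin

definition Lp :: "nat \<Rightarrow> ((real \<Rightarrow> real^'d) \<Rightarrow> 'b::euclidean_space) \<Rightarrow> bool" where
  "Lp p X \<longleftrightarrow> X \<in> borel_measurable P \<and> integrable P (\<lambda>\<omega>. norm (X \<omega>) ^ p)"

text \<open>The moment itself and not its root: the recursions for the schemes are linear in this
  quantity.\<close>

definition mom :: "nat \<Rightarrow> ((real \<Rightarrow> real^'d) \<Rightarrow> 'b::euclidean_space) \<Rightarrow> real" where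
  "mom p X = expectation (\<lambda>\<omega>. norm (X \<omega>) ^ p)"

lemma LpD: "Lp p X \<Longrightarrow> X \<in> borel_measurable P" "Lp p X \<Longrightarrow> integrable P (\<lambda>\<omega>. norm (X \<omega>) ^ p)"
  by (auto simp: Lp_def)

lemma mom_nonneg [simp]: "mom p X \<ge> 0"
  by (simp add: mom_def)

lemma Lp_dominated:
  assumes "X \<in> borel_measurable P" "integrable P Z" "\<And>\<omega>. \<omega> \<in> space P \<Longrightarrow> norm (X \<omega>) ^ p \<le> Z \<omega>"
  shows "Lp p X" "mom p X \<le> expectation Z"
proof -
  have "integrable P (\<lambda>\<omega>. norm (X \<omega>) ^ p)"
    using assms(2) by (rule Bochner_Integration.integrable_bound)
      (use assms(1,3) in \<open>auto intro!: AE_I2 order_trans[OF _ abs_ge_self]\<close>)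
  with assms show "Lp p X" "mom p X \<le> expectation Z"
    by (auto simp: Lp_def mom_def intro!: integral_mono)
qed

lemma Lp_le:
  assumes "X \<in> borel_measurable P" "Lp p Y" "K \<ge> 0" "\<And>\<omega>. \<omega> \<in> space P \<Longrightarrow> norm (X \<omega>) \<le> K * norm (Y \<omega>)"
  shows "Lp p X" "mom p X \<le> K ^ p * mom p Y"
proof -
  have "norm (X \<omega>) ^ p \<le> K ^ p * norm (Y \<omega>) ^ p" if "\<omega> \<in> space P" for \<omega>
    using power_mono[OF assms(4)[OF that]] by (simp add: power_mult_distrib)
  with Lp_dominated[OF assms(1), of "\<lambda>\<omega>. K ^ p * norm (Y \<omega>) ^ p" p] LpD(2)[OF assms(2)]
  show "Lp p X" "mom p X \<le> K ^ p * mom p Y" by (auto simp: mom_def)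
qed

lemma Lp_add:
  assumes "Lp p X" "Lp p Y"
  shows "Lp p (\<lambda>\<omega>. X \<omega> + Y \<omega>)" "mom p (\<lambda>\<omega>. X \<omega> + Y \<omega>) \<le> 2 ^ p * (mom p X + mom p Y)"
proof -
  note [measurable] = LpD(1)[OF assms(1)] LpD(1)[OF assms(2)]
  have i: "integrable P (\<lambda>\<omega>. 2 ^ p * (norm (X \<omega>) ^ p + norm (Y \<omega>) ^ p))"
    using assms[THEN LpD(2)] by auto
  show "Lp p (\<lambda>\<omega>. X \<omega> + Y \<omega>)" "mom p (\<lambda>\<omega>. X \<omega> + Y \<omega>) \<le> 2 ^ p * (mom p X + mom p Y)"
    using Lp_dominated[OF _ i norm_power_add_le] assms[THEN LpD(2)] by (auto simp: mom_def)
qed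

lemma Lp_const: "Lp p (\<lambda>\<omega>. c)" "mom p (\<lambda>\<omega>. c) = norm c ^ p"
  by (auto simp: Lp_def mom_def prob_space)

lemma Lp_scaleR:
  assumes "Lp p X"
  shows "Lp p (\<lambda>\<omega>. c *\<^sub>R X \<omega>)" "mom p (\<lambda>\<omega>. c *\<^sub>R X \<omega>) = \<bar>c\<bar> ^ p * mom p X"
  using assms by (auto simp: Lp_def mom_def power_mult_distrib)

lemma Lp_diff:
  assumes "Lp p X" "Lp p Y"
  shows "Lp p (\<lambda>\<omega>. X \<omega> - Y \<omega>)" "mom p (\<lambda>\<omega>. X \<omega> - Y \<omega>) \<le> 2 ^ p * (mom p X + mom p Y)"
  using Lp_add[OF assms(1) Lp_scaleR(1)[OF assms(2), of "-1"]] Lp_scaleR(2)[OF assms(2), of "-1"] by auto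

text \<open>Brownian scaling, read off from the even Gaussian moments of the coordinates.\<close>

lemma increment_norm_moment:
  assumes "q \<ge> 1"
  shows "\<exists>C\<ge>0. \<forall>a b. 0 \<le> a \<longrightarrow> a \<le> b \<longrightarrow> Lp (2 * q) (\<lambda>\<omega>. \<omega> b - \<omega> a) \<and>
    mom (2 * q) (\<lambda>\<omega>. \<omega> b - \<omega> a) \<le> C * (b - a) ^ q"
proof -
  define c where "c = (fact (2 * q) / (2 ^ q * fact q) :: real)"
  define C where "C = real CARD('d) ^ (2 * q) * (real CARD('d) * c)"
  show ?thesis
  proof (intro exI[of _ C] conjI allI impI)
    show "C \<ge> 0" by (simp add: C_def c_def)
    fix a b :: real assume ab: "0 \<le> a" "a \<le> b"
    let ?Z = "\<lambda>\<omega>::real \<Rightarrow> real^'d. real CARD('d) ^ (2 * q) * (\<Sum>j\<in>UNIV. ((\<omega> b - \<omega> a) $ j) ^ (2 * q))"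
    have m: "(\<lambda>\<omega>. \<omega> b - \<omega> a) \<in> borel_measurable P" using increment_measurable[OF ab] .
    have i: "integrable P ?Z" using increment_moment_integrable[OF ab]
      by (intro integrable_mult_right Bochner_Integration.integrable_sum) auto
    have "expectation ?Z = real CARD('d) ^ (2 * q) * (\<Sum>j\<in>(UNIV::'d set). c * (b - a) ^ q)"
      using increment_moment_integrable[OF ab] increment_moment_even[OF ab, of q] assms
      by (simp add: Bochner_Integration.integral_sum c_def del: vector_minus_component)
    then have "expectation ?Z = C * (b - a) ^ q" by (simp add: C_def)
    with Lp_dominated[OF m i norm_power_le_sum_components]
    show "Lp (2 * q) (\<lambda>\<omega>. \<omega> b - \<omega> a)" "mom (2 * q) (\<lambda>\<omega>. \<omega> b - \<omega> a) \<le> C * (b - a) ^ q" by auto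
  qed
qed

text \<open>The coefficient may be frozen at a time \<open>c\<close> before \<open>a\<close>: in
  \<open>eul_regularity\<close> a coefficient known at \<open>T j\<close> multiplies an increment
  that starts at \<open>T (Suc j)\<close>.\<close>

lemma Lp_mult_increment:
  fixes \<Gamma> :: "(real \<Rightarrow> real^'d) \<Rightarrow> real^'d^'n"
  assumes "0 \<le> c" "c \<le> a" "a \<le> b" "\<Gamma> \<in> borel_measurable (F c)" "Lp (2 * q) \<Gamma>" "q \<ge> 1"
  shows "Lp (2 * q) (\<lambda>\<omega>. \<Gamma> \<omega> *v (\<omega> b - \<omega> a))"
    "mom (2 * q) (\<lambda>\<omega>. \<Gamma> \<omega> *v (\<omega> b - \<omega> a)) \<le> mom (2 * q) \<Gamma> * mom (2 * q) (\<lambda>\<omega>. \<omega> b - \<omega> a)"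
proof -
  have ab: "0 \<le> a" "a \<le> b" using assms by auto
  have m: "(\<lambda>\<omega>. \<omega> b - \<omega> a) \<in> borel_measurable P" using increment_measurable[OF ab] .
  have \<Gamma>a: "\<Gamma> \<in> borel_measurable (F a)" using assms measurable_F_mono by blast
  have "(\<lambda>\<omega>. norm (\<Gamma> \<omega>) ^ (2 * q)) \<in> borel_measurable (F a)" using \<Gamma>a by measurable
  note e = expectation_mult_increment[OF ab this LpD(2)[OF assms(5)], of "\<lambda>w. norm w ^ (2 * q)"]
  have i: "integrable P (\<lambda>\<omega>. norm (\<omega> b - \<omega> a) ^ (2 * q))"
    using increment_norm_moment[OF assms(6)] ab LpD(2) by blast
  have "norm (\<Gamma> \<omega> *v (\<omega> b - \<omega> a)) ^ (2 * q) \<le> norm (\<Gamma> \<omega>) ^ (2 * q) * norm (\<omega> b - \<omega> a) ^ (2 * q)" for \<omega>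
    using power_mono[OF norm_matrix_vector_mult_le] by (simp flip: power_mult_distrib)
  from Lp_dominated[OF borel_measurable_matrix_vector_mult[OF LpD(1)[OF assms(5)] m] e(1)[OF _ i] this] e(2)[OF _ i]
  show "Lp (2 * q) (\<lambda>\<omega>. \<Gamma> \<omega> *v (\<omega> b - \<omega> a))"
    "mom (2 * q) (\<lambda>\<omega>. \<Gamma> \<omega> *v (\<omega> b - \<omega> a)) \<le> mom (2 * q) \<Gamma> * mom (2 * q) (\<lambda>\<omega>. \<omega> b - \<omega> a)"
    by (auto simp: mom_def)
qed

text \<open>The inner product is linear in the increment and splits into
  \<open>F a\<close>-measurable weights \<open>U j\<close> times centred coordinate increments; the
  weights are integrable by the crude Young inequality.\<close>

lemma expectation_inner_increment_zero:
  fixes \<Gamma> :: "(real \<Rightarrow> real^'d) \<Rightarrow> real^'d^'n"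
  assumes ab: "0 \<le> a" "a \<le> b" and V: "V \<in> borel_measurable (F a)" "Lp (2 * q) V"
    and G: "\<Gamma> \<in> borel_measurable (F a)" "Lp (2 * q) \<Gamma>" and q: "q \<ge> 1"
  shows "integrable P (\<lambda>\<omega>. norm (V \<omega>) ^ (2 * q - 2) * (V \<omega> \<bullet> (\<Gamma> \<omega> *v (\<omega> b - \<omega> a))))"
    "expectation (\<lambda>\<omega>. norm (V \<omega>) ^ (2 * q - 2) * (V \<omega> \<bullet> (\<Gamma> \<omega> *v (\<omega> b - \<omega> a)))) = 0"
proof -
  define U where "U = (\<lambda>j \<omega>. norm (V \<omega>) ^ (2 * q - 2) * (V \<omega> \<bullet> (\<Gamma> \<omega> *v axis j 1)))"
  obtain m where m: "q = Suc m" using q by (metis Suc_le_D One_nat_def)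
  have Um: "U j \<in> borel_measurable (F a)" for j
    unfolding U_def using V(1) G(1) by measurable
  have Ui: "integrable P (U j)" for j
  proof (rule Bochner_Integration.integrable_bound)
    show "integrable P (\<lambda>\<omega>. norm (V \<omega>) ^ (2 * q) + norm (\<Gamma> \<omega>) ^ (2 * q))"
      using LpD(2)[OF V(2)] LpD(2)[OF G(2)] by auto
    show "U j \<in> borel_measurable P" by (rule measurable_F_P[OF Um])
    show "AE \<omega> in P. norm (U j \<omega>) \<le> norm (norm (V \<omega>) ^ (2 * q) + norm (\<Gamma> \<omega>) ^ (2 * q))"
    proof (rule AE_I2)
      fix \<omega>
      have "\<bar>V \<omega> \<bullet> (\<Gamma> \<omega> *v axis j 1)\<bar> \<le> norm (V \<omega>) * (norm (\<Gamma> \<omega>) * norm (axis j (1::real)))"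
        by (rule order_trans[OF Cauchy_Schwarz_ineq2]) (intro mult_left_mono norm_matrix_vector_mult_le, simp)
      then have "\<bar>U j \<omega>\<bar> \<le> norm (V \<omega>) ^ (2 * m) * (norm (V \<omega>) * norm (\<Gamma> \<omega>))"
        by (simp add: U_def abs_mult norm_axis_1 m mult_left_mono)
      also have "\<dots> = norm (V \<omega>) ^ (2 * m + 1) * norm (\<Gamma> \<omega>) ^ 1" by simp
      also have "\<dots> \<le> norm (V \<omega>) ^ (2 * m + 1 + 1) + norm (\<Gamma> \<omega>) ^ (2 * m + 1 + 1)"
        by (rule power_mult_le_add_powers) auto
      finally show "norm (U j \<omega>) \<le> norm (norm (V \<omega>) ^ (2 * q) + norm (\<Gamma> \<omega>) ^ (2 * q))"
        by (simp add: m)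
    qed
  qed
  have eq: "norm (V \<omega>) ^ (2 * q - 2) * (V \<omega> \<bullet> (\<Gamma> \<omega> *v w)) = (\<Sum>j\<in>UNIV. U j \<omega> * w $ j)" for \<omega> w
  proof -
    have "\<Gamma> \<omega> *v w = \<Gamma> \<omega> *v (\<Sum>j\<in>UNIV. w $ j *s axis j 1)" by (simp add: basis_expansion)
    also have "\<dots> = (\<Sum>j\<in>UNIV. w $ j *\<^sub>R (\<Gamma> \<omega> *v axis j 1))"
      by (simp add: linear_sum[OF matrix_vector_mul_linear] scalar_mult_eq_scaleR
          linear_scale[OF matrix_vector_mul_linear])
    finally show ?thesis
      by (simp add: U_def inner_sum_right sum_distrib_left sum_distrib_right algebra_simps)
  qed
  have ii: "integrable P (\<lambda>\<omega>. (\<omega> b - \<omega> a) $ j)" for j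
    using increment_moment_integrable[OF ab, of j 1] by (simp del: vector_minus_component)
  note e = expectation_mult_increment[OF ab Um Ui _ ii]
  show "integrable P (\<lambda>\<omega>. norm (V \<omega>) ^ (2 * q - 2) * (V \<omega> \<bullet> (\<Gamma> \<omega> *v (\<omega> b - \<omega> a))))"
    unfolding eq using e(1) by (intro Bochner_Integration.integrable_sum) auto
  show "expectation (\<lambda>\<omega>. norm (V \<omega>) ^ (2 * q - 2) * (V \<omega> \<bullet> (\<Gamma> \<omega> *v (\<omega> b - \<omega> a)))) = 0"
    unfolding eq using e increment_mean_zero[OF ab]
    by (subst Bochner_Integration.integral_sum) (auto simp del: vector_minus_component)
qed

text \<open>The estimate behind all Gronwall arguments for the schemes: in the expansion of the
  power the term linear in the Brownian increment has mean 0, and everything else is of order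
  \<open>h\<close>. The drift carries the factor \<open>h\<close>, a bound for the step, and
  \<open>\<alpha>\<close> is only asked to have moments. Any perturbation can thus be put into
  \<open>\<alpha>\<close> after division by \<open>h\<close>, which is how unequal steps and
  displaced increments are treated.\<close>

lemma moment_step:
  assumes q: "q \<ge> 1"
  shows "\<exists>C\<ge>0. \<forall>a b h. \<forall>V \<alpha> :: (real \<Rightarrow> real^'d) \<Rightarrow> real^'n. \<forall>\<Gamma> :: (real \<Rightarrow> real^'d) \<Rightarrow> real^'d^'n.
    0 \<le> a \<longrightarrow> a \<le> b \<longrightarrow> b - a \<le> h \<longrightarrow> h \<le> 1 \<longrightarrow> V \<in> borel_measurable (F a) \<longrightarrow> Lp (2 * q) V \<longrightarrow>
    Lp (2 * q) \<alpha> \<longrightarrow> \<Gamma> \<in> borel_measurable (F a) \<longrightarrow> Lp (2 * q) \<Gamma> \<longrightarrow>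
    Lp (2 * q) (\<lambda>\<omega>. V \<omega> + h *\<^sub>R \<alpha> \<omega> + \<Gamma> \<omega> *v (\<omega> b - \<omega> a)) \<and>
    mom (2 * q) (\<lambda>\<omega>. V \<omega> + h *\<^sub>R \<alpha> \<omega> + \<Gamma> \<omega> *v (\<omega> b - \<omega> a)) \<le>
      (1 + C * h) * mom (2 * q) V + C * h * (mom (2 * q) \<alpha> + mom (2 * q) \<Gamma>)"
proof -
  obtain m where m: "q = Suc m" using q by (metis Suc_le_D One_nat_def)
  let ?p = "2 * q"
  obtain C0 where C0: "C0 \<ge> 0" "\<And>v w :: real^'n. norm (v + w) ^ (2 * q) \<le> norm v ^ (2 * q) + 2 * real q * norm v ^ (2 * q - 2) * (v \<bullet> w)
      + C0 * (norm v ^ (2 * q - 2) * (norm w)\<^sup>2 + norm w ^ (2 * q))"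
    using norm_power_add_expansion[OF q, where 'a="real^'n"] by blast
  obtain c where c: "c \<ge> 0" "\<And>a b. 0 \<le> a \<Longrightarrow> a \<le> b \<Longrightarrow> Lp ?p (\<lambda>\<omega>. \<omega> b - \<omega> a) \<and>
    mom ?p (\<lambda>\<omega>. \<omega> b - \<omega> a) \<le> c * (b - a) ^ q" using increment_norm_moment[OF q] by blast
  obtain c2 where c2: "c2 \<ge> 0" "\<And>a b. 0 \<le> a \<Longrightarrow> a \<le> b \<Longrightarrow> Lp 2 (\<lambda>\<omega>. \<omega> b - \<omega> a) \<and>
    mom 2 (\<lambda>\<omega>. \<omega> b - \<omega> a) \<le> c2 * (b - a)" using increment_norm_moment[of 1] by auto
  \<comment> \<open>\<open>2 * real q\<close> is for the drift in the first-order term,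
    \<open>2 * C0\<close> for the quadratic term after splitting drift from noise,
    \<open>C0 * 2 ^ ?p\<close> for the highest power.\<close>
  define K where "K = 2 * real q + 2 * C0 + C0 * 2 ^ ?p"
  have K: "K \<ge> 0" using C0 by (simp add: K_def)
  define C where "C = K * (1 + c + c2)"
  have CK: "K \<le> C" "K * c \<le> C" "K * c2 \<le> C" "C \<ge> 0" using K c(1) c2(1) by (auto simp: C_def distrib_left)
  \<comment> \<open>The pathwise form, integrated later. In the first-order term only the drift is
    estimated; the noise part is kept as it is, since its mean vanishes.\<close>
  have key: "norm (v + (h *\<^sub>R \<alpha> + G *v w)) ^ ?p \<le> norm v ^ ?p + 2 * real q * (norm v ^ (?p - 2) * (v \<bullet> (G *v w)))
     + (K * h * norm v ^ ?p + K * h * norm \<alpha> ^ ?p + K * (norm v ^ (2 * m) * norm G ^ 2 * norm w ^ 2) + K * (norm G ^ ?p * norm w ^ ?p))"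
    if h: "0 \<le> h" "h \<le> 1" for v \<alpha> :: "real^'n" and G :: "real^'d^'n" and w h
  proof -
    have hp: "h ^ 2 \<le> h" "h ^ ?p \<le> h" using h q power_decreasing[of 1 "?p" h] power_decreasing[of 1 2 h] by auto
    define u where "u = norm v ^ ?p"
    define z where "z = norm \<alpha> ^ ?p"
    have uz: "u \<ge> 0" "z \<ge> 0" by (auto simp: u_def z_def)
    have A1: "norm v ^ (?p - 2) * (v \<bullet> (h *\<^sub>R \<alpha>)) \<le> h * (u + z)"
    proof -
      have "norm v ^ (2*m) * (v \<bullet> \<alpha>) \<le> norm v ^ (2*m) * (norm v * norm \<alpha>)"
        by (intro mult_left_mono norm_cauchy_schwarz) auto
      also have "\<dots> = norm v ^ (2*m+1) * norm \<alpha> ^ 1" by simp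
      also have "\<dots> \<le> norm v ^ (2*m+1+1) + norm \<alpha> ^ (2*m+1+1)" by (rule power_mult_le_add_powers) auto
      also have "\<dots> = u + z" by (simp add: u_def z_def m)
      finally show ?thesis using mult_left_mono[OF _ h(1)] by (simp add: m mult.left_commute)
    qed
    have Gw: "norm (G *v w) \<le> norm G * norm w" by (rule norm_matrix_vector_mult_le)
    have A2: "norm v ^ (2*m) * norm (h *\<^sub>R \<alpha> + G *v w) ^ 2 \<le> 2 * h * (u + z) + 2 * (norm v ^ (2 * m) * norm G ^ 2 * norm w ^ 2)"
    proof -
      have "norm (h *\<^sub>R \<alpha> + G *v w) ^ 2 \<le> (norm (h *\<^sub>R \<alpha>) + norm (G *v w)) ^ 2"
        by (intro power_mono norm_triangle_ineq) simp
      also have "\<dots> \<le> 2 * norm (h *\<^sub>R \<alpha>) ^ 2 + 2 * norm (G *v w) ^ 2"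
        using sum_squares_bound[of "norm (h *\<^sub>R \<alpha>)" "norm (G *v w)"] by (simp add: power2_sum)
      also have "\<dots> \<le> 2 * (h * norm \<alpha> ^ 2) + 2 * (norm G * norm w) ^ 2"
        using h hp by (intro add_mono mult_left_mono power_mono Gw) (auto simp: power_mult_distrib intro!: mult_right_mono)
      finally have "norm v ^ (2*m) * norm (h *\<^sub>R \<alpha> + G *v w) ^ 2 \<le> norm v ^ (2*m) * (2 * (h * norm \<alpha> ^ 2) + 2 * (norm G * norm w) ^ 2)"
        by (intro mult_left_mono) auto
      also have "\<dots> = 2 * h * (norm v ^ (2*m) * norm \<alpha> ^ 2) + 2 * (norm v ^ (2 * m) * norm G ^ 2 * norm w ^ 2)"
        by (simp add: algebra_simps power_mult_distrib)
      also have "norm v ^ (2*m) * norm \<alpha> ^ 2 \<le> u + z"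
        using power_mult_le_add_powers[of "norm v" "norm \<alpha>" "2*m" 2] by (simp add: u_def z_def m)
      finally show ?thesis using h by (auto intro: mult_left_mono)
    qed
    have A3: "norm (h *\<^sub>R \<alpha> + G *v w) ^ ?p \<le> 2 ^ ?p * (h * z + norm G ^ ?p * norm w ^ ?p)"
    proof -
      have "norm (h *\<^sub>R \<alpha> + G *v w) ^ ?p \<le> 2 ^ ?p * (norm (h *\<^sub>R \<alpha>) ^ ?p + norm (G *v w) ^ ?p)" by (rule norm_power_add_le)
      also have "norm (h *\<^sub>R \<alpha>) ^ ?p \<le> h * z"
        using hp h by (simp add: z_def power_mult_distrib mult_right_mono)
      also have "norm (G *v w) ^ ?p \<le> norm G ^ ?p * norm w ^ ?p"
        using power_mono[OF Gw, of ?p] by (simp add: power_mult_distrib)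
      finally show ?thesis by simp
    qed
    let ?R = "norm v ^ (2 * m) * norm G ^ 2 * norm w ^ 2" and ?S = "norm G ^ ?p * norm w ^ ?p"
    have RS: "?R \<ge> 0" "?S \<ge> 0" by auto
    have "norm (v + (h *\<^sub>R \<alpha> + G *v w)) ^ ?p \<le> u + 2 * real q * (norm v ^ (?p - 2) * (v \<bullet> (h *\<^sub>R \<alpha>))) + 2 * real q * (norm v ^ (?p - 2) * (v \<bullet> (G *v w)))
      + C0 * (norm v ^ (2*m) * norm (h *\<^sub>R \<alpha> + G *v w) ^ 2) + C0 * norm (h *\<^sub>R \<alpha> + G *v w) ^ ?p"
      using C0(2)[of v "h *\<^sub>R \<alpha> + G *v w"] by (simp add: u_def m inner_add_right algebra_simps)
    also have "\<dots> \<le> u + 2 * real q * (h * (u + z)) + 2 * real q * (norm v ^ (?p - 2) * (v \<bullet> (G *v w)))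
      + C0 * (2 * h * (u + z) + 2 * ?R) + C0 * (2 ^ ?p * (h * z + ?S))"
      using A1 A2 A3 C0(1) by (intro add_mono mult_left_mono order_refl) auto
    also have "\<dots> = u + 2 * real q * (norm v ^ (?p - 2) * (v \<bullet> (G *v w))) + ((2 * real q + 2 * C0) * (h * u) + K * (h * z) + 2 * C0 * ?R + C0 * 2 ^ ?p * ?S)"
      unfolding K_def by (simp add: algebra_simps)
    also have "\<dots> \<le> u + 2 * real q * (norm v ^ (?p - 2) * (v \<bullet> (G *v w))) + (K * (h * u) + K * (h * z) + K * ?R + K * ?S)"
    proof -
      have K': "2 * real q + 2 * C0 \<le> K" "2 * C0 \<le> K" "C0 * 2 ^ ?p \<le> K" using C0(1) by (auto simp: K_def)
      have "(2 * real q + 2 * C0) * (h * u) \<le> K * (h * u)" "2 * C0 * ?R \<le> K * ?R" "C0 * 2 ^ ?p * ?S \<le> K * ?S"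
        using K' h uz RS by (intro mult_right_mono; simp)+
      then show ?thesis by simp
    qed
    finally show ?thesis unfolding u_def z_def by (simp add: mult.assoc)
  qed
  show ?thesis
  proof (intro exI[of _ C] conjI allI impI)
    show "C \<ge> 0" by (fact CK)
    fix a b h :: real and V \<alpha> :: "(real \<Rightarrow> real^'d) \<Rightarrow> real^'n" and \<Gamma> :: "(real \<Rightarrow> real^'d) \<Rightarrow> real^'d^'n"
    assume ab: "0 \<le> a" "a \<le> b" and h: "b - a \<le> h" "h \<le> 1" and V: "V \<in> borel_measurable (F a)" "Lp ?p V"
      and \<alpha>: "Lp ?p \<alpha>" and \<Gamma>: "\<Gamma> \<in> borel_measurable (F a)" "Lp ?p \<Gamma>"
    let ?w = "\<lambda>\<omega>. \<omega> b - \<omega> a"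
    let ?V' = "\<lambda>\<omega>. V \<omega> + h *\<^sub>R \<alpha> \<omega> + \<Gamma> \<omega> *v ?w \<omega>"
    have h0: "0 \<le> h" using ab h by simp
    have wm: "?w \<in> borel_measurable P" using increment_measurable[OF ab] .
    have meas: "?V' \<in> borel_measurable P"
      using LpD(1)[OF V(2)] LpD(1)[OF \<alpha>] LpD(1)[OF \<Gamma>(2)] wm by measurable
    define M where "M = (\<lambda>\<omega>. norm (V \<omega>) ^ (?p - 2) * (V \<omega> \<bullet> (\<Gamma> \<omega> *v ?w \<omega>)))"
    have M: "integrable P M" "expectation M = 0"
      using expectation_inner_increment_zero[OF ab V \<Gamma> q] by (auto simp: M_def)
    define R where "R = (\<lambda>\<omega>. norm (V \<omega>) ^ (2 * m) * norm (\<Gamma> \<omega>) ^ 2 * norm (?w \<omega>) ^ 2)"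
    have Rb: "norm (V \<omega>) ^ (2 * m) * norm (\<Gamma> \<omega>) ^ 2 \<le> norm (V \<omega>) ^ ?p + norm (\<Gamma> \<omega>) ^ ?p" for \<omega>
      using power_mult_le_add_powers[of "norm (V \<omega>)" "norm (\<Gamma> \<omega>)" "2*m" 2] by (simp add: m)
    have iVG: "integrable P (\<lambda>\<omega>. norm (V \<omega>) ^ ?p + norm (\<Gamma> \<omega>) ^ ?p)"
      using LpD(2)[OF V(2)] LpD(2)[OF \<Gamma>(2)] by auto
    have Ym: "(\<lambda>\<omega>. norm (V \<omega>) ^ (2 * m) * norm (\<Gamma> \<omega>) ^ 2) \<in> borel_measurable (F a)"
      using V(1) \<Gamma>(1) by measurable
    have Yi: "integrable P (\<lambda>\<omega>. norm (V \<omega>) ^ (2 * m) * norm (\<Gamma> \<omega>) ^ 2)"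
      using iVG measurable_F_P[OF Ym] by (rule Bochner_Integration.integrable_bound) (use Rb in \<open>auto intro!: AE_I2\<close>)
    have wi: "integrable P (\<lambda>\<omega>. norm (?w \<omega>) ^ 2)" "expectation (\<lambda>\<omega>. norm (?w \<omega>) ^ 2) \<le> c2 * h"
      using c2(2)[OF ab] LpD(2) mult_left_mono[OF h(1) c2(1)] by (auto simp: mom_def)
    have R: "integrable P R" "expectation R \<le> (mom ?p V + mom ?p \<Gamma>) * (c2 * h)"
    proof -
      note e = expectation_mult_increment[OF ab Ym Yi, of "\<lambda>w. norm w ^ 2", OF _ wi(1)]
      show "integrable P R" using e(1) by (simp add: R_def)
      have "expectation R = expectation (\<lambda>\<omega>. norm (V \<omega>) ^ (2 * m) * norm (\<Gamma> \<omega>) ^ 2) * expectation (\<lambda>\<omega>. norm (?w \<omega>) ^ 2)"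
        using e(2) by (simp add: R_def)
      also have "\<dots> \<le> (mom ?p V + mom ?p \<Gamma>) * (c2 * h)"
      proof (intro mult_mono wi(2))
        show "expectation (\<lambda>\<omega>. norm (V \<omega>) ^ (2 * m) * norm (\<Gamma> \<omega>) ^ 2) \<le> mom ?p V + mom ?p \<Gamma>"
          using integral_mono[OF Yi iVG Rb] LpD(2)[OF V(2)] LpD(2)[OF \<Gamma>(2)] by (simp add: mom_def)
      qed (auto simp: add_nonneg_nonneg)
      finally show "expectation R \<le> (mom ?p V + mom ?p \<Gamma>) * (c2 * h)" .
    qed
    define S where "S = (\<lambda>\<omega>. norm (\<Gamma> \<omega>) ^ ?p * norm (?w \<omega>) ^ ?p)"
    have S: "integrable P S" "expectation S \<le> mom ?p \<Gamma> * (c * h)"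
    proof -
      have Gm: "(\<lambda>\<omega>. norm (\<Gamma> \<omega>) ^ ?p) \<in> borel_measurable (F a)" using \<Gamma>(1) by measurable
      have ww: "integrable P (\<lambda>\<omega>. norm (?w \<omega>) ^ ?p)" using c(2)[OF ab] LpD(2) by blast
      note e = expectation_mult_increment[OF ab Gm LpD(2)[OF \<Gamma>(2)], of "\<lambda>w. norm w ^ ?p", OF _ ww]
      show "integrable P S" using e(1) by (simp add: S_def)
      \<comment> \<open>As the step is at most 1, order \<open>q\<close> in its length may be
        weakened to order 1.\<close>
      have "(b - a) ^ q \<le> (b - a) ^ 1" using ab h q by (intro power_decreasing) auto
      with h have "c * (b - a) ^ q \<le> c * h" using c(1) by (intro mult_left_mono) auto
      then have "mom ?p ?w \<le> c * h" using c(2)[OF ab] by simp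
      then show "expectation S \<le> mom ?p \<Gamma> * (c * h)"
        using e(2) by (simp add: S_def flip: mom_def) (intro mult_left_mono, auto)
    qed
    define Z where "Z = (\<lambda>\<omega>. norm (V \<omega>) ^ ?p + 2 * real q * M \<omega>
      + (K * h * norm (V \<omega>) ^ ?p + K * h * norm (\<alpha> \<omega>) ^ ?p + K * R \<omega> + K * S \<omega>))"
    have Zi: "integrable P Z" unfolding Z_def using M(1) R(1) S(1) LpD(2)[OF V(2)] LpD(2)[OF \<alpha>] by auto
    have le: "norm (?V' \<omega>) ^ ?p \<le> Z \<omega>" for \<omega>
      using key[OF h0 h(2), of "V \<omega>" "\<alpha> \<omega>" "\<Gamma> \<omega>" "?w \<omega>"] by (simp add: Z_def M_def R_def S_def add.assoc)
    show "Lp ?p ?V'" by (rule Lp_dominated[OF meas Zi le])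
    have "mom ?p ?V' \<le> expectation Z" by (rule Lp_dominated[OF meas Zi le])
    also have "expectation Z = mom ?p V + 2 * real q * expectation M
       + (K * h * mom ?p V + K * h * mom ?p \<alpha> + K * expectation R + K * expectation S)"
      unfolding Z_def mom_def using M(1) R(1) S(1) LpD(2)[OF V(2)] LpD(2)[OF \<alpha>] by simp
    also have "\<dots> \<le> mom ?p V + 2 * real q * 0 + (K * h * mom ?p V + K * h * mom ?p \<alpha>
       + K * ((mom ?p V + mom ?p \<Gamma>) * (c2 * h)) + K * (mom ?p \<Gamma> * (c * h)))"
      using M(2) R(2) S(2) K by (intro add_mono mult_left_mono order_refl) auto
    also have "\<dots> = mom ?p V + (K * (1 + c2) * (h * mom ?p V) + K * (h * mom ?p \<alpha>) + K * (c2 + c) * (h * mom ?p \<Gamma>))"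
      by (simp add: algebra_simps)
    also have "\<dots> \<le> mom ?p V + (C * (h * mom ?p V) + C * (h * mom ?p \<alpha>) + C * (h * mom ?p \<Gamma>))"
    proof -
      have "K * (1 + c2) \<le> C" "K \<le> C" "K * (c2 + c) \<le> C"
        unfolding C_def using K c(1) c2(1) by (auto intro!: mult_left_mono simp: mult_le_cancel_left1)
      then have "K * (1 + c2) * (h * mom ?p V) \<le> C * (h * mom ?p V)" "K * (h * mom ?p \<alpha>) \<le> C * (h * mom ?p \<alpha>)"
        "K * (c2 + c) * (h * mom ?p \<Gamma>) \<le> C * (h * mom ?p \<Gamma>)"
        using h0 by (intro mult_right_mono; simp)+
      then show ?thesis by simp
    qed
    finally show "mom ?p ?V' \<le> (1 + C * h) * mom ?p V + C * h * (mom ?p \<alpha> + mom ?p \<Gamma>)"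
      by (simp add: algebra_simps)
  qed
qed

end

section \<open>Euler schemes\<close>

text \<open>Consecutive times may coincide, so that a grid truncated at some time can stay constant
  from there on.\<close>

definition grid :: "(nat \<Rightarrow> real) \<Rightarrow> real \<Rightarrow> bool" where
  "grid T h \<longleftrightarrow> 0 \<le> T 0 \<and> (\<forall>j. T j \<le> T (Suc j) \<and> T (Suc j) - T j \<le> h)"

definition euler_step ::
  "(real^'n \<Rightarrow> real^'n) \<Rightarrow> (real^'n \<Rightarrow> real^'d^'n) \<Rightarrow> real^'n \<Rightarrow> real \<Rightarrow> real^'d \<Rightarrow> real^'n" where
  "euler_step f g z \<Delta> w = z + \<Delta> *\<^sub>R f z + g z *v w"

text \<open>The grid is an arbitrary sequence of times: a value at a time off the mesh is obtained
  by truncating the grid there and not by interpolation.\<close>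

primrec euler ::
  "(real^'n \<Rightarrow> real^'n) \<Rightarrow> (real^'n \<Rightarrow> real^'d^'n) \<Rightarrow> real^'n \<Rightarrow> (nat \<Rightarrow> real) \<Rightarrow> (real \<Rightarrow> real^'d) \<Rightarrow> nat \<Rightarrow> real^'n" where
  "euler f g x T \<omega> 0 = x"
| "euler f g x T \<omega> (Suc j) = euler_step f g (euler f g x T \<omega> j) (T (Suc j) - T j) (\<omega> (T (Suc j)) - \<omega> (T j))"

lemma grid_nonneg: "grid T h \<Longrightarrow> 0 \<le> T j"
  by (induction j) (auto simp: grid_def intro: order_trans)

text \<open>\<open>1 + A * h\<close> is at most \<open>exp (A * h)\<close>. Only the bound
  \<open>R\<close> for the total time enters the result, which makes the estimates uniform in the
  step.\<close>

lemma discrete_gronwall: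
  fixes a :: "nat \<Rightarrow> real"
  assumes "\<And>j. j < M \<Longrightarrow> a (Suc j) \<le> (1 + A * h) * a j + B * h"
    and "0 \<le> A" "0 \<le> B" "0 \<le> h" "0 \<le> a 0" "real M * h \<le> R" "j \<le> M"
  shows "a j \<le> exp (A * R) * (a 0 + B * R)"
proof -
  have "a j \<le> (1 + A * h) ^ j * (a 0 + B * (real j * h))"
    using \<open>j \<le> M\<close>
  proof (induction j)
    case (Suc j)
    have "a (Suc j) \<le> (1 + A * h) * a j + B * h" using Suc.prems assms(1) by simp
    also have "\<dots> \<le> (1 + A * h) * ((1 + A * h) ^ j * (a 0 + B * (real j * h))) + (1 + A * h) ^ Suc j * (B * h)"
    proof (intro add_mono mult_left_mono)
      have "1 \<le> (1 + A * h) ^ Suc j" using assms by (intro one_le_power) auto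
      then show "B * h \<le> (1 + A * h) ^ Suc j * (B * h)"
        using assms mult_right_mono[of 1 "(1 + A * h) ^ Suc j" "B * h"] by simp
    qed (use Suc assms in auto)
    also have "\<dots> = (1 + A * h) ^ Suc j * (a 0 + B * (real (Suc j) * h))" by (simp add: algebra_simps)
    finally show ?case .
  qed simp
  also have "\<dots> \<le> exp (A * R) * (a 0 + B * R)"
  proof (intro mult_mono add_mono mult_left_mono)
    have jh: "real j * h \<le> R" using assms(4,6,7) mult_right_mono[of "real j" "real M" h] by simp
    then show "real j * h \<le> R" .
    have "(1 + A * h) ^ j \<le> exp (A * h) ^ j" using assms by (intro power_mono) auto
    also have "\<dots> = exp (A * (real j * h))" by (simp add: exp_of_nat_mult[symmetric] algebra_simps)
    also have "\<dots> \<le> exp (A * R)" using jh assms by (simp add: mult_left_mono)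
    finally show "(1 + A * h) ^ j \<le> exp (A * R)" .
  qed (use assms in auto)
  finally show ?thesis .
qed

locale sde_coeffs = wiener P for P :: "(real \<Rightarrow> real^'d) measure" +
  fixes f :: "real^'n \<Rightarrow> real^'n" and g :: "real^'n \<Rightarrow> real^'d^'n" and L :: real
  assumes L_nonneg: "L \<ge> 0"
    and f_lip: "norm (f x - f y) \<le> L * norm (x - y)"
    and g_lip: "norm (g x - g y) \<le> L * norm (x - y)"
begin

abbreviation eul where "eul \<equiv> euler f g"

lemma f_cont: "continuous_on S f" and g_cont: "continuous_on S g"
proof -
  have "L-lipschitz_on S f" "L-lipschitz_on S g"
    using L_nonneg f_lip g_lip by (auto simp: lipschitz_on_def dist_norm)
  then show "continuous_on S f" "continuous_on S g" by (auto intro: lipschitz_on_continuous_on)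
qed

lemma f_meas [measurable]: "f \<in> borel_measurable borel" and g_meas [measurable]: "g \<in> borel_measurable borel"
  using f_cont g_cont by (auto intro: borel_measurable_continuous_onI)

section \<open>Moment estimates for the schemes\<close>

lemma affine_growth_mom:
  fixes \<phi> :: "real^'n \<Rightarrow> 'c::euclidean_space" and Y :: "(real \<Rightarrow> real^'d) \<Rightarrow> real^'n"
  assumes Y: "Lp (2 * q) Y" and \<phi>: "\<phi> \<in> borel_measurable borel" "\<And>x y. norm (\<phi> x - \<phi> y) \<le> L * norm (x - y)"
    and K: "norm (\<phi> 0) ^ (2 * q) \<le> K" "L ^ (2 * q) \<le> K"
  shows "Lp (2 * q) (\<lambda>\<omega>. \<phi> (Y \<omega>))" "mom (2 * q) (\<lambda>\<omega>. \<phi> (Y \<omega>)) \<le> 2 ^ (2 * q) * K * (1 + mom (2 * q) Y)"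
proof -
  note [measurable] = LpD(1)[OF Y] \<phi>(1)
  have i: "integrable P (\<lambda>\<omega>. 2 ^ (2 * q) * K * (1 + norm (Y \<omega>) ^ (2 * q)))" using LpD(2)[OF Y] by auto
  have "norm (\<phi> x) ^ (2 * q) \<le> 2 ^ (2 * q) * K * (1 + norm x ^ (2 * q))" for x
  proof -
    have "norm (\<phi> x) ^ (2 * q) = norm (\<phi> 0 + (\<phi> x - \<phi> 0)) ^ (2 * q)" by simp
    also have "\<dots> \<le> 2 ^ (2 * q) * (norm (\<phi> 0) ^ (2 * q) + norm (\<phi> x - \<phi> 0) ^ (2 * q))" by (rule norm_power_add_le)
    also have "norm (\<phi> x - \<phi> 0) ^ (2 * q) \<le> K * norm x ^ (2 * q)"
    proof -
      have "norm (\<phi> x - \<phi> 0) ^ (2 * q) \<le> L ^ (2 * q) * norm x ^ (2 * q)"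
        using power_mono[OF \<phi>(2)[of x 0]] by (simp add: power_mult_distrib)
      also have "\<dots> \<le> K * norm x ^ (2 * q)" by (intro mult_right_mono K(2)) simp
      finally show ?thesis .
    qed
    also note K(1)
    finally show ?thesis by (simp add: algebra_simps)
  qed
  with Lp_dominated[OF _ i, of "\<lambda>\<omega>. \<phi> (Y \<omega>)" "2 * q"] LpD(2)[OF Y]
  show "Lp (2 * q) (\<lambda>\<omega>. \<phi> (Y \<omega>))" "mom (2 * q) (\<lambda>\<omega>. \<phi> (Y \<omega>)) \<le> 2 ^ (2 * q) * K * (1 + mom (2 * q) Y)"
    by (auto simp: mom_def prob_space)
qed

lemma growth:
  "\<exists>K\<ge>0. \<forall>Y. Lp (2 * q) Y \<longrightarrow> Lp (2 * q) (\<lambda>\<omega>. f (Y \<omega>)) \<and> Lp (2 * q) (\<lambda>\<omega>. g (Y \<omega>)) \<and>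
    mom (2 * q) (\<lambda>\<omega>. f (Y \<omega>)) \<le> K * (1 + mom (2 * q) Y) \<and> mom (2 * q) (\<lambda>\<omega>. g (Y \<omega>)) \<le> K * (1 + mom (2 * q) Y)"
proof -
  define K0 where "K0 = norm (f 0) ^ (2 * q) + norm (g 0) ^ (2 * q) + L ^ (2 * q)"
  have K0: "norm (f 0) ^ (2 * q) \<le> K0" "norm (g 0) ^ (2 * q) \<le> K0" "L ^ (2 * q) \<le> K0" "K0 \<ge> 0"
    using L_nonneg by (auto simp: K0_def)
  show ?thesis
    using affine_growth_mom[OF _ f_meas f_lip K0(1,3)] affine_growth_mom[OF _ g_meas g_lip K0(2,3)] K0(4)
    by (intro exI[of _ "2 ^ (2 * q) * K0"]) simp
qed

lemma lip_mom:
  assumes "Lp p Y" "Lp p Y'"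
  shows "Lp p (\<lambda>\<omega>. f (Y \<omega>) - f (Y' \<omega>))" "Lp p (\<lambda>\<omega>. g (Y \<omega>) - g (Y' \<omega>))"
    "mom p (\<lambda>\<omega>. f (Y \<omega>) - f (Y' \<omega>)) \<le> L ^ p * mom p (\<lambda>\<omega>. Y \<omega> - Y' \<omega>)"
    "mom p (\<lambda>\<omega>. g (Y \<omega>) - g (Y' \<omega>)) \<le> L ^ p * mom p (\<lambda>\<omega>. Y \<omega> - Y' \<omega>)"
proof -
  note [measurable] = LpD(1)[OF assms(1)] LpD(1)[OF assms(2)]
  note le = Lp_le[OF _ Lp_diff(1)[OF assms] L_nonneg]
  show "Lp p (\<lambda>\<omega>. f (Y \<omega>) - f (Y' \<omega>))" "Lp p (\<lambda>\<omega>. g (Y \<omega>) - g (Y' \<omega>))"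
    "mom p (\<lambda>\<omega>. f (Y \<omega>) - f (Y' \<omega>)) \<le> L ^ p * mom p (\<lambda>\<omega>. Y \<omega> - Y' \<omega>)"
    "mom p (\<lambda>\<omega>. g (Y \<omega>) - g (Y' \<omega>)) \<le> L ^ p * mom p (\<lambda>\<omega>. Y \<omega> - Y' \<omega>)"
    by (rule le; use f_lip g_lip in simp)+
qed

lemma eul_F:
  assumes "grid T h"
  shows "(\<lambda>\<omega>. eul x T \<omega> j) \<in> borel_measurable (F (T j))"
proof (induction j)
  case (Suc j)
  have T: "T j \<le> T (Suc j)" "0 \<le> T j" using assms grid_nonneg[OF assms] by (auto simp: grid_def)
  have [measurable]: "(\<lambda>\<omega>. eul x T \<omega> j) \<in> borel_measurable (F (T (Suc j)))"
    by (rule measurable_F_mono[OF Suc T(1)])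
  have [measurable]: "(\<lambda>\<omega>. \<omega> (T (Suc j))) \<in> borel_measurable (F (T (Suc j)))"
    "(\<lambda>\<omega>. \<omega> (T j)) \<in> borel_measurable (F (T (Suc j)))" using T by (auto intro!: eval_F)
  show ?case unfolding euler.simps euler_step_def by measurable
qed simp

text \<open>The recursion is written for 1 plus the moment, which turns the affine growth of the
  coefficients into a linear bound.\<close>

lemma eul_moment:
  assumes q: "q \<ge> 1" and R: "R \<ge> 0"
  shows "\<exists>C\<ge>0. \<forall>x T h M. grid T h \<longrightarrow> 0 < h \<longrightarrow> h \<le> 1 \<longrightarrow> real M * h \<le> R \<longrightarrow>
    Lp (2 * q) (\<lambda>\<omega>. eul x T \<omega> M) \<and> 1 + mom (2 * q) (\<lambda>\<omega>. eul x T \<omega> M) \<le> C * (1 + norm x ^ (2 * q))"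
proof -
  let ?p = "2 * q"
  obtain C1 where C1: "C1 \<ge> 0" "\<And>a b h V \<alpha> \<Gamma>. 0 \<le> a \<Longrightarrow> a \<le> b \<Longrightarrow> b - a \<le> h \<Longrightarrow> h \<le> 1 \<Longrightarrow> V \<in> borel_measurable (F a) \<Longrightarrow> Lp ?p V \<Longrightarrow>
    Lp ?p \<alpha> \<Longrightarrow> \<Gamma> \<in> borel_measurable (F a) \<Longrightarrow> Lp ?p \<Gamma> \<Longrightarrow>
    Lp ?p (\<lambda>\<omega>. V \<omega> + h *\<^sub>R \<alpha> \<omega> + \<Gamma> \<omega> *v (\<omega> b - \<omega> a) :: real^'n) \<and>
    mom ?p (\<lambda>\<omega>. V \<omega> + h *\<^sub>R \<alpha> \<omega> + \<Gamma> \<omega> *v (\<omega> b - \<omega> a)) \<le>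
      (1 + C1 * h) * mom ?p V + C1 * h * (mom ?p \<alpha> + mom ?p \<Gamma>)"
    using moment_step[OF q, where 'n='n] by meson
  obtain K where K: "K \<ge> 0" "\<And>Y. Lp ?p Y \<Longrightarrow> Lp ?p (\<lambda>\<omega>. f (Y \<omega>)) \<and> Lp ?p (\<lambda>\<omega>. g (Y \<omega>)) \<and>
    mom ?p (\<lambda>\<omega>. f (Y \<omega>)) \<le> K * (1 + mom ?p Y) \<and> mom ?p (\<lambda>\<omega>. g (Y \<omega>)) \<le> K * (1 + mom ?p Y)"
    using growth by blast
  define A where "A = C1 + C1 * (2 * K)"
  have A: "A \<ge> 0" using C1 K by (simp add: A_def)
  show ?thesis
  proof (intro exI[of _ "exp (A * R)"] conjI allI impI)
    show "0 \<le> exp (A * R)" by simp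
    fix x T h M assume g: "grid T h" and h: "0 < h" "h \<le> (1::real)" and M: "real M * h \<le> R"
    have "Lp ?p (\<lambda>\<omega>. eul x T \<omega> j) \<and> (j < M \<longrightarrow>
      1 + mom ?p (\<lambda>\<omega>. eul x T \<omega> (Suc j)) \<le> (1 + A * h) * (1 + mom ?p (\<lambda>\<omega>. eul x T \<omega> j)) + 0 * h)" (is "?P j \<and> (_ \<longrightarrow> ?Q j)") for j
    proof -
      have step: "?P (Suc j) \<and> ?Q j" if P: "?P j" for j
      proof -
        let ?Y = "\<lambda>\<omega>. eul x T \<omega> j" and ?\<Delta> = "T (Suc j) - T j"
        have T: "0 \<le> ?\<Delta>" "?\<Delta> \<le> h" "0 \<le> T j" using g grid_nonneg[OF g] by (auto simp: grid_def)
        have Ym: "?Y \<in> borel_measurable (F (T j))" by (rule eul_F[OF g])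
        have Gm: "(\<lambda>\<omega>. g (?Y \<omega>)) \<in> borel_measurable (F (T j))" using Ym by measurable
        note k = K(2)[OF P]
        \<comment> \<open>The true step is a fraction of \<open>h\<close>; the quotient, at most 1,
          goes into the drift.\<close>
        have a: "Lp ?p (\<lambda>\<omega>. (?\<Delta> / h) *\<^sub>R f (?Y \<omega>))" using k by (intro Lp_scaleR) auto
        have "mom ?p (\<lambda>\<omega>. (?\<Delta> / h) *\<^sub>R f (?Y \<omega>)) = (?\<Delta> / h) ^ ?p * mom ?p (\<lambda>\<omega>. f (?Y \<omega>))"
          using Lp_scaleR(2)[of ?p "\<lambda>\<omega>. f (?Y \<omega>)"] k T h by simp
        also have "\<dots> \<le> 1 * mom ?p (\<lambda>\<omega>. f (?Y \<omega>))"
          using T h by (intro mult_right_mono power_le_one) auto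
        finally have a2: "mom ?p (\<lambda>\<omega>. (?\<Delta> / h) *\<^sub>R f (?Y \<omega>)) \<le> K * (1 + mom ?p ?Y)" using k by simp
        have eq: "(\<lambda>\<omega>. eul x T \<omega> (Suc j)) = (\<lambda>\<omega>. ?Y \<omega> + h *\<^sub>R ((?\<Delta> / h) *\<^sub>R f (?Y \<omega>)) + g (?Y \<omega>) *v (\<omega> (T (Suc j)) - \<omega> (T j)))"
          using h by (simp add: euler_step_def)
        have s: "Lp ?p (\<lambda>\<omega>. eul x T \<omega> (Suc j))" "mom ?p (\<lambda>\<omega>. eul x T \<omega> (Suc j)) \<le>
          (1 + C1 * h) * mom ?p ?Y + C1 * h * (mom ?p (\<lambda>\<omega>. (?\<Delta> / h) *\<^sub>R f (?Y \<omega>)) + mom ?p (\<lambda>\<omega>. g (?Y \<omega>)))"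
          unfolding eq using C1(2)[OF T(3) _ T(2) h(2) Ym P a Gm] T(1) k by auto
        have "mom ?p (\<lambda>\<omega>. eul x T \<omega> (Suc j)) \<le> (1 + C1 * h) * mom ?p ?Y + C1 * h * (K * (1 + mom ?p ?Y) + K * (1 + mom ?p ?Y))"
          by (rule order_trans[OF s(2)]) (use a2 k C1 h in \<open>intro add_mono mult_left_mono; simp\<close>)
        also have "\<dots> + 1 \<le> (1 + A * h) * (1 + mom ?p ?Y)"
          using C1(1) h by (simp add: A_def algebra_simps)
        finally show ?thesis using s(1) by simp
      qed
      have "?P j" by (induction j) (use step Lp_const in auto)
      with step show ?thesis by blast
    qed
    then have P: "\<And>j. ?P j" and Q: "\<And>j. j < M \<Longrightarrow> ?Q j" by blast+
    show "?P M" by (rule P)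
    have "1 + mom ?p (\<lambda>\<omega>. eul x T \<omega> M) \<le> exp (A * R) * (1 + mom ?p (\<lambda>\<omega>. eul x T \<omega> 0) + 0 * R)"
      by (rule discrete_gronwall[where a="\<lambda>j. 1 + mom ?p (\<lambda>\<omega>. eul x T \<omega> j)", OF Q A _ _ _ M])
        (use h in \<open>auto simp: add_nonneg_nonneg\<close>)
    then show "1 + mom ?p (\<lambda>\<omega>. eul x T \<omega> M) \<le> exp (A * R) * (1 + norm x ^ ?p)" by (simp add: Lp_const)
  qed
qed

text \<open>The increments along \<open>T\<close> and along \<open>T'\<close> differ by two pieces,
  over \<open>[T j, T' j]\<close> and \<open>[T (Suc j), T' (Suc j)]\<close>. These are put into the
  drift of \<open>moment_step\<close>; the compensating factor \<open>1 / h\<close> is the origin of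
  the denominator \<open>h ^ (2 * q)\<close>. As \<open>T\<close> runs before \<open>T'\<close>,
  both schemes are adapted at the times of \<open>T'\<close>.\<close>

lemma eul_regularity:
  assumes q: "q \<ge> 1" and R: "R \<ge> 0"
  shows "\<exists>C\<ge>0. \<forall>x x' T T' h \<delta> M. grid T h \<longrightarrow> grid T' h \<longrightarrow> (\<forall>j. T j \<le> T' j \<and> T' j \<le> T j + \<delta>) \<longrightarrow>
    0 \<le> \<delta> \<longrightarrow> \<delta> \<le> 1 \<longrightarrow> 0 < h \<longrightarrow> h \<le> 1 \<longrightarrow> real M * h \<le> R \<longrightarrow>
    Lp (2 * q) (\<lambda>\<omega>. eul x T \<omega> M - eul x' T' \<omega> M) \<and>
    mom (2 * q) (\<lambda>\<omega>. eul x T \<omega> M - eul x' T' \<omega> M) \<le> C * (norm (x - x') ^ (2 * q) + (1 + norm x ^ (2 * q)) * (\<delta> ^ q / h ^ (2 * q)))"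
proof -
  let ?p = "2 * q"
  obtain C1 where C1: "C1 \<ge> 0" "\<And>a b h V \<alpha> \<Gamma>. 0 \<le> a \<Longrightarrow> a \<le> b \<Longrightarrow> b - a \<le> h \<Longrightarrow> h \<le> 1 \<Longrightarrow> V \<in> borel_measurable (F a) \<Longrightarrow> Lp ?p V \<Longrightarrow>
    Lp ?p \<alpha> \<Longrightarrow> \<Gamma> \<in> borel_measurable (F a) \<Longrightarrow> Lp ?p \<Gamma> \<Longrightarrow>
    Lp ?p (\<lambda>\<omega>. V \<omega> + h *\<^sub>R \<alpha> \<omega> + \<Gamma> \<omega> *v (\<omega> b - \<omega> a) :: real^'n) \<and>
    mom ?p (\<lambda>\<omega>. V \<omega> + h *\<^sub>R \<alpha> \<omega> + \<Gamma> \<omega> *v (\<omega> b - \<omega> a)) \<le>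
      (1 + C1 * h) * mom ?p V + C1 * h * (mom ?p \<alpha> + mom ?p \<Gamma>)"
    using moment_step[OF q, where 'n='n] by meson
  obtain K where K: "K \<ge> 0" "\<And>Y. Lp ?p Y \<Longrightarrow> Lp ?p (\<lambda>\<omega>. f (Y \<omega>)) \<and> Lp ?p (\<lambda>\<omega>. g (Y \<omega>)) \<and>
    mom ?p (\<lambda>\<omega>. f (Y \<omega>)) \<le> K * (1 + mom ?p Y) \<and> mom ?p (\<lambda>\<omega>. g (Y \<omega>)) \<le> K * (1 + mom ?p Y)"
    using growth by blast
  obtain Cm where Cm: "Cm \<ge> 0" "\<And>x T h M. grid T h \<Longrightarrow> 0 < h \<Longrightarrow> h \<le> 1 \<Longrightarrow> real M * h \<le> R \<Longrightarrow>
    Lp ?p (\<lambda>\<omega>. eul x T \<omega> M) \<and> 1 + mom ?p (\<lambda>\<omega>. eul x T \<omega> M) \<le> Cm * (1 + norm x ^ ?p)"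
    using eul_moment[OF q R] by blast
  obtain c where c: "c \<ge> 0" "\<And>a b. 0 \<le> a \<Longrightarrow> a \<le> b \<Longrightarrow> Lp ?p (\<lambda>\<omega>. \<omega> b - \<omega> a) \<and>
    mom ?p (\<lambda>\<omega>. \<omega> b - \<omega> a) \<le> c * (b - a) ^ q" using increment_norm_moment[OF q] by blast
  \<comment> \<open>In \<open>D\<close> the 1 is for \<open>\<alpha>2\<close> and the rest for
    \<open>\<alpha>3\<close>; the power of 4 in \<open>B\<close> comes from splitting the drift
    twice into two parts.\<close>
  define D where "D = Cm * K * (1 + 2 ^ ?p * (c + c))"
  define A where "A = C1 * (1 + L ^ ?p + 2 ^ ?p * L ^ ?p)"
  define B where "B = C1 * 4 ^ ?p * D"
  have D: "D \<ge> 0" using Cm K c by (simp add: D_def)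
  have A: "A \<ge> 0" using C1 L_nonneg by (simp add: A_def)
  have B: "B \<ge> 0" using C1 D by (simp add: B_def)
  define C where "C = exp (A * R) * (1 + B * R)"
  have C: "exp (A * R) \<le> C" "exp (A * R) * (B * R) \<le> C" "C \<ge> 0" using B R by (auto simp: C_def distrib_left)
  show ?thesis
  proof (intro exI[of _ C] conjI allI impI)
    show "C \<ge> 0" by (fact C(3))
    fix x x' :: "real^'n" and T T' :: "nat \<Rightarrow> real" and h \<delta> :: real and M :: nat
    assume g: "grid T h" "grid T' h" and TT: "\<forall>j. T j \<le> T' j \<and> T' j \<le> T j + \<delta>"
      and \<delta>: "0 \<le> \<delta>" "\<delta> \<le> (1::real)" and h: "0 < h" "h \<le> (1::real)" and M: "real M * h \<le> R"
    define E where "E = (1 + norm x ^ ?p) * (\<delta> ^ q / h ^ ?p)"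
    have E: "E \<ge> 0" using \<delta> h by (auto simp: E_def intro!: mult_nonneg_nonneg divide_nonneg_nonneg)
    let ?V = "\<lambda>j \<omega>. eul x T \<omega> j - eul x' T' \<omega> j"
    have jM: "real j * h \<le> R" if "j \<le> M" for j using that h by (intro order_trans[OF mult_right_mono M]) auto
    have Y: "Lp ?p (\<lambda>\<omega>. eul x T \<omega> j)" "1 + mom ?p (\<lambda>\<omega>. eul x T \<omega> j) \<le> Cm * (1 + norm x ^ ?p)"
      "Lp ?p (\<lambda>\<omega>. eul x' T' \<omega> j)" if "j \<le> M" for j
      using Cm(2)[OF g(1) h jM[OF that]] Cm(2)[OF g(2) h jM[OF that]] by auto
    have step: "mom ?p (?V (Suc j)) \<le> (1 + A * h) * mom ?p (?V j) + B * E * h" if j: "j < M" for j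
    proof -
      let ?Y = "\<lambda>\<omega>. eul x T \<omega> j" and ?Y' = "\<lambda>\<omega>. eul x' T' \<omega> j"
      let ?\<Delta> = "T (Suc j) - T j" and ?\<Delta>' = "T' (Suc j) - T' j"
      have j': "j \<le> M" using j by simp
      have T: "0 \<le> ?\<Delta>" "?\<Delta> \<le> h" "0 \<le> T j" "0 \<le> ?\<Delta>'" "?\<Delta>' \<le> h" "0 \<le> T' j" "T j \<le> T' j" "T (Suc j) \<le> T' (Suc j)" "0 \<le> T (Suc j)"
        "T j \<le> T (Suc j)" "T' j - T j \<le> \<delta>" "T' (Suc j) - T (Suc j) \<le> \<delta>"
        using g grid_nonneg[OF g(1)] grid_nonneg[OF g(2)] TT[rule_format, of j] TT[rule_format, of "Suc j"] by (auto simp: grid_def)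
      have \<Delta>\<Delta>: "\<bar>?\<Delta> - ?\<Delta>'\<bar> \<le> \<delta>" using TT[rule_format, of j] TT[rule_format, of "Suc j"] by auto
      have Ym: "?Y \<in> borel_measurable (F (T j))" "?Y' \<in> borel_measurable (F (T' j))" by (rule eul_F[OF g(1)], rule eul_F[OF g(2)])
      have Ym': "?Y \<in> borel_measurable (F (T' j))" by (rule measurable_F_mono[OF Ym(1) T(7)])
      have gYm: "(\<lambda>\<omega>. g (?Y \<omega>)) \<in> borel_measurable (F (T j))" using Ym by measurable
      note YLp = Y(1)[OF j'] Y(3)[OF j']
      note k = K(2)[OF YLp(1)]
      have kD: "K * (1 + mom ?p ?Y) \<le> Cm * K * (1 + norm x ^ ?p)"
        using mult_left_mono[OF Y(2)[OF j'] K(1)] by (simp add: algebra_simps)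
      have h1: "(1 / h) ^ ?p * \<delta> ^ q = \<delta> ^ q / h ^ ?p" by (simp add: power_divide)
      \<comment> \<open>\<open>\<alpha>1\<close> is the Lipschitz difference of the drifts,
        \<open>\<alpha>2\<close> the change of the step length, and \<open>\<alpha>3\<close> the two
        extra pieces of the noise.\<close>
      define \<alpha>1 where "\<alpha>1 = (\<lambda>\<omega>. (?\<Delta>' / h) *\<^sub>R (f (?Y \<omega>) - f (?Y' \<omega>)))"
      define \<alpha>2 where "\<alpha>2 = (\<lambda>\<omega>. ((?\<Delta> - ?\<Delta>') / h) *\<^sub>R f (?Y \<omega>))"
      define \<beta>1 where "\<beta>1 = (\<lambda>\<omega>. g (?Y \<omega>) *v (\<omega> (T' j) - \<omega> (T j)))"
      define \<beta>2 where "\<beta>2 = (\<lambda>\<omega>. g (?Y \<omega>) *v (\<omega> (T' (Suc j)) - \<omega> (T (Suc j))))"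
      define \<alpha>3 where "\<alpha>3 = (\<lambda>\<omega>. (1 / h) *\<^sub>R (\<beta>1 \<omega> - \<beta>2 \<omega>))"
      have a1: "Lp ?p \<alpha>1" "mom ?p \<alpha>1 \<le> L ^ ?p * mom ?p (?V j)"
      proof -
        note l = lip_mom[OF YLp]
        show "Lp ?p \<alpha>1" unfolding \<alpha>1_def by (rule Lp_scaleR[OF l(1)])
        have "mom ?p \<alpha>1 = (?\<Delta>' / h) ^ ?p * mom ?p (\<lambda>\<omega>. f (?Y \<omega>) - f (?Y' \<omega>))"
          using T h unfolding \<alpha>1_def Lp_scaleR(2)[OF l(1)] by simp
        also have "\<dots> \<le> 1 * mom ?p (\<lambda>\<omega>. f (?Y \<omega>) - f (?Y' \<omega>))"
          using T h by (intro mult_right_mono power_le_one) auto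
        finally show "mom ?p \<alpha>1 \<le> L ^ ?p * mom ?p (?V j)" using l(3) by simp
      qed
      have a2: "Lp ?p \<alpha>2" "mom ?p \<alpha>2 \<le> Cm * K * E"
      proof -
        have l: "Lp ?p (\<lambda>\<omega>. f (?Y \<omega>))" using k by simp
        show "Lp ?p \<alpha>2" unfolding \<alpha>2_def by (rule Lp_scaleR[OF l])
        have "mom ?p \<alpha>2 = (\<bar>?\<Delta> - ?\<Delta>'\<bar> / h) ^ ?p * mom ?p (\<lambda>\<omega>. f (?Y \<omega>))"
          using h unfolding \<alpha>2_def Lp_scaleR(2)[OF l] by simp
        also have "\<dots> \<le> (\<delta> ^ q / h ^ ?p) * (Cm * K * (1 + norm x ^ ?p))"
        proof (rule mult_mono)
          \<comment> \<open>The change of step length is of order \<open>\<delta>\<close>, better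
            than the noise; it is weakened to the order \<open>\<delta> ^ q\<close> of the
            latter.\<close>
          have "\<bar>?\<Delta> - ?\<Delta>'\<bar> ^ ?p \<le> \<delta> ^ ?p" by (intro power_mono \<Delta>\<Delta>) simp
          also have "\<dots> \<le> \<delta> ^ q" using \<delta> by (intro power_decreasing) auto
          finally show "(\<bar>?\<Delta> - ?\<Delta>'\<bar> / h) ^ ?p \<le> \<delta> ^ q / h ^ ?p"
            using h by (simp add: power_divide divide_right_mono)
        qed (use k kD \<delta> h in auto)
        also have "\<dots> = Cm * K * E" by (simp add: E_def)
        finally show "mom ?p \<alpha>2 \<le> Cm * K * E" .
      qed
      have b: "Lp ?p \<beta>1" "Lp ?p \<beta>2" "mom ?p \<beta>1 \<le> Cm * K * (1 + norm x ^ ?p) * (c * \<delta> ^ q)"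
         "mom ?p \<beta>2 \<le> Cm * K * (1 + norm x ^ ?p) * (c * \<delta> ^ q)"
      proof -
        have gL: "Lp ?p (\<lambda>\<omega>. g (?Y \<omega>))" using k by simp
        note m1 = Lp_mult_increment[OF T(3) order_refl T(7) gYm gL q]
        note m2 = Lp_mult_increment[OF T(3) T(10) T(8) gYm gL q]
        have gk: "mom ?p (\<lambda>\<omega>. g (?Y \<omega>)) \<le> Cm * K * (1 + norm x ^ ?p)" using k kD by simp
        show "Lp ?p \<beta>1" "Lp ?p \<beta>2" using m1 m2 by (auto simp: \<beta>1_def \<beta>2_def)
        have "mom ?p (\<lambda>\<omega>. \<omega> (T' j) - \<omega> (T j)) \<le> c * \<delta> ^ q"
          using c(2)[OF T(3) T(7)] mult_left_mono[OF power_mono[OF T(11), of q] c(1)] T by auto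
        with gk show "mom ?p \<beta>1 \<le> Cm * K * (1 + norm x ^ ?p) * (c * \<delta> ^ q)"
          unfolding \<beta>1_def by (intro order_trans[OF m1(2)] mult_mono) (use Cm K in auto)
        have "mom ?p (\<lambda>\<omega>. \<omega> (T' (Suc j)) - \<omega> (T (Suc j))) \<le> c * \<delta> ^ q"
          using c(2)[OF T(9) T(8)] mult_left_mono[OF power_mono[OF T(12), of q] c(1)] T by auto
        with gk show "mom ?p \<beta>2 \<le> Cm * K * (1 + norm x ^ ?p) * (c * \<delta> ^ q)"
          unfolding \<beta>2_def by (intro order_trans[OF m2(2)] mult_mono) (use Cm K in auto)
      qed
      have a3: "Lp ?p \<alpha>3" "mom ?p \<alpha>3 \<le> Cm * K * (2 ^ ?p * (c + c)) * E"
      proof -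
        note l = Lp_diff[OF b(1,2)]
        show "Lp ?p \<alpha>3" unfolding \<alpha>3_def by (rule Lp_scaleR[OF l(1)])
        have "mom ?p \<alpha>3 = (1 / h) ^ ?p * mom ?p (\<lambda>\<omega>. \<beta>1 \<omega> - \<beta>2 \<omega>)"
          using h unfolding \<alpha>3_def Lp_scaleR(2)[OF l(1)] by simp
        also have "\<dots> \<le> (1 / h) ^ ?p * (2 ^ ?p * (Cm * K * (1 + norm x ^ ?p) * (c * \<delta> ^ q) + Cm * K * (1 + norm x ^ ?p) * (c * \<delta> ^ q)))"
          using b h by (intro mult_left_mono order_trans[OF l(2)] add_mono) auto
        also have "\<dots> = Cm * K * (2 ^ ?p * (c + c)) * ((1 + norm x ^ ?p) * ((1 / h) ^ ?p * \<delta> ^ q))"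
          by (simp add: algebra_simps)
        finally show "mom ?p \<alpha>3 \<le> Cm * K * (2 ^ ?p * (c + c)) * E" by (simp add: E_def h1)
      qed
      define \<alpha> where "\<alpha> = (\<lambda>\<omega>. \<alpha>1 \<omega> + (\<alpha>2 \<omega> + \<alpha>3 \<omega>))"
      have a23: "Lp ?p (\<lambda>\<omega>. \<alpha>2 \<omega> + \<alpha>3 \<omega>)" "mom ?p (\<lambda>\<omega>. \<alpha>2 \<omega> + \<alpha>3 \<omega>) \<le> 2 ^ ?p * (D * E)"
      proof -
        show "Lp ?p (\<lambda>\<omega>. \<alpha>2 \<omega> + \<alpha>3 \<omega>)" by (rule Lp_add[OF a2(1) a3(1)])
        have "mom ?p (\<lambda>\<omega>. \<alpha>2 \<omega> + \<alpha>3 \<omega>) \<le> 2 ^ ?p * (mom ?p \<alpha>2 + mom ?p \<alpha>3)" by (rule Lp_add[OF a2(1) a3(1)])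
        also have "\<dots> \<le> 2 ^ ?p * (Cm * K * E + Cm * K * (2 ^ ?p * (c + c)) * E)"
          by (intro mult_left_mono add_mono a2 a3) simp
        finally show "mom ?p (\<lambda>\<omega>. \<alpha>2 \<omega> + \<alpha>3 \<omega>) \<le> 2 ^ ?p * (D * E)" by (simp add: D_def algebra_simps)
      qed
      have a: "Lp ?p \<alpha>" "mom ?p \<alpha> \<le> 2 ^ ?p * L ^ ?p * mom ?p (?V j) + 4 ^ ?p * D * E"
      proof -
        show "Lp ?p \<alpha>" unfolding \<alpha>_def by (rule Lp_add[OF a1(1) a23(1)])
        have "mom ?p \<alpha> \<le> 2 ^ ?p * (mom ?p \<alpha>1 + mom ?p (\<lambda>\<omega>. \<alpha>2 \<omega> + \<alpha>3 \<omega>))" unfolding \<alpha>_def by (rule Lp_add[OF a1(1) a23(1)])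
        also have "\<dots> \<le> 2 ^ ?p * (L ^ ?p * mom ?p (?V j) + 2 ^ ?p * (D * E))"
          by (intro mult_left_mono add_mono a1 a23) simp
        also have "\<dots> = 2 ^ ?p * L ^ ?p * mom ?p (?V j) + (2 * 2) ^ ?p * D * E" unfolding power_mult_distrib by (simp add: algebra_simps)
        finally show "mom ?p \<alpha> \<le> 2 ^ ?p * L ^ ?p * mom ?p (?V j) + 4 ^ ?p * D * E" by simp
      qed
      note G = lip_mom(2,4)[OF YLp]
      have Gm: "(\<lambda>\<omega>. g (?Y \<omega>) - g (?Y' \<omega>)) \<in> borel_measurable (F (T' j))" using Ym(2) Ym' by measurable
      have Vm: "?V j \<in> borel_measurable (F (T' j))" using Ym(2) Ym' by measurable
      have VL: "Lp ?p (?V j)" by (rule Lp_diff[OF YLp])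
      have eq: "?V (Suc j) = (\<lambda>\<omega>. ?V j \<omega> + h *\<^sub>R \<alpha> \<omega> + (g (?Y \<omega>) - g (?Y' \<omega>)) *v (\<omega> (T' (Suc j)) - \<omega> (T' j)))"
      proof
        fix \<omega>
        have "h *\<^sub>R \<alpha> \<omega> = ?\<Delta>' *\<^sub>R (f (?Y \<omega>) - f (?Y' \<omega>)) + (?\<Delta> - ?\<Delta>') *\<^sub>R f (?Y \<omega>) + (\<beta>1 \<omega> - \<beta>2 \<omega>)"
          using h by (simp add: \<alpha>_def \<alpha>1_def \<alpha>2_def \<alpha>3_def scaleR_add_right)
        also have "\<dots> = ?\<Delta> *\<^sub>R f (?Y \<omega>) - ?\<Delta>' *\<^sub>R f (?Y' \<omega>) + (\<beta>1 \<omega> - \<beta>2 \<omega>)" by (simp add: algebra_simps)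
        finally show "?V (Suc j) \<omega> = ?V j \<omega> + h *\<^sub>R \<alpha> \<omega> + (g (?Y \<omega>) - g (?Y' \<omega>)) *v (\<omega> (T' (Suc j)) - \<omega> (T' j))"
          by (simp add: euler_step_def \<beta>1_def \<beta>2_def matrix_vector_mult_diff_distrib matrix_vector_mult_diff_rdistrib algebra_simps)
      qed
      have T'j: "T' j \<le> T' (Suc j)" using T by simp
      have "mom ?p (?V (Suc j)) \<le> (1 + C1 * h) * mom ?p (?V j) + C1 * h * (mom ?p \<alpha> + mom ?p (\<lambda>\<omega>. g (?Y \<omega>) - g (?Y' \<omega>)))"
        unfolding eq using C1(2)[OF T(6) T'j T(5) h(2) Vm VL a(1) Gm G(1)] by blast
      also have "\<dots> \<le> (1 + C1 * h) * mom ?p (?V j) + C1 * h * ((2 ^ ?p * L ^ ?p * mom ?p (?V j) + 4 ^ ?p * D * E) + L ^ ?p * mom ?p (?V j))"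
        using a(2) G(2) C1(1) h by (intro add_mono mult_left_mono order_refl) auto
      also have "\<dots> = (1 + A * h) * mom ?p (?V j) + B * E * h" by (simp add: A_def B_def algebra_simps)
      finally show ?thesis .
    qed
    show "Lp ?p (?V M)" by (rule Lp_diff) (use Y in auto)
    have "mom ?p (?V M) \<le> exp (A * R) * (mom ?p (?V 0) + B * E * R)"
      by (rule discrete_gronwall[where a="\<lambda>j. mom ?p (?V j)", OF step A _ _ _ M]) (use h B E in auto)
    also have "\<dots> = exp (A * R) * norm (x - x') ^ ?p + exp (A * R) * (B * R) * E" by (simp add: Lp_const algebra_simps)
    also have "\<dots> \<le> C * norm (x - x') ^ ?p + C * E" using C E by (intro add_mono mult_right_mono) auto
    finally show "mom ?p (?V M) \<le> C * (norm (x - x') ^ ?p + (1 + norm x ^ ?p) * (\<delta> ^ q / h ^ ?p))"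
      by (simp add: E_def distrib_left)
  qed
qed

text \<open>A coarse step is a pair of fine steps with coefficients frozen at its start. In the
  first half both schemes use coefficients at the same time and the Lipschitz property suffices; in
  the second half the fine scheme has moved by an amount whose moment is of order
  \<open>h ^ q\<close>. This is the strong order 1/2 of the Euler scheme.\<close>

lemma eul_refinement:
  assumes q: "q \<ge> 1" and R: "R \<ge> 0"
  shows "\<exists>C\<ge>0. \<forall>x S h M. grid S h \<longrightarrow> 0 < h \<longrightarrow> h \<le> 1/2 \<longrightarrow> 2 * real M * h \<le> R \<longrightarrow>
    Lp (2 * q) (\<lambda>\<omega>. eul x (\<lambda>j. S (2 * j)) \<omega> M - eul x S \<omega> (2 * M)) \<and>
    mom (2 * q) (\<lambda>\<omega>. eul x (\<lambda>j. S (2 * j)) \<omega> M - eul x S \<omega> (2 * M)) \<le> C * ((1 + norm x ^ (2 * q)) * h ^ q)"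
proof -
  let ?p = "2 * q"
  obtain C1 where C1: "C1 \<ge> 0" "\<And>a b h V \<alpha> \<Gamma>. 0 \<le> a \<Longrightarrow> a \<le> b \<Longrightarrow> b - a \<le> h \<Longrightarrow> h \<le> 1 \<Longrightarrow> V \<in> borel_measurable (F a) \<Longrightarrow> Lp ?p V \<Longrightarrow>
    Lp ?p \<alpha> \<Longrightarrow> \<Gamma> \<in> borel_measurable (F a) \<Longrightarrow> Lp ?p \<Gamma> \<Longrightarrow>
    Lp ?p (\<lambda>\<omega>. V \<omega> + h *\<^sub>R \<alpha> \<omega> + \<Gamma> \<omega> *v (\<omega> b - \<omega> a) :: real^'n) \<and>
    mom ?p (\<lambda>\<omega>. V \<omega> + h *\<^sub>R \<alpha> \<omega> + \<Gamma> \<omega> *v (\<omega> b - \<omega> a)) \<le>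
      (1 + C1 * h) * mom ?p V + C1 * h * (mom ?p \<alpha> + mom ?p \<Gamma>)"
    using moment_step[OF q, where 'n='n] by meson
  obtain K where K: "K \<ge> 0" "\<And>Y. Lp ?p Y \<Longrightarrow> Lp ?p (\<lambda>\<omega>. f (Y \<omega>)) \<and> Lp ?p (\<lambda>\<omega>. g (Y \<omega>)) \<and>
    mom ?p (\<lambda>\<omega>. f (Y \<omega>)) \<le> K * (1 + mom ?p Y) \<and> mom ?p (\<lambda>\<omega>. g (Y \<omega>)) \<le> K * (1 + mom ?p Y)"
    using growth by blast
  obtain Cm where Cm: "Cm \<ge> 0" "\<And>x T h M. grid T h \<Longrightarrow> 0 < h \<Longrightarrow> h \<le> 1 \<Longrightarrow> real M * h \<le> R \<Longrightarrow>
    Lp ?p (\<lambda>\<omega>. eul x T \<omega> M) \<and> 1 + mom ?p (\<lambda>\<omega>. eul x T \<omega> M) \<le> Cm * (1 + norm x ^ ?p)"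
    using eul_moment[OF q R] by blast
  obtain c where c: "c \<ge> 0" "\<And>a b. 0 \<le> a \<Longrightarrow> a \<le> b \<Longrightarrow> Lp ?p (\<lambda>\<omega>. \<omega> b - \<omega> a) \<and>
    mom ?p (\<lambda>\<omega>. \<omega> b - \<omega> a) \<le> c * (b - a) ^ q" using increment_norm_moment[OF q] by blast
  \<comment> \<open>\<open>D\<close> is for the displacement in one fine step, \<open>A1\<close> and
    \<open>A2\<close> for the two halves of a coarse step. \<open>A\<close> collects the product of
    the growth factors, with \<open>h * h\<close> estimated by \<open>h\<close>.\<close>
  define D where "D = 2 ^ ?p * (Cm * K + Cm * K * c)"
  define A1 where "A1 = C1 * (1 + 2 * L ^ ?p)"
  define A2 where "A2 = C1 * (2 * L ^ ?p * 2 ^ ?p)"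
  define A where "A = A1 + C1 + C1 * A1 + A2"
  define B where "B = A2 * D"
  have D: "D \<ge> 0" using Cm K c by (simp add: D_def)
  have A12: "A1 \<ge> 0" "A2 \<ge> 0" using C1 L_nonneg by (auto simp: A1_def A2_def)
  have A: "A \<ge> 0" using C1 A12 by (simp add: A_def)
  have B: "B \<ge> 0" using A12 D by (simp add: B_def)
  have CC: "exp (A * R) * (B * R) \<ge> 0" using B R by simp
  show ?thesis
  proof (intro exI[of _ "exp (A * R) * (B * R)"] conjI allI impI)
    show "0 \<le> exp (A * R) * (B * R)" by (fact CC)
    fix x :: "real^'n" and S :: "nat \<Rightarrow> real" and h :: real and M :: nat
    assume gS: "grid S h" and h: "0 < h" "h \<le> (1/2::real)" and M: "2 * real M * h \<le> R"
    have h1: "h \<le> 1" "2 * h \<le> 1" "0 < 2 * h" using h by auto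
    define T where "T = (\<lambda>j. S (2 * j))"
    have gT: "grid T (2 * h)"
    proof -
      have "S (2 * j) \<le> S (2 * Suc j) \<and> S (2 * Suc j) - S (2 * j) \<le> 2 * h" for j
        using gS[unfolded grid_def, THEN conjunct2, rule_format, of "2*j"] gS[unfolded grid_def, THEN conjunct2, rule_format, of "2*j+1"] by simp
      then show ?thesis using gS by (auto simp: grid_def T_def)
    qed
    define E where "E = (1 + norm x ^ ?p) * h ^ q"
    have E: "E \<ge> 0" using h by (auto simp: E_def intro!: mult_nonneg_nonneg)
    let ?C = "\<lambda>j \<omega>. eul x T \<omega> j" and ?Y = "\<lambda>j \<omega>. eul x S \<omega> j"
    let ?V = "\<lambda>j \<omega>. ?C j \<omega> - ?Y (2 * j) \<omega>"
    have jM: "real (2 * j) * h \<le> R" "real j * (2 * h) \<le> R" if "j \<le> M" for j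
      using that h order_trans[OF mult_right_mono[of "real j" "real M" "2 * h"], of R] M by (auto simp: mult_ac)
    have YC: "Lp ?p (?C j)" "Lp ?p (?Y (2 * j))" "1 + mom ?p (?Y (2 * j)) \<le> Cm * (1 + norm x ^ ?p)" if "j \<le> M" for j
      using Cm(2)[OF gT h1(3,2) jM(2)[OF that]] Cm(2)[OF gS h(1) h1(1) jM(1)[OF that]] by auto
    have step: "mom ?p (?V (Suc j)) \<le> (1 + A * h) * mom ?p (?V j) + B * E * h" if j: "j < M" for j
    proof -
      have j': "j \<le> M" using j by simp
      define i where "i = 2 * j"
      have i2: "2 * Suc j = Suc (Suc i)" by (simp add: i_def)
      have Ti: "T j = S i" "T (Suc j) = S (Suc (Suc i))" by (auto simp: T_def i_def)
      let ?Ya = "\<lambda>\<omega>. eul x S \<omega> i" and ?Yb = "\<lambda>\<omega>. eul x S \<omega> (Suc i)"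
      let ?Ca = "\<lambda>\<omega>. eul x T \<omega> j"
      let ?Da = "S (Suc i) - S i" and ?Db = "S (Suc (Suc i)) - S (Suc i)"
      have S: "0 \<le> ?Da" "?Da \<le> h" "0 \<le> ?Db" "?Db \<le> h" "0 \<le> S i" "0 \<le> S (Suc i)" "S i \<le> S (Suc i)" "S (Suc i) \<le> S (Suc (Suc i))"
        using gS grid_nonneg[OF gS] by (auto simp: grid_def)
      have Y0: "Lp ?p ?Ya" "1 + mom ?p ?Ya \<le> Cm * (1 + norm x ^ ?p)" and C0: "Lp ?p ?Ca" using YC[OF j'] by (auto simp: i_def)
      have "real (Suc i) * h \<le> real (2 * M) * h" using j h by (intro mult_right_mono) (auto simp: i_def)
      then have "real (Suc i) * h \<le> R" using M by simp
      from Cm(2)[OF gS h(1) h1(1) this] have Y1: "Lp ?p ?Yb" by blast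
      have Y0m: "?Ya \<in> borel_measurable (F (S i))" and Y1m: "?Yb \<in> borel_measurable (F (S (Suc i)))"
        by (rule eul_F[OF gS])+
      have C0m: "?Ca \<in> borel_measurable (F (S i))" using eul_F[OF gT, of x j] by (simp add: Ti)
      have C0m': "?Ca \<in> borel_measurable (F (S (Suc i)))" by (rule measurable_F_mono[OF C0m S(7)])
      note k = K(2)[OF Y0(1)]
      have kD: "K * (1 + mom ?p ?Ya) \<le> Cm * K * (1 + norm x ^ ?p)"
        using mult_left_mono[OF Y0(2) K(1)] by (simp add: algebra_simps)
      have Y01: "Lp ?p (\<lambda>\<omega>. ?Ya \<omega> - ?Yb \<omega>)" "mom ?p (\<lambda>\<omega>. ?Ya \<omega> - ?Yb \<omega>) \<le> D * E"
      proof -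
        show "Lp ?p (\<lambda>\<omega>. ?Ya \<omega> - ?Yb \<omega>)" by (rule Lp_diff[OF Y0(1) Y1])
        have gYm: "(\<lambda>\<omega>. g (?Ya \<omega>)) \<in> borel_measurable (F (S i))" using Y0m by measurable
        have gL: "Lp ?p (\<lambda>\<omega>. g (?Ya \<omega>))" and fL: "Lp ?p (\<lambda>\<omega>. f (?Ya \<omega>))" using k by auto
        define u where "u = (\<lambda>\<omega>. ?Da *\<^sub>R f (?Ya \<omega>))"
        define v where "v = (\<lambda>\<omega>. g (?Ya \<omega>) *v (\<omega> (S (Suc i)) - \<omega> (S i)))"
        note m1 = Lp_mult_increment[OF S(5) order_refl S(7) gYm gL q, folded v_def]
        have hq: "?Da ^ q \<le> h ^ q" "?Da ^ ?p \<le> h ^ q"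
        proof -
          show "?Da ^ q \<le> h ^ q" using S by (intro power_mono) auto
          have "?Da ^ ?p \<le> h ^ ?p" using S by (intro power_mono) auto
          also have "\<dots> \<le> h ^ q" using h by (intro power_decreasing) auto
          finally show "?Da ^ ?p \<le> h ^ q" .
        qed
        have "mom ?p (\<lambda>\<omega>. \<omega> (S (Suc i)) - \<omega> (S i)) \<le> c * h ^ q"
          using c(2)[OF S(5) S(7)] mult_left_mono[OF hq(1) c(1)] by auto
        then have v: "mom ?p v \<le> Cm * K * (1 + norm x ^ ?p) * (c * h ^ q)"
          using k kD by (intro order_trans[OF m1(2)] mult_mono) (use Cm K in auto)
        have uL: "Lp ?p u" unfolding u_def by (rule Lp_scaleR[OF fL])
        have "mom ?p u = ?Da ^ ?p * mom ?p (\<lambda>\<omega>. f (?Ya \<omega>))"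
          using S unfolding u_def Lp_scaleR(2)[OF fL] by simp
        also have "\<dots> \<le> h ^ q * (Cm * K * (1 + norm x ^ ?p))"
          using hq k kD h by (intro mult_mono) auto
        finally have u: "mom ?p u \<le> h ^ q * (Cm * K * (1 + norm x ^ ?p))" .
        have eq: "(\<lambda>\<omega>. ?Ya \<omega> - ?Yb \<omega>) = (\<lambda>\<omega>. (-1) *\<^sub>R (u \<omega> + v \<omega>))"
          by (auto simp: euler_step_def u_def v_def)
        have "mom ?p (\<lambda>\<omega>. ?Ya \<omega> - ?Yb \<omega>) = mom ?p (\<lambda>\<omega>. u \<omega> + v \<omega>)"
          unfolding eq Lp_scaleR(2)[OF Lp_add(1)[OF uL m1(1)]] by simp
        also have "\<dots> \<le> 2 ^ ?p * (mom ?p u + mom ?p v)" by (rule Lp_add[OF uL m1(1)])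
        also have "\<dots> \<le> 2 ^ ?p * (h ^ q * (Cm * K * (1 + norm x ^ ?p)) + Cm * K * (1 + norm x ^ ?p) * (c * h ^ q))"
          by (intro mult_left_mono add_mono u v) simp
        also have "\<dots> = D * E" by (simp add: D_def E_def algebra_simps)
        finally show "mom ?p (\<lambda>\<omega>. ?Ya \<omega> - ?Yb \<omega>) \<le> D * E" .
      qed
      let ?Va = "\<lambda>\<omega>. ?Ca \<omega> - ?Ya \<omega>"
      define v0 where "v0 = mom ?p ?Va"
      have v0: "v0 \<ge> 0" by (simp add: v0_def)
      have V0L: "Lp ?p ?Va" by (rule Lp_diff[OF C0 Y0(1)])
      have V0m: "?Va \<in> borel_measurable (F (S i))" using C0m Y0m by measurable
      \<comment> \<open>The difference after the first half: the coarse scheme is continued to the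
        midpoint with its frozen coefficients.\<close>
      define V1 where "V1 = (\<lambda>\<omega>. ?Ca \<omega> + ?Da *\<^sub>R f (?Ca \<omega>) + g (?Ca \<omega>) *v (\<omega> (S (Suc i)) - \<omega> (S i)) - ?Yb \<omega>)"
      have scale: "Lp ?p (\<lambda>\<omega>. (d / h) *\<^sub>R Z \<omega>) \<and> mom ?p (\<lambda>\<omega>. (d / h) *\<^sub>R Z \<omega>) \<le> mom ?p Z"
        if "0 \<le> d" "d \<le> h" "Lp ?p Z" for d and Z :: "_ \<Rightarrow> real^'n"
      proof -
        have "\<bar>d / h\<bar> ^ ?p * mom ?p Z \<le> 1 * mom ?p Z"
          using that h by (intro mult_right_mono power_le_one) auto
        then show ?thesis using Lp_scaleR[OF that(3), of "d / h"] by simp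
      qed
      have V1: "Lp ?p V1" "mom ?p V1 \<le> (1 + A1 * h) * v0"
      proof -
        note l = lip_mom[OF C0 Y0(1)]
        note s = scale[OF S(1,2) l(1)]
        have Gm: "(\<lambda>\<omega>. g (?Ca \<omega>) - g (?Ya \<omega>)) \<in> borel_measurable (F (S i))" using C0m Y0m by measurable
        have eq: "V1 = (\<lambda>\<omega>. ?Va \<omega> + h *\<^sub>R ((?Da / h) *\<^sub>R (f (?Ca \<omega>) - f (?Ya \<omega>))) + (g (?Ca \<omega>) - g (?Ya \<omega>)) *v (\<omega> (S (Suc i)) - \<omega> (S i)))"
          using h by (simp add: V1_def euler_step_def matrix_vector_mult_diff_rdistrib scaleR_diff_right add_diff_eq diff_add_eq diff_diff_add)
        note c1 = C1(2)[OF S(5) S(7) S(2) h1(1) V0m V0L s[THEN conjunct1] Gm l(2), folded eq]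
        show "Lp ?p V1" using c1 by blast
        have "mom ?p V1 \<le> (1 + C1 * h) * v0 + C1 * h * (L ^ ?p * v0 + L ^ ?p * v0)"
          using c1 s l(3,4) h C1(1) by (auto simp: v0_def intro!: order_trans[OF c1[THEN conjunct2]] add_mono mult_left_mono)
        then show "mom ?p V1 \<le> (1 + A1 * h) * v0" by (simp add: A1_def algebra_simps)
      qed
      have V2: "mom ?p (?V (Suc j)) \<le> (1 + C1 * h) * mom ?p V1 + A2 * h * (v0 + D * E)"
      proof -
        note l = lip_mom[OF C0 Y1]
        note s = scale[OF S(3,4) l(1)]
        have Gm: "(\<lambda>\<omega>. g (?Ca \<omega>) - g (?Yb \<omega>)) \<in> borel_measurable (F (S (Suc i)))" using C0m' Y1m by measurable
        have wm: "(\<lambda>\<omega>. \<omega> (S (Suc i))) \<in> borel_measurable (F (S (Suc i)))" "(\<lambda>\<omega>. \<omega> (S i)) \<in> borel_measurable (F (S (Suc i)))"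
          using S by (auto intro!: eval_F)
        have V1m: "V1 \<in> borel_measurable (F (S (Suc i)))"
          unfolding V1_def using C0m' Y1m wm by measurable
        have eq: "?V (Suc j) = (\<lambda>\<omega>. V1 \<omega> + h *\<^sub>R ((?Db / h) *\<^sub>R (f (?Ca \<omega>) - f (?Yb \<omega>))) + (g (?Ca \<omega>) - g (?Yb \<omega>)) *v (\<omega> (S (Suc (Suc i))) - \<omega> (S (Suc i))))"
        proof
          fix \<omega>
          have "?C (Suc j) \<omega> = ?Ca \<omega> + (?Da + ?Db) *\<^sub>R f (?Ca \<omega>) + g (?Ca \<omega>) *v ((\<omega> (S (Suc i)) - \<omega> (S i)) + (\<omega> (S (Suc (Suc i))) - \<omega> (S (Suc i))))"
            by (simp add: euler_step_def Ti)
          also have "\<dots> = ?Ca \<omega> + ?Da *\<^sub>R f (?Ca \<omega>) + ?Db *\<^sub>R f (?Ca \<omega>) + g (?Ca \<omega>) *v (\<omega> (S (Suc i)) - \<omega> (S i)) + g (?Ca \<omega>) *v (\<omega> (S (Suc (Suc i))) - \<omega> (S (Suc i)))"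
            unfolding matrix_vector_right_distrib scaleR_add_left by (simp add: add.assoc)
          finally have 1: "?C (Suc j) \<omega> = \<dots>" .
          have 2: "?Y (2 * Suc j) \<omega> = ?Yb \<omega> + ?Db *\<^sub>R f (?Yb \<omega>) + g (?Yb \<omega>) *v (\<omega> (S (Suc (Suc i))) - \<omega> (S (Suc i)))"
            unfolding i2 euler.simps(2)[of f g x S \<omega> "Suc i"] euler_step_def ..
          have 3: "h *\<^sub>R ((?Db / h) *\<^sub>R (f (?Ca \<omega>) - f (?Yb \<omega>))) = ?Db *\<^sub>R f (?Ca \<omega>) - ?Db *\<^sub>R f (?Yb \<omega>)"
            using h by (simp add: scaleR_diff_right)
          show "?V (Suc j) \<omega> = V1 \<omega> + h *\<^sub>R ((?Db / h) *\<^sub>R (f (?Ca \<omega>) - f (?Yb \<omega>))) + (g (?Ca \<omega>) - g (?Yb \<omega>)) *v (\<omega> (S (Suc (Suc i))) - \<omega> (S (Suc i)))"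
            unfolding 1 2 3 V1_def matrix_vector_mult_diff_rdistrib by (simp del: euler.simps)
        qed
        note c1 = C1(2)[OF S(6) S(8) S(4) h1(1) V1m V1(1) s[THEN conjunct1] Gm l(2), folded eq]
        have CY: "mom ?p (\<lambda>\<omega>. ?Ca \<omega> - ?Yb \<omega>) \<le> 2 ^ ?p * (v0 + D * E)"
        proof -
          have "(\<lambda>\<omega>. ?Ca \<omega> - ?Yb \<omega>) = (\<lambda>\<omega>. ?Va \<omega> + (?Ya \<omega> - ?Yb \<omega>))" by auto
          then have "mom ?p (\<lambda>\<omega>. ?Ca \<omega> - ?Yb \<omega>) \<le> 2 ^ ?p * (v0 + mom ?p (\<lambda>\<omega>. ?Ya \<omega> - ?Yb \<omega>))"
            using Lp_add(2)[OF V0L Y01(1)] by (simp add: v0_def del: euler.simps)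
          also have "\<dots> \<le> 2 ^ ?p * (v0 + D * E)" using Y01(2) by (intro mult_left_mono add_mono) auto
          finally show ?thesis .
        qed
        have lb: "L ^ ?p * mom ?p (\<lambda>\<omega>. ?Ca \<omega> - ?Yb \<omega>) \<le> L ^ ?p * (2 ^ ?p * (v0 + D * E))"
          using CY L_nonneg by (intro mult_left_mono) auto
        have "mom ?p (?V (Suc j)) \<le> (1 + C1 * h) * mom ?p V1 + C1 * h * (L ^ ?p * (2 ^ ?p * (v0 + D * E)) + L ^ ?p * (2 ^ ?p * (v0 + D * E)))"
          by (rule order_trans[OF c1[THEN conjunct2]], intro add_mono mult_left_mono)
            (use s l(3,4) lb h C1(1) in \<open>auto simp del: euler.simps\<close>)
        then show ?thesis by (simp add: A2_def algebra_simps)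
      qed
      have "(1 + C1 * h) * mom ?p V1 \<le> (1 + C1 * h) * ((1 + A1 * h) * v0)"
        using V1(2) C1(1) h by (intro mult_left_mono) auto
      also have "\<dots> = v0 + (A1 + C1 + C1 * A1 * h) * (h * v0)" by (simp add: algebra_simps)
      also have "\<dots> \<le> v0 + (A1 + C1 + C1 * A1 * 1) * (h * v0)"
        using h1 h v0 C1 A12 by (intro add_mono mult_right_mono mult_left_mono order_refl) auto
      finally have "mom ?p (?V (Suc j)) \<le> v0 + (A1 + C1 + C1 * A1 * 1) * (h * v0) + A2 * h * (v0 + D * E)"
        using V2 by linarith
      also have "\<dots> = (1 + A * h) * v0 + B * E * h" by (simp add: A_def B_def algebra_simps)
      finally show ?thesis by (simp add: v0_def i_def)
    qed
    show "Lp ?p (\<lambda>\<omega>. eul x (\<lambda>j. S (2 * j)) \<omega> M - eul x S \<omega> (2 * M))"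
      unfolding T_def[symmetric] by (rule Lp_diff) (use YC in auto)
    have "real M * h \<le> R" using M h by (simp add: mult_nonneg_nonneg order_trans[rotated])
    then have "mom ?p (?V M) \<le> exp (A * R) * (mom ?p (?V 0) + B * E * R)"
      by (intro discrete_gronwall[where a="\<lambda>j. mom ?p (?V j)", OF step A]) (use h B E in auto)
    also have "mom ?p (?V 0) = 0" using q by (simp add: mom_def)
    finally show "mom ?p (\<lambda>\<omega>. eul x (\<lambda>j. S (2 * j)) \<omega> M - eul x S \<omega> (2 * M)) \<le> exp (A * R) * (B * R) * ((1 + norm x ^ ?p) * h ^ q)"
      by (simp add: E_def T_def algebra_simps)
  qed
qed

end

section \<open>Uniform convergence of the Euler schemes\<close>

lemma half_power_cancel: "m = i + l \<Longrightarrow> (1/2::real) ^ m * 2 ^ l = (1/2) ^ i"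
  by (simp add: power_add mult.assoc flip: power_mult_distrib)

lemma euler_step_zero [simp]: "euler_step f g z 0 0 = z"
  by (simp add: euler_step_def)

lemma euler_const_tail:
  assumes "\<And>j. N \<le> j \<Longrightarrow> T (Suc j) = T j" "N \<le> M"
  shows "euler f g x T \<omega> M = euler f g x T \<omega> N"
  using \<open>N \<le> M\<close> by (induction M rule: dec_induct) (simp_all add: assms(1))

section \<open>Dyadic nets of parameters\<close>

definition dyadic_floor :: "nat \<Rightarrow> real \<Rightarrow> real" where
  "dyadic_floor j u = of_int \<lfloor>u * 2 ^ j\<rfloor> / 2 ^ j"

lemma dyadic_floor_le: "dyadic_floor j u \<le> u"
  by (simp add: dyadic_floor_def divide_le_eq)

lemma dyadic_floor_gt: "u < dyadic_floor j u + 1 / 2 ^ j"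
proof -
  have "u * 2 ^ j < of_int \<lfloor>u * 2 ^ j\<rfloor> + 1" by linarith
  then show ?thesis by (simp add: dyadic_floor_def field_simps)
qed

lemma dyadic_floor_dist: "\<bar>u - dyadic_floor j u\<bar> \<le> 1 / 2 ^ j"
  using dyadic_floor_le[of j u] dyadic_floor_gt[of u j] by linarith

text \<open>Integers are dyadic at every level, so rounding down never crosses one; this keeps
  rounded points in the boxes, whose bounds are integers.\<close>

lemma dyadic_floor_ge:
  assumes "of_int z \<le> u"
  shows "of_int z \<le> dyadic_floor j u"
proof -
  have "of_int z * 2 ^ j \<le> u * 2 ^ j" using assms by (intro mult_right_mono) auto
  then have "of_int (z * 2 ^ j) \<le> u * 2 ^ j" by simp
  then have "z * 2 ^ j \<le> \<lfloor>u * 2 ^ j\<rfloor>" by (simp only: le_floor_iff)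
  then have "of_int (z * 2 ^ j) \<le> (of_int \<lfloor>u * 2 ^ j\<rfloor> :: real)" by (simp only: of_int_le_iff)
  then show ?thesis by (simp add: dyadic_floor_def field_simps)
qed

text \<open>Rounding is consistent between levels. The projections onto the nets are therefore
  nested, and chaining meets only pairs consisting of a net point and its own projection.\<close>

lemma dyadic_floor_Suc: "dyadic_floor j (dyadic_floor (Suc j) u) = dyadic_floor j u"
proof -
  have "dyadic_floor (Suc j) u * 2 ^ j = of_int \<lfloor>u * 2 ^ Suc j\<rfloor> / of_int 2" by (simp add: dyadic_floor_def)
  then have "\<lfloor>dyadic_floor (Suc j) u * 2 ^ j\<rfloor> = \<lfloor>u * 2 ^ Suc j\<rfloor> div 2" by (simp only: floor_divide_of_int_eq)
  also have "\<dots> = \<lfloor>u * 2 ^ j\<rfloor>"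
    using floor_divide_real_eq_div[of 2 "u * 2 ^ Suc j"] by simp
  finally show ?thesis by (simp add: dyadic_floor_def)
qed

lemma dyadic_floor_Ints: "dyadic_floor j u * 2 ^ j \<in> \<int>"
  by (simp add: dyadic_floor_def)

lemma dyadic_floor_tendsto: "(\<lambda>j. dyadic_floor j u) \<longlonglongrightarrow> u"
proof (rule Lim_null_comparison[THEN LIM_zero_cancel])
  show "\<forall>\<^sub>F j in sequentially. norm (dyadic_floor j u - u) \<le> (1/2) ^ j"
    using dyadic_floor_dist[of u] by (intro always_eventually allI) (simp add: power_one_over abs_minus_commute)
  show "(\<lambda>j. (1/2::real) ^ j) \<longlonglongrightarrow> 0" by (intro LIMSEQ_power_zero) simp
qed

text \<open>The bound on \<open>x\<close> is imposed coordinate by coordinate, because a Euclidean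
  ball need not be preserved by \<open>proj_net\<close>.\<close>

definition pbox :: "nat \<Rightarrow> (real \<times> real \<times> (real^'n)) set" where
  "pbox R = {0..real R} \<times> {0..real R} \<times> {x. \<forall>i. \<bar>x $ i\<bar> \<le> real R}"

definition proj_net :: "nat \<Rightarrow> real \<times> real \<times> (real^'n) \<Rightarrow> real \<times> real \<times> (real^'n)" where
  "proj_net j = (\<lambda>(s, t, x). (dyadic_floor j s, dyadic_floor j t, \<chi> i. dyadic_floor j (x $ i)))"

definition net :: "nat \<Rightarrow> nat \<Rightarrow> (real \<times> real \<times> (real^'n)) set" where
  "net j R = {(s, t, x) \<in> pbox R. s * 2 ^ j \<in> \<int> \<and> t * 2 ^ j \<in> \<int> \<and> (\<forall>i. x $ i * 2 ^ j \<in> \<int>)}"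

lemma net_subset: "net j R \<subseteq> pbox R"
  by (auto simp: net_def)

lemma proj_net_in_net:
  assumes "a \<in> pbox R"
  shows "proj_net j a \<in> net j R"
proof -
  obtain s t x where a: "a = (s, t, x)" by (cases a)
  have 0: "0 \<le> dyadic_floor j u \<and> dyadic_floor j u \<le> real R" if "0 \<le> u" "u \<le> real R" for u
    using that dyadic_floor_ge[of 0 u j] dyadic_floor_le[of j u] by auto
  have 1: "\<bar>dyadic_floor j u\<bar> \<le> real R" if "\<bar>u\<bar> \<le> real R" for u
    using that dyadic_floor_ge[of "- int R" u j] dyadic_floor_le[of j u] by (simp add: abs_le_iff)
  show ?thesis using assms 0 1 dyadic_floor_Ints by (auto simp: a proj_net_def net_def pbox_def)
qed

lemma proj_net_Suc: "proj_net j (proj_net (Suc j) a) = proj_net j a"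
  by (cases a) (simp add: proj_net_def dyadic_floor_Suc)

lemma proj_net_tendsto: "(\<lambda>j. proj_net j a) \<longlonglongrightarrow> a"
proof -
  obtain s t x where a: "a = (s, t, x)" by (cases a)
  have "(\<lambda>j. \<chi> i. dyadic_floor j (x $ i)) \<longlonglongrightarrow> x"
    by (rule vec_tendstoI) (simp add: dyadic_floor_tendsto)
  then show ?thesis unfolding a proj_net_def by (auto intro!: tendsto_Pair dyadic_floor_tendsto)
qed

text \<open>The exponent counts the \<open>CARD('n)\<close> coordinates of \<open>x\<close> and the
  two times.\<close>

lemma net_card:
  "finite (net j R :: (real \<times> real \<times> (real^'n)) set)"
  "card (net j R :: (real \<times> real \<times> (real^'n)) set) \<le> ((2 * R + 1) * 2 ^ j) ^ (CARD('n) + 2)"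
proof -
  define S where "S = (\<lambda>z. of_int z / 2 ^ j :: real) ` {- int (R * 2 ^ j) .. int (R * 2 ^ j)}"
  have S: "finite S" "card S \<le> (2 * R + 1) * 2 ^ j"
  proof -
    show "finite S" by (simp add: S_def)
    have "card S \<le> card {- int (R * 2 ^ j) .. int (R * 2 ^ j)}" unfolding S_def by (rule card_image_le) simp
    also have "\<dots> = 2 * (R * 2 ^ j) + 1" by (simp add: nat_add_distrib nat_mult_distrib nat_power_eq)
    also have "\<dots> \<le> (2 * R + 1) * 2 ^ j" by simp
    finally show "card S \<le> (2 * R + 1) * 2 ^ j" .
  qed
  have inS: "u \<in> S" if u: "u * 2 ^ j \<in> \<int>" "\<bar>u\<bar> \<le> real R" for u
  proof -
    obtain z where z: "u * 2 ^ j = of_int z" using u by (auto elim: Ints_cases)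
    have "\<bar>u * 2 ^ j\<bar> \<le> real R * 2 ^ j" using u by (simp add: abs_mult)
    then have "\<bar>of_int z\<bar> \<le> (of_int (int (R * 2 ^ j)) :: real)" by (simp add: z)
    then have "\<bar>z\<bar> \<le> int (R * 2 ^ j)" by (simp only: of_int_le_iff of_int_abs[symmetric])
    moreover have "u = of_int z / 2 ^ j" using z by (simp add: field_simps)
    ultimately show ?thesis unfolding S_def by (intro image_eqI[of _ _ z]) auto
  qed
  define V where "V = vec_lambda ` (PiE (UNIV :: 'n set) (\<lambda>_. S))"
  have V: "finite V" "card V \<le> card S ^ CARD('n)"
  proof -
    have fin: "finite (PiE (UNIV :: 'n set) (\<lambda>_. S))" using S by (intro finite_PiE) auto
    then show "finite V" by (simp add: V_def)
    show "card V \<le> card S ^ CARD('n)"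
      using card_image_le[OF fin, of vec_lambda] by (simp add: V_def card_PiE)
  qed
  have sub: "net j R \<subseteq> S \<times> S \<times> V"
  proof
    fix a :: "real \<times> real \<times> (real^'n)" assume a: "a \<in> net j R"
    obtain s t x where eq: "a = (s, t, x)" by (cases a)
    have "x = vec_lambda (\<lambda>i. x $ i)" by simp
    moreover have "(\<lambda>i. x $ i) \<in> PiE (UNIV :: 'n set) (\<lambda>_. S)" using a inS by (auto simp: eq net_def pbox_def)
    ultimately have "x \<in> V" unfolding V_def by (rule image_eqI)
    then show "a \<in> S \<times> S \<times> V" using a inS by (auto simp: eq net_def pbox_def)
  qed
  then show "finite (net j R :: (real \<times> real \<times> (real^'n)) set)" using S V by (auto intro: finite_subset)
  have "card (net j R :: (real \<times> real \<times> (real^'n)) set) \<le> card (S \<times> S \<times> V)" using sub S V by (intro card_mono) auto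
  also have "\<dots> = card S * (card S * card V)" by (simp add: card_cartesian_product)
  also have "\<dots> \<le> card S * (card S * card S ^ CARD('n))" using V by simp
  also have "\<dots> = card S ^ (CARD('n) + 2)" by (simp add: power_add power2_eq_square mult_ac)
  also have "\<dots> \<le> ((2 * R + 1) * 2 ^ j) ^ (CARD('n) + 2)" by (intro power_mono S) simp
  finally show "card (net j R :: (real \<times> real \<times> (real^'n)) set) \<le> ((2 * R + 1) * 2 ^ j) ^ (CARD('n) + 2)" .
qed

text \<open>Telescoping along the successive projections of \<open>a\<close>, which converge to
  \<open>a\<close>; the increments form a geometric series from level \<open>J\<close> on.\<close>

lemma chaining:
  fixes \<phi> :: "real \<times> real \<times> (real^'n) \<Rightarrow> 'b::real_normed_vector"
  assumes cont: "continuous_on (pbox R) \<phi>" and a: "a \<in> pbox R"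
    and le: "\<And>j. J \<le> j \<Longrightarrow> norm (\<phi> (proj_net (Suc j) a) - \<phi> (proj_net j a)) \<le> B * \<rho> ^ j"
    and \<rho>: "0 \<le> \<rho>" "\<rho> < 1" and B: "0 \<le> B"
  shows "norm (\<phi> a - \<phi> (proj_net J a)) \<le> B / (1 - \<rho>) * \<rho> ^ J"
proof -
  have fin: "norm (\<phi> (proj_net (J + m) a) - \<phi> (proj_net J a)) \<le> B / (1 - \<rho>) * \<rho> ^ J" for m
  proof -
    have "\<phi> (proj_net (J + m) a) - \<phi> (proj_net J a) = (\<Sum>i<m. \<phi> (proj_net (J + Suc i) a) - \<phi> (proj_net (J + i) a))"
      using sum_lessThan_telescope[of "\<lambda>i. \<phi> (proj_net (J + i) a)" m] by simp
    also have "norm \<dots> \<le> (\<Sum>i<m. B * \<rho> ^ J * \<rho> ^ i)"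
    proof (rule order_trans[OF norm_sum], rule sum_mono)
      fix i
      show "norm (\<phi> (proj_net (J + Suc i) a) - \<phi> (proj_net (J + i) a)) \<le> B * \<rho> ^ J * \<rho> ^ i"
        using le[of "J + i"] by (simp add: power_add mult.assoc)
    qed
    also have "\<dots> = B * \<rho> ^ J * (\<Sum>i<m. \<rho> ^ i)" by (simp add: sum_distrib_left)
    also have "(\<Sum>i<m. \<rho> ^ i) \<le> 1 / (1 - \<rho>)"
      using sum_le_suminf[of "\<lambda>i. \<rho> ^ i" "{..<m}"] \<rho> suminf_geometric[of \<rho>] by (simp add: summable_geometric)
    finally show ?thesis using \<rho> B by (simp add: mult_left_mono)
  qed
  have lim: "(\<lambda>m. proj_net (J + m) a) \<longlonglongrightarrow> a"
    using LIMSEQ_ignore_initial_segment[OF proj_net_tendsto, of J a] by (simp add: add.commute)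
  have "(\<lambda>m. \<phi> (proj_net (J + m) a)) \<longlonglongrightarrow> \<phi> a"
    using net_subset proj_net_in_net[OF a] by (intro continuous_on_tendsto_compose[OF cont lim a] always_eventually) blast
  then have "(\<lambda>m. norm (\<phi> (proj_net (J + m) a) - \<phi> (proj_net J a))) \<longlonglongrightarrow> norm (\<phi> a - \<phi> (proj_net J a))"
    by (intro tendsto_intros)
  then show ?thesis by (rule tendsto_upperbound) (use fin in auto)
qed

text \<open>A substitute for the Borel-Cantelli lemma: the double series has finite expectation, so
  almost surely it is finite, and it dominates each of its terms. Only positive parts count, as
  \<open>ennreal\<close> sends negative numbers to 0.\<close>

lemma (in prob_space) AE_bounded_of_summable:
  fixes Z :: "nat \<Rightarrow> nat \<Rightarrow> 'a \<Rightarrow> real"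
  assumes Z: "\<And>k j. Z k j \<in> borel_measurable M" "\<And>k j. (\<integral>\<^sup>+\<omega>. ennreal (Z k j \<omega>) \<partial>M) \<le> ennreal (C * (1/2) ^ k * (1/2) ^ j)"
    and C: "C \<ge> 0"
  shows "AE \<omega> in M. \<exists>B. \<forall>k j. Z k j \<omega> \<le> B"
proof -
  let ?S = "\<lambda>\<omega>. \<Sum>k. \<Sum>j. ennreal (Z k j \<omega>)"
  have s: "(\<Sum>j. ennreal (D * (1/2) ^ j)) = ennreal (D * 2)" if "D \<ge> 0" for D
  proof -
    have "(\<lambda>j. D * (1/2) ^ j) sums (D * 2)" using geometric_sums[of "1/2::real"] by (intro sums_mult) simp
    then show ?thesis using that by (intro suminf_ennreal_eq) auto
  qed
  have "(\<integral>\<^sup>+\<omega>. ?S \<omega> \<partial>M) = (\<Sum>k. \<Sum>j. (\<integral>\<^sup>+\<omega>. ennreal (Z k j \<omega>) \<partial>M))"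
    using Z(1) by (simp add: nn_integral_suminf)
  also have "\<dots> \<le> (\<Sum>k. \<Sum>j. ennreal (C * (1/2) ^ k * (1/2) ^ j))"
    by (intro suminf_le Z(2) summableI)
  also have "\<dots> = (\<Sum>k. ennreal (C * (1/2) ^ k * 2))"
    using C by (intro arg_cong[where f=suminf] ext s) simp
  also have "\<dots> = (\<Sum>k. ennreal (C * 2 * (1/2) ^ k))" by (simp only: mult_ac)
  also have "\<dots> = ennreal (C * 2 * 2)" using C by (intro s) simp
  finally have "(\<integral>\<^sup>+\<omega>. ?S \<omega> \<partial>M) \<noteq> \<infinity>" by (auto simp: top_unique)
  then have "AE \<omega> in M. ?S \<omega> \<noteq> \<infinity>" using Z(1) by (intro nn_integral_PInf_AE) auto
  then show ?thesis
  proof eventually_elim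
    case (elim \<omega>)
    have "Z k j \<omega> \<le> enn2real (?S \<omega>)" for k j
    proof -
      have "ennreal (Z k j \<omega>) \<le> (\<Sum>j. ennreal (Z k j \<omega>))" using sum_le_suminf[of "\<lambda>j. ennreal (Z k j \<omega>)" "{j}"] by simp
      also have "\<dots> \<le> ?S \<omega>" using sum_le_suminf[of "\<lambda>k. \<Sum>j. ennreal (Z k j \<omega>)" "{k}"] by simp
      finally have "ennreal (Z k j \<omega>) \<le> ennreal (enn2real (?S \<omega>))" using elim by (simp add: less_top)
      then show ?thesis by (simp add: ennreal_le_iff)
    qed
    then show ?case by blast
  qed
qed

context sde_coeffs
begin

text \<open>
  A triple \<open>(s, t, x)\<close> consists of the starting time, the elapsed time and the starting point.
\<close>

definition poly_at :: "nat \<Rightarrow> real \<times> real \<times> (real^'n) \<Rightarrow> (real \<Rightarrow> real^'d) \<Rightarrow> real^'n" where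
  "poly_at k = (\<lambda>(s, t, x) \<omega>. eul x (\<lambda>j. s + min (real j / 2 ^ k) t) \<omega> (nat \<lceil>t * 2 ^ k\<rceil>))"

text \<open>Beyond time \<open>t\<close> the truncated grid is constant, so additional steps change
  nothing. One number of steps thus serves a whole box.\<close>

lemma poly_at_eq:
  assumes "t * 2 ^ k \<le> real M"
  shows "poly_at k (s, t, x) \<omega> = eul x (\<lambda>j. s + min (real j / 2 ^ k) t) \<omega> M"
proof -
  have "t \<le> real j / 2 ^ k" if "nat \<lceil>t * 2 ^ k\<rceil> \<le> j" for j
  proof -
    have "t * 2 ^ k \<le> real j" using that by linarith
    then show ?thesis by (simp add: field_simps)
  qed
  then have "s + min (real (Suc j) / 2 ^ k) t = s + min (real j / 2 ^ k) t" if "nat \<lceil>t * 2 ^ k\<rceil> \<le> j" for j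
    using that \<open>\<And>j. nat \<lceil>t * 2 ^ k\<rceil> \<le> j \<Longrightarrow> t \<le> real j / 2 ^ k\<close>[of j]
      \<open>\<And>j. nat \<lceil>t * 2 ^ k\<rceil> \<le> j \<Longrightarrow> t \<le> real j / 2 ^ k\<close>[of "Suc j"] by (simp only: min.absorb2 le_SucI)
  moreover have "nat \<lceil>t * 2 ^ k\<rceil> \<le> M" using assms by linarith
  ultimately show ?thesis
    unfolding poly_at_def prod.case by (rule euler_const_tail[symmetric])
qed

lemma poly_at_box:
  assumes "(s, t, x) \<in> pbox R"
  shows "poly_at k (s, t, x) \<omega> = eul x (\<lambda>j. s + min (real j / 2 ^ k) t) \<omega> (R * 2 ^ k)"
  using assms by (intro poly_at_eq) (auto simp: pbox_def)

lemma grid_poly: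
  assumes "0 \<le> s" "0 \<le> t"
  shows "grid (\<lambda>j. s + min (real j / 2 ^ k) t) (1 / 2 ^ k)"
proof -
  have "real (Suc j) / 2 ^ k = real j / 2 ^ k + 1 / (2 ^ k :: real)" for j by (simp add: add_divide_distrib)
  then have "real j / 2 ^ k \<le> real (Suc j) / 2 ^ k" "real (Suc j) / 2 ^ k - real j / 2 ^ k = 1 / (2 ^ k :: real)" for j
    by (simp_all add: divide_right_mono)
  moreover have "(0::real) \<le> 1 / 2 ^ k" by simp
  ultimately have "min (real j / 2 ^ k) t \<le> min (real (Suc j) / 2 ^ k) t \<and>
      min (real (Suc j) / 2 ^ k) t - min (real j / 2 ^ k) t \<le> 1 / 2 ^ k" for j
    by (smt (verit))
  then show ?thesis using assms unfolding grid_def by auto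
qed

text \<open>The number \<open>M\<close> of steps is fixed here, whereas the one in
  \<open>poly_at\<close> jumps with \<open>t\<close>; on each box \<open>poly_at_box\<close>
  reconciles the two.\<close>

lemma continuous_euler:
  assumes w: "\<omega> \<in> path_space"
  shows "continuous_on ({0..} \<times> {0..} \<times> UNIV) (\<lambda>(s, t, x). eul x (\<lambda>j. s + min (real j / 2 ^ k) t) \<omega> M)"
proof (induction M)
  case 0
  then show ?case by (auto simp: split_beta intro!: continuous_intros)
next
  case (Suc M)
  have w': "continuous_on {0..} \<omega>" using w by (simp add: path_space_def)
  have wc: "continuous_on ({0..} \<times> {0..} \<times> UNIV) (\<lambda>a :: real \<times> real \<times> (real^'n). \<omega> (fst a + min (real j / 2 ^ k) (fst (snd a))))" for j
    by (rule continuous_on_compose2[OF w']) (auto intro!: continuous_intros)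
  have ec: "continuous_on ({0..} \<times> {0..} \<times> UNIV) (\<lambda>a. eul (snd (snd a)) (\<lambda>j. fst a + min (real j / 2 ^ k) (fst (snd a))) \<omega> M)"
    using Suc by (simp add: split_beta)
  have fc: "continuous_on ({0..} \<times> {0..} \<times> UNIV) (\<lambda>a. f (eul (snd (snd a)) (\<lambda>j. fst a + min (real j / 2 ^ k) (fst (snd a))) \<omega> M))"
    by (rule continuous_on_compose2[OF f_cont[of UNIV] ec]) auto
  have gc: "continuous_on ({0..} \<times> {0..} \<times> UNIV) (\<lambda>a. g (eul (snd (snd a)) (\<lambda>j. fst a + min (real j / 2 ^ k) (fst (snd a))) \<omega> M))"
    by (rule continuous_on_compose2[OF g_cont[of UNIV] ec]) auto
  show ?case
    unfolding split_beta euler.simps euler_step_def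
    by (intro continuous_intros ec fc gc wc)
qed

lemma continuous_poly_at:
  assumes "\<omega> \<in> path_space"
  shows "continuous_on (pbox R) (\<lambda>a. poly_at k a \<omega>)"
proof -
  have "pbox R \<subseteq> ({0..} \<times> {0..} \<times> UNIV :: (real \<times> real \<times> (real^'n)) set)" by (auto simp: pbox_def)
  from continuous_on_subset[OF continuous_euler[OF assms, of k "R * 2 ^ k"] this] show ?thesis
    by (rule continuous_on_eq) (use poly_at_box in auto)
qed

lemma poly_at_F:
  assumes "0 \<le> s" "0 \<le> t"
  shows "(\<lambda>\<omega>. poly_at k (s, t, x) \<omega>) \<in> borel_measurable (F (s + t))"
proof -
  have "(\<lambda>\<omega>. eul x (\<lambda>j. s + min (real j / 2 ^ k) t) \<omega> (nat \<lceil>t * 2 ^ k\<rceil>)) \<in>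
      borel_measurable (F (s + min (real (nat \<lceil>t * 2 ^ k\<rceil>) / 2 ^ k) t))"
    by (rule eul_F[OF grid_poly[OF assms]])
  then show ?thesis unfolding poly_at_def by (auto intro: measurable_F_mono)
qed

lemma poly_at_P: "a \<in> pbox R \<Longrightarrow> (\<lambda>\<omega>. poly_at k a \<omega>) \<in> borel_measurable P"
  by (cases a) (auto simp: pbox_def intro: measurable_F_P[OF poly_at_F])

section \<open>Moments of oscillations and of refinements\<close>

text \<open>The number of real parameters, \<open>CARD('n) + 2\<close>, with some room to
  spare.\<close>

definition dimN :: nat where "dimN = CARD('n) + 4"

lemma norm_pbox_le:
  assumes "(s, t, x) \<in> pbox R"
  shows "norm (x :: real^'n) \<le> real CARD('n) * real R"
proof -
  have "norm x \<le> (\<Sum>i\<in>UNIV. \<bar>x $ i\<bar>)" by (rule norm_le_l1_cart)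
  also have "\<dots> \<le> (\<Sum>i\<in>(UNIV::'n set). real R)" using assms by (intro sum_mono) (auto simp: pbox_def)
  finally show ?thesis by simp
qed

text \<open>
  The restriction \<open>3 * k + 1 \<le> j\<close> compensates the factor \<open>\<delta> ^ q / h ^ (2 * q)\<close> of \<open>eul_regularity\<close>,
  here with \<open>\<delta> = 2 ^ (1 - j)\<close> and \<open>h = 2 ^ - k\<close>. The order \<open>24 * dimN\<close> of the moments is large
  enough for their decay to beat the number of points of the nets.
\<close>

lemma oscillation_moment:
  "\<exists>C\<ge>0. \<forall>k j. \<forall>a\<in>pbox R. 3 * k + 1 \<le> j \<longrightarrow>
     Lp (24 * dimN) (\<lambda>\<omega>. poly_at k (proj_net j a) \<omega> - poly_at k a \<omega>) \<and>
     mom (24 * dimN) (\<lambda>\<omega>. poly_at k (proj_net j a) \<omega> - poly_at k a \<omega>) \<le> C * (1/2) ^ (4 * dimN * j)"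
proof -
  define q where "q = 12 * dimN"
  have q: "q \<ge> 1" "2 * q = 24 * dimN" by (auto simp: q_def dimN_def)
  let ?p = "2 * q"
  obtain C0 where C0: "C0 \<ge> 0" "\<And>x x' T T' h \<delta> M. grid T h \<Longrightarrow> grid T' h \<Longrightarrow> (\<forall>j. T j \<le> T' j \<and> T' j \<le> T j + \<delta>) \<Longrightarrow>
    0 \<le> \<delta> \<Longrightarrow> \<delta> \<le> 1 \<Longrightarrow> 0 < h \<Longrightarrow> h \<le> 1 \<Longrightarrow> real M * h \<le> real R \<Longrightarrow>
    Lp ?p (\<lambda>\<omega>. eul x T \<omega> M - eul x' T' \<omega> M) \<and>
    mom ?p (\<lambda>\<omega>. eul x T \<omega> M - eul x' T' \<omega> M) \<le> C0 * (norm (x - x') ^ ?p + (1 + norm x ^ ?p) * (\<delta> ^ q / h ^ ?p))"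
    using eul_regularity[OF q(1) of_nat_0_le_iff[of R]] by blast
  define n where "n = real CARD('n)"
  define K where "K = n ^ ?p + (1 + (n * real R) ^ ?p) * 2 ^ q"
  have n: "n \<ge> 0" by (simp add: n_def)
  have K: "K \<ge> 0" using n by (simp add: K_def)
  show ?thesis
  proof (intro exI[of _ "C0 * K"] conjI allI ballI impI)
    show "0 \<le> C0 * K" using C0 K by simp
    fix k j :: nat and a :: "real \<times> real \<times> (real^'n)" assume a: "a \<in> pbox R" and j: "3 * k + 1 \<le> j"
    obtain s t x where eq: "a = (s, t, x)" by (cases a)
    define s' t' x' where "s' = dyadic_floor j s" and "t' = dyadic_floor j t" and "x' = (\<chi> i. dyadic_floor j (x $ i))"
    have eq': "proj_net j a = (s', t', x')" by (simp add: eq proj_net_def s'_def t'_def x'_def)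
    have a': "(s', t', x') \<in> pbox R" using subsetD[OF net_subset proj_net_in_net[OF a, of j]] unfolding eq' .
    have pos: "0 \<le> s" "0 \<le> t" "0 \<le> s'" "0 \<le> t'" using a a' by (auto simp: eq pbox_def)
    let ?T = "\<lambda>i. s' + min (real i / 2 ^ k) t'" and ?T' = "\<lambda>i. s + min (real i / 2 ^ k) t"
    \<comment> \<open>The starting time and the truncation time are each rounded down by less than
      \<open>1 / 2 ^ j\<close>, whence the 2. Rounding down also makes \<open>?T\<close> the earlier
      grid, as \<open>eul_regularity\<close> requires.\<close>
    let ?\<delta> = "2 / 2 ^ j :: real" and ?h = "1 / 2 ^ k :: real"
    have T: "\<forall>i. ?T i \<le> ?T' i \<and> ?T' i \<le> ?T i + ?\<delta>"
      using dyadic_floor_le[of j s] dyadic_floor_le[of j t] dyadic_floor_gt[of s j] dyadic_floor_gt[of t j]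
      unfolding s'_def t'_def by (smt (verit) add_divide_distrib)
    have \<delta>1: "?\<delta> \<le> 1"
      using power_increasing[of 1 j "2::real"] j by (simp add: divide_le_eq)
    have M: "real (R * 2 ^ k) * ?h \<le> real R" by simp
    have \<delta>0: "0 \<le> ?\<delta>" and h: "0 < ?h" "?h \<le> 1" by simp_all
    note b = C0(2)[OF grid_poly[OF pos(3,4)] grid_poly[OF pos(1,2)] T \<delta>0 \<delta>1 h M, of x' x]
    have eqs: "poly_at k (proj_net j a) \<omega> = eul x' ?T \<omega> (R * 2 ^ k)" "poly_at k a \<omega> = eul x ?T' \<omega> (R * 2 ^ k)" for \<omega>
      unfolding eq' unfolding eq by (rule poly_at_box[OF a'], rule poly_at_box[OF a[unfolded eq]])
    have b1: "Lp ?p (\<lambda>\<omega>. poly_at k (proj_net j a) \<omega> - poly_at k a \<omega>)"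
      and b2: "mom ?p (\<lambda>\<omega>. poly_at k (proj_net j a) \<omega> - poly_at k a \<omega>)
        \<le> C0 * (norm (x' - x) ^ ?p + (1 + norm x' ^ ?p) * (?\<delta> ^ q / ?h ^ ?p))"
      unfolding eqs using b by blast+
    have e1: "norm (x' - x) ^ ?p \<le> n ^ ?p * (1/2) ^ (4 * dimN * j)"
    proof -
      have "norm (x' - x) \<le> (\<Sum>i\<in>UNIV. \<bar>(x' - x) $ i\<bar>)" by (rule norm_le_l1_cart)
      also have "\<dots> \<le> (\<Sum>i\<in>(UNIV::'n set). (1/2) ^ j)"
        using dyadic_floor_dist by (intro sum_mono) (simp add: x'_def power_one_over abs_minus_commute)
      finally have "norm (x' - x) ^ ?p \<le> (n * (1/2) ^ j) ^ ?p" by (intro power_mono) (auto simp: n_def)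
      also have "\<dots> = n ^ ?p * (1/2) ^ (j * ?p)" by (simp only: power_mult_distrib power_mult)
      also have "\<dots> \<le> n ^ ?p * (1/2) ^ (4 * dimN * j)"
        using n by (intro mult_left_mono power_decreasing) (simp_all add: q_def)
      finally show ?thesis .
    qed
    have e2: "?\<delta> ^ q / ?h ^ ?p \<le> 2 ^ q * (1/2) ^ (4 * dimN * j)"
    proof -
      \<comment> \<open>Because \<open>3 * k \<le> j\<close>, dividing by \<open>?h ^ ?p\<close>
        costs at most a factor \<open>2 ^ (8 * dimN * j)\<close>, while \<open>?\<delta> ^ q\<close>
        gains \<open>2 ^ (12 * dimN * j)\<close> up to a constant. The rate \<open>4 * dimN\<close>
        is what remains.\<close>
      have "k * ?p = 8 * dimN * (3 * k)" by (simp add: q_def)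
      also have "\<dots> \<le> 8 * dimN * j" using j by (intro mult_le_mono2) simp
      finally have kp: "k * ?p \<le> 8 * dimN * j" .
      have "?\<delta> ^ q / ?h ^ ?p = 2 ^ q * ((1/2) ^ (j * q) * 2 ^ (k * ?p))"
      proof -
        have "?\<delta> ^ q = 2 ^ q * (1/2) ^ (j * q)" by (simp add: power_divide power_mult)
        moreover have "1 / ?h ^ ?p = 2 ^ (k * ?p)" by (simp only: power_divide power_mult power_one div_by_1 divide_divide_eq_right mult_1)
        ultimately have "?\<delta> ^ q * (1 / ?h ^ ?p) = 2 ^ q * (1/2) ^ (j * q) * 2 ^ (k * ?p)" by (simp only:)
        then show ?thesis by simp
      qed
      also have "\<dots> \<le> 2 ^ q * ((1/2) ^ (j * q) * 2 ^ (8 * dimN * j))"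
        using kp by (intro mult_left_mono power_increasing) auto
      also have "(1/2) ^ (j * q) * 2 ^ (8 * dimN * j) = (1/2::real) ^ (4 * dimN * j)"
        by (rule half_power_cancel) (simp add: q_def)
      finally show ?thesis .
    qed
    have e3: "1 + norm x' ^ ?p \<le> 1 + (n * real R) ^ ?p"
      using norm_pbox_le[OF a'] by (auto intro!: power_mono simp: n_def)
    have "norm (x' - x) ^ ?p + (1 + norm x' ^ ?p) * (?\<delta> ^ q / ?h ^ ?p)
        \<le> n ^ ?p * (1/2) ^ (4 * dimN * j) + (1 + (n * real R) ^ ?p) * (2 ^ q * (1/2) ^ (4 * dimN * j))"
      by (intro add_mono mult_mono e1 e2 e3) auto
    also have "\<dots> = K * (1/2) ^ (4 * dimN * j)" by (simp add: K_def algebra_simps)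
    finally have "C0 * (norm (x' - x) ^ ?p + (1 + norm x' ^ ?p) * (?\<delta> ^ q / ?h ^ ?p)) \<le> C0 * (K * (1/2) ^ (4 * dimN * j))"
      by (rule mult_left_mono[OF _ C0(1)])
    with b2 have "mom ?p (\<lambda>\<omega>. poly_at k (proj_net j a) \<omega> - poly_at k a \<omega>) \<le> C0 * K * (1/2) ^ (4 * dimN * j)"
      unfolding mult.assoc[of C0] by (rule order_trans)
    with b1 show "Lp (24 * dimN) (\<lambda>\<omega>. poly_at k (proj_net j a) \<omega> - poly_at k a \<omega>)"
      "mom (24 * dimN) (\<lambda>\<omega>. poly_at k (proj_net j a) \<omega> - poly_at k a \<omega>) \<le> C0 * K * (1/2) ^ (4 * dimN * j)"
      unfolding q(2) .
  qed
qed

text \<open>The grid of level \<open>k\<close> consists of every second point of the grid of level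
  \<open>Suc k\<close>, so \<open>eul_refinement\<close> applies with
  \<open>q = 12 * dimN\<close>.\<close>

lemma refinement_moment:
  "\<exists>C\<ge>0. \<forall>k. \<forall>a\<in>pbox R.
     Lp (24 * dimN) (\<lambda>\<omega>. poly_at k a \<omega> - poly_at (Suc k) a \<omega>) \<and>
     mom (24 * dimN) (\<lambda>\<omega>. poly_at k a \<omega> - poly_at (Suc k) a \<omega>) \<le> C * (1/2) ^ (12 * dimN * k)"
proof -
  define q where "q = 12 * dimN"
  have q: "q \<ge> 1" "2 * q = 24 * dimN" by (auto simp: q_def dimN_def)
  let ?p = "2 * q"
  obtain C0 where C0: "C0 \<ge> 0" "\<And>x S h M. grid S h \<Longrightarrow> 0 < h \<Longrightarrow> h \<le> 1/2 \<Longrightarrow> 2 * real M * h \<le> real R \<Longrightarrow>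
    Lp ?p (\<lambda>\<omega>. eul x (\<lambda>j. S (2 * j)) \<omega> M - eul x S \<omega> (2 * M)) \<and>
    mom ?p (\<lambda>\<omega>. eul x (\<lambda>j. S (2 * j)) \<omega> M - eul x S \<omega> (2 * M)) \<le> C0 * ((1 + norm x ^ ?p) * h ^ q)"
    using eul_refinement[OF q(1) of_nat_0_le_iff[of R]] by blast
  define n where "n = real CARD('n)"
  define K where "K = 1 + (n * real R) ^ ?p"
  have K: "K \<ge> 0" by (simp add: K_def n_def)
  show ?thesis
  proof (intro exI[of _ "C0 * K"] conjI allI ballI impI)
    show "0 \<le> C0 * K" using C0 K by simp
    fix k :: nat and a :: "real \<times> real \<times> (real^'n)" assume a: "a \<in> pbox R"
    obtain s t x where eq: "a = (s, t, x)" by (cases a)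
    have pos: "0 \<le> s" "0 \<le> t" using a by (auto simp: eq pbox_def)
    let ?S = "\<lambda>i. s + min (real i / 2 ^ Suc k) t" and ?h = "1 / 2 ^ Suc k :: real"
    have h: "?h \<le> 1 / 2" using one_le_power[of "2::real" k] by (simp add: field_simps)
    have S2: "(\<lambda>j. ?S (2 * j)) = (\<lambda>j. s + min (real j / 2 ^ k) t)" by auto
    have RM: "R * 2 ^ Suc k = 2 * (R * 2 ^ k)" by simp
    have M: "2 * real (R * 2 ^ k) * ?h \<le> real R" by simp
    note b = C0(2)[OF grid_poly[OF pos] _ h M, of x, unfolded S2]
    have eqs: "poly_at k a \<omega> = eul x (\<lambda>j. s + min (real j / 2 ^ k) t) \<omega> (R * 2 ^ k)" "poly_at (Suc k) a \<omega> = eul x ?S \<omega> (2 * (R * 2 ^ k))" for \<omega>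
      unfolding eq by (rule poly_at_box[OF a[unfolded eq]], rule poly_at_box[OF a[unfolded eq], of "Suc k", unfolded RM])
    have b1: "Lp ?p (\<lambda>\<omega>. poly_at k a \<omega> - poly_at (Suc k) a \<omega>)"
      and b2: "mom ?p (\<lambda>\<omega>. poly_at k a \<omega> - poly_at (Suc k) a \<omega>) \<le> C0 * ((1 + norm x ^ ?p) * ?h ^ q)"
      unfolding eqs using b by simp_all
    have "(1 + norm x ^ ?p) * ?h ^ q \<le> K * (1/2) ^ (12 * dimN * k)"
    proof (intro mult_mono)
      show "1 + norm x ^ ?p \<le> K" unfolding K_def n_def
        using norm_pbox_le a by (auto intro!: power_mono simp: eq)
      have "?h ^ q \<le> ((1/2) ^ k) ^ q" by (intro power_mono) (auto simp: power_one_over field_simps)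
      then show "?h ^ q \<le> (1/2) ^ (12 * dimN * k)" by (simp only: q_def power_mult[symmetric] mult.commute)
    qed (auto simp: K)
    from order_trans[OF b2 mult_left_mono[OF this C0(1)]]
    have "mom ?p (\<lambda>\<omega>. poly_at k a \<omega> - poly_at (Suc k) a \<omega>) \<le> C0 * K * (1/2) ^ (12 * dimN * k)"
      unfolding mult.assoc[of C0] .
    with b1 show "Lp (24 * dimN) (\<lambda>\<omega>. poly_at k a \<omega> - poly_at (Suc k) a \<omega>)"
      "mom (24 * dimN) (\<lambda>\<omega>. poly_at k a \<omega> - poly_at (Suc k) a \<omega>) \<le> C0 * K * (1/2) ^ (12 * dimN * k)"
      unfolding q(2) .
  qed
qed

section \<open>From moments to almost sure bounds\<close>

text \<open>The exponent makes \<open>rate ^ (24 * dimN)\<close> equal to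
  \<open>(1/2) ^ (2 * dimN)\<close>, the reciprocal of the weight per level in
  \<open>AE_net_bounds\<close>.\<close>

definition rate :: real where "rate = (1/2) powr (1/12)"

lemma rate: "0 < rate" "rate < 1" "rate ^ (24 * dimN) = (1/2) ^ (2 * dimN)"
proof -
  show "0 < rate" by (simp add: rate_def)
  have "rate ^ 12 = rate powr real 12" using \<open>0 < rate\<close> by (rule powr_realpow[symmetric])
  also have "\<dots> = 1 / 2" unfolding rate_def powr_powr by simp
  finally have "rate ^ 12 = 1 / 2" .
  show "rate < 1"
  proof (rule ccontr)
    assume "\<not> rate < 1"
    then have "1 \<le> rate ^ 12" by (intro one_le_power) simp
    with \<open>rate ^ 12 = 1 / 2\<close> show False by simp
  qed
  have "24 * dimN = 12 * (2 * dimN)" by simp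
  then have "rate ^ (24 * dimN) = (rate ^ 12) ^ (2 * dimN)" by (simp only: power_mult)
  then show "rate ^ (24 * dimN) = (1/2) ^ (2 * dimN)" using \<open>rate ^ 12 = 1 / 2\<close> by simp
qed

text \<open>Undoes the power \<open>24 * dimN\<close>; passing to \<open>max 1 B\<close> avoids
  taking a root of \<open>B\<close>.\<close>

lemma le_rate:
  assumes "y ^ (24 * dimN) * 2 ^ (2 * dimN * j) \<le> B" "y \<ge> 0"
  shows "y \<le> max 1 B * rate ^ j"
proof (rule power_le_imp_le_base)
  define p where "p = 24 * dimN"
  have p: "p = Suc (p - 1)" "p \<ge> 1" by (auto simp: p_def dimN_def)
  have "y ^ p \<le> B * (1/2) ^ (2 * dimN * j)" using assms(1) by (simp add: p_def power_one_over field_simps)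
  also have "\<dots> \<le> max 1 B ^ p * (1/2) ^ (2 * dimN * j)"
  proof (intro mult_right_mono)
    have "max 1 B ^ 1 \<le> max 1 B ^ p" using p by (intro power_increasing) auto
    then show "B \<le> max 1 B ^ p" by simp
  qed simp
  also have "(1/2) ^ (2 * dimN * j) = (rate ^ j) ^ p"
  proof -
    have "(rate ^ j) ^ p = (rate ^ p) ^ j" by (simp only: power_mult[symmetric] mult.commute)
    then show ?thesis unfolding p_def rate(3) by (simp only: power_mult[symmetric])
  qed
  finally show "y ^ Suc (p - 1) \<le> (max 1 B * rate ^ j) ^ Suc (p - 1)" using p(1) by (simp add: power_mult_distrib)
  show "0 \<le> max 1 B * rate ^ j" using rate by simp
qed

text \<open>The maximum over a net is at most the sum, and the sums of the powers, even with the
  weights \<open>2 ^ (2 * dimN * j)\<close> and \<open>2 ^ (2 * dimN * k)\<close>, have summable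
  expectations. The weights then return as the rate of decay.\<close>

lemma AE_net_bounds:
  "AE \<omega> in P. \<exists>B\<ge>0. (\<forall>k j. \<forall>a\<in>net (Suc j) R. 3 * k + 1 \<le> j \<longrightarrow> norm (poly_at k (proj_net j a) \<omega> - poly_at k a \<omega>) \<le> B * rate ^ j) \<and>
    (\<forall>k. \<forall>a\<in>net (4 * k) R. norm (poly_at k a \<omega> - poly_at (Suc k) a \<omega>) \<le> B * rate ^ k)"
proof -
  let ?p = "24 * dimN"
  obtain C1 where C1: "C1 \<ge> 0" "\<And>k j a. a \<in> pbox R \<Longrightarrow> 3 * k + 1 \<le> j \<Longrightarrow>
     Lp ?p (\<lambda>\<omega>. poly_at k (proj_net j a) \<omega> - poly_at k a \<omega>) \<and>
     mom ?p (\<lambda>\<omega>. poly_at k (proj_net j a) \<omega> - poly_at k a \<omega>) \<le> C1 * (1/2) ^ (4 * dimN * j)"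
    using oscillation_moment by blast
  obtain C2 where C2: "C2 \<ge> 0" "\<And>k a. a \<in> pbox R \<Longrightarrow>
     Lp ?p (\<lambda>\<omega>. poly_at k a \<omega> - poly_at (Suc k) a \<omega>) \<and>
     mom ?p (\<lambda>\<omega>. poly_at k a \<omega> - poly_at (Suc k) a \<omega>) \<le> C2 * (1/2) ^ (12 * dimN * k)"
    using refinement_moment by blast
  define Z1 where "Z1 = (\<lambda>k j \<omega>. if 3 * k + 1 \<le> j then
    \<Sum>a\<in>net (Suc j) R. norm (poly_at k (proj_net j a) \<omega> - poly_at k a \<omega>) ^ ?p * 2 ^ (2 * dimN * j) else 0)"
  \<comment> \<open>A single series over \<open>k\<close>, placed at \<open>j = 0\<close> so that
    the lemma on double series covers it.\<close>
  define Z2 where "Z2 = (\<lambda>k (j::nat) \<omega>. if j = 0 then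
    \<Sum>a\<in>net (4 * k) R. norm (poly_at k a \<omega> - poly_at (Suc k) a \<omega>) ^ ?p * 2 ^ (2 * dimN * k) else 0)"
  define r where "r = (2 * R + 1)"
  have nnint: "(\<integral>\<^sup>+\<omega>. ennreal (\<Sum>a\<in>A. norm (D a \<omega>) ^ ?p * c) \<partial>P) \<le> ennreal (real N * (m * c))"
    if D: "\<And>a. a \<in> A \<Longrightarrow> Lp ?p (D a)" "\<And>a. a \<in> A \<Longrightarrow> mom ?p (D a) \<le> m" and c: "c \<ge> 0"
      and A: "finite A" "card A \<le> N" and m: "m \<ge> 0"
    for A :: "(real \<times> real \<times> (real^'n)) set" and D :: "_ \<Rightarrow> _ \<Rightarrow> real^'n" and c m and N :: nat
  proof -
    have i: "integrable P (\<lambda>\<omega>. \<Sum>a\<in>A. norm (D a \<omega>) ^ ?p * c)"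
      by (intro Bochner_Integration.integrable_sum integrable_mult_left LpD(2) D(1))
    have "(\<integral>\<^sup>+\<omega>. ennreal (\<Sum>a\<in>A. norm (D a \<omega>) ^ ?p * c) \<partial>P) = ennreal (expectation (\<lambda>\<omega>. \<Sum>a\<in>A. norm (D a \<omega>) ^ ?p * c))"
      using c by (intro nn_integral_eq_integral i AE_I2 sum_nonneg) auto
    also have "expectation (\<lambda>\<omega>. \<Sum>a\<in>A. norm (D a \<omega>) ^ ?p * c) = (\<Sum>a\<in>A. mom ?p (D a) * c)"
      unfolding mom_def by (subst Bochner_Integration.integral_sum) (simp_all add: LpD(2)[OF D(1)])
    also have "\<dots> \<le> (\<Sum>a\<in>A. m * c)" using D(2) c by (intro sum_mono mult_right_mono) auto
    also have "\<dots> \<le> real N * (m * c)" using A m c by (simp add: mult_right_mono)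
    finally show ?thesis by (simp add: ennreal_leI)
  qed
  have "AE \<omega> in P. \<exists>B. \<forall>k j. Z1 k j \<omega> \<le> B"
  proof (rule AE_bounded_of_summable)
    show "Z1 k j \<in> borel_measurable P" for k j
    proof (cases "3 * k + 1 \<le> j")
      case True
      have "(\<lambda>\<omega>. norm (poly_at k (proj_net j a) \<omega> - poly_at k a \<omega>) ^ ?p * 2 ^ (2 * dimN * j)) \<in> borel_measurable P"
        if "a \<in> net (Suc j) R" for a
      proof -
        have [measurable]: "(\<lambda>\<omega>. poly_at k (proj_net j a) \<omega> - poly_at k a \<omega>) \<in> borel_measurable P"
          using C1(2)[OF _ True] that net_subset LpD(1) by blast
        show ?thesis by measurable
      qed
      then show ?thesis using True by (auto simp: Z1_def intro!: borel_measurable_sum)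
    qed (auto simp: Z1_def)
    define C where "C = real (r * 2) ^ (CARD('n) + 2) * C1"
    show "0 \<le> C" using C1 by (simp add: C_def)
    show "(\<integral>\<^sup>+\<omega>. ennreal (Z1 k j \<omega>) \<partial>P) \<le> ennreal (C * (1/2) ^ k * (1/2) ^ j)" for k j
    proof (cases "3 * k + 1 \<le> j")
      case True
      have D: "\<And>a. a \<in> net (Suc j) R \<Longrightarrow> Lp ?p (\<lambda>\<omega>. poly_at k (proj_net j a) \<omega> - poly_at k a \<omega>)"
        "\<And>a. a \<in> net (Suc j) R \<Longrightarrow> mom ?p (\<lambda>\<omega>. poly_at k (proj_net j a) \<omega> - poly_at k a \<omega>) \<le> C1 * (1/2) ^ (4 * dimN * j)"
        using C1(2)[OF _ True] net_subset by blast+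
      have "(\<integral>\<^sup>+\<omega>. ennreal (Z1 k j \<omega>) \<partial>P) \<le> ennreal (real ((r * 2 ^ Suc j) ^ (CARD('n) + 2)) * (C1 * (1/2) ^ (4 * dimN * j) * 2 ^ (2 * dimN * j)))"
        using True net_card[of "Suc j" R] C1(1) unfolding Z1_def r_def by (simp only: if_True) (intro nnint D, auto)
      also have "\<dots> \<le> ennreal (C * (1/2) ^ k * (1/2) ^ j)"
      proof (rule ennreal_leI)
        have "real ((r * 2 ^ Suc j) ^ (CARD('n) + 2)) = real (r * 2) ^ (CARD('n) + 2) * 2 ^ (j * (CARD('n) + 2))"
          by (simp only: of_nat_power of_nat_mult power_mult_distrib power_Suc of_nat_numeral power_mult mult_ac)
        moreover have "(1/2::real) ^ (4 * dimN * j) * 2 ^ (2 * dimN * j) = (1/2) ^ (2 * dimN * j)"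
          by (rule half_power_cancel) simp
        moreover have "(2::real) ^ (j * (CARD('n) + 2)) * (1/2) ^ (2 * dimN * j) \<le> (1/2) ^ k * (1/2) ^ j"
        proof -
          \<comment> \<open>The net costs \<open>CARD('n) + 2\<close> powers of 2 per level, the
            weighted moments gain \<open>2 * dimN\<close>, that is \<open>2 * CARD('n) + 8\<close>.
            The surplus also pays for the sum over \<open>k\<close>, since \<open>k \<le> j\<close>
            here.\<close>
          have "(2::real) ^ (j * (CARD('n) + 2)) * (1/2) ^ (2 * dimN * j) = (1/2) ^ (j * (CARD('n) + 6))"
            by (subst mult.commute, rule half_power_cancel) (simp add: dimN_def algebra_simps)
          also have "\<dots> \<le> (1/2) ^ (k + j)" using True by (intro power_decreasing) (auto simp: algebra_simps trans_le_add1)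
          finally show ?thesis by (simp add: power_add)
        qed
        ultimately have "real ((r * 2 ^ Suc j) ^ (CARD('n) + 2)) * (C1 * (1/2) ^ (4 * dimN * j) * 2 ^ (2 * dimN * j))
            = C * (2 ^ (j * (CARD('n) + 2)) * (1/2) ^ (2 * dimN * j))"
          unfolding C_def mult.assoc[of C1 "(1/2) ^ _"] by (simp only: mult_ac)
        also have "\<dots> \<le> C * ((1/2) ^ k * (1/2) ^ j)"
          using \<open>2 ^ (j * (CARD('n) + 2)) * (1/2) ^ (2 * dimN * j) \<le> (1/2) ^ k * (1/2::real) ^ j\<close> \<open>0 \<le> C\<close> by (rule mult_left_mono)
        finally show "real ((r * 2 ^ Suc j) ^ (CARD('n) + 2)) * (C1 * (1/2) ^ (4 * dimN * j) * 2 ^ (2 * dimN * j)) \<le> C * (1/2) ^ k * (1/2) ^ j"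
          by (simp only: mult.assoc)
      qed
      finally show ?thesis .
    qed (simp add: Z1_def)
  qed
  moreover have "AE \<omega> in P. \<exists>B. \<forall>k j. Z2 k j \<omega> \<le> B"
  proof (rule AE_bounded_of_summable)
    show "Z2 k j \<in> borel_measurable P" for k j
    proof -
      have "(\<lambda>\<omega>. norm (poly_at k a \<omega> - poly_at (Suc k) a \<omega>) ^ ?p * 2 ^ (2 * dimN * k)) \<in> borel_measurable P"
        if "a \<in> net (4 * k) R" for a
      proof -
        have [measurable]: "(\<lambda>\<omega>. poly_at k a \<omega> - poly_at (Suc k) a \<omega>) \<in> borel_measurable P"
          using C2(2) that net_subset LpD(1) by blast
        show ?thesis by measurable
      qed
      then show ?thesis by (cases "j = 0") (auto simp: Z2_def intro!: borel_measurable_sum)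
    qed
    define C where "C = real r ^ (CARD('n) + 2) * C2"
    show C: "0 \<le> C" using C2 by (simp add: C_def)
    show "(\<integral>\<^sup>+\<omega>. ennreal (Z2 k j \<omega>) \<partial>P) \<le> ennreal (C * (1/2) ^ k * (1/2) ^ j)" for k j
    proof (cases "j = 0")
      case True
      have D: "\<And>a. a \<in> net (4 * k) R \<Longrightarrow> Lp ?p (\<lambda>\<omega>. poly_at k a \<omega> - poly_at (Suc k) a \<omega>)"
        "\<And>a. a \<in> net (4 * k) R \<Longrightarrow> mom ?p (\<lambda>\<omega>. poly_at k a \<omega> - poly_at (Suc k) a \<omega>) \<le> C2 * (1/2) ^ (12 * dimN * k)"
        using C2(2) net_subset by blast+
      have "(\<integral>\<^sup>+\<omega>. ennreal (Z2 k j \<omega>) \<partial>P) \<le> ennreal (real ((r * 2 ^ (4 * k)) ^ (CARD('n) + 2)) * (C2 * (1/2) ^ (12 * dimN * k) * 2 ^ (2 * dimN * k)))"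
        using True net_card[of "4 * k" R] C2(1) unfolding Z2_def r_def by (simp only: if_True simp_thms) (intro nnint D, auto)
      also have "\<dots> \<le> ennreal (C * (1/2) ^ k * (1/2) ^ j)"
      proof (rule ennreal_leI)
        have "real ((r * 2 ^ (4 * k)) ^ (CARD('n) + 2)) = real r ^ (CARD('n) + 2) * 2 ^ (4 * k * (CARD('n) + 2))"
          by (simp only: of_nat_power of_nat_mult power_mult_distrib of_nat_numeral power_mult)
        moreover have "(1/2::real) ^ (12 * dimN * k) * 2 ^ (2 * dimN * k) = (1/2) ^ (10 * dimN * k)"
          by (rule half_power_cancel) simp
        moreover have "(2::real) ^ (4 * k * (CARD('n) + 2)) * (1/2) ^ (10 * dimN * k) \<le> (1/2) ^ k * (1/2) ^ j"
        proof -
          \<comment> \<open>Per unit of \<open>k\<close> the net of level \<open>4 * k\<close> costs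
            \<open>4 * CARD('n) + 8\<close> powers of 2, against a gain of
            \<open>10 * dimN\<close>.\<close>
          have "(2::real) ^ (4 * k * (CARD('n) + 2)) * (1/2) ^ (10 * dimN * k) = (1/2) ^ (k * (6 * CARD('n) + 32))"
            by (subst mult.commute, rule half_power_cancel) (simp add: dimN_def algebra_simps)
          also have "\<dots> \<le> (1/2) ^ (k + j)" using True by (intro power_decreasing) auto
          finally show ?thesis by (simp add: power_add)
        qed
        ultimately have "real ((r * 2 ^ (4 * k)) ^ (CARD('n) + 2)) * (C2 * (1/2) ^ (12 * dimN * k) * 2 ^ (2 * dimN * k))
            = C * (2 ^ (4 * k * (CARD('n) + 2)) * (1/2) ^ (10 * dimN * k))"
          unfolding C_def mult.assoc[of C2 "(1/2) ^ _"] by (simp only: mult_ac)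
        also have "\<dots> \<le> C * ((1/2) ^ k * (1/2) ^ j)"
          using \<open>2 ^ (4 * k * (CARD('n) + 2)) * (1/2) ^ (10 * dimN * k) \<le> (1/2) ^ k * (1/2::real) ^ j\<close> \<open>0 \<le> C\<close> by (rule mult_left_mono)
        finally show "real ((r * 2 ^ (4 * k)) ^ (CARD('n) + 2)) * (C2 * (1/2) ^ (12 * dimN * k) * 2 ^ (2 * dimN * k)) \<le> C * (1/2) ^ k * (1/2) ^ j"
          by (simp only: mult.assoc)
      qed
      finally show ?thesis .
    qed (simp add: Z2_def)
  qed
  ultimately show ?thesis
  proof eventually_elim
    case (elim \<omega>)
    then obtain B1 B2 where B: "\<And>k j. Z1 k j \<omega> \<le> B1" "\<And>k j. Z2 k j \<omega> \<le> B2" by blast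
    define B where "B = max (max 1 B1) (max 1 B2)"
    have "norm (poly_at k (proj_net j a) \<omega> - poly_at k a \<omega>) \<le> B * rate ^ j"
      if "a \<in> net (Suc j) R" "3 * k + 1 \<le> j" for k j a
    proof -
      have "norm (poly_at k (proj_net j a) \<omega> - poly_at k a \<omega>) ^ ?p * 2 ^ (2 * dimN * j) \<le> Z1 k j \<omega>"
        using that net_card(1)[of "Suc j" R] unfolding Z1_def by (simp only: if_True) (intro member_le_sum, auto)
      also note B(1)
      finally have "norm (poly_at k (proj_net j a) \<omega> - poly_at k a \<omega>) \<le> max 1 B1 * rate ^ j" by (rule le_rate) simp
      also have "\<dots> \<le> B * rate ^ j" using rate by (intro mult_right_mono) (auto simp: B_def)
      finally show ?thesis .
    qed
    moreover have "norm (poly_at k a \<omega> - poly_at (Suc k) a \<omega>) \<le> B * rate ^ k" if "a \<in> net (4 * k) R" for k a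
    proof -
      have "norm (poly_at k a \<omega> - poly_at (Suc k) a \<omega>) ^ ?p * 2 ^ (2 * dimN * k) \<le> Z2 k 0 \<omega>"
        using that net_card(1)[of "4 * k" R] unfolding Z2_def by (simp only: if_True simp_thms) (intro member_le_sum, auto)
      also note B(2)
      finally have "norm (poly_at k a \<omega> - poly_at (Suc k) a \<omega>) \<le> max 1 B2 * rate ^ k" by (rule le_rate) simp
      also have "\<dots> \<le> B * rate ^ k" using rate by (intro mult_right_mono) (auto simp: B_def)
      finally show ?thesis .
    qed
    moreover have "B \<ge> 0" by (simp add: B_def)
    ultimately show ?case by blast
  qed
qed

text \<open>
  The quantification over the starting times in \<open>pbox R\<close> is what makes this set shift invariant.
\<close>

definition good :: "(real \<Rightarrow> real^'d) set" where
  "good = {\<omega> \<in> space P. \<forall>R. \<exists>B. \<forall>k\<ge>4. \<forall>a\<in>pbox R. norm (poly_at k a \<omega> - poly_at (Suc k) a \<omega>) \<le> B * rate ^ k}"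

text \<open>At a point of the box each of the two schemes is compared, by chaining, with its value
  at the projection on the net of level \<open>4 * k\<close>, where the refinement bound is
  available.\<close>

lemma AE_good: "AE \<omega> in P. \<omega> \<in> good"
proof -
  have "AE \<omega> in P. \<forall>R. \<exists>B\<ge>0. (\<forall>k j. \<forall>a\<in>net (Suc j) R. 3 * k + 1 \<le> j \<longrightarrow> norm (poly_at k (proj_net j a) \<omega> - poly_at k a \<omega>) \<le> B * rate ^ j) \<and>
    (\<forall>k. \<forall>a\<in>net (4 * k) R. norm (poly_at k a \<omega> - poly_at (Suc k) a \<omega>) \<le> B * rate ^ k)"
    unfolding AE_all_countable using AE_net_bounds by blast
  then show ?thesis
    using AE_space
  proof eventually_elim
    case (elim \<omega>)
    show ?case
      unfolding good_def
    proof (intro CollectI conjI allI)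
      show w: "\<omega> \<in> space P" by fact
      then have w': "\<omega> \<in> path_space" by (simp add: space_P)
      fix R
      obtain B where B: "B \<ge> 0" "\<And>k j a. a \<in> net (Suc j) R \<Longrightarrow> 3 * k + 1 \<le> j \<Longrightarrow> norm (poly_at k (proj_net j a) \<omega> - poly_at k a \<omega>) \<le> B * rate ^ j"
        "\<And>k a. a \<in> net (4 * k) R \<Longrightarrow> norm (poly_at k a \<omega> - poly_at (Suc k) a \<omega>) \<le> B * rate ^ k"
        using elim(1) by blast
      have ch: "norm (poly_at k a \<omega> - poly_at k (proj_net J a) \<omega>) \<le> B / (1 - rate) * rate ^ J"
        if a: "a \<in> pbox R" and J: "3 * k + 1 \<le> J" for k J a
      proof (rule chaining[OF continuous_poly_at[OF w'] a _ _ rate(2) B(1)])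
        fix j assume "J \<le> j"
        then have "3 * k + 1 \<le> j" using J by simp
        from B(2)[OF proj_net_in_net[OF a] this]
        show "norm (poly_at k (proj_net (Suc j) a) \<omega> - poly_at k (proj_net j a) \<omega>) \<le> B * rate ^ j"
          by (simp add: proj_net_Suc norm_minus_commute)
      qed (use rate in auto)
      show "\<exists>B. \<forall>k\<ge>4. \<forall>a\<in>pbox R. norm (poly_at k a \<omega> - poly_at (Suc k) a \<omega>) \<le> B * rate ^ k"
      proof (intro exI[of _ "B / (1 - rate) + B + B / (1 - rate)"] allI impI ballI)
        fix k :: nat and a :: "real \<times> real \<times> (real^'n)" assume k: "4 \<le> k" and a: "a \<in> pbox R"
        \<comment> \<open>Chaining for the scheme of level \<open>Suc k\<close> asks for
          \<open>3 * Suc k + 1 \<le> 4 * k\<close>; this is the origin of the bound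
          \<open>k \<ge> 4\<close> in \<open>good\<close>.\<close>
        let ?b = "proj_net (4 * k) a"
        have "norm (poly_at k a \<omega> - poly_at (Suc k) a \<omega>) \<le> norm (poly_at k a \<omega> - poly_at k ?b \<omega>)
           + norm (poly_at k ?b \<omega> - poly_at (Suc k) ?b \<omega>) + norm (poly_at (Suc k) a \<omega> - poly_at (Suc k) ?b \<omega>)"
          using norm_triangle_ineq4[of "(poly_at k a \<omega> - poly_at k ?b \<omega>) + (poly_at k ?b \<omega> - poly_at (Suc k) ?b \<omega>)" "poly_at (Suc k) a \<omega> - poly_at (Suc k) ?b \<omega>"]
            norm_triangle_ineq[of "poly_at k a \<omega> - poly_at k ?b \<omega>" "poly_at k ?b \<omega> - poly_at (Suc k) ?b \<omega>"] by simp
        also have "\<dots> \<le> B / (1 - rate) * rate ^ (4 * k) + B * rate ^ k + B / (1 - rate) * rate ^ (4 * k)"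
          using k a by (intro add_mono ch B(3) proj_net_in_net) auto
        also have "\<dots> \<le> B / (1 - rate) * rate ^ k + B * rate ^ k + B / (1 - rate) * rate ^ k"
          using rate B(1) by (intro add_mono mult_left_mono power_decreasing order_refl) auto
        finally show "norm (poly_at k a \<omega> - poly_at (Suc k) a \<omega>) \<le> (B / (1 - rate) + B + B / (1 - rate)) * rate ^ k"
          by (simp add: algebra_simps)
      qed
    qed
  qed
qed

text \<open>By continuity the box may be replaced by the countable union of its nets, and
  \<open>B\<close> by a natural number; only countable operations remain.\<close>

lemma good_sets: "good \<in> sets P"
proof -
  define N where "N R = (\<Union>j. net j R :: (real \<times> real \<times> (real^'n)) set)" for R
  have cN: "countable (N R)" for R unfolding N_def using net_card(1) by (auto intro: countable_finite)
  have sub: "N R \<subseteq> pbox R" for R using net_subset by (auto simp: N_def)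
  have eq: "good = {\<omega> \<in> space P. \<forall>R. \<exists>B::nat. \<forall>k\<in>{4..}. \<forall>a\<in>N R. norm (poly_at k a \<omega> - poly_at (Suc k) a \<omega>) \<le> real B * rate ^ k}"
  proof (intro set_eqI iffI)
    fix \<omega> assume w: "\<omega> \<in> good"
    have "\<exists>B::nat. \<forall>k\<in>{4..}. \<forall>a\<in>N R. norm (poly_at k a \<omega> - poly_at (Suc k) a \<omega>) \<le> real B * rate ^ k" for R
    proof -
      obtain B where B: "\<And>k a. k \<ge> 4 \<Longrightarrow> a \<in> pbox R \<Longrightarrow> norm (poly_at k a \<omega> - poly_at (Suc k) a \<omega>) \<le> B * rate ^ k"
        using w unfolding good_def mem_Collect_eq by meson
      have "B * rate ^ k \<le> real (nat \<lceil>B\<rceil>) * rate ^ k" for k using rate by (intro mult_right_mono) (linarith, simp)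
      show ?thesis
      proof (intro exI[of _ "nat \<lceil>B\<rceil>"] ballI)
        fix k :: nat and a :: "real \<times> real \<times> (real^'n)" assume "k \<in> {4..}" "a \<in> N R"
        then have "norm (poly_at k a \<omega> - poly_at (Suc k) a \<omega>) \<le> B * rate ^ k" using B[of k a] subsetD[OF sub, of a R] by simp
        also note \<open>B * rate ^ k \<le> real (nat \<lceil>B\<rceil>) * rate ^ k\<close>
        finally show "norm (poly_at k a \<omega> - poly_at (Suc k) a \<omega>) \<le> real (nat \<lceil>B\<rceil>) * rate ^ k" .
      qed
    qed
    with w show "\<omega> \<in> {\<omega> \<in> space P. \<forall>R. \<exists>B::nat. \<forall>k\<in>{4..}. \<forall>a\<in>N R. norm (poly_at k a \<omega> - poly_at (Suc k) a \<omega>) \<le> real B * rate ^ k}"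
      by (simp add: good_def)
  next
    fix \<omega> assume w: "\<omega> \<in> {\<omega> \<in> space P. \<forall>R. \<exists>B::nat. \<forall>k\<in>{4..}. \<forall>a\<in>N R. norm (poly_at k a \<omega> - poly_at (Suc k) a \<omega>) \<le> real B * rate ^ k}"
    then have w': "\<omega> \<in> path_space" by (simp add: space_P)
    have "\<exists>B. \<forall>k\<ge>4. \<forall>a\<in>pbox R. norm (poly_at k a \<omega> - poly_at (Suc k) a \<omega>) \<le> B * rate ^ k" for R
    proof -
      obtain B :: nat where B: "\<And>k a. k \<ge> 4 \<Longrightarrow> a \<in> N R \<Longrightarrow> norm (poly_at k a \<omega> - poly_at (Suc k) a \<omega>) \<le> B * rate ^ k"
        using w unfolding mem_Collect_eq by (meson atLeast_iff)
      have "norm (poly_at k a \<omega> - poly_at (Suc k) a \<omega>) \<le> B * rate ^ k" if k: "k \<ge> 4" and a: "a \<in> pbox R" for k a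
      proof -
        have pn: "proj_net j a \<in> N R" for j using proj_net_in_net[OF a] by (auto simp: N_def)
        have c: "continuous_on (pbox R) (\<lambda>a. norm (poly_at k a \<omega> - poly_at (Suc k) a \<omega>))"
          by (intro continuous_intros continuous_poly_at w')
        have "(\<lambda>j. norm (poly_at k (proj_net j a) \<omega> - poly_at (Suc k) (proj_net j a) \<omega>)) \<longlonglongrightarrow> norm (poly_at k a \<omega> - poly_at (Suc k) a \<omega>)"
          using sub pn by (intro continuous_on_tendsto_compose[OF c proj_net_tendsto a] always_eventually) blast
        then show ?thesis by (rule tendsto_upperbound) (use B[OF k pn] in auto)
      qed
      then show ?thesis by blast
    qed
    with w show "\<omega> \<in> good" by (simp add: good_def)
  qed
  have meas: "{\<omega> \<in> space P. norm (poly_at k a \<omega> - poly_at (Suc k) a \<omega>) \<le> real B * rate ^ k} \<in> sets P" if "a \<in> N R" for k a R and B :: nat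
  proof -
    have [measurable]: "(\<lambda>\<omega>. poly_at k a \<omega>) \<in> borel_measurable P" for k using sub that poly_at_P by blast
    show ?thesis by measurable
  qed
  have ball: "{\<omega> \<in> space P. \<forall>a\<in>N R. norm (poly_at k a \<omega> - poly_at (Suc k) a \<omega>) \<le> real B * rate ^ k} \<in> sets P" for R k and B :: nat
  proof -
    have "space P - (\<Union>a\<in>N R. space P - {\<omega> \<in> space P. norm (poly_at k a \<omega> - poly_at (Suc k) a \<omega>) \<le> real B * rate ^ k}) \<in> sets P"
      by (intro sets.Diff sets.top sets.countable_UN'' cN meas)
    also have "space P - (\<Union>a\<in>N R. space P - {\<omega> \<in> space P. norm (poly_at k a \<omega> - poly_at (Suc k) a \<omega>) \<le> real B * rate ^ k})
       = {\<omega> \<in> space P. \<forall>a\<in>N R. norm (poly_at k a \<omega> - poly_at (Suc k) a \<omega>) \<le> real B * rate ^ k}" by auto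
    finally show ?thesis .
  qed
  show ?thesis
    unfolding eq
    by (intro sets.sets_Collect_countable_All sets.sets_Collect_countable_Ex sets.sets_Collect_countable_Ball ball)
qed

end

section \<open>The flow and its cocycle property\<close>

lemma euler_cong:
  assumes "\<And>i. i \<le> j \<Longrightarrow> T i = T' i"
  shows "euler f g x T \<omega> j = euler f g x T' \<omega> j"
  using assms by (induction j) auto

lemma euler_add: "euler f g x T \<omega> (m + j) = euler f g (euler f g x T \<omega> m) (\<lambda>i. T (m + i)) \<omega> j"
  by (induction j) auto

text \<open>A scheme reads the path through its increments only, and these do not feel the
  subtraction of \<open>\<omega> s\<close>. The times are nonnegative because
  \<open>path_shift\<close> is cut off at 0.\<close>

lemma euler_shift:
  assumes "\<And>i. 0 \<le> T i"
  shows "euler f g x T (path_shift s \<omega>) j = euler f g x (\<lambda>i. s + T i) \<omega> j"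
proof (induction j)
  case (Suc j)
  have "path_shift s \<omega> (T (Suc j)) - path_shift s \<omega> (T j) = \<omega> (s + T (Suc j)) - \<omega> (s + T j)"
    using assms[of j] assms[of "Suc j"] by (simp add: path_shift_def add.commute)
  then show ?case by (simp add: Suc)
qed simp

lemma path_shift_path_shift:
  assumes "0 \<le> s" "0 \<le> t"
  shows "path_shift t (path_shift s \<omega>) = path_shift (s + t) \<omega>"
  using assms by (auto simp: path_shift_def fun_eq_iff add_ac)

lemma continuous_on_halfline:
  fixes \<phi> :: "real \<Rightarrow> 'a::topological_space"
  assumes "\<And>R::nat. continuous_on {0..real R} \<phi>"
  shows "continuous_on {0..} \<phi>"
  unfolding continuous_on_eq_continuous_within
proof
  fix t :: real assume t: "t \<in> {0..}"
  obtain R :: nat where R: "t < real R" using reals_Archimedean2 by blast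
  have "continuous (at t within {0..real R}) \<phi>"
    using assms[of R] t R by (auto simp: continuous_on_eq_continuous_within)
  moreover have "at t within {0..real R} = at t within {0..}"
    by (rule at_within_nhd[of _ "{..<real R}"]) (use R in auto)
  ultimately show "continuous (at t within {0..}) \<phi>" by simp
qed

lemma in_pbox_ex:
  assumes "0 \<le> s" "0 \<le> t"
  shows "\<exists>R. (s, t, x :: real^'n) \<in> pbox R"
proof -
  obtain R :: nat where R: "max s (max t (norm x)) < real R" using reals_Archimedean2 by blast
  have "\<bar>x $ i\<bar> \<le> real R" for i using component_le_norm_cart[of x i] R by simp
  then show ?thesis using assms R by (auto simp: pbox_def intro!: exI[of _ R])
qed

context sde_coeffs
begin

lemma poly_at_shift:
  assumes "0 \<le> s" "0 \<le> r" "0 \<le> t"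
  shows "poly_at k (r, t, x) (path_shift s \<omega>) = poly_at k (s + r, t, x) \<omega>"
  using assms unfolding poly_at_def by (simp add: euler_shift add.assoc)

text \<open>The box of size \<open>R\<close> for the shifted path lies, in the time of the original
  path, in a box enlarged by an integer \<open>m \<ge> s\<close>.\<close>

lemma good_shift:
  assumes w: "\<omega> \<in> good" and s: "0 \<le> s"
  shows "path_shift s \<omega> \<in> good"
  unfolding good_def
proof (intro CollectI conjI allI)
  show "path_shift s \<omega> \<in> space P"
    using w s path_shift_in_path_space by (auto simp: good_def space_P)
  fix R
  obtain m :: nat where m: "s \<le> real m" using real_arch_simple by blast
  define R' where "R' = R + m"
  obtain B where B: "\<And>k a. k \<ge> 4 \<Longrightarrow> a \<in> pbox R' \<Longrightarrow> norm (poly_at k a \<omega> - poly_at (Suc k) a \<omega>) \<le> B * rate ^ k"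
    using w unfolding good_def mem_Collect_eq by meson
  show "\<exists>B. \<forall>k\<ge>4. \<forall>a\<in>pbox R. norm (poly_at k a (path_shift s \<omega>) - poly_at (Suc k) a (path_shift s \<omega>)) \<le> B * rate ^ k"
  proof (intro exI[of _ B] allI impI ballI)
    fix k :: nat and a :: "real \<times> real \<times> (real^'n)" assume k: "4 \<le> k" and a: "a \<in> pbox R"
    obtain r t x where eq: "a = (r, t, x)" by (cases a)
    have rt: "0 \<le> r" "0 \<le> t" using a by (auto simp: eq pbox_def)
    have "\<bar>x $ i\<bar> \<le> real R'" for i
      using a order_trans[of "\<bar>x $ i\<bar>" "real R" "real R'"] by (auto simp: eq pbox_def R'_def)
    then have "(s + r, t, x) \<in> pbox R'" using a s m by (auto simp: eq pbox_def R'_def)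
    from B[OF k this] show "norm (poly_at k a (path_shift s \<omega>) - poly_at (Suc k) a (path_shift s \<omega>)) \<le> B * rate ^ k"
      unfolding eq poly_at_shift[OF s rt] .
  qed
qed

section \<open>The limit of the schemes and its flow property\<close>

definition zlim :: "real \<times> real \<times> (real^'n) \<Rightarrow> (real \<Rightarrow> real^'d) \<Rightarrow> real^'n" where
  "zlim a \<omega> = lim (\<lambda>k. poly_at k a \<omega>)"

text \<open>Consecutive schemes differ by a geometric term on the box, so the Weierstrass M-test
  applies to the telescoping series from level 4 on.\<close>

lemma uniform_limit_poly:
  assumes w: "\<omega> \<in> good"
  shows "uniform_limit (pbox R) (\<lambda>k a. poly_at k a \<omega>) (\<lambda>a. zlim a \<omega>) sequentially"
proof -
  obtain B where B: "\<And>k a. k \<ge> 4 \<Longrightarrow> a \<in> pbox R \<Longrightarrow> norm (poly_at k a \<omega> - poly_at (Suc k) a \<omega>) \<le> B * rate ^ k"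
    using w unfolding good_def mem_Collect_eq by meson
  define l where "l = (\<lambda>a. poly_at 4 a \<omega> + (\<Sum>i. poly_at (Suc (i + 4)) a \<omega> - poly_at (i + 4) a \<omega>))"
  have "uniform_limit (pbox R) (\<lambda>n a. \<Sum>i<n. poly_at (Suc (i + 4)) a \<omega> - poly_at (i + 4) a \<omega>)
      (\<lambda>a. \<Sum>i. poly_at (Suc (i + 4)) a \<omega> - poly_at (i + 4) a \<omega>) sequentially"
  proof (rule Weierstrass_m_test[where M="\<lambda>i. B * rate ^ (i + 4)"])
    show "norm (poly_at (Suc (i + 4)) a \<omega> - poly_at (i + 4) a \<omega>) \<le> B * rate ^ (i + 4)" if "a \<in> pbox R" for i a
      using B[of "i + 4" a] that by (simp add: norm_minus_commute)
    show "summable (\<lambda>i. B * rate ^ (i + 4))"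
      using rate by (simp add: power_add summable_mult2 summable_mult summable_geometric flip: mult.assoc)
  qed
  then have "uniform_limit (pbox R) (\<lambda>n a. poly_at 4 a \<omega> + (\<Sum>i<n. poly_at (Suc (i + 4)) a \<omega> - poly_at (i + 4) a \<omega>)) l sequentially"
    unfolding l_def by (intro uniform_limit_intros)
  moreover have "poly_at 4 a \<omega> + (\<Sum>i<n. poly_at (Suc (i + 4)) a \<omega> - poly_at (i + 4) a \<omega>) = poly_at (n + 4) a \<omega>" for n a
    using sum_lessThan_telescope[of "\<lambda>i. poly_at (i + 4) a \<omega>" n] by simp
  ultimately have "uniform_limit (pbox R) (\<lambda>n a. poly_at (n + 4) a \<omega>) l sequentially" by simp
  then have u: "uniform_limit (pbox R) (\<lambda>n a. poly_at n a \<omega>) l sequentially"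
    unfolding uniform_limit_iff
    using eventually_sequentially_seg[of "\<lambda>n. \<forall>a\<in>pbox R. dist (poly_at n a \<omega>) (l a) < _" 4] by simp
  have "zlim a \<omega> = l a" if "a \<in> pbox R" for a
    unfolding zlim_def using tendsto_uniform_limitI[OF u that] by (rule limI)
  with u show ?thesis by (simp cong: uniform_limit_cong')
qed

lemma tendsto_poly:
  assumes "\<omega> \<in> good" "0 \<le> s" "0 \<le> t"
  shows "(\<lambda>k. poly_at k (s, t, x) \<omega>) \<longlonglongrightarrow> zlim (s, t, x) \<omega>"
  using in_pbox_ex[OF assms(2,3)] tendsto_uniform_limitI[OF uniform_limit_poly[OF assms(1)]] by blast

lemma good_path_space: "\<omega> \<in> good \<Longrightarrow> \<omega> \<in> path_space"
  by (auto simp: good_def space_P)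

lemma continuous_zlim:
  assumes "\<omega> \<in> good"
  shows "continuous_on (pbox R) (\<lambda>a. zlim a \<omega>)"
  by (rule uniform_limit_theorem[OF _ uniform_limit_poly[OF assms]])
    (auto intro: continuous_poly_at good_path_space assms always_eventually)

lemma zlim_tendsto:
  assumes w: "\<omega> \<in> good" and a: "\<And>i. a i \<in> pbox R" "b \<in> pbox R" "a \<longlonglongrightarrow> b"
  shows "(\<lambda>i. zlim (a i) \<omega>) \<longlonglongrightarrow> zlim b \<omega>"
  using a by (intro continuous_on_tendsto_compose[OF continuous_zlim[OF w]]) auto

text \<open>The argument may move with \<open>k\<close>, as happens when a scheme is restarted from
  its own value; the uniformity of the convergence absorbs this.\<close>

lemma poly_zlim_tendsto:
  assumes w: "\<omega> \<in> good" and a: "\<And>i. a i \<in> pbox R" "b \<in> pbox R" "a \<longlonglongrightarrow> b"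
  shows "(\<lambda>k. poly_at k (a k) \<omega>) \<longlonglongrightarrow> zlim b \<omega>"
proof -
  have "(\<lambda>k. poly_at k (a k) \<omega> - zlim (a k) \<omega>) \<longlonglongrightarrow> 0"
    unfolding tendsto_iff
  proof (intro allI impI)
    fix e :: real assume "e > 0"
    from uniform_limitD[OF uniform_limit_poly[OF w] this, of R]
    show "\<forall>\<^sub>F k in sequentially. dist (poly_at k (a k) \<omega> - zlim (a k) \<omega>) 0 < e"
      by eventually_elim (use a(1) in \<open>auto simp: dist_norm\<close>)
  qed
  from tendsto_add[OF this zlim_tendsto[OF assms]] show ?thesis by simp
qed

text \<open>Exact because \<open>t\<close> is a mesh point of level \<open>k\<close>; a restart at
  another time would displace the remaining grid.\<close>

lemma poly_flow:
  assumes "0 \<le> r" and t: "t = real m / 2 ^ k"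
  shows "poly_at k (s, t + r, x) \<omega> = poly_at k (s + t, r, poly_at k (s, t, x) \<omega>) \<omega>"
proof -
  define M where "M = nat \<lceil>r * 2 ^ k\<rceil>"
  have M: "r * 2 ^ k \<le> real M" by (simp add: M_def of_nat_ceiling)
  have 1: "poly_at k (s, t, x) \<omega> = eul x (\<lambda>j. s + min (real j / 2 ^ k) t) \<omega> m"
    by (rule poly_at_eq) (simp add: t)
  have "(t + r) * 2 ^ k \<le> real (m + M)" using M by (simp add: t distrib_right)
  then have "poly_at k (s, t + r, x) \<omega> = eul x (\<lambda>j. s + min (real j / 2 ^ k) (t + r)) \<omega> (m + M)"
    by (rule poly_at_eq)
  also have "\<dots> = eul (eul x (\<lambda>j. s + min (real j / 2 ^ k) (t + r)) \<omega> m) (\<lambda>j. s + min (real (m + j) / 2 ^ k) (t + r)) \<omega> M"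
    by (rule euler_add)
  also have "eul x (\<lambda>j. s + min (real j / 2 ^ k) (t + r)) \<omega> m = poly_at k (s, t, x) \<omega>"
    unfolding 1
  proof (rule euler_cong)
    fix i assume "i \<le> m"
    then have "real i / 2 ^ k \<le> t" by (simp add: t divide_right_mono)
    then show "s + min (real i / 2 ^ k) (t + r) = s + min (real i / 2 ^ k) t" using assms(1) by simp
  qed
  also have "(\<lambda>j. s + min (real (m + j) / 2 ^ k) (t + r)) = (\<lambda>j. s + t + min (real j / 2 ^ k) r)"
    by (auto simp: t add_divide_distrib min_def)
  also have "eul (poly_at k (s, t, x) \<omega>) \<dots> \<omega> M = poly_at k (s + t, r, poly_at k (s, t, x) \<omega>) \<omega>"
    by (rule poly_at_eq[OF M, symmetric])
  finally show ?thesis .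
qed

text \<open>A dyadic \<open>t\<close> is a mesh point of every level \<open>k \<ge> i\<close>, so
  \<open>poly_flow\<close> holds for all large \<open>k\<close>; its intermediate starting point
  depends on \<open>k\<close>, which \<open>poly_zlim_tendsto\<close> allows.\<close>

lemma zlim_flow_dyadic:
  assumes w: "\<omega> \<in> good" and pos: "0 \<le> s" "0 \<le> r" and t: "t = real m / 2 ^ i"
  shows "zlim (s, t + r, x) \<omega> = zlim (s + t, r, zlim (s, t, x) \<omega>) \<omega>"
proof -
  have t0: "0 \<le> t" by (simp add: t)
  define y where "y = (\<lambda>k. poly_at k (s, t, x) \<omega>)"
  have y: "y \<longlonglongrightarrow> zlim (s, t, x) \<omega>" unfolding y_def by (rule tendsto_poly[OF w pos(1) t0])
  obtain K where K: "\<And>k. norm (y k) \<le> K"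
    using convergent_imp_Bseq[of y] y unfolding Bseq_def convergent_def by blast
  obtain R :: nat where R: "max (s + t) (max r (max K (norm (zlim (s, t, x) \<omega>)))) < real R" using reals_Archimedean2 by blast
  have box: "(s + t, r, z) \<in> pbox R" if "norm z \<le> real R" for z :: "real^'n"
    using R pos t0 that component_le_norm_cart[of z] by (auto simp: pbox_def intro: order_trans)
  have "(\<lambda>k. poly_at k (s + t, r, y k) \<omega>) \<longlonglongrightarrow> zlim (s + t, r, zlim (s, t, x) \<omega>) \<omega>"
  proof (rule poly_zlim_tendsto[OF w])
    show "(s + t, r, y k) \<in> pbox R" for k using K[of k] R by (intro box) simp
    show "(s + t, r, zlim (s, t, x) \<omega>) \<in> pbox R" using R by (intro box) simp
  qed (intro tendsto_intros y)
  moreover have "\<forall>\<^sub>F k in sequentially. poly_at k (s + t, r, y k) \<omega> = poly_at k (s, t + r, x) \<omega>"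
    using eventually_ge_at_top[of i]
  proof eventually_elim
    case (elim k)
    obtain l where "k = i + l" using elim le_iff_add by blast
    then have "t = real (m * 2 ^ l) / 2 ^ k" by (simp add: t power_add)
    from poly_flow[OF pos(2) this, of s x \<omega>] show ?case by (simp add: y_def)
  qed
  ultimately have "(\<lambda>k. poly_at k (s, t + r, x) \<omega>) \<longlonglongrightarrow> zlim (s + t, r, zlim (s, t, x) \<omega>) \<omega>"
    by (rule Lim_transform_eventually)
  moreover have "(\<lambda>k. poly_at k (s, t + r, x) \<omega>) \<longlonglongrightarrow> zlim (s, t + r, x) \<omega>"
    using pos t0 by (intro tendsto_poly w) auto
  ultimately show ?thesis using LIMSEQ_unique by blast
qed

text \<open>Dyadic times approach \<open>t\<close> from below. The intermediate points converge,
  hence stay in one box, and there the limit is jointly continuous in all three parameters.\<close>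

lemma zlim_flow:
  assumes w: "\<omega> \<in> good" and pos: "0 \<le> s" "0 \<le> r" "0 \<le> t"
  shows "zlim (s, t + r, x) \<omega> = zlim (s + t, r, zlim (s, t, x) \<omega>) \<omega>"
proof -
  define \<tau> where "\<tau> = (\<lambda>i. dyadic_floor i t)"
  have \<tau>: "0 \<le> \<tau> i" "\<tau> i \<le> t" "\<tau> \<longlonglongrightarrow> t" for i
    using dyadic_floor_ge[of 0 t i] pos dyadic_floor_le[of i t] dyadic_floor_tendsto[of t] by (auto simp: \<tau>_def)
  have dy: "\<exists>m. \<tau> i = real m / 2 ^ i" for i
    using pos by (intro exI[of _ "nat \<lfloor>t * 2 ^ i\<rfloor>"]) (simp add: \<tau>_def dyadic_floor_def)
  obtain R0 where R0: "(s, t + r, x) \<in> pbox R0" using in_pbox_ex pos by (metis add_nonneg_nonneg)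
  have b1: "(s, \<tau> i, x) \<in> pbox R0" "(s, \<tau> i + r, x) \<in> pbox R0" "(s, t, x) \<in> pbox R0" for i
    using R0 pos \<tau>(1,2)[of i] by (auto simp: pbox_def)
  have z: "(\<lambda>i. zlim (s, \<tau> i, x) \<omega>) \<longlonglongrightarrow> zlim (s, t, x) \<omega>"
    by (rule zlim_tendsto[OF w b1(1,3)]) (intro tendsto_intros \<tau>)
  have z2: "(\<lambda>i. zlim (s, \<tau> i + r, x) \<omega>) \<longlonglongrightarrow> zlim (s, t + r, x) \<omega>"
    by (rule zlim_tendsto[OF w b1(2) R0]) (intro tendsto_intros \<tau>)
  obtain K where K: "\<And>i. norm (zlim (s, \<tau> i, x) \<omega>) \<le> K"
    using convergent_imp_Bseq[of "\<lambda>i. zlim (s, \<tau> i, x) \<omega>"] z unfolding Bseq_def convergent_def by blast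
  obtain R :: nat where R: "max (s + t) (max r (max K (norm (zlim (s, t, x) \<omega>)))) < real R" using reals_Archimedean2 by blast
  have box: "(s + u, r, y) \<in> pbox R" if "norm y \<le> real R" "0 \<le> u" "u \<le> t" for y :: "real^'n" and u
    using R pos that component_le_norm_cart[of y] by (auto simp: pbox_def intro: order_trans)
  have "(\<lambda>i. zlim (s + \<tau> i, r, zlim (s, \<tau> i, x) \<omega>) \<omega>) \<longlonglongrightarrow> zlim (s + t, r, zlim (s, t, x) \<omega>) \<omega>"
  proof (rule zlim_tendsto[OF w])
    show "(s + \<tau> i, r, zlim (s, \<tau> i, x) \<omega>) \<in> pbox R" for i using K[of i] R \<tau> by (intro box) auto
    show "(s + t, r, zlim (s, t, x) \<omega>) \<in> pbox R" using R pos by (intro box) auto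
  qed (intro tendsto_intros z \<tau>)
  moreover have "zlim (s + \<tau> i, r, zlim (s, \<tau> i, x) \<omega>) \<omega> = zlim (s, \<tau> i + r, x) \<omega>" for i
    using dy[of i] zlim_flow_dyadic[OF w pos(1,2)] by metis
  ultimately show ?thesis using z2 LIMSEQ_unique by auto
qed

text \<open>The constant path off \<open>good\<close> keeps every trajectory continuous, as
  \<open>sde_solution\<close> demands for all paths and not only almost surely.\<close>

definition flow :: "real^'n \<Rightarrow> real \<Rightarrow> (real \<Rightarrow> real^'d) \<Rightarrow> real^'n" where
  "flow x t \<omega> = (if \<omega> \<in> good then zlim (0, t, x) \<omega> else x)"

lemma zlim_shift:
  assumes "0 \<le> s" "0 \<le> t"
  shows "zlim (0, t, x) (path_shift s \<omega>) = zlim (s, t, x) \<omega>"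
  unfolding zlim_def using poly_at_shift[OF assms(1) order_refl assms(2)] by simp

lemma flow_cocycle:
  assumes w: "\<omega> \<in> good" and pos: "0 \<le> s" "0 \<le> t"
  shows "flow (flow x s \<omega>) t (path_shift s \<omega>) = flow x (s + t) \<omega>"
  using zlim_flow[OF w order_refl pos(2,1), of x] good_shift[OF w pos(1)] w
  by (simp add: flow_def zlim_shift[OF pos])

lemma good_null: "space P - good \<in> null_sets P"
  using AE_good good_sets by (auto simp: AE_iff_null_sets set_diff_eq)

text \<open>\<open>good\<close> depends on the whole path, but its complement is a null set and so
  belongs to the augmented filtration at every time. This keeps the case distinction in
  \<open>flow\<close> adapted.\<close>

lemma good_F: "good \<in> sets (F t)"
proof -
  have "space (F t) - (space P - good) \<in> sets (F t)" by (intro sets.compl_sets null_sets_F good_null)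
  then show ?thesis using sets.sets_into_space[OF good_sets] by (simp add: double_diff)
qed

lemma flow_F:
  assumes "0 \<le> t"
  shows "(\<lambda>\<omega>. flow x t \<omega>) \<in> borel_measurable (F t)"
proof -
  have "(\<lambda>\<omega>. zlim (0, t, x) \<omega>) \<in> borel_measurable (F t)"
    unfolding zlim_def using poly_at_F[OF order_refl assms] by (intro borel_measurable_lim_metric) simp
  then show ?thesis
    unfolding flow_def using good_F by (intro measurable_If_set sets.Int sets.top) auto
qed

lemma euler_joint_measurable:
  assumes "\<And>i. 0 \<le> T i"
  shows "(\<lambda>z. eul (fst z) T (snd z) j) \<in> borel_measurable (borel \<Otimes>\<^sub>M P)"
proof (induction j)
  case (Suc j)
  have [measurable]: "(\<lambda>z. snd z (T i)) \<in> borel_measurable (borel \<Otimes>\<^sub>M P)" for i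
    by (rule measurable_compose[OF measurable_snd eval_measurable[OF assms]])
  show ?case unfolding euler.simps euler_step_def using Suc by measurable
qed simp

lemma flow_joint_measurable:
  assumes "0 \<le> t"
  shows "(\<lambda>z. flow (fst z) t (snd z)) \<in> borel_measurable (borel \<Otimes>\<^sub>M P)"
proof -
  have "(\<lambda>z. poly_at k (0, t, fst z) (snd z)) \<in> borel_measurable (borel \<Otimes>\<^sub>M P)" for k
    unfolding poly_at_def prod.case using assms by (intro euler_joint_measurable) simp
  then have "(\<lambda>z. zlim (0, t, fst z) (snd z)) \<in> borel_measurable (borel \<Otimes>\<^sub>M P)"
    unfolding zlim_def by (rule borel_measurable_lim_metric)
  moreover have "{z \<in> space (borel \<Otimes>\<^sub>M P). snd z \<in> good} \<in> sets (borel \<Otimes>\<^sub>M P)"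
    using measurable_sets[OF measurable_snd good_sets, of borel] by (simp add: vimage_def Int_def conj_commute)
  ultimately show ?thesis
    unfolding flow_def by (intro measurable_If) auto
qed

lemma flow_continuous: "continuous_on {0..} (\<lambda>t. flow x t \<omega>)"
proof (cases "\<omega> \<in> good")
  case True
  have "continuous_on {0..real R} (\<lambda>t. zlim (0, t, x) \<omega>)" for R
  proof -
    obtain R' where R': "(real R, real R, x) \<in> pbox R'" using in_pbox_ex by (metis of_nat_0_le_iff)
    have "continuous_on {0..real R} (\<lambda>t. zlim (0, t, x) \<omega>)"
      by (rule continuous_on_compose2[OF continuous_zlim[OF True, of R']])
        (use R' in \<open>auto simp: pbox_def intro!: continuous_intros\<close>)
    then show ?thesis .
  qed
  then show ?thesis using True by (simp add: flow_def continuous_on_halfline)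
next
  case False
  then show ?thesis by (simp add: flow_def)
qed

lemma flow_map_measurable:
  assumes "0 \<le> t"
  shows "flow_map flow t \<in> measurable (borel \<Otimes>\<^sub>M P) (borel \<Otimes>\<^sub>M P)"
  unfolding flow_map_def split_beta
  using flow_joint_measurable[OF assms] measurable_compose[OF measurable_snd shift_measurable[OF assms], of borel]
  by (rule measurable_Pair)

lemma flow_map_cocycle:
  assumes "\<omega> \<in> good" "0 \<le> s" "0 \<le> t"
  shows "(flow_map flow t \<circ> flow_map flow s) (x, \<omega>) = flow_map flow (s + t) (x, \<omega>)"
  using flow_cocycle[OF assms] path_shift_path_shift[OF assms(2,3)] by (simp add: flow_map_def)

end

section \<open>The flow solves the equation\<close>

text \<open>The sets \<open>A k\<close> may fail to be measurable: \<open>measure\<close> is then 0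
  by convention, and they can be replaced by the empty set before dominated convergence is
  applied.\<close>

lemma (in prob_space) measure_tendsto_zero_of_AE:
  assumes "AE \<omega> in M. \<forall>\<^sub>F k in sequentially. \<omega> \<notin> A k"
  shows "(\<lambda>k::nat. measure M (A k)) \<longlonglongrightarrow> 0"
proof -
  define A' where "A' k = (if A k \<in> sets M then A k else {})" for k
  have A': "A' k \<in> sets M" "measure M (A k) = measure M (A' k)" for k
    by (auto simp: A'_def measure_notin_sets)
  have "(\<lambda>k. \<integral>\<omega>. indicator (A' k) \<omega> \<partial>M) \<longlonglongrightarrow> (\<integral>\<omega>. (0::real) \<partial>M)"
  proof (rule integral_dominated_convergence[where w="\<lambda>_. 1"])
    show "AE \<omega> in M. (\<lambda>k. indicator (A' k) \<omega> :: real) \<longlonglongrightarrow> 0"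
      using assms
    proof eventually_elim
      case (elim \<omega>)
      then have "\<forall>\<^sub>F k in sequentially. indicator (A' k) \<omega> = (0::real)"
        by eventually_elim (auto simp: A'_def)
      then show ?case by (rule tendsto_eventually)
    qed
  qed (use A' in \<open>auto simp: indicator_def\<close>)
  then show ?thesis using A' by simp
qed

text \<open>\<open>step_process\<close> asks for bounded coefficients, while \<open>g\<close> has
  linear growth. Clipping at a level that tends to infinity is eventually invisible along each good
  path.\<close>

definition clip :: "real \<Rightarrow> real \<Rightarrow> real" where
  "clip c y = max (- c) (min c y)"

lemma clip_bound: "0 \<le> c \<Longrightarrow> \<bar>clip c y\<bar> \<le> c" and clip_id: "\<bar>y\<bar> \<le> c \<Longrightarrow> clip c y = y"
  by (auto simp: clip_def)

text \<open>The numbers \<open>c i\<close> need not be values of \<open>H\<close>: in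
  \<open>flow_equation\<close> they are values along the Euler scheme while \<open>H\<close> is
  taken along the flow.\<close>

lemma riemann_sum_error:
  fixes H :: "real \<Rightarrow> real" and T :: "nat \<Rightarrow> real"
  assumes H: "continuous_on {0..t} H" and T: "T 0 = 0" "\<And>i. T i \<le> T (Suc i)" "\<And>i. T i \<le> t"
    and c: "\<And>i u. i < m \<Longrightarrow> T i \<le> u \<Longrightarrow> u \<le> T (Suc i) \<Longrightarrow> \<bar>c i - H u\<bar> \<le> e"
  shows "\<bar>(\<Sum>i<m. (T (Suc i) - T i) * c i) - integral {0..T m} H\<bar> \<le> e * T m"
  using c
proof (induction m)
  case 0
  then show ?case by (simp add: T)
next
  case (Suc m)
  have T0: "0 \<le> T i" for i by (induction i) (auto simp: T intro: order_trans[OF _ T(2)])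
  have int: "H integrable_on {a..b}" if "0 \<le> a" "b \<le> t" for a b
    using that by (intro integrable_continuous_real continuous_on_subset[OF H]) auto
  have split: "integral {0..T (Suc m)} H = integral {0..T m} H + integral {T m..T (Suc m)} H"
    using T0[of m] T(2)[of m] T(3)[of "Suc m"] by (intro Henstock_Kurzweil_Integration.integral_combine[symmetric] int) auto
  have "\<bar>integral {T m..T (Suc m)} (\<lambda>u. H u - c m)\<bar> \<le> e * (T (Suc m) - T m)"
  proof (rule integral_bound[where f="\<lambda>u. H u - c m", unfolded real_norm_def])
    show "T m \<le> T (Suc m)" by (rule T)
    show "continuous_on {T m..T (Suc m)} (\<lambda>u. H u - c m)"
      using T0[of m] T(3)[of "Suc m"] by (intro continuous_intros continuous_on_subset[OF H]) auto
    show "\<bar>H u - c m\<bar> \<le> e" if "u \<in> {T m..T (Suc m)}" for u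
      using Suc.prems[of m u] that by (simp add: abs_minus_commute)
  qed
  also have "integral {T m..T (Suc m)} (\<lambda>u. H u - c m) = integral {T m..T (Suc m)} H - (T (Suc m) - T m) * c m"
    using T0[of m] T(2)[of m] T(3)[of "Suc m"] by (subst Henstock_Kurzweil_Integration.integral_diff) (auto intro!: int)
  finally have "\<bar>integral {T m..T (Suc m)} H - (T (Suc m) - T m) * c m\<bar> \<le> e * (T (Suc m) - T m)" .
  moreover have "\<bar>(\<Sum>i<m. (T (Suc i) - T i) * c i) - integral {0..T m} H\<bar> \<le> e * T m"
    using Suc.prems by (intro Suc.IH) auto
  ultimately show ?case unfolding split by (simp add: right_diff_distrib)
qed

context wiener
begin

text \<open>\<open>X\<close> is the limit of its evaluations at the time rounded down to level
  \<open>k\<close>, and for each \<open>k\<close> only countably many times are involved.\<close>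

lemma progressively_measurable_continuous:
  fixes X :: "real \<Rightarrow> (real \<Rightarrow> real^'d) \<Rightarrow> real"
  assumes X: "\<And>t. 0 \<le> t \<Longrightarrow> X t \<in> borel_measurable (F t)"
    and cont: "\<And>\<omega>. \<omega> \<in> space P \<Longrightarrow> continuous_on {0..} (\<lambda>t. X t \<omega>)"
  shows "progressively_measurable F X"
  unfolding progressively_measurable_def
proof (intro allI impI)
  fix t :: real assume t: "0 \<le> t"
  let ?M = "restrict_space borel {0..t} \<Otimes>\<^sub>M F t"
  \<comment> \<open>Clipping to \<open>[0, t]\<close> makes the function
    \<open>F t\<close>-measurable for every integer \<open>i\<close>; it is inactive for the indices
    that occur.\<close>
  define A where "A = (\<lambda>k (i::int) (z :: real \<times> (real \<Rightarrow> real^'d)). X (max 0 (min t (of_int i / 2 ^ k))) (snd z))"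
  have "(\<lambda>z. A k \<lfloor>fst z * 2 ^ k\<rfloor> z) \<in> borel_measurable ?M" for k :: nat
  proof (rule measurable_compose_countable)
    fix i
    have "X (max 0 (min t (of_int i / 2 ^ k))) \<in> borel_measurable (F t)"
      using t by (intro measurable_F_mono[OF X]) auto
    then show "A k i \<in> borel_measurable ?M"
      unfolding A_def by (rule measurable_compose[OF measurable_snd])
    have "fst \<in> measurable ?M borel"
      by (rule measurable_compose[OF measurable_fst measurable_restrict_space1[OF measurable_ident_sets[OF refl]], unfolded id_def comp_def])
    then show "(\<lambda>z. \<lfloor>fst z * 2 ^ k\<rfloor>) \<in> measurable ?M (count_space UNIV)" by measurable
  qed
  then have "(\<lambda>z. X (fst z) (snd z)) \<in> borel_measurable ?M"
  proof (rule borel_measurable_LIMSEQ_metric)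
    fix z assume z: "z \<in> space ?M"
    then have u: "0 \<le> fst z" "fst z \<le> t" and w: "snd z \<in> space P" by (auto simp: space_pair_measure space_restrict_space)
    have d: "0 \<le> dyadic_floor k (fst z)" "dyadic_floor k (fst z) \<le> t" for k
      using dyadic_floor_ge[of 0 "fst z" k] dyadic_floor_le[of k "fst z"] u by auto
    then have "A k \<lfloor>fst z * 2 ^ k\<rfloor> z = X (dyadic_floor k (fst z)) (snd z)" for k
      using d[of k] by (simp add: A_def dyadic_floor_def)
    moreover have "(\<lambda>k. X (dyadic_floor k (fst z)) (snd z)) \<longlonglongrightarrow> X (fst z) (snd z)"
      using d u by (intro continuous_on_tendsto_compose[OF cont[OF w] dyadic_floor_tendsto]) auto
    ultimately show "(\<lambda>k. A k \<lfloor>fst z * 2 ^ k\<rfloor> z) \<longlonglongrightarrow> X (fst z) (snd z)" by simp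
  qed
  then show "(\<lambda>(u, \<omega>). X u \<omega>) \<in> borel_measurable ?M" by (simp add: split_beta)
qed

end

text \<open>
  The coordinates of the stochastic integrals are obtained by adding them to the state: the
  augmented system has state space \<open>real ^ ('n + 'n \<times> 'd)\<close>, with a further coordinate
  \<open>Inr (i, j)\<close> solving \<open>dJ\<^sup>i\<^sup>j = g(X)\<^sup>i\<^sub>j dW\<^sup>j\<close>.
\<close>

definition aug_proj :: "real^('n::finite + 'n \<times> 'd::finite) \<Rightarrow> real^'n" where
  "aug_proj z = (\<chi> i. z $ Inl i)"

definition aug_emb :: "real^'n \<Rightarrow> real^('n::finite + 'n \<times> 'd::finite)" where
  "aug_emb x = (\<chi> i. case i of Inl a \<Rightarrow> x $ a | Inr _ \<Rightarrow> 0)"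

definition aug_f :: "(real^'n \<Rightarrow> real^'n) \<Rightarrow> real^('n::finite + 'n \<times> 'd::finite) \<Rightarrow> real^('n::finite + 'n \<times> 'd::finite)" where
  "aug_f f z = aug_emb (f (aug_proj z))"

text \<open>Row \<open>Inr (i, j)\<close> keeps only the entry in column \<open>j\<close>, so that
  this coordinate is driven by the \<open>j\<close>-th Brownian motion alone.\<close>

definition aug_mat :: "real^'d^'n \<Rightarrow> real^'d^('n::finite + 'n \<times> 'd::finite)" where
  "aug_mat m = (\<chi> i l. case i of Inl a \<Rightarrow> m $ a $ l | Inr p \<Rightarrow> (if l = snd p then m $ fst p $ l else 0))"

definition aug_g :: "(real^'n \<Rightarrow> real^'d^'n) \<Rightarrow> real^('n::finite + 'n \<times> 'd::finite) \<Rightarrow> real^'d^('n::finite + 'n \<times> 'd::finite)" where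
  "aug_g g z = aug_mat (g (aug_proj z))"

lemma norm_le_sum_norm_components: "norm (x :: 'a::real_normed_vector ^ 'n) \<le> (\<Sum>i\<in>UNIV. norm (x $ i))"
  unfolding norm_vec_def by (rule L2_set_le_sum) simp

lemma norm_aug_proj_le: "norm (aug_proj z) \<le> real CARD('n) * norm (z :: real^('n::finite + 'n \<times> 'd::finite))"
proof -
  have "norm (aug_proj z) \<le> (\<Sum>i\<in>UNIV. norm (aug_proj z $ i))" by (rule norm_le_sum_norm_components)
  also have "\<dots> \<le> (\<Sum>i\<in>(UNIV::'n set). norm z)"
    by (intro sum_mono) (simp add: aug_proj_def component_le_norm_cart)
  finally show ?thesis by simp
qed

lemma norm_aug_emb_le: "norm (aug_emb x :: real^('n::finite + 'n \<times> 'd::finite)) \<le> real CARD('n + 'n \<times> 'd) * norm x"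
proof -
  have "norm (aug_emb x :: real^('n + 'n \<times> 'd)) \<le> (\<Sum>i\<in>UNIV. norm ((aug_emb x :: real^('n + 'n \<times> 'd)) $ i))" by (rule norm_le_sum_norm_components)
  also have "\<dots> \<le> (\<Sum>i\<in>(UNIV::('n + 'n \<times> 'd) set). norm x)"
    by (intro sum_mono) (auto simp: aug_emb_def component_le_norm_cart split: sum.split)
  finally show ?thesis by simp
qed

lemma norm_aug_mat_le: "norm (aug_mat m) \<le> real CARD('n + 'n \<times> 'd) * (real CARD('d) * norm (m :: real^'d::finite^'n::finite))"
proof -
  have e: "\<bar>m $ a $ l\<bar> \<le> norm m" for a l
    using order_trans[OF component_le_norm_cart[of "m $ a" l] Finite_Cartesian_Product.norm_nth_le[of m a]] by simp
  have "norm (aug_mat m) \<le> (\<Sum>i\<in>UNIV. norm (aug_mat m $ i))" by (rule norm_le_sum_norm_components)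
  also have "\<dots> \<le> (\<Sum>i\<in>(UNIV::('n + 'n \<times> 'd) set). \<Sum>l\<in>(UNIV::'d set). norm (aug_mat m $ i $ l))"
    by (intro sum_mono norm_le_sum_norm_components)
  also have "\<dots> \<le> (\<Sum>i\<in>(UNIV::('n + 'n \<times> 'd) set). \<Sum>l\<in>(UNIV::'d set). norm m)"
    by (intro sum_mono) (auto simp: aug_mat_def e split: sum.split)
  finally show ?thesis by simp
qed

lemma aug_emb_diff: "aug_emb x - aug_emb y = aug_emb (x - y)"
  by (auto simp: aug_emb_def vec_eq_iff split: sum.split)

lemma aug_mat_diff: "aug_mat x - aug_mat y = aug_mat (x - y)"
  by (auto simp: aug_mat_def vec_eq_iff split: sum.split)

lemma aug_proj_diff: "aug_proj x - aug_proj y = aug_proj (x - y)"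
  by (auto simp: aug_proj_def vec_eq_iff)

text \<open>The coordinates of the original state evolve without reference to the additional ones,
  so the augmented scheme projects exactly onto the original scheme.\<close>

lemma aug_proj_euler: "aug_proj (euler (aug_f f) (aug_g g) (aug_emb x) T \<omega> j) = euler f g x T \<omega> j"
proof (induction j)
  case 0
  then show ?case by (simp add: aug_proj_def aug_emb_def vec_eq_iff)
next
  case (Suc j)
  have step: "aug_proj (euler_step (aug_f f) (aug_g g) z \<Delta> w) = euler_step f g (aug_proj z) \<Delta> w" for z \<Delta> w
    by (simp add: euler_step_def aug_f_def aug_g_def aug_mat_def aug_emb_def vec_eq_iff matrix_vector_mult_def)
      (simp add: aug_proj_def)
  show ?case by (simp add: step Suc)
qed

text \<open>The additional coordinates of the scheme are left-point Riemann sums of the stochastic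
  integrals, so their limits are the candidates for the integrals.\<close>

lemma aug_euler_integral:
  "euler (aug_f f) (aug_g g) (aug_emb x) T \<omega> j $ Inr (a, b) =
     (\<Sum>i<j. g (euler f g x T \<omega> i) $ a $ b * (\<omega> (T (Suc i)) $ b - \<omega> (T i) $ b))"
proof (induction j)
  case 0
  then show ?case by (simp add: aug_emb_def)
next
  case (Suc j)
  have step: "euler_step (aug_f f) (aug_g g) z \<Delta> w $ Inr (a, b) = z $ Inr (a, b) + g (aug_proj z) $ a $ b * w $ b" for z \<Delta> w
    by (simp add: euler_step_def aug_f_def aug_g_def aug_mat_def aug_emb_def matrix_vector_mult_def if_distrib
        if_distribR cong: if_cong)
  show ?case by (simp add: step Suc aug_proj_euler)
qed

lemma euler_integral_form:
  "euler f g x T \<omega> j = x + (\<Sum>i<j. (T (Suc i) - T i) *\<^sub>R f (euler f g x T \<omega> i)) + (\<Sum>i<j. g (euler f g x T \<omega> i) *v (\<omega> (T (Suc i)) - \<omega> (T i)))"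
  by (induction j) (simp_all add: euler_step_def)

context sde_coeffs
begin

text \<open>The augmented coefficients are again Lipschitz, so the convergence, continuity and
  adaptedness of the flow hold for the stochastic integrals as well. The cardinalities in the
  constant stem from crude bounds of a norm by the sum over the coordinates.\<close>

interpretation aug: sde_coeffs P "aug_f f :: real^('n + 'n \<times> 'd) \<Rightarrow> _" "aug_g g"
  "real CARD('n + 'n \<times> 'd) * (real CARD('d) * (L * real CARD('n)))"
proof
  let ?c = "real CARD('n + 'n \<times> 'd)" and ?L' = "real CARD('n + 'n \<times> 'd) * (real CARD('d) * (L * real CARD('n)))"
  show "0 \<le> ?L'" using L_nonneg by simp
  fix x y :: "real^('n + 'n \<times> 'd)"
  have p: "L * norm (aug_proj x - aug_proj y) \<le> L * (real CARD('n) * norm (x - y))"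
    unfolding aug_proj_diff using norm_aug_proj_le[of "x - y"] L_nonneg by (rule mult_left_mono)
  have d1: "1 \<le> real CARD('d)" by (simp add: Suc_leI)
  have "norm (aug_f f x - aug_f f y :: real^('n + 'n \<times> 'd)) \<le> ?c * norm (f (aug_proj x) - f (aug_proj y))"
    unfolding aug_f_def aug_emb_diff by (rule norm_aug_emb_le)
  also have "\<dots> \<le> ?c * (L * (real CARD('n) * norm (x - y)))"
    by (intro mult_left_mono order_trans[OF f_lip p]) simp
  also have "\<dots> \<le> ?c * (real CARD('d) * (L * (real CARD('n) * norm (x - y))))"
    using L_nonneg d1 mult_right_mono[OF d1, of "L * (real CARD('n) * norm (x - y))"] by (intro mult_left_mono) auto
  finally show "norm (aug_f f x - aug_f f y :: real^('n + 'n \<times> 'd)) \<le> ?L' * norm (x - y)" by (simp add: mult.assoc)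
  have "norm (aug_g g x - aug_g g y) \<le> ?c * (real CARD('d) * norm (g (aug_proj x) - g (aug_proj y)))"
    unfolding aug_g_def aug_mat_diff by (rule norm_aug_mat_le)
  also have "\<dots> \<le> ?c * (real CARD('d) * (L * (real CARD('n) * norm (x - y))))"
    by (intro mult_left_mono order_trans[OF g_lip p]) simp_all
  finally show "norm (aug_g g x - aug_g g y) \<le> ?L' * norm (x - y)" by (simp add: mult.assoc)
qed

section \<open>Passage to the limit in the equation\<close>

text \<open>Uniform convergence on a box is combined with uniform continuity of the limit in time:
  the value at the left mesh point serves for the whole mesh interval.\<close>

lemma poly_flow_uniform:
  assumes w: "\<omega> \<in> good" and t: "0 \<le> t" and e: "e > 0"
  shows "\<forall>\<^sub>F k in sequentially. \<forall>i u. real i / 2 ^ k \<le> u \<longrightarrow> u \<le> real (Suc i) / 2 ^ k \<longrightarrow> u \<le> t \<longrightarrow>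
    dist (poly_at k (0, real i / 2 ^ k, x) \<omega>) (flow x u \<omega>) < e"
proof -
  obtain R where R: "(0, t, x) \<in> pbox R" using in_pbox_ex[OF order_refl t] by blast
  have b: "(0, u, x) \<in> pbox R" if "0 \<le> u" "u \<le> t" for u using R that by (auto simp: pbox_def)
  have "uniformly_continuous_on {0..t} (\<lambda>u. flow x u \<omega>)"
    by (intro compact_uniformly_continuous continuous_on_subset[OF flow_continuous]) auto
  then obtain d where d: "d > 0" "\<And>u v. u \<in> {0..t} \<Longrightarrow> v \<in> {0..t} \<Longrightarrow> dist v u < d \<Longrightarrow> dist (flow x v \<omega>) (flow x u \<omega>) < e / 2"
    unfolding uniformly_continuous_on_def using e by (meson half_gt_zero)
  have "\<forall>\<^sub>F k in sequentially. (1/2) ^ k < d"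
    using order_tendstoD(2)[OF LIMSEQ_power_zero[of "1/2::real"] d(1)] by simp
  moreover have "\<forall>\<^sub>F k in sequentially. \<forall>a\<in>pbox R. dist (poly_at k a \<omega>) (zlim a \<omega>) < e / 2"
    by (rule uniform_limitD[OF uniform_limit_poly[OF w]]) (use e in simp)
  ultimately show ?thesis
  proof eventually_elim
    case (elim k)
    show ?case
    proof (intro allI impI)
      fix i u assume u: "real i / 2 ^ k \<le> u" "u \<le> real (Suc i) / 2 ^ k" "u \<le> t"
      let ?v = "real i / 2 ^ k"
      have v: "0 \<le> ?v" "?v \<le> t" using u by (simp, linarith)
      have "dist (poly_at k (0, ?v, x) \<omega>) (flow x ?v \<omega>) < e / 2"
        using elim(2) b[OF v] w by (simp add: flow_def)
      moreover have "dist (flow x ?v \<omega>) (flow x u \<omega>) < e / 2"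
      proof (rule d(2))
        have "u - ?v \<le> (1/2) ^ k" using u(2) by (simp add: add_divide_distrib power_one_over)
        then show "dist ?v u < d" using elim(1) u(1) by (simp add: dist_real_def)
      qed (use u v order_trans[OF v(1) u(1)] in auto)
      ultimately show "dist (poly_at k (0, ?v, x) \<omega>) (flow x u \<omega>) < e"
        using dist_triangle[of "poly_at k (0, ?v, x) \<omega>" "flow x u \<omega>" "flow x ?v \<omega>"] by linarith
    qed
  qed
qed

lemma poly_compose_uniform:
  fixes \<phi> :: "real^'n \<Rightarrow> real"
  assumes w: "\<omega> \<in> good" and t: "0 \<le> t" and e: "e > 0" and \<phi>: "\<And>x y. \<bar>\<phi> x - \<phi> y\<bar> \<le> L * norm (x - y)"
  shows "\<forall>\<^sub>F k in sequentially. \<forall>i u. real i / 2 ^ k \<le> u \<longrightarrow> u \<le> real (Suc i) / 2 ^ k \<longrightarrow> u \<le> t \<longrightarrow>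
    \<bar>\<phi> (poly_at k (0, real i / 2 ^ k, x) \<omega>) - \<phi> (flow x u \<omega>)\<bar> \<le> e"
proof -
  \<comment> \<open>Dividing by \<open>L + 1\<close> covers the case \<open>L = 0\<close>.\<close>
  have "\<forall>\<^sub>F k in sequentially. \<forall>i u. real i / 2 ^ k \<le> u \<longrightarrow> u \<le> real (Suc i) / 2 ^ k \<longrightarrow> u \<le> t \<longrightarrow>
    dist (poly_at k (0, real i / 2 ^ k, x) \<omega>) (flow x u \<omega>) < e / (L + 1)"
    using L_nonneg e by (intro poly_flow_uniform[OF w t]) auto
  then show ?thesis
  proof eventually_elim
    case (elim k)
    show ?case
    proof (intro allI impI)
      fix i u assume u: "real i / 2 ^ k \<le> u" "u \<le> real (Suc i) / 2 ^ k" "u \<le> t"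
      let ?n = "norm (poly_at k (0, real i / 2 ^ k, x) \<omega> - flow x u \<omega>)"
      have "?n \<le> e / (L + 1)" using elim u by (fastforce simp: dist_norm intro: less_imp_le)
      then have "(L + 1) * ?n \<le> e" using L_nonneg by (simp add: field_simps)
      moreover have "L * ?n \<le> (L + 1) * ?n" by (intro mult_right_mono) auto
      ultimately show "\<bar>\<phi> (poly_at k (0, real i / 2 ^ k, x) \<omega>) - \<phi> (flow x u \<omega>)\<bar> \<le> e"
        using \<phi>[of "poly_at k (0, real i / 2 ^ k, x) \<omega>" "flow x u \<omega>"] by linarith
    qed
  qed
qed

lemma f_comp_lip: "\<bar>f x $ a - f y $ a\<bar> \<le> L * norm (x - y)"
  using order_trans[OF component_le_norm_cart[of "f x - f y" a] f_lip] by simp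

lemma g_comp_lip: "\<bar>g x $ a $ b - g y $ a $ b\<bar> \<le> L * norm (x - y)"
  using order_trans[OF component_le_norm_cart[of "(g x - g y) $ a" b]
      order_trans[OF Finite_Cartesian_Product.norm_nth_le[of "g x - g y" a] g_lip]] by simp

text \<open>Up to index \<open>i\<close> the grids truncated at \<open>t\<close> and at
  \<open>real i / 2 ^ k\<close> agree.\<close>

lemma eul_eq_poly:
  assumes "real i / 2 ^ k \<le> t"
  shows "eul x (\<lambda>j. min (real j / 2 ^ k) t) \<omega> i = poly_at k (0, real i / 2 ^ k, x) \<omega>"
proof -
  have "eul x (\<lambda>j. min (real j / 2 ^ k) t) \<omega> i = eul x (\<lambda>j. 0 + min (real j / 2 ^ k) (real i / 2 ^ k)) \<omega> i"
  proof (rule euler_cong)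
    fix j assume "j \<le> i"
    then have "real j / 2 ^ k \<le> real i / (2 ^ k :: real)" by (simp add: divide_right_mono)
    with assms show "min (real j / 2 ^ k) t = 0 + min (real j / 2 ^ k) (real i / 2 ^ k)" by (simp add: min_def)
  qed
  also have "\<dots> = poly_at k (0, real i / 2 ^ k, x) \<omega>" by (rule poly_at_eq[symmetric]) simp
  finally show ?thesis .
qed

text \<open>The limit of the summed form of the scheme: the drift is a Riemann sum with perturbed
  values, and the noise is by construction a sum of coordinates of the augmented scheme.\<close>

lemma flow_equation:
  assumes w: "\<omega> \<in> good" "\<omega> \<in> aug.good" and t: "0 \<le> t"
  shows "flow x t \<omega> $ a = x $ a + integral {0..t} (\<lambda>u. f (flow x u \<omega>) $ a) + (\<Sum>b\<in>UNIV. aug.flow (aug_emb x) t \<omega> $ Inr (a, b))"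
proof -
  define M where "M k = nat \<lceil>t * 2 ^ k\<rceil>" for k
  define T where "T k i = min (real i / 2 ^ k) t" for k i
  have TM: "T k (M k) = t" for k
  proof -
    have "t * 2 ^ k \<le> real (M k)" by (simp add: M_def of_nat_ceiling)
    then show ?thesis by (simp add: T_def field_simps)
  qed
  have Tm: "T k i \<le> T k (Suc i)" for k i
  proof -
    have "real i / 2 ^ k \<le> real (Suc i) / (2 ^ k :: real)" by (intro divide_right_mono) auto
    then show ?thesis by (simp add: T_def min_le_iff_disj)
  qed
  define D where "D k = (\<Sum>i<M k. (T k (Suc i) - T k i) * f (eul x (T k) \<omega> i) $ a)" for k
  have eq: "poly_at k (0, t, x) \<omega> $ a = x $ a + D k + (\<Sum>b\<in>UNIV. aug.poly_at k (0, t, aug_emb x) \<omega> $ Inr (a, b))" for k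
  proof -
    have "poly_at k (0, t, x) \<omega> = eul x (T k) \<omega> (M k)" by (simp add: poly_at_def T_def[abs_def] M_def)
    then have "poly_at k (0, t, x) \<omega> $ a = x $ a + D k + (\<Sum>i<M k. (g (eul x (T k) \<omega> i) *v (\<omega> (T k (Suc i)) - \<omega> (T k i))) $ a)"
      by (simp add: euler_integral_form[of f g x "T k" \<omega> "M k"] D_def)
    also have "(\<Sum>i<M k. (g (eul x (T k) \<omega> i) *v (\<omega> (T k (Suc i)) - \<omega> (T k i))) $ a)
      = (\<Sum>b\<in>UNIV. \<Sum>i<M k. g (eul x (T k) \<omega> i) $ a $ b * (\<omega> (T k (Suc i)) $ b - \<omega> (T k i) $ b))"
      by (simp add: matrix_vector_mult_def) (rule sum.swap)
    also have "\<dots> = (\<Sum>b\<in>UNIV. aug.poly_at k (0, t, aug_emb x) \<omega> $ Inr (a, b))"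
      by (simp add: aug.poly_at_def aug_euler_integral T_def[abs_def] M_def)
    finally show ?thesis .
  qed
  have Hc: "continuous_on {0..t} (\<lambda>u. f (flow x u \<omega>) $ a)"
    by (intro continuous_on_component continuous_on_compose2[OF f_cont[of UNIV]] continuous_on_subset[OF flow_continuous]) auto
  have "D \<longlonglongrightarrow> integral {0..t} (\<lambda>u. f (flow x u \<omega>) $ a)"
    unfolding lim_sequentially
  proof (intro allI impI)
    fix e :: real assume e: "e > 0"
    \<comment> \<open>The summand 1 covers \<open>t = 0\<close>, and the 2 makes the final
      inequality strict.\<close>
    define e' where "e' = e / (2 * (t + 1))"
    have e': "e' > 0" "e' * t < e"
    proof -
      show "e' > 0" using e t by (simp add: e'_def)
      have "e' * t \<le> e' * (t + 1)" using \<open>e' > 0\<close> by simp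
      also have "\<dots> = e / 2" using t by (simp add: e'_def field_simps)
      finally show "e' * t < e" using e by simp
    qed
    have "\<forall>\<^sub>F k in sequentially. dist (D k) (integral {0..t} (\<lambda>u. f (flow x u \<omega>) $ a)) < e"
      using poly_compose_uniform[where \<phi>="\<lambda>y. f y $ a" and x=x, OF w(1) t e'(1) f_comp_lip]
    proof eventually_elim
      case (elim k)
      have "\<bar>D k - integral {0..T k (M k)} (\<lambda>u. f (flow x u \<omega>) $ a)\<bar> \<le> e' * T k (M k)"
        unfolding D_def
      proof (rule riemann_sum_error[OF Hc])
        show "T k 0 = 0" using t by (simp add: T_def)
        fix i u assume i: "i < M k" "T k i \<le> u" "u \<le> T k (Suc i)"
        have "real i < t * 2 ^ k" using i(1) unfolding M_def by linarith
        then have it: "real i / 2 ^ k \<le> t" by (simp add: field_simps)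
        have "eul x (T k) \<omega> i = poly_at k (0, real i / 2 ^ k, x) \<omega>"
          unfolding T_def by (rule eul_eq_poly[OF it])
        moreover have "real i / 2 ^ k \<le> u" "u \<le> real (Suc i) / 2 ^ k" "u \<le> t" using i it by (auto simp: T_def)
        ultimately show "\<bar>f (eul x (T k) \<omega> i) $ a - f (flow x u \<omega>) $ a\<bar> \<le> e'" using elim by simp
      qed (use Tm in \<open>auto simp: T_def\<close>)
      then show ?case using e'(2) unfolding TM by (simp add: dist_real_def)
    qed
    then show "\<exists>no. \<forall>n\<ge>no. dist (D n) (integral {0..t} (\<lambda>u. f (flow x u \<omega>) $ a)) < e"
      by (simp add: eventually_sequentially)
  qed
  moreover have "(\<lambda>k. aug.poly_at k (0, t, aug_emb x) \<omega> $ Inr (a, b)) \<longlonglongrightarrow> aug.flow (aug_emb x) t \<omega> $ Inr (a, b)" for b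
    using tendsto_vec_nth[OF aug.tendsto_poly[OF w(2) order_refl t, of "aug_emb x"]] w(2) by (simp add: aug.flow_def)
  ultimately have "(\<lambda>k. poly_at k (0, t, x) \<omega> $ a) \<longlonglongrightarrow> x $ a + integral {0..t} (\<lambda>u. f (flow x u \<omega>) $ a) + (\<Sum>b\<in>UNIV. aug.flow (aug_emb x) t \<omega> $ Inr (a, b))"
    unfolding eq by (intro tendsto_add tendsto_const tendsto_sum)
  moreover have "(\<lambda>k. poly_at k (0, t, x) \<omega> $ a) \<longlonglongrightarrow> flow x t \<omega> $ a"
    using tendsto_vec_nth[OF tendsto_poly[OF w(1) order_refl t, of x]] w(1) by (simp add: flow_def)
  ultimately show ?thesis using LIMSEQ_unique by blast
qed

text \<open>The approximating step processes hold the clipped values of \<open>g\<close> along the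
  scheme of level \<open>k\<close>. Along a good path and for large \<open>k\<close> the clipping is
  inactive up to time \<open>t\<close>, and the step integral is then exactly an additional
  coordinate of the augmented scheme.\<close>

lemma flow_ito_integral:
  "ito_integral P F (\<lambda>t \<omega>. \<omega> t $ b) (\<lambda>u \<omega>. g (flow x u \<omega>) $ a $ b) (\<lambda>t \<omega>. aug.flow (aug_emb x) t \<omega> $ Inr (a, b))"
  unfolding ito_integral_def
proof (intro conjI)
  let ?H = "\<lambda>u \<omega>. g (flow x u \<omega>) $ a $ b"
  let ?J = "\<lambda>t \<omega>. aug.flow (aug_emb x) t \<omega> $ Inr (a, b)"
  have Hc: "continuous_on S (\<lambda>u. ?H u \<omega>)" if "S \<subseteq> {0..}" for S \<omega>
    by (intro continuous_on_component continuous_on_compose2[OF g_cont[of UNIV]] continuous_on_subset[OF flow_continuous that]) auto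
  have gab [measurable]: "(\<lambda>y. g y $ a $ b) \<in> borel_measurable borel"
    by (intro borel_measurable_continuous_onI continuous_on_component g_cont)
  show "progressively_measurable F ?H"
  proof (rule progressively_measurable_continuous)
    fix t :: real assume "0 \<le> t"
    from measurable_compose[OF flow_F[OF this] gab] show "?H t \<in> borel_measurable (F t)" .
  qed (rule Hc, simp)
  show "\<forall>t\<ge>0. ?J t \<in> borel_measurable (F t)"
    using measurable_compose[OF aug.flow_F borel_measurable_nth] by auto
  show "\<forall>\<omega>\<in>space P. continuous_on {0..} (\<lambda>t. ?J t \<omega>)"
    by (auto intro!: continuous_on_component aug.flow_continuous)
  \<comment> \<open>The number of intervals of length \<open>1 / 2 ^ k\<close> that cover
    \<open>[0, k]\<close>, hence eventually \<open>[0, t]\<close>.\<close>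
  define m where "m = (\<lambda>k::nat. k * 2 ^ k)"
  define \<tau> where "\<tau> = (\<lambda>k i. real i / 2 ^ k :: real)"
  define \<xi> where "\<xi> = (\<lambda>k i \<omega>. clip (real k) (g (poly_at k (0, real i / 2 ^ k, x) \<omega>) $ a $ b))"
  have AEgood: "AE \<omega> in P. \<omega> \<in> good \<and> \<omega> \<in> aug.good" using AE_good aug.AE_good by eventually_elim simp
  have main: "\<forall>\<^sub>F k in sequentially. real k \<ge> t \<and> (\<forall>i u. real i / 2 ^ k \<le> u \<longrightarrow> u \<le> real (Suc i) / 2 ^ k \<longrightarrow> u \<le> t \<longrightarrow>
     \<bar>\<xi> k i \<omega> - ?H u \<omega>\<bar> \<le> e \<and> \<xi> k i \<omega> = g (poly_at k (0, real i / 2 ^ k, x) \<omega>) $ a $ b)"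
    if w: "\<omega> \<in> good" and t: "0 \<le> t" and e: "e > 0" for \<omega> t e
  proof -
    have "compact ((\<lambda>u. ?H u \<omega>) ` {0..t})" by (intro compact_continuous_image Hc) auto
    then obtain K where K: "\<And>u. 0 \<le> u \<Longrightarrow> u \<le> t \<Longrightarrow> \<bar>?H u \<omega>\<bar> \<le> K"
      using compact_imp_bounded bounded_real by (metis (no_types, lifting) atLeastAtMost_iff imageI)
    \<comment> \<open>\<open>K\<close> bounds the integrand along the flow; the 1 is for the
      distance of its values along the scheme.\<close>
    have "\<forall>\<^sub>F k in sequentially. real k \<ge> t" "\<forall>\<^sub>F k in sequentially. real k \<ge> K + 1"
      by (auto simp: eventually_sequentially intro: exI[of _ "nat \<lceil>_\<rceil>"] dest!: order_trans[OF real_nat_ceiling_ge] of_nat_mono[where 'a=real])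
    moreover have "\<forall>\<^sub>F k in sequentially. \<forall>i u. real i / 2 ^ k \<le> u \<longrightarrow> u \<le> real (Suc i) / 2 ^ k \<longrightarrow> u \<le> t \<longrightarrow>
        \<bar>g (poly_at k (0, real i / 2 ^ k, x) \<omega>) $ a $ b - ?H u \<omega>\<bar> \<le> min e 1"
      by (rule poly_compose_uniform[OF w t _ g_comp_lip]) (use e in simp)
    ultimately show ?thesis
    proof eventually_elim
      case (elim k)
      show ?case
      proof (intro conjI allI impI)
        show "t \<le> real k" by fact
        fix i u assume u: "real i / 2 ^ k \<le> u" "u \<le> real (Suc i) / 2 ^ k" "u \<le> t"
        have "0 \<le> u" using u(1) by (rule order_trans[rotated]) simp
        have 1: "\<bar>g (poly_at k (0, real i / 2 ^ k, x) \<omega>) $ a $ b - ?H u \<omega>\<bar> \<le> min e 1" using elim(3) u by blast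
        with K[OF \<open>0 \<le> u\<close> u(3)] elim(2) have "\<bar>g (poly_at k (0, real i / 2 ^ k, x) \<omega>) $ a $ b\<bar> \<le> real k" by linarith
        then show 2: "\<xi> k i \<omega> = g (poly_at k (0, real i / 2 ^ k, x) \<omega>) $ a $ b" unfolding \<xi>_def by (rule clip_id)
        show "\<bar>\<xi> k i \<omega> - ?H u \<omega>\<bar> \<le> e" using 1 unfolding 2 by simp
      qed
    qed
  qed
  show "\<exists>m \<tau> \<xi>. (\<forall>k. step_process F (space P) (m k) (\<tau> k) (\<xi> k)) \<and>
        (\<forall>t\<ge>0. \<forall>e>0.
           (\<lambda>k. measure P {\<omega> \<in> space P.
              (\<integral>\<^sup>+u\<in>{0..t}. ennreal ((step_value (m k) (\<tau> k) (\<xi> k) u \<omega> - ?H u \<omega>)\<^sup>2) \<partial>lborel)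
                > ennreal e}) \<longlonglongrightarrow> 0 \<and>
           (\<lambda>k. measure P {\<omega> \<in> space P.
              \<bar>step_integral (\<lambda>t \<omega>. \<omega> t $ b) (m k) (\<tau> k) (\<xi> k) t \<omega> - ?J t \<omega>\<bar> > e}) \<longlonglongrightarrow> 0)"
  proof (intro exI[of _ m] exI[of _ \<tau>] exI[of _ \<xi>] conjI allI impI)
    fix k
    show "step_process F (space P) (m k) (\<tau> k) (\<xi> k)"
      unfolding step_process_def
    proof (intro conjI allI impI)
      show "0 \<le> \<tau> k 0" by (simp add: \<tau>_def)
      fix i
      show "\<tau> k i < \<tau> k (Suc i)" by (simp add: \<tau>_def divide_strict_right_mono)
      have "(\<lambda>\<omega>. poly_at k (0, real i / 2 ^ k, x) \<omega>) \<in> borel_measurable (F (0 + real i / 2 ^ k))"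
        by (rule poly_at_F) auto
      then have [measurable]: "(\<lambda>\<omega>. g (poly_at k (0, real i / 2 ^ k, x) \<omega>) $ a $ b) \<in> borel_measurable (F (\<tau> k i))"
        unfolding \<tau>_def using measurable_compose[OF _ gab] by auto
      show "\<xi> k i \<in> borel_measurable (F (\<tau> k i))" unfolding \<xi>_def clip_def by measurable
      show "\<exists>C. \<forall>\<omega>\<in>space P. \<bar>\<xi> k i \<omega>\<bar> \<le> C" unfolding \<xi>_def using clip_bound by (intro exI[of _ "real k"]) simp
    qed
  next
    fix t e :: real assume t: "0 \<le> t" and e: "e > 0"
    show "(\<lambda>k. measure P {\<omega> \<in> space P.
              (\<integral>\<^sup>+u\<in>{0..t}. ennreal ((step_value (m k) (\<tau> k) (\<xi> k) u \<omega> - ?H u \<omega>)\<^sup>2) \<partial>lborel)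
                > ennreal e}) \<longlonglongrightarrow> 0"
    proof (rule measure_tendsto_zero_of_AE)
      show "AE \<omega> in P. \<forall>\<^sub>F k in sequentially. \<omega> \<notin> {\<omega> \<in> space P.
              (\<integral>\<^sup>+u\<in>{0..t}. ennreal ((step_value (m k) (\<tau> k) (\<xi> k) u \<omega> - ?H u \<omega>)\<^sup>2) \<partial>lborel) > ennreal e}"
        using AEgood
      proof eventually_elim
        case (elim \<omega>)
        define e' where "e' = sqrt (e / (t + 1))"
        have e': "e' > 0" "e'\<^sup>2 * t \<le> e" using e t by (auto simp: e'_def field_simps)
        from main[OF conjunct1[OF elim] t e'(1)] show ?case
        proof eventually_elim
          case (elim k)
          have sv: "\<bar>step_value (m k) (\<tau> k) (\<xi> k) u \<omega> - ?H u \<omega>\<bar> \<le> e'" if u: "0 < u" "u \<le> t" for u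
          proof -
            \<comment> \<open>The intervals are open on the left, so the index is a ceiling minus 1.
              Time 0 lies in none of them and is discarded below as a null set.\<close>
            define i where "i = nat (\<lceil>u * 2 ^ k\<rceil> - 1)"
            have c: "0 < \<lceil>u * 2 ^ k\<rceil>" using u by simp
            then have i: "real i = of_int \<lceil>u * 2 ^ k\<rceil> - 1" by (simp add: i_def)
            have "real i < u * 2 ^ k" "u * 2 ^ k \<le> real i + 1" unfolding i by linarith+
            then have iu: "\<tau> k i < u" "u \<le> \<tau> k (Suc i)" by (simp_all add: \<tau>_def field_simps)
            have "u * 2 ^ k \<le> real k * 2 ^ k" using u elim by (intro mult_right_mono) auto
            from less_le_trans[OF \<open>real i < u * 2 ^ k\<close> this] have "real i < real (m k)" by (simp add: m_def)
            then have im: "i < m k" by simp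
            have uniq: "indicator {\<tau> k l<..\<tau> k (Suc l)} u = (if l = i then 1 else 0 :: real)" for l
            proof (cases "l = i")
              case False
              have "u \<notin> {\<tau> k l<..\<tau> k (Suc l)}"
              proof (cases "l < i")
                case True
                then have "\<tau> k (Suc l) \<le> \<tau> k i" unfolding \<tau>_def by (intro divide_right_mono) auto
                with iu show ?thesis by simp
              next
                case False
                then have "\<tau> k (Suc i) \<le> \<tau> k l" using \<open>l \<noteq> i\<close> unfolding \<tau>_def by (intro divide_right_mono) auto
                with iu show ?thesis by simp
              qed
              with False show ?thesis by simp
            qed (use iu in simp)
            have "step_value (m k) (\<tau> k) (\<xi> k) u \<omega> = \<xi> k i \<omega>"
              unfolding step_value_def uniq using im by (simp add: if_distrib cong: if_cong)
            moreover have "\<bar>\<xi> k i \<omega> - ?H u \<omega>\<bar> \<le> e'" using elim iu u by (auto simp: \<tau>_def)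
            ultimately show ?thesis by simp
          qed
          have "(\<integral>\<^sup>+u\<in>{0..t}. ennreal ((step_value (m k) (\<tau> k) (\<xi> k) u \<omega> - ?H u \<omega>)\<^sup>2) \<partial>lborel) \<le> (\<integral>\<^sup>+u. ennreal (e'\<^sup>2) * indicator {0..t} u \<partial>lborel)"
          proof (rule nn_integral_mono_AE)
            show "AE u in lborel. ennreal ((step_value (m k) (\<tau> k) (\<xi> k) u \<omega> - ?H u \<omega>)\<^sup>2) * indicator {0..t} u \<le> ennreal (e'\<^sup>2) * indicator {0..t} u"
              using AE_lborel_singleton[of 0]
            proof eventually_elim
              case (elim u)
              show ?case
              proof (cases "u \<in> {0..t}")
                case True
                then have "\<bar>step_value (m k) (\<tau> k) (\<xi> k) u \<omega> - ?H u \<omega>\<bar>\<^sup>2 \<le> e'\<^sup>2"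
                  using elim by (intro power_mono sv) auto
                then show ?thesis using True by (simp add: ennreal_leI)
              qed simp
            qed
          qed
          also have "\<dots> = ennreal (e'\<^sup>2 * t)" using t by (simp add: nn_integral_cmult_indicator ennreal_mult)
          also have "\<dots> \<le> ennreal e" by (intro ennreal_leI e')
          finally show ?case by (simp add: not_less)
        qed
      qed
    qed
    show "(\<lambda>k. measure P {\<omega> \<in> space P.
              \<bar>step_integral (\<lambda>t \<omega>. \<omega> t $ b) (m k) (\<tau> k) (\<xi> k) t \<omega> - ?J t \<omega>\<bar> > e}) \<longlonglongrightarrow> 0"
    proof (rule measure_tendsto_zero_of_AE)
      show "AE \<omega> in P. \<forall>\<^sub>F k in sequentially. \<omega> \<notin> {\<omega> \<in> space P.
              \<bar>step_integral (\<lambda>t \<omega>. \<omega> t $ b) (m k) (\<tau> k) (\<xi> k) t \<omega> - ?J t \<omega>\<bar> > e}"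
        using AEgood
      proof eventually_elim
        case (elim \<omega>)
        then have w: "\<omega> \<in> good" "\<omega> \<in> aug.good" by auto
        have "(\<lambda>k. aug.poly_at k (0, t, aug_emb x) \<omega> $ Inr (a, b)) \<longlonglongrightarrow> ?J t \<omega>"
          using tendsto_vec_nth[OF aug.tendsto_poly[OF w(2) order_refl t, of "aug_emb x"]] w(2) by (simp add: aug.flow_def)
        from tendstoD[OF this e] main[OF w(1) t zero_less_one] show ?case
        proof eventually_elim
          case (elim k)
          define T where "T i = min (real i / 2 ^ k) t" for i
          have "t * 2 ^ k \<le> real (m k)" using elim(2) by (simp add: m_def mult_right_mono)
          from aug.poly_at_eq[OF this, of 0 "aug_emb x" \<omega>]
          have "aug.poly_at k (0, t, aug_emb x) \<omega> $ Inr (a, b) = (\<Sum>i<m k. g (eul x T \<omega> i) $ a $ b * (\<omega> (T (Suc i)) $ b - \<omega> (T i) $ b))"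
            by (simp add: aug_euler_integral T_def[abs_def])
          also have "\<dots> = step_integral (\<lambda>t \<omega>. \<omega> t $ b) (m k) (\<tau> k) (\<xi> k) t \<omega>"
            unfolding step_integral_def
          proof (rule sum.cong[OF refl])
            fix i
            show "g (eul x T \<omega> i) $ a $ b * (\<omega> (T (Suc i)) $ b - \<omega> (T i) $ b) = \<xi> k i \<omega> * (\<omega> (min (\<tau> k (Suc i)) t) $ b - \<omega> (min (\<tau> k i) t) $ b)"
            proof (cases "real i / 2 ^ k \<le> t")
              case True
              have "real i / 2 ^ k \<le> real (Suc i) / (2 ^ k :: real)" by (intro divide_right_mono) auto
              then have "\<xi> k i \<omega> = g (poly_at k (0, real i / 2 ^ k, x) \<omega>) $ a $ b" using elim(2) True by blast
              then show ?thesis using eul_eq_poly[OF True, of x \<omega>] by (simp add: T_def[abs_def] \<tau>_def)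
            next
              case False
              moreover have "real i / 2 ^ k \<le> real (Suc i) / (2 ^ k :: real)" by (intro divide_right_mono) auto
              ultimately have "T i = t" "T (Suc i) = t" by (auto simp: T_def)
              then show ?thesis by (simp add: T_def \<tau>_def)
            qed
          qed
          finally show ?case using elim(1) by (simp add: dist_real_def)
        qed
      qed
    qed
  qed
qed

theorem flow_solution: "sde_solution P f g x (flow x)"
  unfolding sde_solution_def
proof (intro conjI allI impI ballI exI[of _ "\<lambda>a b t \<omega>. aug.flow (aug_emb x) t \<omega> $ Inr (a, b)"])
  show "flow x t \<in> borel_measurable (F t)" if "0 \<le> t" for t using flow_F[OF that] by simp
  show "continuous_on {0..} (\<lambda>t. flow x t \<omega>)" for \<omega> by (rule flow_continuous)
  show "ito_integral P F (\<lambda>t \<omega>. \<omega> t $ j) (\<lambda>u \<omega>. g (flow x u \<omega>) $ i $ j) (\<lambda>t \<omega>. aug.flow (aug_emb x) t \<omega> $ Inr (i, j))" for i j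
    by (rule flow_ito_integral)
  show "AE \<omega> in P. \<forall>t\<ge>0. \<forall>i. flow x t \<omega> $ i = x $ i + integral {0..t} (\<lambda>u. f (flow x u \<omega>) $ i) +
      (\<Sum>j\<in>UNIV. aug.flow (aug_emb x) t \<omega> $ Inr (i, j))"
    using AE_good aug.AE_good by eventually_elim (auto intro!: flow_equation)
qed

end

section \<open>Ito integrals as limits of Riemann sums\<close>

text \<open>The nodes up to \<open>\<alpha>\<close> form an initial segment of \<open>m K\<close>
  indices, so the sum telescopes, and its last node tends to \<open>min \<alpha> t\<close>.\<close>

lemma dyadic_indicator_limit:
  fixes B :: "real \<Rightarrow> real"
  assumes B: "continuous_on {0..} B" and t: "0 \<le> t" and \<alpha>: "0 \<le> \<alpha>"
  shows "(\<lambda>K. \<Sum>l<2 ^ K. (if real l * (t / 2 ^ K) \<le> \<alpha> then 1 else 0) * (B (real (Suc l) * (t / 2 ^ K)) - B (real l * (t / 2 ^ K))))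
    \<longlonglongrightarrow> B (min \<alpha> t) - B 0"
proof -
  define m :: "nat \<Rightarrow> nat" where "m K = (if \<alpha> < t then nat \<lfloor>\<alpha> * 2 ^ K / t\<rfloor> + 1 else 2 ^ K)" for K
  have m: "m K \<le> 2 ^ K" "l < 2 ^ K \<Longrightarrow> (real l * (t / 2 ^ K) \<le> \<alpha>) = (l < m K)"
    "\<bar>real (m K) * (t / 2 ^ K) - min \<alpha> t\<bar> \<le> t * (1/2) ^ K" for K l
  proof -
    have "m K \<le> 2 ^ K \<and> (l < 2 ^ K \<longrightarrow> (real l * (t / 2 ^ K) \<le> \<alpha>) = (l < m K)) \<and> \<bar>real (m K) * (t / 2 ^ K) - min \<alpha> t\<bar> \<le> t * (1/2) ^ K"
    proof (cases "\<alpha> < t")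
      case True
      then have t0: "0 < t" using \<alpha> by simp
      let ?z = "\<alpha> * 2 ^ K / t"
      have z: "0 \<le> ?z" "?z < 2 ^ K" using True \<alpha> t0 by (simp_all add: divide_less_eq)
      have zz: "real (m K) = of_int \<lfloor>?z\<rfloor> + 1" using True z by (simp add: m_def)
      have "\<lfloor>?z\<rfloor> < 2 ^ K" using z by (simp add: floor_less_iff)
      then have 1: "m K \<le> 2 ^ K" using True z by (simp add: m_def nat_less_iff Suc_le_eq)
      have "real l * (t / 2 ^ K) \<le> \<alpha> \<longleftrightarrow> real l \<le> ?z" using t0 by (simp add: field_simps)
      also have "\<dots> \<longleftrightarrow> int l \<le> \<lfloor>?z\<rfloor>" by (simp add: le_floor_iff)
      also have "\<dots> \<longleftrightarrow> l < m K" using True z by (simp add: m_def) linarith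
      finally have 2: "(real l * (t / 2 ^ K) \<le> \<alpha>) = (l < m K)" .
      have "?z \<le> real (m K)" "real (m K) \<le> ?z + 1" unfolding zz by linarith+
      then have "?z * (t / 2 ^ K) \<le> real (m K) * (t / 2 ^ K)" "real (m K) * (t / 2 ^ K) \<le> (?z + 1) * (t / 2 ^ K)"
        using t0 by (intro mult_right_mono; simp)+
      moreover have "?z * (t / 2 ^ K) = \<alpha>" using t0 by simp
      moreover have "(?z + 1) * (t / 2 ^ K) = \<alpha> + t / 2 ^ K" using t0 by (simp add: field_simps)
      moreover have "t * (1/2) ^ K = t / 2 ^ K" by (simp add: power_one_over)
      ultimately have "\<bar>real (m K) * (t / 2 ^ K) - min \<alpha> t\<bar> \<le> t * (1/2) ^ K"
        using True by (simp only: min.absorb1 less_imp_le)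
      with 1 2 show ?thesis by blast
    next
      case False
      have "real l * (t / 2 ^ K) \<le> \<alpha>" if "l < 2 ^ K"
      proof -
        have "real l \<le> real (2 ^ K)" using that by (simp only: of_nat_le_iff less_imp_le)
        then have "real l \<le> 2 ^ K" by simp
        then have "real l * (t / 2 ^ K) \<le> 2 ^ K * (t / 2 ^ K)" using t by (intro mult_right_mono) auto
        then show ?thesis using False by simp
      qed
      then show ?thesis using False t by (auto simp: m_def min_def)
    qed
    then show "m K \<le> 2 ^ K" "l < 2 ^ K \<Longrightarrow> (real l * (t / 2 ^ K) \<le> \<alpha>) = (l < m K)"
      "\<bar>real (m K) * (t / 2 ^ K) - min \<alpha> t\<bar> \<le> t * (1/2) ^ K" by blast+
  qed
  have "(\<Sum>l<2 ^ K. (if real l * (t / 2 ^ K) \<le> \<alpha> then 1 else 0) * (B (real (Suc l) * (t / 2 ^ K)) - B (real l * (t / 2 ^ K))))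
      = B (real (m K) * (t / 2 ^ K)) - B 0" for K
  proof -
    have "(\<Sum>l<2 ^ K. (if real l * (t / 2 ^ K) \<le> \<alpha> then 1 else 0) * (B (real (Suc l) * (t / 2 ^ K)) - B (real l * (t / 2 ^ K))))
      = (\<Sum>l<m K. B (real (Suc l) * (t / 2 ^ K)) - B (real l * (t / 2 ^ K)))"
    proof (rule sum.mono_neutral_cong_right)
      show "{..<m K} \<subseteq> {..<2 ^ K}" using m(1)[of K] by auto
    qed (use m(2)[of _ K] m(1)[of K] in \<open>auto simp: order_less_le_trans\<close>)
    also have "\<dots> = B (real (m K) * (t / 2 ^ K)) - B (real 0 * (t / 2 ^ K))"
      by (rule sum_lessThan_telescope)
    finally show ?thesis by simp
  qed
  moreover have "(\<lambda>K. B (real (m K) * (t / 2 ^ K)) - B 0) \<longlonglongrightarrow> B (min \<alpha> t) - B 0"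
  proof (intro tendsto_diff tendsto_const continuous_on_tendsto_compose[OF B])
    have "(\<lambda>K. real (m K) * (t / 2 ^ K) - min \<alpha> t) \<longlonglongrightarrow> 0"
    proof (rule Lim_null_comparison)
      show "\<forall>\<^sub>F K in sequentially. norm (real (m K) * (t / 2 ^ K) - min \<alpha> t) \<le> t * (1/2) ^ K" using m(3) by simp
      show "(\<lambda>K. t * (1/2) ^ K) \<longlonglongrightarrow> 0" using tendsto_mult_left[OF LIMSEQ_power_zero[of "1/2::real"], of t] by simp
    qed
    then show "(\<lambda>K. real (m K) * (t / 2 ^ K)) \<longlonglongrightarrow> min \<alpha> t" by (rule LIM_zero_cancel)
  qed (use t \<alpha> in \<open>auto intro!: always_eventually\<close>)
  ultimately show ?thesis by simp
qed

text \<open>The indicator of a half-open interval is a difference of indicators of two half-lines,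
  to which \<open>dyadic_indicator_limit\<close> applies.\<close>

lemma step_integral_limit:
  fixes B :: "real \<Rightarrow> 'a \<Rightarrow> real"
  assumes B: "continuous_on {0..} (\<lambda>t. B t \<omega>)" and t: "0 \<le> t" and \<tau>: "\<And>i. i < m \<Longrightarrow> 0 \<le> \<tau> i \<and> \<tau> i < \<tau> (Suc i)"
  shows "(\<lambda>K. \<Sum>l<2 ^ K. step_value m \<tau> \<xi> (real l * (t / 2 ^ K)) \<omega> * (B (real (Suc l) * (t / 2 ^ K)) \<omega> - B (real l * (t / 2 ^ K)) \<omega>))
    \<longlonglongrightarrow> step_integral B m \<tau> \<xi> t \<omega>"
proof -
  let ?d = "\<lambda>K l. B (real (Suc l) * (t / 2 ^ K)) \<omega> - B (real l * (t / 2 ^ K)) \<omega>"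
  let ?I = "\<lambda>K \<alpha>. \<Sum>l<2 ^ K. (if real l * (t / 2 ^ K) \<le> \<alpha> then 1 else 0) * ?d K l"
  have ind: "indicator {\<tau> i<..\<tau> (Suc i)} u = (if u \<le> \<tau> (Suc i) then 1 else 0) - (if u \<le> \<tau> i then 1 else 0 :: real)" if "i < m" for i u
    using \<tau>[OF that] by (auto simp: indicator_def)
  have "(\<Sum>l<2 ^ K. step_value m \<tau> \<xi> (real l * (t / 2 ^ K)) \<omega> * ?d K l) = (\<Sum>i<m. \<xi> i \<omega> * (?I K (\<tau> (Suc i)) - ?I K (\<tau> i)))" for K
  proof -
    have "(\<Sum>l<2 ^ K. step_value m \<tau> \<xi> (real l * (t / 2 ^ K)) \<omega> * ?d K l)
      = (\<Sum>l<2 ^ K. \<Sum>i<m. \<xi> i \<omega> * (indicator {\<tau> i<..\<tau> (Suc i)} (real l * (t / 2 ^ K)) * ?d K l))"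
      by (simp only: step_value_def sum_distrib_right mult.assoc)
    also have "\<dots> = (\<Sum>i<m. \<Sum>l<2 ^ K. \<xi> i \<omega> * (indicator {\<tau> i<..\<tau> (Suc i)} (real l * (t / 2 ^ K)) * ?d K l))"
      by (rule sum.swap)
    also have "\<dots> = (\<Sum>i<m. \<xi> i \<omega> * (?I K (\<tau> (Suc i)) - ?I K (\<tau> i)))"
      by (intro sum.cong refl) (simp add: ind sum_distrib_left left_diff_distrib sum_subtractf right_diff_distrib)
    finally show ?thesis .
  qed
  moreover have "(\<lambda>K. \<Sum>i<m. \<xi> i \<omega> * (?I K (\<tau> (Suc i)) - ?I K (\<tau> i))) \<longlonglongrightarrow>
    (\<Sum>i<m. \<xi> i \<omega> * ((B (min (\<tau> (Suc i)) t) \<omega> - B 0 \<omega>) - (B (min (\<tau> i) t) \<omega> - B 0 \<omega>)))"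
    using \<tau> by (intro tendsto_sum tendsto_mult tendsto_const tendsto_diff[of "\<lambda>K. ?I K _"] dyadic_indicator_limit[OF B t]) (auto intro: order_trans less_imp_le)
  ultimately show ?thesis by (simp add: step_integral_def)
qed

text \<open>The left endpoints approach \<open>u\<close> strictly from the left, so left continuity
  is enough and step integrands, which jump, are covered. The sums are integrals of the step
  functions \<open>s K\<close>, and dominated convergence applies.\<close>

lemma riemann_sum_limit:
  fixes q :: "real \<Rightarrow> real"
  assumes t: "0 < t" and q: "q \<in> borel_measurable borel" "\<And>u. 0 \<le> u \<Longrightarrow> u \<le> t \<Longrightarrow> \<bar>q u\<bar> \<le> C"
    and left: "\<And>u. 0 < u \<Longrightarrow> u \<le> t \<Longrightarrow> (q \<longlongrightarrow> q u) (at_left u)"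
  shows "(\<lambda>K. \<Sum>l<2 ^ K. t / 2 ^ K * q (real l * (t / 2 ^ K))) \<longlonglongrightarrow> (LINT u|lborel. indicator {0<..t} u * q u)"
proof -
  define h where "h K = t / 2 ^ K" for K
  have h: "h K > 0" "2 ^ K * h K = t" for K using t by (auto simp: h_def)
  define s where "s K u = (\<Sum>l<2 ^ K. indicator {real l * h K<..real (Suc l) * h K} u * q (real l * h K))" for K u
  have s: "\<exists>l<2 ^ K. s K u = q (real l * h K) \<and> real l * h K < u \<and> u \<le> real (Suc l) * h K" if u: "0 < u" "u \<le> t" for K u
  proof -
    define l where "l = nat (\<lceil>u / h K\<rceil> - 1)"
    have "0 < u / h K" using u h by simp
    then have c: "0 < \<lceil>u / h K\<rceil>" by simp
    then have rl: "real l = of_int \<lceil>u / h K\<rceil> - 1" by (simp add: l_def)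
    have "real l < u / h K" "u / h K \<le> real (Suc l)" unfolding of_nat_Suc rl by linarith+
    then have lu: "real l * h K < u" "u \<le> real (Suc l) * h K" using h(1)[of K] by (simp_all add: field_simps)
    have "real l * h K < real (2 ^ K) * h K" using lu u h(2)[of K] by simp
    then have l2: "l < 2 ^ K" using h(1)[of K] by (simp only: mult_less_cancel_right_pos of_nat_less_iff)
    have ind: "indicator {real i * h K<..real (Suc i) * h K} u = (if i = l then 1 else 0 :: real)" for i
    proof (cases "i = l")
      case False
      have "u \<notin> {real i * h K<..real (Suc i) * h K}"
      proof (cases "i < l")
        case True
        then have "real (Suc i) * h K \<le> real l * h K" using h(1)[of K] by (intro mult_right_mono) auto
        with lu show ?thesis by simp
      next
        case False
        then have "real (Suc l) * h K \<le> real i * h K" using \<open>i \<noteq> l\<close> h(1)[of K] by (intro mult_right_mono) auto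
        with lu show ?thesis by simp
      qed
      with False show ?thesis by simp
    qed (use lu in simp)
    have "s K u = q (real l * h K)" unfolding s_def ind using l2 by (simp add: if_distrib if_distribR cong: if_cong)
    with l2 lu show ?thesis by blast
  qed
  have s0: "s K u = 0" if "u \<notin> {0<..t}" for K u
    unfolding s_def
  proof (rule sum.neutral, rule ballI)
    fix l assume "l \<in> {..<2 ^ K :: nat}"
    then have "Suc l \<le> 2 ^ K" by simp
    then have "real (Suc l) \<le> real (2 ^ K)" by (simp only: of_nat_le_iff)
    then have "real (Suc l) * h K \<le> real (2 ^ K) * h K" using h(1)[of K] by (intro mult_right_mono) auto
    then have "real (Suc l) * h K \<le> t" using h(2)[of K] by simp
    moreover have "0 \<le> real l * h K" using h(1)[of K] by simp
    ultimately have "u \<notin> {real l * h K<..real (Suc l) * h K}" using that by auto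
    then show "indicator {real l * h K<..real (Suc l) * h K} u * q (real l * h K) = 0" by simp
  qed
  have ints: "(LINT u|lborel. s K u) = (\<Sum>l<2 ^ K. h K * q (real l * h K))" for K
  proof -
    have "(LINT u|lborel. s K u) = (\<Sum>l<2 ^ K. LINT u|lborel. indicator {real l * h K<..real (Suc l) * h K} u * q (real l * h K))"
      unfolding s_def using h(1)[of K]
      by (intro Bochner_Integration.integral_sum integrable_mult_left integrable_real_indicator)
        (auto simp: distrib_right emeasure_lborel_Ioc)
    also have "\<dots> = (\<Sum>l<2 ^ K. h K * q (real l * h K))"
      using h(1)[of K] by (intro sum.cong refl) (simp add: distrib_right)
    finally show ?thesis .
  qed
  have "(\<lambda>K. LINT u|lborel. s K u) \<longlonglongrightarrow> (LINT u|lborel. indicator {0<..t} u * q u)"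
  proof (rule integral_dominated_convergence[where w="\<lambda>u. \<bar>C\<bar> * indicator {0<..t} u"])
    show "(\<lambda>u. indicator {0<..t} u * q u) \<in> borel_measurable lborel" using q(1) by measurable
    show "s K \<in> borel_measurable lborel" for K unfolding s_def by measurable
    show "integrable lborel (\<lambda>u. \<bar>C\<bar> * indicator {0<..t} u)" using t by (intro integrable_mult_right integrable_real_indicator) auto
    show "AE u in lborel. (\<lambda>K. s K u) \<longlonglongrightarrow> indicator {0<..t} u * q u"
    proof (rule AE_I2)
      fix u
      show "(\<lambda>K. s K u) \<longlonglongrightarrow> indicator {0<..t} u * q u"
      proof (cases "u \<in> {0<..t}")
        case True
        then have u: "0 < u" "u \<le> t" by auto
        obtain r where r: "\<And>K. s K u = q (real (r K) * h K) \<and> real (r K) * h K < u \<and> u \<le> real (Suc (r K)) * h K"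
          using s[OF u] by metis
        have "filterlim (\<lambda>K. real (r K) * h K) (at_left u) sequentially"
          unfolding filterlim_at
        proof (intro conjI)
          have "(\<lambda>K. real (r K) * h K - u) \<longlonglongrightarrow> 0"
          proof (rule Lim_null_comparison)
            show "\<forall>\<^sub>F K in sequentially. norm (real (r K) * h K - u) \<le> t * (1/2) ^ K"
            proof (intro always_eventually allI)
              fix K
              show "norm (real (r K) * h K - u) \<le> t * (1/2) ^ K"
              proof -
                have "real (Suc (r K)) * h K = real (r K) * h K + h K" by (simp add: distrib_right)
                then have "\<bar>real (r K) * h K - u\<bar> \<le> h K" using r[of K] by linarith
                then show ?thesis by (simp add: h_def power_one_over)
              qed
            qed
            show "(\<lambda>K. t * (1/2) ^ K) \<longlonglongrightarrow> 0" using tendsto_mult_left[OF LIMSEQ_power_zero[of "1/2::real"], of t] by simp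
          qed
          then show "(\<lambda>K. real (r K) * h K) \<longlonglongrightarrow> u" by (rule LIM_zero_cancel)
        qed (use r in \<open>auto intro!: always_eventually\<close>)
        from filterlim_compose[OF left[OF u] this] have "(\<lambda>K. q (real (r K) * h K)) \<longlonglongrightarrow> q u" .
        then show ?thesis using True r by simp
      qed (simp add: s0)
    qed
    show "AE u in lborel. norm (s K u) \<le> \<bar>C\<bar> * indicator {0<..t} u" for K
    proof (rule AE_I2)
      fix u
      show "norm (s K u) \<le> \<bar>C\<bar> * indicator {0<..t} u"
      proof (cases "u \<in> {0<..t}")
        case True
        then obtain l where l: "s K u = q (real l * h K)" "real l * h K < u" using s[of u K] by auto
        have "\<bar>q (real l * h K)\<bar> \<le> C" using True l h(1)[of K] by (intro q(2)) auto
        then show ?thesis using True l by simp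
      qed (simp add: s0)
    qed
  qed
  then show ?thesis unfolding ints by (simp add: h_def)
qed

text \<open>A left Riemann sum of a nondecreasing function lies below its integral. This preserves
  the factorials when Gronwall's inequality is iterated on Riemann sums.\<close>

lemma sum_powers_le: "(\<Sum>l<N. real l ^ n) \<le> real N ^ Suc n / real (Suc n)"
proof (induction N)
  case (Suc N)
  have "real (Suc n) * real N ^ n + real N ^ Suc n \<le> real (Suc N) ^ Suc n"
  proof (cases "N = 0")
    case False
    have "1 + real (Suc n) * (1 / real N) \<le> (1 + 1 / real N) ^ Suc n" by (rule Bernoulli_inequality) (simp add: False divide_nonneg_nonneg order_trans[of "-1" 0])
    then have "real N ^ Suc n * (1 + real (Suc n) * (1 / real N)) \<le> real N ^ Suc n * (1 + 1 / real N) ^ Suc n"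
      by (intro mult_left_mono) auto
    also have "\<dots> = (real N * (1 + 1 / real N)) ^ Suc n" by (simp only: power_mult_distrib)
    also have "real N * (1 + 1 / real N) = real (Suc N)" using False by (simp add: field_simps)
    also have "real N ^ Suc n * (1 + real (Suc n) * (1 / real N)) = real (Suc n) * real N ^ n + real N ^ Suc n"
      using False by (simp add: field_simps)
    finally show ?thesis .
  qed (cases n; simp)
  then have "(real (Suc n) * real N ^ n + real N ^ Suc n) / real (Suc n) \<le> real (Suc N) ^ Suc n / real (Suc n)"
    by (rule divide_right_mono) simp
  moreover have "real (Suc n) * real N ^ n / real (Suc n) = real N ^ n"
    by (rule nonzero_mult_div_cancel_left) simp
  ultimately have "real N ^ n + real N ^ Suc n / real (Suc n) \<le> real (Suc N) ^ Suc n / real (Suc n)"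
    by (simp only: add_divide_distrib)
  with Suc show ?case by simp
qed simp

context wiener
begin

text \<open>Induction on the number of terms: in the square of the sum the cross term is an
  \<open>F (T n)\<close>-measurable factor times a centred increment.\<close>

lemma ito_isometry:
  fixes a :: "nat \<Rightarrow> (real \<Rightarrow> real^'d) \<Rightarrow> real" and b :: 'd
  assumes T: "0 \<le> T 0" "\<And>l. T l \<le> T (Suc l)"
    and a: "\<And>l. l < N \<Longrightarrow> a l \<in> borel_measurable (F (T l))" "\<And>l \<omega>. l < N \<Longrightarrow> \<omega> \<in> space P \<Longrightarrow> \<bar>a l \<omega>\<bar> \<le> c"
  defines "S \<equiv> \<lambda>N \<omega>. \<Sum>l<N. a l \<omega> * (\<omega> (T (Suc l)) $ b - \<omega> (T l) $ b)"
  shows "S N \<in> borel_measurable (F (T N))" "integrable P (\<lambda>\<omega>. (S N \<omega>)\<^sup>2)"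
    "expectation (\<lambda>\<omega>. (S N \<omega>)\<^sup>2) = (\<Sum>l<N. (T (Suc l) - T l) * expectation (\<lambda>\<omega>. (a l \<omega>)\<^sup>2))"
proof -
  have T0: "0 \<le> T l" for l by (induction l) (auto simp: T intro: order_trans[OF _ T(2)])
  have "S n \<in> borel_measurable (F (T n)) \<and> integrable P (\<lambda>\<omega>. (S n \<omega>)\<^sup>2) \<and>
    expectation (\<lambda>\<omega>. (S n \<omega>)\<^sup>2) = (\<Sum>l<n. (T (Suc l) - T l) * expectation (\<lambda>\<omega>. (a l \<omega>)\<^sup>2))" if "n \<le> N" for n
    using that
  proof (induction n)
    case 0
    then show ?case by (simp add: S_def)
  next
    case (Suc n)
    then have IH: "S n \<in> borel_measurable (F (T n))" "integrable P (\<lambda>\<omega>. (S n \<omega>)\<^sup>2)"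
      "expectation (\<lambda>\<omega>. (S n \<omega>)\<^sup>2) = (\<Sum>l<n. (T (Suc l) - T l) * expectation (\<lambda>\<omega>. (a l \<omega>)\<^sup>2))" and n: "n < N" by auto
    let ?w = "\<lambda>\<omega>. (\<omega> (T (Suc n)) - \<omega> (T n)) $ b"
    have an: "a n \<in> borel_measurable (F (T n))" using a n by simp
    note aP = measurable_F_P[OF an] and SP = measurable_F_P[OF IH(1)]
    obtain \<omega>0 where "\<omega>0 \<in> space P" using not_empty by blast
    from a(2)[OF n this] have c: "0 \<le> c" by linarith
    have a2i: "integrable P (\<lambda>\<omega>. (a n \<omega>)\<^sup>2)"
      using aP a(2)[OF n] c by (intro integrable_const_bound[where B="c\<^sup>2"] AE_I2) (auto simp: power2_le_iff_abs_le)
    have Sai: "integrable P (\<lambda>\<omega>. S n \<omega> * a n \<omega>)"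
    proof (rule Bochner_Integration.integrable_bound)
      show "integrable P (\<lambda>\<omega>. (S n \<omega>)\<^sup>2 + (a n \<omega>)\<^sup>2)" using IH(2) a2i by auto
      show "(\<lambda>\<omega>. S n \<omega> * a n \<omega>) \<in> borel_measurable P" using aP SP by measurable
      have "\<bar>x * y\<bar> \<le> x\<^sup>2 + y\<^sup>2" for x y :: real
      proof -
        have "0 \<le> \<bar>x\<bar> * \<bar>y\<bar>" by simp
        then show ?thesis using sum_squares_bound[of "\<bar>x\<bar>" "\<bar>y\<bar>"] unfolding abs_mult power2_abs by linarith
      qed
      then show "AE \<omega> in P. norm (S n \<omega> * a n \<omega>) \<le> norm ((S n \<omega>)\<^sup>2 + (a n \<omega>)\<^sup>2)" by simp
    qed
    have m1: "(\<lambda>\<omega>. S n \<omega> * a n \<omega>) \<in> borel_measurable (F (T n))" "(\<lambda>\<omega>. (a n \<omega>)\<^sup>2) \<in> borel_measurable (F (T n))"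
      using an IH(1) by measurable
    have nb: "(\<lambda>w::real^'d. w $ b) \<in> borel_measurable borel" "(\<lambda>w::real^'d. (w $ b)\<^sup>2) \<in> borel_measurable borel" by measurable
    have w1: "integrable P ?w" "integrable P (\<lambda>\<omega>. (?w \<omega>)\<^sup>2)"
      using increment_moment_integrable[OF T0 T(2), where j=b and k=1] increment_moment_integrable[OF T0 T(2), where j=b and k=2]
      by (simp_all del: vector_minus_component)
    have w2: "expectation (\<lambda>\<omega>. (?w \<omega>)\<^sup>2) = T (Suc n) - T n"
      using increment_moment_even[OF T0 T(2), where j=b and k=1] by (simp del: vector_minus_component)
    note e1 = expectation_mult_increment[OF T0 T(2) m1(1) Sai nb(1) w1(1)]
    note e2 = expectation_mult_increment[OF T0 T(2) m1(2) a2i nb(2) w1(2)]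
    have sq: "(S (Suc n) \<omega>)\<^sup>2 = (S n \<omega>)\<^sup>2 + 2 * (S n \<omega> * a n \<omega> * ?w \<omega>) + (a n \<omega>)\<^sup>2 * (?w \<omega>)\<^sup>2" for \<omega>
      by (simp add: S_def power2_eq_square algebra_simps)
    have meas: "S (Suc n) \<in> borel_measurable (F (T (Suc n)))"
    proof -
      have [measurable]: "S n \<in> borel_measurable (F (T (Suc n)))" "a n \<in> borel_measurable (F (T (Suc n)))"
        using IH(1) an T(2) by (auto intro: measurable_F_mono)
      have [measurable]: "(\<lambda>\<omega>. \<omega> (T (Suc n)) $ b) \<in> borel_measurable (F (T (Suc n)))" "(\<lambda>\<omega>. \<omega> (T n) $ b) \<in> borel_measurable (F (T (Suc n)))"
        by (rule measurable_compose[OF eval_F[OF T0] borel_measurable_nth], use T(2) in simp)+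
      have "(\<lambda>\<omega>. S n \<omega> + a n \<omega> * (\<omega> (T (Suc n)) $ b - \<omega> (T n) $ b)) \<in> borel_measurable (F (T (Suc n)))" by measurable
      then show ?thesis by (simp add: S_def)
    qed
    have int: "integrable P (\<lambda>\<omega>. (S (Suc n) \<omega>)\<^sup>2)"
      unfolding sq by (intro Bochner_Integration.integrable_add integrable_mult_right IH(2) e1(1) e2(1))
    have "expectation (\<lambda>\<omega>. (S (Suc n) \<omega>)\<^sup>2) = expectation (\<lambda>\<omega>. (S n \<omega>)\<^sup>2) + 2 * expectation (\<lambda>\<omega>. S n \<omega> * a n \<omega> * ?w \<omega>) + expectation (\<lambda>\<omega>. (a n \<omega>)\<^sup>2 * (?w \<omega>)\<^sup>2)"
      unfolding sq using IH(2) e1(1) e2(1) by (simp del: vector_minus_component)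
    also have "\<dots> = (\<Sum>l<Suc n. (T (Suc l) - T l) * expectation (\<lambda>\<omega>. (a l \<omega>)\<^sup>2))"
      unfolding e1(2) e2(2) increment_mean_zero[OF T0 T(2)] w2 IH(3) by simp
    finally show ?case using meas int by blast
  qed
  from this[of N] show "S N \<in> borel_measurable (F (T N))" "integrable P (\<lambda>\<omega>. (S N \<omega>)\<^sup>2)"
    "expectation (\<lambda>\<omega>. (S N \<omega>)\<^sup>2) = (\<Sum>l<N. (T (Suc l) - T l) * expectation (\<lambda>\<omega>. (a l \<omega>)\<^sup>2))" by auto
qed

text \<open>
  The classical inequality behind the extension of the integral by continuity in probability:
  freezing the integrand before its quadratic variation exceeds \<open>\<delta>\<close> costs nothing on the event
  where it stays below \<open>\<delta>\<close>.
\<close>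

lemma stochastic_sum_tail:
  fixes a :: "nat \<Rightarrow> (real \<Rightarrow> real^'d) \<Rightarrow> real" and b :: 'd
  assumes T: "0 \<le> T 0" "\<And>l. T l \<le> T (Suc l)"
    and a: "\<And>l. l < N \<Longrightarrow> a l \<in> borel_measurable (F (T l))" "\<And>l \<omega>. l < N \<Longrightarrow> \<omega> \<in> space P \<Longrightarrow> \<bar>a l \<omega>\<bar> \<le> c"
    and D: "D \<in> sets P" and e: "e > 0" and \<delta>: "\<delta> > 0"
  defines "Q \<equiv> \<lambda>\<omega>. \<Sum>l<N. a l \<omega> * (\<omega> (T (Suc l)) $ b - \<omega> (T l) $ b)"
    and "V \<equiv> \<lambda>n \<omega>. \<Sum>l<n. (T (Suc l) - T l) * (a l \<omega>)\<^sup>2"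
  shows "prob {\<omega> \<in> space P. \<omega> \<in> D \<and> \<bar>Q \<omega>\<bar> > e} \<le> \<delta> / e\<^sup>2 + prob {\<omega> \<in> space P. \<omega> \<in> D \<and> V N \<omega> > \<delta>}"
proof -
  have T0: "0 \<le> T l" for l by (induction l) (auto simp: T intro: order_trans[OF _ T(2)])
  have Tmono: "T i \<le> T j" if "i \<le> j" for i j using that by (rule lift_Suc_mono_le[of T, rotated]) (rule T(2))
  have Vm: "V (Suc l) \<in> borel_measurable (F (T l))" if "l < N" for l
    unfolding V_def
  proof (intro borel_measurable_sum)
    fix i assume "i \<in> {..<Suc l}"
    then have [measurable]: "a i \<in> borel_measurable (F (T l))" using that by (intro measurable_F_mono[OF a(1)] Tmono) auto
    show "(\<lambda>\<omega>. (T (Suc i) - T i) * (a i \<omega>)\<^sup>2) \<in> borel_measurable (F (T l))" by measurable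
  qed
  have V_mono: "V i \<omega> \<le> V j \<omega>" if "i \<le> j" for i j \<omega>
    unfolding V_def using that T by (intro sum_mono2) auto
  define a' where "a' = (\<lambda>l \<omega>. if V (Suc l) \<omega> \<le> \<delta> then a l \<omega> else 0)"
  have a': "\<And>l. l < N \<Longrightarrow> a' l \<in> borel_measurable (F (T l))" "\<And>l \<omega>. l < N \<Longrightarrow> \<omega> \<in> space P \<Longrightarrow> \<bar>a' l \<omega>\<bar> \<le> c"
  proof -
    fix l assume l: "l < N"
    note [measurable] = Vm[OF l] a(1)[OF l]
    show "a' l \<in> borel_measurable (F (T l))" unfolding a'_def by measurable
    show "\<bar>a' l \<omega>\<bar> \<le> c" if "\<omega> \<in> space P" for \<omega> using a(2)[OF l that] by (auto simp: a'_def)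
  qed
  define Q' where "Q' = (\<lambda>\<omega>. \<Sum>l<N. a' l \<omega> * (\<omega> (T (Suc l)) $ b - \<omega> (T l) $ b))"
  have iso: "Q' \<in> borel_measurable (F (T N))" "integrable P (\<lambda>\<omega>. (Q' \<omega>)\<^sup>2)"
    "expectation (\<lambda>\<omega>. (Q' \<omega>)\<^sup>2) = (\<Sum>l<N. (T (Suc l) - T l) * expectation (\<lambda>\<omega>. (a' l \<omega>)\<^sup>2))"
    unfolding Q'_def by (rule ito_isometry[where N=N and a=a' and c=c and b=b, OF T a'], assumption+)+
  have pw: "(\<Sum>l<n. (T (Suc l) - T l) * (a' l \<omega>)\<^sup>2) \<le> min \<delta> (V n \<omega>)" for n \<omega>
  proof (induction n)
    case (Suc n)
    then show ?case using \<delta> V_mono[of n "Suc n" \<omega>] by (auto simp: a'_def V_def min_def split: if_splits)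
  qed (use \<delta> in \<open>simp add: V_def\<close>)
  have a'i: "integrable P (\<lambda>\<omega>. (a' l \<omega>)\<^sup>2)" if l: "l < N" for l
  proof (intro integrable_const_bound[where B="c\<^sup>2"] AE_I2)
    show "(\<lambda>\<omega>. (a' l \<omega>)\<^sup>2) \<in> borel_measurable P" using measurable_F_P[OF a'(1)[OF l]] by measurable
    fix \<omega> assume "\<omega> \<in> space P"
    from a'(2)[OF l this] have "\<bar>a' l \<omega>\<bar> \<le> c" "0 \<le> c" by linarith+
    then show "norm ((a' l \<omega>)\<^sup>2) \<le> c\<^sup>2" by (simp add: power2_le_iff_abs_le)
  qed
  have "expectation (\<lambda>\<omega>. (Q' \<omega>)\<^sup>2) = (\<Sum>l<N. (T (Suc l) - T l) * expectation (\<lambda>\<omega>. (a' l \<omega>)\<^sup>2))" by (rule iso(3))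
  also have "\<dots> = expectation (\<lambda>\<omega>. \<Sum>l<N. (T (Suc l) - T l) * (a' l \<omega>)\<^sup>2)"
    using a'i by (subst Bochner_Integration.integral_sum) auto
  also have "\<dots> \<le> expectation (\<lambda>\<omega>. \<delta>)"
    using a'i order_trans[OF pw min.cobounded1] by (intro integral_mono Bochner_Integration.integrable_sum) auto
  finally have EQ: "expectation (\<lambda>\<omega>. (Q' \<omega>)\<^sup>2) \<le> \<delta>" by (simp add: prob_space)
  have Q'm: "Q' \<in> borel_measurable P" using iso(1) by (rule measurable_F_P)
  have "prob {\<omega> \<in> space P. (Q' \<omega>)\<^sup>2 \<ge> e\<^sup>2} \<le> expectation (\<lambda>\<omega>. (Q' \<omega>)\<^sup>2) / e\<^sup>2"
    by (rule integral_Markov_inequality_measure[OF iso(2) sets.empty_sets]) (use e in auto)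
  also have "\<dots> \<le> \<delta> / e\<^sup>2" using EQ by (simp add: divide_right_mono)
  finally have M: "prob {\<omega> \<in> space P. (Q' \<omega>)\<^sup>2 \<ge> e\<^sup>2} \<le> \<delta> / e\<^sup>2" .
  have VP: "V N \<in> borel_measurable P"
    unfolding V_def using measurable_F_P[OF a(1)] by (intro borel_measurable_sum borel_measurable_times borel_measurable_power) auto
  have sub: "{\<omega> \<in> space P. \<omega> \<in> D \<and> \<bar>Q \<omega>\<bar> > e} \<subseteq> {\<omega> \<in> space P. (Q' \<omega>)\<^sup>2 \<ge> e\<^sup>2} \<union> {\<omega> \<in> space P. \<omega> \<in> D \<and> V N \<omega> > \<delta>}"
  proof
    fix \<omega> assume w: "\<omega> \<in> {\<omega> \<in> space P. \<omega> \<in> D \<and> \<bar>Q \<omega>\<bar> > e}"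
    show "\<omega> \<in> {\<omega> \<in> space P. (Q' \<omega>)\<^sup>2 \<ge> e\<^sup>2} \<union> {\<omega> \<in> space P. \<omega> \<in> D \<and> V N \<omega> > \<delta>}"
    proof (cases "V N \<omega> \<le> \<delta>")
      case True
      have "a' l \<omega> = a l \<omega>" if "l < N" for l
        using V_mono[of "Suc l" N \<omega>] that True by (auto simp: a'_def)
      then have "Q' \<omega> = Q \<omega>" by (simp add: Q'_def Q_def)
      then show ?thesis using w e power_mono[of e "\<bar>Q \<omega>\<bar>" 2] by auto
    qed (use w in auto)
  qed
  have m: "{\<omega> \<in> space P. (Q' \<omega>)\<^sup>2 \<ge> e\<^sup>2} \<in> sets P" "{\<omega> \<in> space P. \<omega> \<in> D \<and> V N \<omega> > \<delta>} \<in> sets P"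
    using Q'm VP D by measurable
  have "prob {\<omega> \<in> space P. \<omega> \<in> D \<and> \<bar>Q \<omega>\<bar> > e} \<le> prob ({\<omega> \<in> space P. (Q' \<omega>)\<^sup>2 \<ge> e\<^sup>2} \<union> {\<omega> \<in> space P. \<omega> \<in> D \<and> V N \<omega> > \<delta>})"
    using m by (intro finite_measure_mono sub) auto
  also have "\<dots> \<le> prob {\<omega> \<in> space P. (Q' \<omega>)\<^sup>2 \<ge> e\<^sup>2} + prob {\<omega> \<in> space P. \<omega> \<in> D \<and> V N \<omega> > \<delta>}"
    using m by (intro measure_Un_le)
  finally show ?thesis using M by simp
qed

end

lemma indicator_tendsto_at_left:
  "((\<lambda>x. indicator {\<alpha><..\<beta>} x :: real) \<longlongrightarrow> indicator {\<alpha><..\<beta>} u) (at_left (u::real))"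
proof (rule tendsto_eventually)
  show "\<forall>\<^sub>F x in at_left u. indicator {\<alpha><..\<beta>} x = (indicator {\<alpha><..\<beta>} u :: real)"
  proof (cases "u \<le> \<alpha>")
    case True
    then show ?thesis unfolding eventually_at_left_field by (intro exI[of _ "u - 1"]) (auto simp: indicator_def)
  next
    case False
    show ?thesis
    proof (cases "u \<le> \<beta>")
      case True
      with False show ?thesis unfolding eventually_at_left_field by (intro exI[of _ \<alpha>]) (auto simp: indicator_def)
    next
      case False
      with \<open>\<not> u \<le> \<alpha>\<close> show ?thesis
        unfolding eventually_at_left_field by (intro exI[of _ "max \<alpha> \<beta>"]) (auto simp: indicator_def)
    qed
  qed
qed

context wiener
begin

section \<open>Convergence in probability on an event\<close>

text \<open>Convergence to 0 in probability on the event \<open>D\<close>. Working on an event where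
  the solutions are bounded takes the place of stopping times.\<close>

definition vanish_on :: "(real \<Rightarrow> real^'d) set \<Rightarrow> (nat \<Rightarrow> (real \<Rightarrow> real^'d) \<Rightarrow> real) \<Rightarrow> bool" where
  "vanish_on D Z \<longleftrightarrow> (\<forall>K. Z K \<in> borel_measurable P) \<and>
     (\<forall>e>0. (\<lambda>K. prob {\<omega> \<in> space P. \<omega> \<in> D \<and> \<bar>Z K \<omega>\<bar> > e}) \<longlonglongrightarrow> 0)"

lemma vanish_on_add:
  assumes D: "D \<in> sets P" and Z: "vanish_on D Z" and Z': "vanish_on D Z'"
  shows "vanish_on D (\<lambda>K \<omega>. Z K \<omega> + Z' K \<omega>)"
  unfolding vanish_on_def
proof (intro conjI allI impI)
  have m [measurable]: "Z K \<in> borel_measurable P" "Z' K \<in> borel_measurable P" for K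
    using Z Z' by (auto simp: vanish_on_def)
  note [measurable] = D
  show "(\<lambda>\<omega>. Z K \<omega> + Z' K \<omega>) \<in> borel_measurable P" for K by measurable
  fix e :: real assume e: "e > 0"
  let ?A = "\<lambda>K. {\<omega> \<in> space P. \<omega> \<in> D \<and> \<bar>Z K \<omega>\<bar> > e / 2}" and ?B = "\<lambda>K. {\<omega> \<in> space P. \<omega> \<in> D \<and> \<bar>Z' K \<omega>\<bar> > e / 2}"
  have "(\<lambda>K. prob (?A K)) \<longlonglongrightarrow> 0" "(\<lambda>K. prob (?B K)) \<longlonglongrightarrow> 0"
    using Z Z' half_gt_zero[OF e] unfolding vanish_on_def by blast+
  from tendsto_add[OF this] have lim: "(\<lambda>K. prob (?A K) + prob (?B K)) \<longlonglongrightarrow> 0" by simp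
  have le: "prob {\<omega> \<in> space P. \<omega> \<in> D \<and> \<bar>Z K \<omega> + Z' K \<omega>\<bar> > e} \<le> prob (?A K) + prob (?B K)" for K
  proof -
    have "prob {\<omega> \<in> space P. \<omega> \<in> D \<and> \<bar>Z K \<omega> + Z' K \<omega>\<bar> > e} \<le> prob (?A K \<union> ?B K)"
    proof (rule finite_measure_mono)
      show "{\<omega> \<in> space P. \<omega> \<in> D \<and> \<bar>Z K \<omega> + Z' K \<omega>\<bar> > e} \<subseteq> ?A K \<union> ?B K"
      proof
        fix \<omega> assume "\<omega> \<in> {\<omega> \<in> space P. \<omega> \<in> D \<and> \<bar>Z K \<omega> + Z' K \<omega>\<bar> > e}"
        moreover from this have "\<bar>Z K \<omega>\<bar> > e / 2 \<or> \<bar>Z' K \<omega>\<bar> > e / 2" by simp linarith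
        ultimately show "\<omega> \<in> ?A K \<union> ?B K" by blast
      qed
      show "?A K \<union> ?B K \<in> sets P" by measurable
    qed
    also have "\<dots> \<le> prob (?A K) + prob (?B K)" by (intro measure_Un_le) measurable
    finally show ?thesis .
  qed
  show "(\<lambda>K. prob {\<omega> \<in> space P. \<omega> \<in> D \<and> \<bar>Z K \<omega> + Z' K \<omega>\<bar> > e}) \<longlonglongrightarrow> 0"
    by (rule tendsto_sandwich[OF _ _ tendsto_const lim]) (intro always_eventually allI measure_nonneg le)+
qed

lemma vanish_on_minus:
  assumes "vanish_on D Z"
  shows "vanish_on D (\<lambda>K \<omega>. - Z K \<omega>)"
  unfolding vanish_on_def abs_minus_cancel
proof
  show "\<forall>K. (\<lambda>\<omega>. - Z K \<omega>) \<in> borel_measurable P"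
    using assms unfolding vanish_on_def by (intro allI borel_measurable_uminus) (elim conjE, erule spec)
qed (rule assms[unfolded vanish_on_def, THEN conjunct2])

lemma vanish_on_sum:
  assumes D: "D \<in> sets P" and Z: "\<And>j. j \<in> A \<Longrightarrow> vanish_on D (Z j)"
  shows "vanish_on D (\<lambda>K \<omega>. \<Sum>j\<in>A. Z j K \<omega>)"
  using Z
proof (induction A rule: infinite_finite_induct)
  case (insert j A)
  then show ?case using vanish_on_add[OF D, of "Z j" "\<lambda>K \<omega>. \<Sum>j\<in>A. Z j K \<omega>"] by simp
qed (auto simp: vanish_on_def)

lemma vanish_on_AE:
  assumes "\<And>K. Z K \<in> borel_measurable P" "AE \<omega> in P. \<omega> \<in> D \<longrightarrow> (\<lambda>K. Z K \<omega>) \<longlonglongrightarrow> 0"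
  shows "vanish_on D Z"
  unfolding vanish_on_def
proof (intro conjI allI impI measure_tendsto_zero_of_AE)
  show "Z K \<in> borel_measurable P" for K by (rule assms(1))
  fix e :: real assume e: "e > 0"
  show "AE \<omega> in P. \<forall>\<^sub>F K in sequentially. \<omega> \<notin> {\<omega> \<in> space P. \<omega> \<in> D \<and> \<bar>Z K \<omega>\<bar> > e}"
    using assms(2)
  proof eventually_elim
    case (elim \<omega>)
    show ?case
    proof (cases "\<omega> \<in> D")
      case True
      with elim have "(\<lambda>K. Z K \<omega>) \<longlonglongrightarrow> 0" by simp
      from tendstoD[OF this e] show ?thesis by eventually_elim auto
    qed simp
  qed
qed

lemma step_process_times_nonneg:
  assumes "step_process G \<Omega> m \<tau> \<xi>" "i \<le> m"
  shows "0 \<le> \<tau> i"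
  using assms(2)
proof (induction i)
  case 0
  then show ?case using assms(1) by (simp add: step_process_def)
next
  case (Suc i)
  then have "\<tau> i < \<tau> (Suc i)" using assms(1) by (simp add: step_process_def)
  with Suc show ?case by simp
qed

lemma ito_integral_measurable:
  assumes "ito_integral P F B H I" "0 \<le> t"
  shows "I t \<in> borel_measurable P"
proof -
  have "\<forall>t\<ge>0. I t \<in> borel_measurable (F t)" using assms(1) unfolding ito_integral_def by (elim conjE)
  then have "I t \<in> borel_measurable (F t)" using assms(2) by (elim allE[of _ t] impE)
  then show ?thesis by (rule measurable_F_P)
qed

text \<open>Every step integral vanishes identically at time 0, hence the limit in probability
  vanishes almost surely.\<close>

lemma ito_integral_zero:
  assumes "ito_integral P F B H I"
  shows "AE \<omega> in P. I 0 \<omega> = 0"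
proof -
  have m [measurable]: "I 0 \<in> borel_measurable P" by (rule ito_integral_measurable[OF assms order_refl])
  obtain m \<tau> \<xi> where step: "\<forall>k. step_process F (space P) (m k) (\<tau> k) (\<xi> k)" and
    lim: "\<forall>t\<ge>0. \<forall>e>0. (\<lambda>k::nat. prob {\<omega> \<in> space P.
        (\<integral>\<^sup>+u\<in>{0..t}. ennreal ((step_value (m k) (\<tau> k) (\<xi> k) u \<omega> - H u \<omega>)\<^sup>2) \<partial>lborel) > ennreal e}) \<longlonglongrightarrow> 0 \<and>
      (\<lambda>k. prob {\<omega> \<in> space P. \<bar>step_integral B (m k) (\<tau> k) (\<xi> k) t \<omega> - I t \<omega>\<bar> > e}) \<longlonglongrightarrow> 0"
    using assms unfolding ito_integral_def by (elim conjE exE) (rule that)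
  have zero: "step_integral B (m k) (\<tau> k) (\<xi> k) 0 \<omega> = 0" for k \<omega>
  proof -
    have "0 \<le> \<tau> k i" if "i \<le> m k" for i
      using step_process_times_nonneg[OF step[rule_format] that] .
    then show ?thesis by (auto simp: step_integral_def intro!: sum.neutral)
  qed
  have "AE \<omega> in P. \<not> \<bar>I 0 \<omega>\<bar> > 1 / real (Suc n)" for n
  proof -
    have "(\<lambda>k::nat. prob {\<omega> \<in> space P. \<bar>I 0 \<omega>\<bar> > 1 / real (Suc n)}) \<longlonglongrightarrow> 0"
      using lim[rule_format, THEN conjunct2, of 0 "1 / real (Suc n)"] unfolding zero by simp
    then have p0: "prob {\<omega> \<in> space P. \<bar>I 0 \<omega>\<bar> > 1 / real (Suc n)} = 0" unfolding LIMSEQ_const_iff .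
    have "{\<omega> \<in> space P. \<bar>I 0 \<omega>\<bar> > 1 / real (Suc n)} \<in> sets P" by measurable
    from prob_eq_0[OF this] p0 show ?thesis by simp
  qed
  then have "AE \<omega> in P. \<forall>n. \<not> \<bar>I 0 \<omega>\<bar> > 1 / real (Suc n)" unfolding AE_all_countable ..
  then show ?thesis
  proof eventually_elim
    case (elim \<omega>)
    show ?case
    proof (rule ccontr)
      assume "I 0 \<omega> \<noteq> 0"
      then have "0 < \<bar>I 0 \<omega>\<bar>" by (simp only: zero_less_abs_iff not_False_eq_True)
      from reals_Archimedean[OF this] obtain n where "1 / real (Suc n) < \<bar>I 0 \<omega>\<bar>"
        unfolding inverse_eq_divide by (rule exE)
      with spec[OF elim, of n] show False by (rule notE)
    qed
  qed
qed

text \<open>\<open>ito_integral\<close> provides some approximating step processes, and the Riemann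
  sums of \<open>H\<close> are compared with one of them, chosen close enough. The difference of the
  two sums is again a stochastic sum, controlled by \<open>stochastic_sum_tail\<close>; on
  \<open>C t\<close> its quadratic variation tends to the integral of the squared distance of the
  integrands. The indicators of \<open>C\<close> bound the coefficients; as \<open>C\<close>
  decreases in time, all of them equal 1 on \<open>C t\<close>.\<close>

lemma ito_riemann_convergence:
  assumes I: "ito_integral P F (\<lambda>t \<omega>. \<omega> t $ b) H I"
    and H_F: "\<And>u. 0 \<le> u \<Longrightarrow> H u \<in> borel_measurable (F u)"
    and H_cont: "\<And>\<omega>. \<omega> \<in> space P \<Longrightarrow> continuous_on {0..} (\<lambda>u. H u \<omega>)"
    and C: "\<And>u. 0 \<le> u \<Longrightarrow> C u \<in> sets (F u)" and C_anti: "\<And>u v. 0 \<le> u \<Longrightarrow> u \<le> v \<Longrightarrow> C v \<subseteq> C u"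
    and bound: "\<And>u \<omega>. 0 \<le> u \<Longrightarrow> \<omega> \<in> C u \<Longrightarrow> \<bar>H u \<omega>\<bar> \<le> c" and t: "0 < t"
  shows "vanish_on (C t) (\<lambda>K \<omega>. (\<Sum>l<2 ^ K. indicator (C (real l * (t / 2 ^ K))) \<omega> * H (real l * (t / 2 ^ K)) \<omega> *
      (\<omega> (real (Suc l) * (t / 2 ^ K)) $ b - \<omega> (real l * (t / 2 ^ K)) $ b)) - I t \<omega>)"
proof -
  define T where "T K l = real l * (t / 2 ^ K)" for K l
  have TS: "T K (Suc l) = T K l + t / 2 ^ K" for K l by (simp only: T_def of_nat_Suc distrib_right mult_1 add.commute)
  then have T: "0 \<le> T K l" "T K l \<le> T K (Suc l)" "T K (Suc l) - T K l = t / 2 ^ K" for K l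
    using t by (simp_all add: T_def[of K l] less_imp_le)
  have Tt: "T K l \<le> t" if "l < 2 ^ K" for K l
  proof -
    have "real l \<le> real (2 ^ K)" using that by (simp only: of_nat_le_iff less_imp_le)
    then have "T K l \<le> real (2 ^ K) * (t / 2 ^ K)" unfolding T_def using t by (intro mult_right_mono) auto
    then show ?thesis by simp
  qed
  define dB where "dB K l \<omega> = \<omega> (T K (Suc l)) $ b - \<omega> (T K l) $ b" for K l and \<omega> :: "real \<Rightarrow> real^'d"
  have dBm [measurable]: "dB K l \<in> borel_measurable P" for K l
    unfolding dB_def by (intro borel_measurable_diff measurable_compose[OF eval_measurable[OF T(1)] borel_measurable_nth])
  define X where "X K l \<omega> = indicator (C (T K l)) \<omega> * H (T K l) \<omega>" for K l \<omega>
  have XF: "X K l \<in> borel_measurable (F (T K l))" for K l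
    unfolding X_def using C[OF T(1)] H_F[OF T(1)] by measurable
  have Xb: "\<bar>X K l \<omega>\<bar> \<le> \<bar>c\<bar>" for K l \<omega>
    using bound[OF T(1), of \<omega> K l] by (auto simp: X_def indicator_def intro: order_trans[OF _ abs_ge_self])
  define R where "R K \<omega> = (\<Sum>l<2 ^ K. X K l \<omega> * dB K l \<omega>)" for K \<omega>
  have It [measurable]: "I t \<in> borel_measurable P" by (rule ito_integral_measurable[OF I less_imp_le[OF t]])
  have Ct [measurable]: "C t \<in> sets P" using C[of t] sets_F_subset t by auto
  have Rm [measurable]: "R K \<in> borel_measurable P" for K
    unfolding R_def using measurable_F_P[OF XF] by (intro borel_measurable_sum borel_measurable_times) auto
  have "vanish_on (C t) (\<lambda>K \<omega>. R K \<omega> - I t \<omega>)"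
    unfolding vanish_on_def tendsto_iff
  proof (intro conjI allI impI)
    show "(\<lambda>\<omega>. R K \<omega> - I t \<omega>) \<in> borel_measurable P" for K by measurable
    fix e \<eta> :: real assume e: "e > 0" and \<eta>: "\<eta> > 0"
    \<comment> \<open>Three comparisons share \<open>e\<close>: the sum for the step process with
      the step integral, the two Riemann sums with each other, the step integral with
      \<open>I t\<close>. Five terms share \<open>\<eta>\<close>, and \<open>\<delta>\<close> is
      chosen to make \<open>\<delta> / e'\<^sup>2\<close> one of them.\<close>
    define e' where "e' = e / 3"
    define \<delta> where "\<delta> = \<eta> / 5 * e'\<^sup>2"
    have pos: "e' > 0" "\<delta> > 0" "\<delta> / e'\<^sup>2 = \<eta> / 5" using e \<eta> by (auto simp: e'_def \<delta>_def)
    obtain m' \<tau>' \<xi>' where step': "\<forall>k. step_process F (space P) (m' k) (\<tau>' k) (\<xi>' k)" and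
      lim: "\<forall>t\<ge>0. \<forall>e>0. (\<lambda>k::nat. prob {\<omega> \<in> space P.
              (\<integral>\<^sup>+u\<in>{0..t}. ennreal ((step_value (m' k) (\<tau>' k) (\<xi>' k) u \<omega> - H u \<omega>)\<^sup>2) \<partial>lborel) > ennreal e}) \<longlonglongrightarrow> 0 \<and>
        (\<lambda>k::nat. prob {\<omega> \<in> space P.
              \<bar>step_integral (\<lambda>t \<omega>. \<omega> t $ b) (m' k) (\<tau>' k) (\<xi>' k) t \<omega> - I t \<omega>\<bar> > e}) \<longlonglongrightarrow> 0"
      using I unfolding ito_integral_def by (elim conjE exE) (rule that)
    have ev1: "\<forall>\<^sub>F k in sequentially. prob {\<omega> \<in> space P.
              (\<integral>\<^sup>+u\<in>{0..t}. ennreal ((step_value (m' k) (\<tau>' k) (\<xi>' k) u \<omega> - H u \<omega>)\<^sup>2) \<partial>lborel) > ennreal (\<delta> / 2)} < \<eta> / 5"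
      by (rule order_tendstoD(2)[OF lim[rule_format, THEN conjunct1]]) (use t pos(2) \<eta> in simp_all)
    have ev2: "\<forall>\<^sub>F k in sequentially. prob {\<omega> \<in> space P.
              \<bar>step_integral (\<lambda>t \<omega>. \<omega> t $ b) (m' k) (\<tau>' k) (\<xi>' k) t \<omega> - I t \<omega>\<bar> > e'} < \<eta> / 5"
      by (rule order_tendstoD(2)[OF lim[rule_format, THEN conjunct2]]) (use t pos(1) \<eta> in simp_all)
    obtain k where k:
      "prob {\<omega> \<in> space P. (\<integral>\<^sup>+u\<in>{0..t}. ennreal ((step_value (m' k) (\<tau>' k) (\<xi>' k) u \<omega> - H u \<omega>)\<^sup>2) \<partial>lborel) > ennreal (\<delta> / 2)} < \<eta> / 5"
      "prob {\<omega> \<in> space P. \<bar>step_integral (\<lambda>t \<omega>. \<omega> t $ b) (m' k) (\<tau>' k) (\<xi>' k) t \<omega> - I t \<omega>\<bar> > e'} < \<eta> / 5"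
      using eventually_happens'[OF sequentially_bot eventually_conj[OF ev1 ev2]] by (elim exE conjE) (rule that)
    define m \<tau> \<xi> where "m = m' k" and "\<tau> = \<tau>' k" and "\<xi> = \<xi>' k"
    define v where "v u \<omega> = step_value m \<tau> \<xi> u \<omega>" for u \<omega>
    define S where "S = step_integral (\<lambda>t \<omega>. \<omega> t $ b) m \<tau> \<xi> t"
    have step: "step_process F (space P) m \<tau> \<xi>" using step' by (simp add: m_def \<tau>_def \<xi>_def)
    have \<tau>0: "0 \<le> \<tau> i" if "i \<le> m" for i
      using step_process_times_nonneg[OF step that] .
    have \<tau>s: "\<tau> i < \<tau> (Suc i)" "\<xi> i \<in> borel_measurable (F (\<tau> i))" if "i < m" for i
      using step that by (auto simp: step_process_def)
    have "\<forall>i\<in>{..<m}. \<exists>Cc. \<forall>\<omega>\<in>space P. \<bar>\<xi> i \<omega>\<bar> \<le> Cc"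
      using step by (simp add: step_process_def)
    from bchoice[OF this] obtain Cc where Cc': "\<forall>i\<in>{..<m}. \<forall>\<omega>\<in>space P. \<bar>\<xi> i \<omega>\<bar> \<le> Cc i" by (elim exE)
    have Cc: "\<bar>\<xi> i \<omega>\<bar> \<le> Cc i" if "i < m" "\<omega> \<in> space P" for i \<omega>
      by (rule Cc'[THEN bspec, THEN bspec]) (use that in simp_all)
    define cv where "cv = (\<Sum>i<m. Cc i)"
    have vb: "\<bar>v u \<omega>\<bar> \<le> cv" if "\<omega> \<in> space P" for u \<omega>
      unfolding v_def step_value_def cv_def
    proof (rule order_trans[OF sum_abs], rule sum_mono)
      fix i assume "i \<in> {..<m}"
      then have "\<bar>\<xi> i \<omega>\<bar> \<le> Cc i" using Cc that by simp
      then show "\<bar>\<xi> i \<omega> * indicator {\<tau> i<..\<tau> (Suc i)} u\<bar> \<le> Cc i" by (auto simp: indicator_def)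
    qed
    have vF: "v u \<in> borel_measurable (F u)" if "0 \<le> u" for u
      unfolding v_def step_value_def
    proof (intro borel_measurable_sum)
      fix i assume "i \<in> {..<m}"
      then have i: "i < m" by (simp only: lessThan_iff)
      show "(\<lambda>\<omega>. \<xi> i \<omega> * indicator {\<tau> i<..\<tau> (Suc i)} u) \<in> borel_measurable (F u)"
      proof (cases "\<tau> i < u")
        case True
        have "\<xi> i \<in> borel_measurable (F u)" by (rule measurable_F_mono[OF \<tau>s(2)[OF i] less_imp_le[OF True]])
        then show ?thesis by measurable
      qed simp
    qed
    have vleft: "((\<lambda>x. v x \<omega>) \<longlongrightarrow> v u \<omega>) (at_left u)" for u \<omega>
      unfolding v_def step_value_def by (intro tendsto_sum tendsto_mult tendsto_const indicator_tendsto_at_left)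
    have Sm [measurable]: "S \<in> borel_measurable P"
      unfolding S_def step_integral_def
    proof (intro borel_measurable_sum borel_measurable_times borel_measurable_diff)
      fix i assume "i \<in> {..<m}"
      then have i: "i < m" by simp
      show "\<xi> i \<in> borel_measurable P" by (rule measurable_F_P[OF \<tau>s(2)[OF i]])
      show "(\<lambda>\<omega>. \<omega> (min (\<tau> (Suc i)) t) $ b) \<in> borel_measurable P" "(\<lambda>\<omega>. \<omega> (min (\<tau> i) t) $ b) \<in> borel_measurable P"
        using \<tau>0[of i] \<tau>0[of "Suc i"] i t by (auto intro!: measurable_compose[OF eval_measurable borel_measurable_nth])
    qed
    define Sv where "Sv K \<omega> = (\<Sum>l<2 ^ K. v (T K l) \<omega> * dB K l \<omega>)" for K \<omega>
    have Svlim: "(\<lambda>K. Sv K \<omega>) \<longlonglongrightarrow> S \<omega>" if "\<omega> \<in> space P" for \<omega>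
    proof -
      have "continuous_on {0..} (\<lambda>t. \<omega> t $ b)" using that by (intro continuous_on_component) (simp add: space_P path_space_def)
      from step_integral_limit[where B="\<lambda>t \<omega>. \<omega> t $ b", OF this less_imp_le[OF t], of m \<tau> \<xi>] \<tau>0 \<tau>s(1)
      show ?thesis by (simp add: Sv_def S_def v_def dB_def T_def)
    qed
    define V where "V K \<omega> = (\<Sum>l<2 ^ K. t / 2 ^ K * (v (T K l) \<omega> - H (T K l) \<omega>)\<^sup>2)" for K \<omega>
    \<comment> \<open>\<open>max 0 u\<close> extends \<open>H\<close> continuously to negative
      times.\<close>
    define J where "J \<omega> = (LINT u|lborel. indicator {0<..t} u * (v u \<omega> - H (max 0 u) \<omega>)\<^sup>2)" for \<omega>
    have J: "(\<lambda>K. V K \<omega>) \<longlonglongrightarrow> J \<omega>"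
      "(\<integral>\<^sup>+u\<in>{0..t}. ennreal ((v u \<omega> - H u \<omega>)\<^sup>2) \<partial>lborel) = ennreal (J \<omega>)" if w: "\<omega> \<in> space P" for \<omega>
    proof -
      have Hc: "continuous_on UNIV (\<lambda>u. H (max 0 u) \<omega>)"
        by (rule continuous_on_compose2[OF H_cont[OF w]]) (auto intro!: continuous_intros)
      have "(\<lambda>u. v u \<omega>) \<in> borel_measurable borel" unfolding v_def step_value_def by measurable
      moreover have "(\<lambda>u. H (max 0 u) \<omega>) \<in> borel_measurable borel" using Hc by (rule borel_measurable_continuous_onI)
      ultimately have qm [measurable]: "(\<lambda>u. (v u \<omega> - H (max 0 u) \<omega>)\<^sup>2) \<in> borel_measurable borel" by measurable
      have "compact ((\<lambda>u. H u \<omega>) ` {0..t})"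
        by (intro compact_continuous_image continuous_on_subset[OF H_cont[OF w]]) auto
      then obtain cH where cH: "\<And>u. 0 \<le> u \<Longrightarrow> u \<le> t \<Longrightarrow> \<bar>H u \<omega>\<bar> \<le> cH"
        using compact_imp_bounded bounded_real by (metis (no_types, lifting) atLeastAtMost_iff imageI)
      have qb: "\<bar>(v u \<omega> - H (max 0 u) \<omega>)\<^sup>2\<bar> \<le> (cv + cH)\<^sup>2" if "0 \<le> u" "u \<le> t" for u
      proof -
        have "\<bar>v u \<omega> - H (max 0 u) \<omega>\<bar> \<le> cv + cH" using vb[OF w, of u] cH[OF that] that(1) by simp
        moreover from this have "0 \<le> cv + cH" by linarith
        ultimately show ?thesis by (simp add: power2_le_iff_abs_le)
      qed
      have ql: "((\<lambda>u. (v u \<omega> - H (max 0 u) \<omega>)\<^sup>2) \<longlongrightarrow> (v u \<omega> - H (max 0 u) \<omega>)\<^sup>2) (at_left u)" for u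
      proof (intro tendsto_power tendsto_diff vleft)
        have "isCont (\<lambda>u. H (max 0 u) \<omega>) u" using Hc by (simp add: continuous_on_eq_continuous_at)
        then have "((\<lambda>u. H (max 0 u) \<omega>) \<longlongrightarrow> H (max 0 u) \<omega>) (at u)" by (simp add: isCont_def)
        then show "((\<lambda>u. H (max 0 u) \<omega>) \<longlongrightarrow> H (max 0 u) \<omega>) (at_left u)" by (rule filterlim_mono) (auto simp: at_le)
      qed
      have "(\<lambda>K. \<Sum>l<2 ^ K. t / 2 ^ K * (v (T K l) \<omega> - H (max 0 (T K l)) \<omega>)\<^sup>2) \<longlonglongrightarrow> J \<omega>"
        unfolding J_def T_def by (rule riemann_sum_limit[OF t qm qb ql])
      then show "(\<lambda>K. V K \<omega>) \<longlonglongrightarrow> J \<omega>" using T(1) by (simp add: V_def max_def)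
      have int: "integrable lborel (\<lambda>u. indicator {0<..t} u * (v u \<omega> - H (max 0 u) \<omega>)\<^sup>2)"
      proof (rule Bochner_Integration.integrable_bound)
        show "integrable lborel (\<lambda>u. (cv + cH)\<^sup>2 * indicator {0<..t} u)" using t by (intro integrable_mult_right integrable_real_indicator) auto
        show "AE u in lborel. norm (indicator {0<..t} u * (v u \<omega> - H (max 0 u) \<omega>)\<^sup>2) \<le> norm ((cv + cH)\<^sup>2 * indicator {0<..t} u)"
          using qb by (intro AE_I2) (auto simp: indicator_def)
      qed measurable
      have "(\<integral>\<^sup>+u\<in>{0..t}. ennreal ((v u \<omega> - H u \<omega>)\<^sup>2) \<partial>lborel) = (\<integral>\<^sup>+u. ennreal (indicator {0<..t} u * (v u \<omega> - H (max 0 u) \<omega>)\<^sup>2) \<partial>lborel)"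
      proof (rule nn_integral_cong_AE)
        show "AE u in lborel. ennreal ((v u \<omega> - H u \<omega>)\<^sup>2) * indicator {0..t} u = ennreal (indicator {0<..t} u * (v u \<omega> - H (max 0 u) \<omega>)\<^sup>2)"
          using AE_lborel_singleton[of 0] by eventually_elim (auto simp: indicator_def max_def)
      qed
      also have "\<dots> = ennreal (J \<omega>)" unfolding J_def by (intro nn_integral_eq_integral int AE_I2) auto
      finally show "(\<integral>\<^sup>+u\<in>{0..t}. ennreal ((v u \<omega> - H u \<omega>)\<^sup>2) \<partial>lborel) = ennreal (J \<omega>)" .
    qed
    have Svm [measurable]: "Sv K \<in> borel_measurable P" for K
      unfolding Sv_def using measurable_F_P[OF vF[OF T(1)]] by (intro borel_measurable_sum borel_measurable_times) auto
    have Vm [measurable]: "V K \<in> borel_measurable P" for K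
      unfolding V_def using measurable_F_P[OF vF[OF T(1)]] measurable_F_P[OF H_F[OF T(1)]]
      by (intro borel_measurable_sum borel_measurable_times borel_measurable_power borel_measurable_diff) auto
    have Jm [measurable]: "J \<in> borel_measurable P"
      by (rule borel_measurable_LIMSEQ_real[OF J(1) Vm])

    have kJ: "prob {\<omega> \<in> space P. J \<omega> > \<delta> / 2} < \<eta> / 5"
    proof -
      have "{\<omega> \<in> space P. J \<omega> > \<delta> / 2} = {\<omega> \<in> space P. (\<integral>\<^sup>+u\<in>{0..t}. ennreal ((v u \<omega> - H u \<omega>)\<^sup>2) \<partial>lborel) > ennreal (\<delta> / 2)}"
      proof (intro Collect_cong conj_cong refl)
        fix \<omega> assume "\<omega> \<in> space P"
        show "(\<delta> / 2 < J \<omega>) = (ennreal (\<delta> / 2) < (\<integral>\<^sup>+u\<in>{0..t}. ennreal ((v u \<omega> - H u \<omega>)\<^sup>2) \<partial>lborel))"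
          unfolding J(2)[OF \<open>\<omega> \<in> space P\<close>] by (rule ennreal_less_iff[symmetric], rule less_imp_le, rule half_gt_zero[OF pos(2)])
      qed
      then show ?thesis using k(1) unfolding v_def m_def \<tau>_def \<xi>_def by (rule back_subst[rotated, where P="\<lambda>A. prob A < \<eta> / 5", OF sym])
    qed
    have kS: "prob {\<omega> \<in> space P. \<bar>S \<omega> - I t \<omega>\<bar> > e'} < \<eta> / 5"
      unfolding S_def m_def \<tau>_def \<xi>_def by (rule k(2))
    have "(\<lambda>K. prob {\<omega> \<in> space P. \<bar>Sv K \<omega> - S \<omega>\<bar> > e'}) \<longlonglongrightarrow> 0"
    proof (rule measure_tendsto_zero_of_AE, rule AE_I2)
      fix \<omega> assume w: "\<omega> \<in> space P"
      from tendstoD[OF Svlim[OF w] pos(1)] show "\<forall>\<^sub>F K in sequentially. \<omega> \<notin> {\<omega> \<in> space P. \<bar>Sv K \<omega> - S \<omega>\<bar> > e'}"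
        by eventually_elim (auto simp: dist_real_def)
    qed
    then have K1: "\<forall>\<^sub>F K in sequentially. prob {\<omega> \<in> space P. \<bar>Sv K \<omega> - S \<omega>\<bar> > e'} < \<eta> / 5"
      using \<eta> by (intro order_tendstoD(2)) auto
    \<comment> \<open>The gap between \<open>\<delta> / 2\<close> and \<open>\<delta>\<close>
      absorbs the error of \<open>V K\<close> against its limit \<open>J\<close>.\<close>
    have "(\<lambda>K. prob {\<omega> \<in> space P. V K \<omega> > \<delta> \<and> J \<omega> \<le> \<delta> / 2}) \<longlonglongrightarrow> 0"
    proof (rule measure_tendsto_zero_of_AE, rule AE_I2)
      fix \<omega> assume w: "\<omega> \<in> space P"
      have "\<delta> / 2 > 0" using pos by simp
      from tendstoD[OF J(1)[OF w] this] show "\<forall>\<^sub>F K in sequentially. \<omega> \<notin> {\<omega> \<in> space P. V K \<omega> > \<delta> \<and> J \<omega> \<le> \<delta> / 2}"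
        unfolding dist_real_def by eventually_elim (clarify, linarith)
    qed
    then have K2: "\<forall>\<^sub>F K in sequentially. prob {\<omega> \<in> space P. V K \<omega> > \<delta> \<and> J \<omega> \<le> \<delta> / 2} < \<eta> / 5"
      using \<eta> by (intro order_tendstoD(2)) auto
    show "\<forall>\<^sub>F K in sequentially. dist (prob {\<omega> \<in> space P. \<omega> \<in> C t \<and> \<bar>R K \<omega> - I t \<omega>\<bar> > e}) 0 < \<eta>"
      using K1 K2
    proof eventually_elim
      case (elim K)
      define a where "a l \<omega> = v (T K l) \<omega> - X K l \<omega>" for l \<omega>
      have aF: "a l \<in> borel_measurable (F (T K l))" for l
        unfolding a_def using vF[OF T(1)] XF by measurable
      have ab: "\<bar>a l \<omega>\<bar> \<le> cv + \<bar>c\<bar>" if "\<omega> \<in> space P" for l \<omega>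
        using vb[OF that, of "T K l"] Xb[of K l \<omega>] by (simp add: a_def)
      define Q where "Q \<omega> = (\<Sum>l<2 ^ K. a l \<omega> * dB K l \<omega>)" for \<omega>
      define V' where "V' \<omega> = (\<Sum>l<2 ^ K. (T K (Suc l) - T K l) * (a l \<omega>)\<^sup>2)" for \<omega>
      have Qm [measurable]: "Q \<in> borel_measurable P" and V'm [measurable]: "V' \<in> borel_measurable P"
      proof -
        have [measurable]: "a l \<in> borel_measurable P" for l by (rule measurable_F_P[OF aF])
        show "Q \<in> borel_measurable P" "V' \<in> borel_measurable P" unfolding Q_def V'_def by measurable
      qed
      have tail: "prob {\<omega> \<in> space P. \<omega> \<in> C t \<and> \<bar>Q \<omega>\<bar> > e'} \<le> \<delta> / e'\<^sup>2 + prob {\<omega> \<in> space P. \<omega> \<in> C t \<and> V' \<omega> > \<delta>}"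
        unfolding Q_def V'_def dB_def
        using stochastic_sum_tail[where T="T K" and a=a and N="2 ^ K" and c="cv + \<bar>c\<bar>" and D="C t" and b=b and e=e' and \<delta>=\<delta>,
          OF T(1)[of K 0] T(2)[of K] aF ab Ct pos(1,2)] by assumption
      have RQ: "R K \<omega> = Sv K \<omega> - Q \<omega>" for \<omega>
        unfolding R_def Sv_def Q_def a_def sum_subtractf[symmetric] by (intro sum.cong refl) (simp only: left_diff_distrib diff_diff_eq2 add_diff_cancel_left')
      have VV: "V' \<omega> = V K \<omega>" if "\<omega> \<in> C t" for \<omega>
        unfolding V'_def V_def
      proof (rule sum.cong[OF refl])
        fix l assume "l \<in> {..<2 ^ K :: nat}"
        then have "l < 2 ^ K" by (simp only: lessThan_iff)
        then have "\<omega> \<in> C (T K l)" by (rule subsetD[OF C_anti[OF T(1) Tt] that])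
        then show "(T K (Suc l) - T K l) * (a l \<omega>)\<^sup>2 = t / 2 ^ K * (v (T K l) \<omega> - H (T K l) \<omega>)\<^sup>2"
          by (simp add: a_def X_def T(3))
      qed
      let ?A1 = "{\<omega> \<in> space P. \<bar>Sv K \<omega> - S \<omega>\<bar> > e'}" and ?A2 = "{\<omega> \<in> space P. \<omega> \<in> C t \<and> \<bar>Q \<omega>\<bar> > e'}"
        and ?A3 = "{\<omega> \<in> space P. \<bar>S \<omega> - I t \<omega>\<bar> > e'}"
        and ?B1 = "{\<omega> \<in> space P. V K \<omega> > \<delta> \<and> J \<omega> \<le> \<delta> / 2}" and ?B2 = "{\<omega> \<in> space P. J \<omega> > \<delta> / 2}"
      have m: "?A1 \<in> sets P" "?A2 \<in> sets P" "?A3 \<in> sets P" "?B1 \<in> sets P" "?B2 \<in> sets P" by measurable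
      have "{\<omega> \<in> space P. \<omega> \<in> C t \<and> V' \<omega> > \<delta>} \<subseteq> ?B1 \<union> ?B2"
      proof
        fix \<omega> assume "\<omega> \<in> {\<omega> \<in> space P. \<omega> \<in> C t \<and> V' \<omega> > \<delta>}"
        then have "\<omega> \<in> space P" "V K \<omega> > \<delta>" using VV[of \<omega>] by simp_all
        then show "\<omega> \<in> ?B1 \<union> ?B2" by (cases "J \<omega> \<le> \<delta> / 2") simp_all
      qed
      then have "prob {\<omega> \<in> space P. \<omega> \<in> C t \<and> V' \<omega> > \<delta>} \<le> prob (?B1 \<union> ?B2)"
        by (rule finite_measure_mono[OF _ sets.Un[OF m(4,5)]])
      also have "\<dots> \<le> prob ?B1 + prob ?B2" by (rule measure_Un_le[OF m(4,5)])
      finally have V': "prob {\<omega> \<in> space P. \<omega> \<in> C t \<and> V' \<omega> > \<delta>} < \<eta> / 5 + \<eta> / 5" using elim(2) kJ by linarith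
      have "{\<omega> \<in> space P. \<omega> \<in> C t \<and> \<bar>R K \<omega> - I t \<omega>\<bar> > e} \<subseteq> (?A1 \<union> ?A2) \<union> ?A3"
      proof
        fix \<omega> assume w: "\<omega> \<in> {\<omega> \<in> space P. \<omega> \<in> C t \<and> \<bar>R K \<omega> - I t \<omega>\<bar> > e}"
        have "\<bar>R K \<omega> - I t \<omega>\<bar> \<le> \<bar>Sv K \<omega> - S \<omega>\<bar> + \<bar>Q \<omega>\<bar> + \<bar>S \<omega> - I t \<omega>\<bar>" unfolding RQ by linarith
        moreover have "e < \<bar>R K \<omega> - I t \<omega>\<bar>" "e = e' + e' + e'" "\<omega> \<in> space P" "\<omega> \<in> C t" using w by (simp_all add: e'_def)
        ultimately have "e' < \<bar>Sv K \<omega> - S \<omega>\<bar> \<or> e' < \<bar>Q \<omega>\<bar> \<or> e' < \<bar>S \<omega> - I t \<omega>\<bar>" by linarith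
        then show "\<omega> \<in> (?A1 \<union> ?A2) \<union> ?A3" using \<open>\<omega> \<in> space P\<close> \<open>\<omega> \<in> C t\<close> by (elim disjE) simp_all
      qed
      then have "prob {\<omega> \<in> space P. \<omega> \<in> C t \<and> \<bar>R K \<omega> - I t \<omega>\<bar> > e} \<le> prob ((?A1 \<union> ?A2) \<union> ?A3)"
        by (rule finite_measure_mono[OF _ sets.Un[OF sets.Un[OF m(1,2)] m(3)]])
      also have "\<dots> \<le> prob (?A1 \<union> ?A2) + prob ?A3" by (rule measure_Un_le[OF sets.Un[OF m(1,2)] m(3)])
      also have "prob (?A1 \<union> ?A2) \<le> prob ?A1 + prob ?A2" by (rule measure_Un_le[OF m(1,2)])
      finally have "prob {\<omega> \<in> space P. \<omega> \<in> C t \<and> \<bar>R K \<omega> - I t \<omega>\<bar> > e} < \<eta>"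
        using elim(1) tail V' kS unfolding pos(3) by linarith
      then show ?case by (simp add: dist_real_def)
    qed
  qed
  then show ?thesis by (simp add: R_def X_def dB_def T_def)
qed

end

section \<open>Uniqueness\<close>

lemma dyadic_riemann_sum_tendsto_integral:
  fixes H :: "real \<Rightarrow> real"
  assumes H: "continuous_on {0..} H" and t: "0 < t"
  shows "(\<lambda>K. \<Sum>l<2 ^ K. t / 2 ^ K * H (real l * (t / 2 ^ K))) \<longlonglongrightarrow> integral {0..t} H"
proof (rule LIMSEQ_I)
  fix e :: real assume e: "e > 0"
  have Hc: "continuous_on {0..t} H" by (rule continuous_on_subset[OF H]) auto
  then have "uniformly_continuous_on {0..t} H" by (rule compact_uniformly_continuous) simp
  moreover have e': "e / (2 * t) > 0" using e t by simp
  ultimately obtain d where d: "d > 0" "\<And>u v. u \<in> {0..t} \<Longrightarrow> v \<in> {0..t} \<Longrightarrow> dist v u < d \<Longrightarrow> dist (H v) (H u) < e / (2 * t)"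
    unfolding uniformly_continuous_on_def by metis
  obtain K0 where K0: "t / d < 2 ^ K0" using real_arch_pow[of 2 "t / d"] by auto
  have "norm ((\<Sum>l<2 ^ K. t / 2 ^ K * H (real l * (t / 2 ^ K))) - integral {0..t} H) < e" if "K \<ge> K0" for K
  proof -
    define h where "h = t / 2 ^ K"
    \<comment> \<open>Constant after index \<open>2 ^ K\<close>, because
      \<open>riemann_sum_error\<close> asks for nodes within \<open>[0, t]\<close> at every
      index.\<close>
    define T where "T i = real (min i (2 ^ K)) * h" for i :: nat
    have "(2::real) ^ K0 \<le> 2 ^ K" using that by (intro power_increasing) auto
    with K0 have "t / d < 2 ^ K" by linarith
    then have h: "0 \<le> h" "h < d" "real (2 ^ K) * h = t" using t d(1) by (auto simp: h_def field_simps)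
    have T: "T 0 = 0" "T i \<le> T (Suc i)" "T i \<le> t" "0 \<le> T i" for i
    proof -
      show "T 0 = 0" "T i \<le> T (Suc i)" "0 \<le> T i" using h(1) by (auto simp: T_def intro!: mult_right_mono)
      have "T i \<le> real (2 ^ K) * h" unfolding T_def using h(1) by (intro mult_right_mono) auto
      then show "T i \<le> t" using h(3) by simp
    qed
    have step: "T (Suc i) - T i = h" "T i = real i * h" if "i < 2 ^ K" for i
      using that by (auto simp: T_def distrib_right min_def)
    have "\<bar>(\<Sum>i<2 ^ K. (T (Suc i) - T i) * H (T i)) - integral {0..T (2 ^ K)} H\<bar> \<le> e / (2 * t) * T (2 ^ K)"
    proof (rule riemann_sum_error[OF Hc T(1-3)])
      fix i u assume i: "i < 2 ^ K" and u: "T i \<le> u" "u \<le> T (Suc i)"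
      have "u \<in> {0..t}" using u T(3)[of "Suc i"] T(4)[of i] by simp
      moreover have "T i \<in> {0..t}" using T(3,4)[of i] by simp
      moreover have "dist (T i) u < d" using u step(1)[OF i] h by (simp add: dist_real_def)
      ultimately show "\<bar>H (T i) - H u\<bar> \<le> e / (2 * t)" using d(2)[of u "T i"] by (simp add: dist_real_def)
    qed
    moreover have "T (2 ^ K) = t" using h(3) by (simp add: T_def)
    moreover have "(\<Sum>i<2 ^ K. (T (Suc i) - T i) * H (T i)) = (\<Sum>l<2 ^ K. h * H (real l * h))"
    proof (rule sum.cong[OF refl])
      fix i assume "i \<in> {..<2 ^ K :: nat}"
      then have i: "i < 2 ^ K" by (simp only: lessThan_iff)
      show "(T (Suc i) - T i) * H (T i) = h * H (real i * h)" unfolding step(1)[OF i] unfolding step(2)[OF i] ..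
    qed
    ultimately show ?thesis using t e by (simp add: h_def)
  qed
  then show "\<exists>K0. \<forall>K\<ge>K0. norm ((\<Sum>l<2 ^ K. t / 2 ^ K * H (real l * (t / 2 ^ K))) - integral {0..t} H) < e" by blast
qed

text \<open>Gronwall's inequality by iteration, formulated with Riemann sums so that no regularity
  of \<open>\<phi>\<close> in time has to be established. After \<open>n\<close> iterations the
  bound is \<open>\<bar>c\<bar> * (\<beta> * t) ^ n / fact n\<close>, which tends to 0.\<close>

lemma riemann_sum_gronwall:
  fixes \<phi> :: "real \<Rightarrow> real"
  assumes \<phi>: "\<And>u. 0 \<le> u \<Longrightarrow> u \<le> T \<Longrightarrow> \<phi> u \<le> c" and zero: "\<phi> 0 \<le> 0" and \<beta>: "0 \<le> \<beta>"
    and step: "\<And>t M. 0 < t \<Longrightarrow> t \<le> T \<Longrightarrow> (\<And>K. (\<Sum>l<2 ^ K. t / 2 ^ K * \<phi> (real l * (t / 2 ^ K))) \<le> M) \<Longrightarrow> \<phi> t \<le> \<beta> * M"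
    and t: "0 \<le> t" "t \<le> T"
  shows "\<phi> t \<le> 0"
proof -
  have c: "0 \<le> \<bar>c\<bar>" by simp
  have bound: "\<phi> u \<le> \<bar>c\<bar> * (\<beta> * u) ^ n / fact n" if "0 \<le> u" "u \<le> T" for n u
    using that
  proof (induction n arbitrary: u)
    case 0
    then show ?case using \<phi>[of u] by (simp add: order_trans[OF _ abs_ge_self])
  next
    case (Suc n)
    show ?case
    proof (cases "u = 0")
      case True
      then show ?thesis using zero by simp
    next
      case False
      with Suc.prems have u: "0 < u" by simp
      \<comment> \<open>The integral over \<open>[0, u]\<close> of the bound obtained so far,
        without one factor \<open>\<beta>\<close>; by \<open>sum_powers_le\<close> it dominates all
        Riemann sums.\<close>
      define M where "M = \<bar>c\<bar> * \<beta> ^ n / fact n * (u ^ Suc n / real (Suc n))"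
      have "(\<Sum>l<2 ^ K. u / 2 ^ K * \<phi> (real l * (u / 2 ^ K))) \<le> M" for K
      proof -
        define h where "h = u / 2 ^ K"
        have h: "0 \<le> h" "real (2 ^ K) * h = u" using u by (auto simp: h_def)
        have "(\<Sum>l<2 ^ K. h * \<phi> (real l * h)) \<le> (\<Sum>l<2 ^ K. \<bar>c\<bar> * \<beta> ^ n / fact n * h ^ Suc n * real l ^ n)"
        proof (rule sum_mono)
          fix l assume "l \<in> {..<2 ^ K :: nat}"
          then have "real l \<le> real (2 ^ K)" by (simp only: lessThan_iff of_nat_le_iff less_imp_le)
          then have "real l * h \<le> real (2 ^ K) * h" using h(1) by (intro mult_right_mono)
          then have "real l * h \<le> T" using h(2) Suc.prems(2) by linarith
          then have "h * \<phi> (real l * h) \<le> h * (\<bar>c\<bar> * (\<beta> * (real l * h)) ^ n / fact n)"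
            using h(1) by (intro mult_left_mono Suc.IH) auto
          also have "\<dots> = \<bar>c\<bar> * \<beta> ^ n / fact n * h ^ Suc n * real l ^ n" by (simp add: power_mult_distrib)
          finally show "h * \<phi> (real l * h) \<le> \<bar>c\<bar> * \<beta> ^ n / fact n * h ^ Suc n * real l ^ n" .
        qed
        also have "\<dots> = \<bar>c\<bar> * \<beta> ^ n / fact n * h ^ Suc n * (\<Sum>l<2 ^ K. real l ^ n)" by (simp only: sum_distrib_left)
        also have "\<dots> \<le> \<bar>c\<bar> * \<beta> ^ n / fact n * h ^ Suc n * (real (2 ^ K) ^ Suc n / real (Suc n))"
          using sum_powers_le[of n "2 ^ K"] h(1) \<beta> by (intro mult_left_mono) auto
        also have "\<dots> = \<bar>c\<bar> * \<beta> ^ n / fact n * ((real (2 ^ K) * h) ^ Suc n / real (Suc n))"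
          by (simp only: power_mult_distrib times_divide_times_eq mult.assoc mult.commute mult.left_commute times_divide_eq_right times_divide_eq_left divide_divide_eq_left)
        also have "\<dots> = M" unfolding h(2) M_def ..
        finally show ?thesis unfolding h_def .
      qed
      then have "\<phi> u \<le> \<beta> * M" by (rule step[OF u Suc.prems(2)])
      also have "\<dots> = \<bar>c\<bar> * (\<beta> * u) ^ Suc n / fact (Suc n)"
        by (simp add: M_def power_mult_distrib mult.assoc mult.commute mult.left_commute)
      finally show ?thesis .
    qed
  qed
  have "(\<lambda>n. \<bar>c\<bar> * ((\<beta> * t) ^ n /\<^sub>R fact n)) \<longlonglongrightarrow> \<bar>c\<bar> * 0"
    by (intro tendsto_mult tendsto_const summable_LIMSEQ_zero summable_exp_generic)
  then have "(\<lambda>n. \<bar>c\<bar> * (\<beta> * t) ^ n / fact n) \<longlonglongrightarrow> 0" by (simp add: divide_inverse mult.assoc mult.commute mult.left_commute)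
  then show ?thesis by (rule LIMSEQ_le_const) (use bound[OF t] in auto)
qed

context wiener
begin

text \<open>By continuity dyadic times suffice, and rounding down keeps them before
  \<open>u\<close>, so that only the past is used.\<close>

lemma running_bound_sets:
  fixes X :: "real \<Rightarrow> (real \<Rightarrow> real^'d) \<Rightarrow> 'e::euclidean_space"
  assumes X: "\<And>v. 0 \<le> v \<Longrightarrow> X v \<in> borel_measurable (F v)"
    and cont: "\<And>\<omega>. \<omega> \<in> space P \<Longrightarrow> continuous_on {0..} (\<lambda>v. X v \<omega>)" and u: "0 \<le> u"
  shows "{\<omega> \<in> space P. \<forall>v\<in>{0..u}. norm (X v \<omega>) \<le> R} \<in> sets (F u)"
proof -
  have "(\<forall>v\<in>{0..u}. norm (X v \<omega>) \<le> R) \<longleftrightarrow> (\<forall>j k::nat. real k / 2 ^ j \<le> u \<longrightarrow> norm (X (real k / 2 ^ j) \<omega>) \<le> R)"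
    if w: "\<omega> \<in> space P" for \<omega>
  proof
    assume b: "\<forall>j k::nat. real k / 2 ^ j \<le> u \<longrightarrow> norm (X (real k / 2 ^ j) \<omega>) \<le> R"
    show "\<forall>v\<in>{0..u}. norm (X v \<omega>) \<le> R"
    proof
      fix v assume v: "v \<in> {0..u}"
      have d0: "0 \<le> dyadic_floor j v" for j using dyadic_floor_ge[of 0 v j] v by simp
      have "(\<lambda>j. norm (X (dyadic_floor j v) \<omega>)) \<longlonglongrightarrow> norm (X v \<omega>)"
        using v d0 by (intro tendsto_norm continuous_on_tendsto_compose[OF cont[OF w] dyadic_floor_tendsto]) auto
      then show "norm (X v \<omega>) \<le> R"
      proof (rule LIMSEQ_le_const2, intro exI[of _ 0] allI impI)
        fix j
        have "dyadic_floor j v = real (nat \<lfloor>v * 2 ^ j\<rfloor>) / 2 ^ j" using v by (simp add: dyadic_floor_def)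
        moreover have "real (nat \<lfloor>v * 2 ^ j\<rfloor>) / 2 ^ j \<le> u" using dyadic_floor_le[of j v] v calculation by simp
        ultimately show "norm (X (dyadic_floor j v) \<omega>) \<le> R" using b by simp
      qed
    qed
  qed auto
  then have "{\<omega> \<in> space P. \<forall>v\<in>{0..u}. norm (X v \<omega>) \<le> R}
      = {\<omega> \<in> space (F u). \<forall>j k::nat. real k / 2 ^ j \<le> u \<longrightarrow> norm (X (real k / 2 ^ j) \<omega>) \<le> R}"
    unfolding space_F by (intro Collect_cong conj_cong refl)
  moreover have "{\<omega> \<in> space (F u). real k / 2 ^ j \<le> u \<longrightarrow> norm (X (real k / 2 ^ j) \<omega>) \<le> R} \<in> sets (F u)" for j k :: nat
  proof (cases "real k / 2 ^ j \<le> u")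
    case True
    have [measurable]: "X (real k / 2 ^ j) \<in> borel_measurable (F u)" by (rule measurable_F_mono[OF X True]) simp
    show ?thesis by measurable
  next
    case False
    then show ?thesis using sets.top[of "F u"] by simp
  qed
  ultimately show ?thesis by (simp only: sets.sets_Collect_countable_All)
qed

text \<open>A bound of Fatou type along convergence in probability. Where \<open>Z K\<close> is
  close to \<open>Y\<close>, the square of a sum is at most twice the sum of the squares, which is
  the origin of the factor 2; on the exceptional event \<open>Y\<close> is at most \<open>c\<close>,
  and the probability of this event tends to 0.\<close>

lemma vanish_on_second_moment_le:
  assumes D: "D \<in> sets P" and Z: "vanish_on D (\<lambda>K \<omega>. Z K \<omega> - Y \<omega>)" and Y: "Y \<in> borel_measurable P"
    and Yb: "\<And>\<omega>. \<omega> \<in> D \<Longrightarrow> \<bar>Y \<omega>\<bar> \<le> c"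
    and Z2: "\<And>K. integrable P (\<lambda>\<omega>. (Z K \<omega>)\<^sup>2)" "\<And>K. expectation (\<lambda>\<omega>. (Z K \<omega>)\<^sup>2) \<le> M"
  shows "integrable P (\<lambda>\<omega>. indicator D \<omega> * (Y \<omega>)\<^sup>2)" "expectation (\<lambda>\<omega>. indicator D \<omega> * (Y \<omega>)\<^sup>2) \<le> 2 * M"
proof -
  note [measurable] = D Y
  have ZY [measurable]: "(\<lambda>\<omega>. Z K \<omega> - Y \<omega>) \<in> borel_measurable P" for K using Z by (simp add: vanish_on_def)
  have Y2: "(Y \<omega>)\<^sup>2 \<le> c\<^sup>2" if "\<omega> \<in> D" for \<omega> using Yb[OF that] power_mono[of "\<bar>Y \<omega>\<bar>" c 2] by simp
  show int: "integrable P (\<lambda>\<omega>. indicator D \<omega> * (Y \<omega>)\<^sup>2)"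
    using Y2 by (intro integrable_const_bound[where B="c\<^sup>2"] AE_I2) (auto simp: indicator_def)
  show "expectation (\<lambda>\<omega>. indicator D \<omega> * (Y \<omega>)\<^sup>2) \<le> 2 * M"
  proof (rule field_le_epsilon)
    fix e :: real assume e: "e > 0"
    define \<epsilon> where "\<epsilon> = sqrt (e / 2)"
    have \<epsilon>: "\<epsilon> > 0" "2 * \<epsilon>\<^sup>2 = e" using e by (auto simp: \<epsilon>_def)
    define A where "A K = {\<omega> \<in> space P. \<omega> \<in> D \<and> \<bar>Z K \<omega> - Y \<omega>\<bar> > \<epsilon>}" for K
    have A: "A K \<in> sets P" for K unfolding A_def by measurable
    have le: "expectation (\<lambda>\<omega>. indicator D \<omega> * (Y \<omega>)\<^sup>2) \<le> 2 * M + e + c\<^sup>2 * prob (A K)" for K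
    proof -
      have "expectation (\<lambda>\<omega>. indicator D \<omega> * (Y \<omega>)\<^sup>2) \<le> expectation (\<lambda>\<omega>. 2 * (Z K \<omega>)\<^sup>2 + e + c\<^sup>2 * indicator (A K) \<omega>)"
      proof (rule integral_mono[OF int])
        show "integrable P (\<lambda>\<omega>. 2 * (Z K \<omega>)\<^sup>2 + e + c\<^sup>2 * indicator (A K) \<omega>)"
          using Z2(1)[of K] A by (intro Bochner_Integration.integrable_add integrable_mult_right integrable_real_indicator) (auto simp: less_top[symmetric])
        fix \<omega> assume w: "\<omega> \<in> space P"
        have nn: "0 \<le> 2 * (Z K \<omega>)\<^sup>2 + e" using e by simp
        consider "\<omega> \<notin> D" | "\<omega> \<in> A K" "\<omega> \<in> D" | "\<omega> \<in> D" "\<bar>Z K \<omega> - Y \<omega>\<bar> \<le> \<epsilon>" "\<omega> \<notin> A K" using w by (fastforce simp: A_def)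
        then show "indicator D \<omega> * (Y \<omega>)\<^sup>2 \<le> 2 * (Z K \<omega>)\<^sup>2 + e + c\<^sup>2 * indicator (A K) \<omega>"
        proof cases
          case 1
          then show ?thesis using nn by simp
        next
          case 2
          then show ?thesis using nn Y2[of \<omega>] by simp
        next
          case 3
          have "(Z K \<omega> - Y \<omega>)\<^sup>2 \<le> \<epsilon>\<^sup>2" using 3 \<epsilon>(1) by (simp add: power2_le_iff_abs_le)
          moreover have "(Y \<omega>)\<^sup>2 \<le> 2 * (Z K \<omega>)\<^sup>2 + 2 * (Z K \<omega> - Y \<omega>)\<^sup>2"
            using zero_le_power2[of "2 * Z K \<omega> - Y \<omega>"] by (simp add: power2_eq_square algebra_simps)
          ultimately have "(Y \<omega>)\<^sup>2 \<le> 2 * (Z K \<omega>)\<^sup>2 + e" using \<epsilon>(2) by linarith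
          then show ?thesis using 3 by simp
        qed
      qed
      also have "\<dots> = 2 * expectation (\<lambda>\<omega>. (Z K \<omega>)\<^sup>2) + e + c\<^sup>2 * prob (A K)"
        using Z2(1)[of K] A by (simp add: prob_space less_top[symmetric])
      finally show ?thesis using Z2(2)[of K] by linarith
    qed
    have "(\<lambda>K. prob (A K)) \<longlonglongrightarrow> 0" using Z \<epsilon>(1) by (simp add: vanish_on_def A_def)
    then have "(\<lambda>K. 2 * M + e + c\<^sup>2 * prob (A K)) \<longlonglongrightarrow> 2 * M + e + c\<^sup>2 * 0" by (intro tendsto_add tendsto_mult tendsto_const)
    then have "expectation (\<lambda>\<omega>. indicator D \<omega> * (Y \<omega>)\<^sup>2) \<le> 2 * M + e + c\<^sup>2 * 0"
      by (rule LIMSEQ_le_const) (use le in blast)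
    then show "expectation (\<lambda>\<omega>. indicator D \<omega> * (Y \<omega>)\<^sup>2) \<le> 2 * M + e" by simp
  qed
qed

end

context sde_coeffs
begin

section \<open>Comparison of two solutions\<close>

text \<open>The equation in discretised form. The indicators sit at left endpoints, where they are
  known, and make the integrands bounded. Drift and noise converge separately; the equation enters
  as a third summand \<open>E\<close>, which is almost surely 0.\<close>

lemma sde_riemann_convergence:
  assumes X: "sde_solution P f g x X"
    and C: "\<And>u. 0 \<le> u \<Longrightarrow> C u \<in> sets (F u)" and C_anti: "\<And>u v. 0 \<le> u \<Longrightarrow> u \<le> v \<Longrightarrow> C v \<subseteq> C u"
    and bound: "\<And>u \<omega>. 0 \<le> u \<Longrightarrow> \<omega> \<in> C u \<Longrightarrow> norm (X u \<omega>) \<le> R" and t: "0 < t"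
  shows "vanish_on (C t) (\<lambda>K \<omega>. (\<Sum>l<2 ^ K. indicator (C (real l * (t / 2 ^ K))) \<omega> * (t / 2 ^ K * f (X (real l * (t / 2 ^ K)) \<omega>) $ a))
      + (\<Sum>b\<in>UNIV. \<Sum>l<2 ^ K. indicator (C (real l * (t / 2 ^ K))) \<omega> * g (X (real l * (t / 2 ^ K)) \<omega>) $ a $ b *
          (\<omega> (real (Suc l) * (t / 2 ^ K)) $ b - \<omega> (real l * (t / 2 ^ K)) $ b))
      - (X t \<omega> - x) $ a)"
proof -
  define T where "T K l = real l * (t / 2 ^ K)" for K l
  have T0: "0 \<le> T K l" for K l using t by (simp add: T_def)
  have Tt: "T K l \<le> t" if "l < 2 ^ K" for K l
  proof -
    have "real l \<le> real (2 ^ K)" using that by (simp only: of_nat_le_iff less_imp_le)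
    then have "T K l \<le> real (2 ^ K) * (t / 2 ^ K)" unfolding T_def using t by (intro mult_right_mono) auto
    then show ?thesis by simp
  qed
  obtain J where X_F: "\<forall>t\<ge>0. X t \<in> borel_measurable (F t)"
    and X_cont: "\<forall>\<omega>\<in>space P. continuous_on {0..} (\<lambda>t. X t \<omega>)"
    and J: "\<forall>i j. ito_integral P F (\<lambda>t \<omega>. \<omega> t $ j) (\<lambda>u \<omega>. g (X u \<omega>) $ i $ j) (J i j)"
    and eq: "AE \<omega> in P. \<forall>t\<ge>0. \<forall>i. X t \<omega> $ i = x $ i + integral {0..t} (\<lambda>u. f (X u \<omega>) $ i) + (\<Sum>j\<in>UNIV. J i j t \<omega>)"
    using X unfolding sde_solution_def by (elim conjE exE) (rule that)
  have XF: "X u \<in> borel_measurable (F u)" if "0 \<le> u" for u using X_F that by (elim allE[of _ u] impE)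
  have XP [measurable]: "X u \<in> borel_measurable P" if "0 \<le> u" for u by (rule measurable_F_P[OF XF[OF that]])
  have CP: "C u \<in> sets P" if "0 \<le> u" for u by (rule subsetD[OF sets_F_subset C[OF that]])
  have gc: "continuous_on UNIV (\<lambda>y. g y $ a $ b)" "continuous_on UNIV (\<lambda>y. f y $ a)" for b
    using g_cont f_cont by (intro continuous_on_component; simp)+
  have gb: "\<bar>g (X u \<omega>) $ a $ b\<bar> \<le> \<bar>g 0 $ a $ b\<bar> + L * R" if "0 \<le> u" "\<omega> \<in> C u" for u \<omega> b
  proof -
    have "L * norm (X u \<omega>) \<le> L * R" using bound[OF that] L_nonneg by (rule mult_left_mono)
    then show ?thesis using g_comp_lip[of "X u \<omega>" a b 0] by simp
  qed
  let ?N = "\<lambda>b K \<omega>. \<Sum>l<2 ^ K. indicator (C (T K l)) \<omega> * g (X (T K l) \<omega>) $ a $ b * (\<omega> (T K (Suc l)) $ b - \<omega> (T K l) $ b)"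
  let ?A = "\<lambda>K \<omega>. \<Sum>l<2 ^ K. indicator (C (T K l)) \<omega> * (t / 2 ^ K * f (X (T K l) \<omega>) $ a)"
  let ?I = "\<lambda>\<omega>. integral {0..t} (\<lambda>u. f (X u \<omega>) $ a)"
  have N: "vanish_on (C t) (\<lambda>K \<omega>. ?N b K \<omega> - J a b t \<omega>)" for b
    unfolding T_def
  proof (rule ito_riemann_convergence[where H="\<lambda>u \<omega>. g (X u \<omega>) $ a $ b" and C=C, OF _ _ _ C C_anti gb t])
    show "ito_integral P F (\<lambda>t \<omega>. \<omega> t $ b) (\<lambda>u \<omega>. g (X u \<omega>) $ a $ b) (J a b)" using J by (elim allE)
    show "(\<lambda>\<omega>. g (X u \<omega>) $ a $ b) \<in> borel_measurable (F u)" if "0 \<le> u" for u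
      by (rule measurable_compose[OF XF[OF that] borel_measurable_continuous_onI[OF gc(1)]])
    show "continuous_on {0..} (\<lambda>u. g (X u \<omega>) $ a $ b)" if "\<omega> \<in> space P" for \<omega>
      by (rule continuous_on_compose2[OF gc(1) bspec[OF X_cont that]]) simp
  qed
  have fX: "continuous_on {0..} (\<lambda>u. f (X u \<omega>) $ a)" if "\<omega> \<in> space P" for \<omega>
    by (rule continuous_on_compose2[OF gc(2) bspec[OF X_cont that]]) simp
  have fXm [measurable]: "(\<lambda>\<omega>. f (X u \<omega>) $ a) \<in> borel_measurable P" if "0 \<le> u" for u
    by (rule measurable_compose[OF XP[OF that] borel_measurable_continuous_onI[OF gc(2)]])
  have lim: "(\<lambda>K. \<Sum>l<2 ^ K. t / 2 ^ K * f (X (T K l) \<omega>) $ a) \<longlonglongrightarrow> ?I \<omega>" if "\<omega> \<in> space P" for \<omega>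
    unfolding T_def by (rule dyadic_riemann_sum_tendsto_integral[OF fX[OF that] t])
  have Im [measurable]: "?I \<in> borel_measurable P"
    by (rule borel_measurable_LIMSEQ_real[OF lim], assumption) (intro borel_measurable_sum borel_measurable_times borel_measurable_const fXm T0)
  have Am [measurable]: "?A K \<in> borel_measurable P" for K
    by (intro borel_measurable_sum borel_measurable_times borel_measurable_const fXm T0 borel_measurable_indicator CP)
  have A: "vanish_on (C t) (\<lambda>K \<omega>. ?A K \<omega> - ?I \<omega>)"
  proof (rule vanish_on_AE)
    show "(\<lambda>\<omega>. ?A K \<omega> - ?I \<omega>) \<in> borel_measurable P" for K by measurable
    show "AE \<omega> in P. \<omega> \<in> C t \<longrightarrow> (\<lambda>K. ?A K \<omega> - ?I \<omega>) \<longlonglongrightarrow> 0"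
    proof (rule AE_I2, rule impI)
      fix \<omega> assume w: "\<omega> \<in> space P" and wC: "\<omega> \<in> C t"
      have "?A K \<omega> = (\<Sum>l<2 ^ K. t / 2 ^ K * f (X (T K l) \<omega>) $ a)" for K
      proof (rule sum.cong[OF refl])
        fix l assume "l \<in> {..<2 ^ K :: nat}"
        then have "l < 2 ^ K" by (simp only: lessThan_iff)
        then have "\<omega> \<in> C (T K l)" by (rule subsetD[OF C_anti[OF T0 Tt] wC])
        then show "indicator (C (T K l)) \<omega> * (t / 2 ^ K * f (X (T K l) \<omega>) $ a) = t / 2 ^ K * f (X (T K l) \<omega>) $ a" by simp
      qed
      then show "(\<lambda>K. ?A K \<omega> - ?I \<omega>) \<longlonglongrightarrow> 0" using lim[OF w] by (simp only: LIM_zero)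
    qed
  qed
  have Jm: "J a b t \<in> borel_measurable P" for b
    using J t by (intro ito_integral_measurable[where B="\<lambda>t \<omega>. \<omega> t $ b" and H="\<lambda>u \<omega>. g (X u \<omega>) $ a $ b"]) auto
  have E: "vanish_on (C t) (\<lambda>K \<omega>. ?I \<omega> + (\<Sum>b\<in>UNIV. J a b t \<omega>) - (X t \<omega> - x) $ a)"
  proof (rule vanish_on_AE)
    have [measurable]: "(\<lambda>\<omega>. (X t \<omega> - x) $ a) \<in> borel_measurable P"
      using XP[OF less_imp_le[OF t]] by (intro measurable_compose[OF _ borel_measurable_nth] borel_measurable_diff borel_measurable_const)
    note [measurable] = Jm
    show "(\<lambda>\<omega>. ?I \<omega> + (\<Sum>b\<in>UNIV. J a b t \<omega>) - (X t \<omega> - x) $ a) \<in> borel_measurable P" for K :: nat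
      by measurable
    show "AE \<omega> in P. \<omega> \<in> C t \<longrightarrow> (\<lambda>K::nat. ?I \<omega> + (\<Sum>b\<in>UNIV. J a b t \<omega>) - (X t \<omega> - x) $ a) \<longlonglongrightarrow> 0"
      using eq
    proof eventually_elim
      case (elim \<omega>)
      then have "X t \<omega> $ a = x $ a + ?I \<omega> + (\<Sum>j\<in>UNIV. J a j t \<omega>)" using t by (elim allE[of _ t] allE[of _ a] impE) auto
      then show ?case by simp
    qed
  qed
  have Ct: "C t \<in> sets P" using CP t by simp
  note V = vanish_on_add[OF Ct vanish_on_add[OF Ct A vanish_on_sum[OF Ct, of UNIV, OF N]] E]
  have "(\<lambda>K \<omega>. ?A K \<omega> + (\<Sum>b\<in>UNIV. ?N b K \<omega>) - (X t \<omega> - x) $ a)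
    = (\<lambda>K \<omega>. ?A K \<omega> - ?I \<omega> + (\<Sum>b\<in>UNIV. ?N b K \<omega> - J a b t \<omega>) + (?I \<omega> + (\<Sum>b\<in>UNIV. J a b t \<omega>) - (X t \<omega> - x) $ a))"
    unfolding sum_subtractf by (intro ext) linarith
  then have "vanish_on (C t) (\<lambda>K \<omega>. ?A K \<omega> + (\<Sum>b\<in>UNIV. ?N b K \<omega>) - (X t \<omega> - x) $ a)" using V by (simp only:)
  then show ?thesis unfolding T_def .
qed

text \<open>Both equations are discretised and subtracted, and the isometry is applied to the
  discretised noise. In the constant, \<open>CARD('n)\<close> counts coordinates, \<open>t\<close>
  is from Cauchy-Schwarz in time for the drift, the square of \<open>CARD('d)\<close> from the sum
  of \<open>CARD('d)\<close> noise terms, and 4 is a 2 for separating drift from noise times the 2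
  lost in \<open>vanish_on_second_moment_le\<close>.\<close>

lemma sde_difference_second_moment_le:
  assumes X: "sde_solution P f g x X" and Y: "sde_solution P f g x Y"
    and C: "\<And>u. 0 \<le> u \<Longrightarrow> C u \<in> sets (F u)" and C_anti: "\<And>u v. 0 \<le> u \<Longrightarrow> u \<le> v \<Longrightarrow> C v \<subseteq> C u"
    and XR: "\<And>u \<omega>. 0 \<le> u \<Longrightarrow> \<omega> \<in> C u \<Longrightarrow> norm (X u \<omega>) \<le> R"
    and YR: "\<And>u \<omega>. 0 \<le> u \<Longrightarrow> \<omega> \<in> C u \<Longrightarrow> norm (Y u \<omega>) \<le> R" and t: "0 < t" and R: "0 \<le> R"
    and M: "\<And>K. (\<Sum>l<2 ^ K. t / 2 ^ K * expectation (\<lambda>\<omega>. indicator (C (real l * (t / 2 ^ K))) \<omega> *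
      (norm (Y (real l * (t / 2 ^ K)) \<omega> - X (real l * (t / 2 ^ K)) \<omega>))\<^sup>2)) \<le> M"
  shows "expectation (\<lambda>\<omega>. indicator (C t) \<omega> * (norm (Y t \<omega> - X t \<omega>))\<^sup>2)
    \<le> real CARD('n) * (4 * (t + (real CARD('d))\<^sup>2) * L\<^sup>2) * M"
proof -
  define T where "T K l = real l * (t / 2 ^ K)" for K l
  have T0: "0 \<le> T K l" for K l using t by (simp add: T_def)
  have TS: "T K (Suc l) = T K l + t / 2 ^ K" for K l by (simp only: T_def of_nat_Suc distrib_right mult_1 add.commute)
  have T_mono: "T K l \<le> T K (Suc l)" "T K (Suc l) - T K l = t / 2 ^ K" for K l using t by (simp_all add: TS)
  have XF: "X u \<in> borel_measurable (F u)" "Y u \<in> borel_measurable (F u)" if "0 \<le> u" for u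
    using X Y that by (simp_all add: sde_solution_def)
  have CP: "C u \<in> sets P" if "0 \<le> u" for u by (rule subsetD[OF sets_F_subset C[OF that]])
  define \<Delta> where "\<Delta> u \<omega> = norm (Y u \<omega> - X u \<omega>)" for u \<omega>
  define \<phi> where "\<phi> u = expectation (\<lambda>\<omega>. indicator (C u) \<omega> * (\<Delta> u \<omega>)\<^sup>2)" for u
  have \<Delta>F: "\<Delta> u \<in> borel_measurable (F u)" if "0 \<le> u" for u
    unfolding \<Delta>_def using XF[OF that] by measurable
  have \<Delta>R: "\<Delta> u \<omega> \<le> 2 * R" if "0 \<le> u" "\<omega> \<in> C u" for u \<omega>
    using norm_triangle_ineq4[of "Y u \<omega>" "X u \<omega>"] XR[OF that] YR[OF that] by (simp add: \<Delta>_def)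
  have \<Delta>2R: "indicator (C u) \<omega> * (\<Delta> u \<omega>)\<^sup>2 \<le> (2 * R)\<^sup>2" if "0 \<le> u" for u \<omega>
    using power_mono[OF \<Delta>R[OF that], of \<omega> 2] by (auto simp: indicator_def \<Delta>_def)
  have \<phi>int: "integrable P (\<lambda>\<omega>. indicator (C u) \<omega> * (\<Delta> u \<omega>)\<^sup>2)" if "0 \<le> u" for u
  proof (rule integrable_const_bound[where B="(2 * R)\<^sup>2"])
    show "(\<lambda>\<omega>. indicator (C u) \<omega> * (\<Delta> u \<omega>)\<^sup>2) \<in> borel_measurable P"
      by (intro borel_measurable_times borel_measurable_power borel_measurable_indicator CP measurable_F_P[OF \<Delta>F] that)
  qed (use \<Delta>2R[OF that] in auto)
  have M: "(\<Sum>l<2 ^ K. t / 2 ^ K * \<phi> (T K l)) \<le> M" for K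
    using M[of K] by (simp only: \<phi>_def \<Delta>_def T_def)
  define p where "p a K l \<omega> = indicator (C (T K l)) \<omega> * (f (Y (T K l) \<omega>) $ a - f (X (T K l) \<omega>) $ a)" for a K l \<omega>
  define q where "q a b K l \<omega> = indicator (C (T K l)) \<omega> * (g (Y (T K l) \<omega>) $ a $ b - g (X (T K l) \<omega>) $ a $ b)" for a b K l \<omega>
  have pq: "\<bar>p a K l \<omega>\<bar> \<le> L * (indicator (C (T K l)) \<omega> * \<Delta> (T K l) \<omega>)"
    "\<bar>q a b K l \<omega>\<bar> \<le> L * (indicator (C (T K l)) \<omega> * \<Delta> (T K l) \<omega>)" for a b K l \<omega>
    unfolding p_def q_def \<Delta>_def using f_comp_lip g_comp_lip by (auto simp: indicator_def)
  have pq2: "(p a K l \<omega>)\<^sup>2 \<le> L\<^sup>2 * (indicator (C (T K l)) \<omega> * (\<Delta> (T K l) \<omega>)\<^sup>2)"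
    "(q a b K l \<omega>)\<^sup>2 \<le> L\<^sup>2 * (indicator (C (T K l)) \<omega> * (\<Delta> (T K l) \<omega>)\<^sup>2)" for a b K l \<omega>
  proof -
    have sq: "(L * (indicator (C (T K l)) \<omega> * \<Delta> (T K l) \<omega>))\<^sup>2 = L\<^sup>2 * (indicator (C (T K l)) \<omega> * (\<Delta> (T K l) \<omega>)\<^sup>2)"
      by (simp add: power_mult_distrib indicator_def)
    show "(p a K l \<omega>)\<^sup>2 \<le> L\<^sup>2 * (indicator (C (T K l)) \<omega> * (\<Delta> (T K l) \<omega>)\<^sup>2)"
      "(q a b K l \<omega>)\<^sup>2 \<le> L\<^sup>2 * (indicator (C (T K l)) \<omega> * (\<Delta> (T K l) \<omega>)\<^sup>2)"
      unfolding sq[symmetric] using power_mono[OF pq(1) abs_ge_zero, of a K l \<omega> 2] power_mono[OF pq(2) abs_ge_zero, of a b K l \<omega> 2]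
      by simp_all
  qed
  have pqb: "\<bar>q a b K l \<omega>\<bar> \<le> L * (2 * R)" "\<bar>p a K l \<omega>\<bar> \<le> L * (2 * R)" for a b K l \<omega>
  proof -
    have "indicator (C (T K l)) \<omega> * \<Delta> (T K l) \<omega> \<le> 2 * R" using \<Delta>R[OF T0, of \<omega> K l] R by (simp add: indicator_def)
    from mult_left_mono[OF this L_nonneg] show "\<bar>q a b K l \<omega>\<bar> \<le> L * (2 * R)" "\<bar>p a K l \<omega>\<bar> \<le> L * (2 * R)"
      using pq(1)[of a K l \<omega>] pq(2)[of a b K l \<omega>] by linarith+
  qed
  have gc: "(\<lambda>y. g y $ a $ b) \<in> borel_measurable borel" "(\<lambda>y. f y $ a) \<in> borel_measurable borel" for a b
    using g_cont f_cont by (intro borel_measurable_continuous_onI continuous_on_component; simp)+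
  have qF: "q a b K l \<in> borel_measurable (F (T K l))" "p a K l \<in> borel_measurable (F (T K l))" for a b K l
    unfolding q_def p_def
    by (intro borel_measurable_times borel_measurable_diff borel_measurable_indicator C[OF T0]
        measurable_compose[OF XF(1)[OF T0] gc(1)] measurable_compose[OF XF(2)[OF T0] gc(1)]
        measurable_compose[OF XF(1)[OF T0] gc(2)] measurable_compose[OF XF(2)[OF T0] gc(2)])+
  have pm [measurable]: "p a K l \<in> borel_measurable P" for a K l by (rule measurable_F_P[OF qF(2)])
  define A where "A a K \<omega> = (\<Sum>l<2 ^ K. t / 2 ^ K * p a K l \<omega>)" for a K \<omega>
  define N where "N a b K \<omega> = (\<Sum>l<2 ^ K. q a b K l \<omega> * (\<omega> (T K (Suc l)) $ b - \<omega> (T K l) $ b))" for a b K and \<omega> :: "real \<Rightarrow> real^'d"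
  note iso = ito_isometry[where T="T K" and N="2 ^ K" and a="q a b K" and c="L * (2 * R)" and b=b for K a b,
      OF T0 T_mono(1) qF(1) pqb(1), folded N_def]
  have N2: "integrable P (\<lambda>\<omega>. (N a b K \<omega>)\<^sup>2)" "expectation (\<lambda>\<omega>. (N a b K \<omega>)\<^sup>2) \<le> L\<^sup>2 * M"
    and Nm: "N a b K \<in> borel_measurable P" for a b K
  proof -
    show "integrable P (\<lambda>\<omega>. (N a b K \<omega>)\<^sup>2)" by (rule iso(2))
    show "N a b K \<in> borel_measurable P" by (rule measurable_F_P[OF iso(1)])
    have "expectation (\<lambda>\<omega>. (N a b K \<omega>)\<^sup>2) = (\<Sum>l<2 ^ K. t / 2 ^ K * expectation (\<lambda>\<omega>. (q a b K l \<omega>)\<^sup>2))"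
      unfolding iso(3) T_mono(2) ..
    also have "\<dots> \<le> (\<Sum>l<2 ^ K. t / 2 ^ K * (L\<^sup>2 * \<phi> (T K l)))"
    proof (intro sum_mono mult_left_mono)
      fix l
      have "expectation (\<lambda>\<omega>. (q a b K l \<omega>)\<^sup>2) \<le> expectation (\<lambda>\<omega>. L\<^sup>2 * (indicator (C (T K l)) \<omega> * (\<Delta> (T K l) \<omega>)\<^sup>2))"
        by (rule integral_mono'[OF integrable_mult_right[OF \<phi>int[OF T0]]]) (auto simp: pq2)
      then show "expectation (\<lambda>\<omega>. (q a b K l \<omega>)\<^sup>2) \<le> L\<^sup>2 * \<phi> (T K l)" by (simp add: \<phi>_def)
    qed (use t in simp)
    also have "\<dots> = L\<^sup>2 * (\<Sum>l<2 ^ K. t / 2 ^ K * \<phi> (T K l))" by (simp add: sum_distrib_left mult_ac)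
    also have "\<dots> \<le> L\<^sup>2 * M" by (intro mult_left_mono M) simp
    finally show "expectation (\<lambda>\<omega>. (N a b K \<omega>)\<^sup>2) \<le> L\<^sup>2 * M" .
  qed
  have A2: "integrable P (\<lambda>\<omega>. (A a K \<omega>)\<^sup>2)" "expectation (\<lambda>\<omega>. (A a K \<omega>)\<^sup>2) \<le> t * (L\<^sup>2 * M)" for a K
  proof -
    let ?U = "\<lambda>\<omega>. t * (L\<^sup>2 * (\<Sum>l<2 ^ K. t / 2 ^ K * (indicator (C (T K l)) \<omega> * (\<Delta> (T K l) \<omega>)\<^sup>2)))"
    have le: "(A a K \<omega>)\<^sup>2 \<le> ?U \<omega>" for \<omega>
    proof -
      have "(A a K \<omega>)\<^sup>2 \<le> (\<Sum>l<2 ^ K. (t / 2 ^ K * p a K l \<omega>)\<^sup>2) * real (card {..<2 ^ K :: nat})"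
        unfolding A_def by (rule sum_squared_le_sum_of_squares)
      also have "\<dots> = t * (\<Sum>l<2 ^ K. t / 2 ^ K * (p a K l \<omega>)\<^sup>2)"
        by (simp add: sum_distrib_left sum_distrib_right power2_eq_square mult_ac)
      also have "\<dots> \<le> t * (\<Sum>l<2 ^ K. t / 2 ^ K * (L\<^sup>2 * (indicator (C (T K l)) \<omega> * (\<Delta> (T K l) \<omega>)\<^sup>2)))"
        using t by (intro mult_left_mono sum_mono pq2) auto
      also have "\<dots> = ?U \<omega>" by (simp add: sum_distrib_left mult_ac)
      finally show ?thesis .
    qed
    have Ui: "integrable P ?U"
      by (intro integrable_mult_right Bochner_Integration.integrable_sum \<phi>int T0)
    have Am: "A a K \<in> borel_measurable P" unfolding A_def by measurable
    show "integrable P (\<lambda>\<omega>. (A a K \<omega>)\<^sup>2)"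
      by (rule Bochner_Integration.integrable_bound[OF Ui]) (use le Am in \<open>auto intro: order_trans[OF _ abs_ge_self]\<close>)
    have "expectation (\<lambda>\<omega>. (A a K \<omega>)\<^sup>2) \<le> expectation ?U"
      by (rule integral_mono'[OF Ui le]) (rule order_trans[OF zero_le_power2 le])
    also have "\<dots> = t * (L\<^sup>2 * (\<Sum>l<2 ^ K. t / 2 ^ K * \<phi> (T K l)))"
      unfolding \<phi>_def by (simp only: integral_mult_right_zero) (subst Bochner_Integration.integral_sum, auto intro!: integrable_mult_right \<phi>int T0)
    also have "\<dots> \<le> t * (L\<^sup>2 * M)" using t by (intro mult_left_mono M) auto
    finally show "expectation (\<lambda>\<omega>. (A a K \<omega>)\<^sup>2) \<le> t * (L\<^sup>2 * M)" .
  qed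
  define D where "D a K \<omega> = A a K \<omega> + (\<Sum>b\<in>UNIV. N a b K \<omega>)" for a K \<omega>
  let ?d = "real CARD('d)"
  have D2: "integrable P (\<lambda>\<omega>. (D a K \<omega>)\<^sup>2)" "expectation (\<lambda>\<omega>. (D a K \<omega>)\<^sup>2) \<le> 2 * (t + ?d\<^sup>2) * L\<^sup>2 * M" for a K
  proof -
    let ?U = "\<lambda>\<omega>. 2 * (A a K \<omega>)\<^sup>2 + 2 * ((\<Sum>b\<in>UNIV. (N a b K \<omega>)\<^sup>2) * ?d)"
    have le: "(D a K \<omega>)\<^sup>2 \<le> ?U \<omega>" for \<omega>
    proof -
      have "(D a K \<omega>)\<^sup>2 \<le> 2 * (A a K \<omega>)\<^sup>2 + 2 * (\<Sum>b\<in>UNIV. N a b K \<omega>)\<^sup>2"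
        unfolding D_def using sum_squares_bound[of "A a K \<omega>" "\<Sum>b\<in>UNIV. N a b K \<omega>"] by (simp add: power2_sum)
      moreover have "(\<Sum>b\<in>UNIV. N a b K \<omega>)\<^sup>2 \<le> (\<Sum>b\<in>UNIV. (N a b K \<omega>)\<^sup>2) * ?d"
        by (rule sum_squared_le_sum_of_squares)
      ultimately show ?thesis by linarith
    qed
    have Ui: "integrable P ?U"
      by (intro Bochner_Integration.integrable_add integrable_mult_right integrable_mult_left Bochner_Integration.integrable_sum A2 N2)
    have Dm: "D a K \<in> borel_measurable P"
    proof -
      note [measurable] = Nm
      show ?thesis unfolding D_def A_def by measurable
    qed
    show "integrable P (\<lambda>\<omega>. (D a K \<omega>)\<^sup>2)"
      by (rule Bochner_Integration.integrable_bound[OF Ui]) (use le Dm in \<open>auto intro: order_trans[OF _ abs_ge_self]\<close>)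
    have "expectation (\<lambda>\<omega>. (D a K \<omega>)\<^sup>2) \<le> expectation ?U"
      by (rule integral_mono'[OF Ui le]) (rule order_trans[OF zero_le_power2 le])
    also have "\<dots> = 2 * expectation (\<lambda>\<omega>. (A a K \<omega>)\<^sup>2) + 2 * ((\<Sum>b\<in>UNIV. expectation (\<lambda>\<omega>. (N a b K \<omega>)\<^sup>2)) * ?d)"
      using A2(1) N2(1) by simp
    also have "\<dots> \<le> 2 * (t * (L\<^sup>2 * M)) + 2 * ((\<Sum>b\<in>(UNIV::'d set). L\<^sup>2 * M) * ?d)"
      by (intro add_mono mult_left_mono mult_right_mono sum_mono A2 N2) auto
    also have "\<dots> = 2 * (t + ?d\<^sup>2) * L\<^sup>2 * M" by (simp add: power2_eq_square algebra_simps)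
    finally show "expectation (\<lambda>\<omega>. (D a K \<omega>)\<^sup>2) \<le> 2 * (t + ?d\<^sup>2) * L\<^sup>2 * M" .
  qed
  have Ct: "C t \<in> sets P" using CP t by simp
  have V: "vanish_on (C t) (\<lambda>K \<omega>. D a K \<omega> - (Y t \<omega> - X t \<omega>) $ a)" for a
  proof -
    define S where "S Z K \<omega> = (\<Sum>l<2 ^ K. indicator (C (T K l)) \<omega> * (t / 2 ^ K * f (Z (T K l) \<omega>) $ a))
      + (\<Sum>b\<in>UNIV. \<Sum>l<2 ^ K. indicator (C (T K l)) \<omega> * g (Z (T K l) \<omega>) $ a $ b * (\<omega> (T K (Suc l)) $ b - \<omega> (T K l) $ b))"
      for Z K \<omega>
    have VX: "vanish_on (C t) (\<lambda>K \<omega>. S X K \<omega> - (X t \<omega> - x) $ a)"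
      unfolding S_def T_def by (rule sde_riemann_convergence[OF X C C_anti XR t])
    have VY: "vanish_on (C t) (\<lambda>K \<omega>. S Y K \<omega> - (Y t \<omega> - x) $ a)"
      unfolding S_def T_def by (rule sde_riemann_convergence[OF Y C C_anti YR t])
    have DS: "D a K \<omega> = S Y K \<omega> - S X K \<omega>" for K \<omega>
    proof -
      have "A a K \<omega> = (\<Sum>l<2 ^ K. indicator (C (T K l)) \<omega> * (t / 2 ^ K * f (Y (T K l) \<omega>) $ a))
        - (\<Sum>l<2 ^ K. indicator (C (T K l)) \<omega> * (t / 2 ^ K * f (X (T K l) \<omega>) $ a))"
        unfolding A_def p_def sum_subtractf[symmetric] by (intro sum.cong refl) (simp add: algebra_simps)
      moreover have "N a b K \<omega> = (\<Sum>l<2 ^ K. indicator (C (T K l)) \<omega> * g (Y (T K l) \<omega>) $ a $ b * (\<omega> (T K (Suc l)) $ b - \<omega> (T K l) $ b))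
        - (\<Sum>l<2 ^ K. indicator (C (T K l)) \<omega> * g (X (T K l) \<omega>) $ a $ b * (\<omega> (T K (Suc l)) $ b - \<omega> (T K l) $ b))" for b
        unfolding N_def q_def sum_subtractf[symmetric] by (intro sum.cong refl) (simp add: algebra_simps)
      ultimately show ?thesis unfolding D_def S_def by (simp only: sum_subtractf)
    qed
    have "(\<lambda>K \<omega>. D a K \<omega> - (Y t \<omega> - X t \<omega>) $ a)
      = (\<lambda>K \<omega>. S Y K \<omega> - (Y t \<omega> - x) $ a + - (S X K \<omega> - (X t \<omega> - x) $ a))"
      unfolding DS by (intro ext) simp
    then show ?thesis using vanish_on_add[OF Ct VY vanish_on_minus[OF VX]] by (simp only:)
  qed
  have comp: "integrable P (\<lambda>\<omega>. indicator (C t) \<omega> * ((Y t \<omega> - X t \<omega>) $ a)\<^sup>2)"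
    "expectation (\<lambda>\<omega>. indicator (C t) \<omega> * ((Y t \<omega> - X t \<omega>) $ a)\<^sup>2) \<le> 2 * (2 * (t + ?d\<^sup>2) * L\<^sup>2 * M)" for a
  proof -
    have m: "(\<lambda>\<omega>. (Y t \<omega> - X t \<omega>) $ a) \<in> borel_measurable P"
      using t by (intro measurable_compose[OF _ borel_measurable_nth] borel_measurable_diff measurable_F_P[OF XF(1)] measurable_F_P[OF XF(2)]) auto
    have b: "\<bar>(Y t \<omega> - X t \<omega>) $ a\<bar> \<le> 2 * R" if "\<omega> \<in> C t" for \<omega>
      using component_le_norm_cart[of "Y t \<omega> - X t \<omega>" a] \<Delta>R[OF less_imp_le[OF t] that] by (simp add: \<Delta>_def)
    show "integrable P (\<lambda>\<omega>. indicator (C t) \<omega> * ((Y t \<omega> - X t \<omega>) $ a)\<^sup>2)"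
      "expectation (\<lambda>\<omega>. indicator (C t) \<omega> * ((Y t \<omega> - X t \<omega>) $ a)\<^sup>2) \<le> 2 * (2 * (t + ?d\<^sup>2) * L\<^sup>2 * M)"
      by (rule vanish_on_second_moment_le[OF Ct V m b D2], assumption)+
  qed
  have nrm: "(norm v)\<^sup>2 = (\<Sum>a\<in>UNIV. (v $ a)\<^sup>2)" for v :: "real^'n"
    by (simp add: norm_vec_def L2_set_def sum_nonneg)
  have "expectation (\<lambda>\<omega>. indicator (C t) \<omega> * (norm (Y t \<omega> - X t \<omega>))\<^sup>2)
    = (\<Sum>a\<in>UNIV. expectation (\<lambda>\<omega>. indicator (C t) \<omega> * ((Y t \<omega> - X t \<omega>) $ a)\<^sup>2))"
    unfolding nrm sum_distrib_left by (rule Bochner_Integration.integral_sum[OF comp(1)])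
  also have "\<dots> \<le> (\<Sum>a\<in>(UNIV::'n set). 2 * (2 * (t + ?d\<^sup>2) * L\<^sup>2 * M))" by (intro sum_mono comp(2))
  also have "2 * (2 * (t + ?d\<^sup>2) * L\<^sup>2 * M) = 4 * (t + ?d\<^sup>2) * L\<^sup>2 * M" by simp
  finally show ?thesis by (simp only: sum_constant mult.assoc)
qed

text \<open>The stochastic integrals vanish at time 0; this is the initial value for the Gronwall
  argument.\<close>

lemma sde_solution_zero:
  assumes X: "sde_solution P f g x X"
  shows "AE \<omega> in P. X 0 \<omega> = x"
proof -
  obtain J where J: "\<forall>i j. ito_integral P F (\<lambda>t \<omega>. \<omega> t $ j) (\<lambda>u \<omega>. g (X u \<omega>) $ i $ j) (J i j)"
    and eq: "AE \<omega> in P. \<forall>t\<ge>0. \<forall>i. X t \<omega> $ i = x $ i + integral {0..t} (\<lambda>u. f (X u \<omega>) $ i) + (\<Sum>j\<in>UNIV. J i j t \<omega>)"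
    using X unfolding sde_solution_def by (elim conjE exE) (rule that)
  have "AE \<omega> in P. J i j 0 \<omega> = 0" for i j
    by (rule ito_integral_zero[OF J[rule_format]])
  then have "AE \<omega> in P. \<forall>i. \<forall>j. J i j 0 \<omega> = 0" unfolding AE_all_countable by (intro allI)
  then show ?thesis using eq
  proof eventually_elim
    case (elim \<omega>)
    have "X 0 \<omega> $ i = x $ i + integral {0..0} (\<lambda>u. f (X u \<omega>) $ i) + (\<Sum>j\<in>UNIV. J i j 0 \<omega>)" for i
      using elim(2) by (elim allE[of _ 0] impE) (rule order_refl, elim allE[of _ i])
    then show ?case using elim(1) by (simp add: vec_eq_iff)
  qed
qed

text \<open>Localisation uses the events \<open>C R u\<close> that both solutions are bounded by
  \<open>R\<close> up to time \<open>u\<close>: they are adapted, decrease in \<open>u\<close>, and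
  contain any given path once \<open>R\<close> is large. Gronwall's inequality is applied to the
  second moment of the difference on \<open>C R u\<close>; integer \<open>R\<close>, dyadic times
  and continuity then lead to one null set for all \<open>t\<close>.\<close>

theorem sde_unique:
  assumes X: "sde_solution P f g x X" and Y: "sde_solution P f g x Y"
  shows "AE \<omega> in P. \<forall>t\<ge>0. Y t \<omega> = X t \<omega>"
proof -
  have XF: "X u \<in> borel_measurable (F u)" "Y u \<in> borel_measurable (F u)" if "0 \<le> u" for u
    using X Y that by (simp_all add: sde_solution_def)
  have cont: "continuous_on {0..} (\<lambda>u. X u \<omega>)" "continuous_on {0..} (\<lambda>u. Y u \<omega>)" if "\<omega> \<in> space P" for \<omega>
    using X Y that by (simp_all add: sde_solution_def)
  define C where "C R u = {\<omega> \<in> space P. \<forall>v\<in>{0..u}. norm (X v \<omega>) \<le> R} \<inter> {\<omega> \<in> space P. \<forall>v\<in>{0..u}. norm (Y v \<omega>) \<le> R}"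
    for R u :: real
  have C: "C R u \<in> sets (F u)" if "0 \<le> u" for R u
    unfolding C_def by (intro sets.Int running_bound_sets[OF XF(1) cont(1) that] running_bound_sets[OF XF(2) cont(2) that])
  have C_anti: "C R v \<subseteq> C R u" if "u \<le> v" for R u v
    using that by (auto simp: C_def)
  have CR: "norm (X u \<omega>) \<le> R" "norm (Y u \<omega>) \<le> R" if "0 \<le> u" "\<omega> \<in> C R u" for R u \<omega>
    using that by (auto simp: C_def)
  have CP: "C R u \<in> sets P" if "0 \<le> u" for R u by (rule subsetD[OF sets_F_subset C[OF that]])
  have local: "AE \<omega> in P. \<omega> \<in> C R t \<longrightarrow> Y t \<omega> = X t \<omega>" if t: "0 \<le> t" and R: "0 \<le> R" for R t
  proof -
    define Z where "Z u \<omega> = indicator (C R u) \<omega> * (norm (Y u \<omega> - X u \<omega>))\<^sup>2" for u \<omega>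
    \<comment> \<open>The factor of \<open>sde_difference_second_moment_le\<close>, taken at the
      final time \<open>t\<close> because it increases with time.\<close>
    define \<beta> where "\<beta> = real CARD('n) * (4 * (t + (real CARD('d))\<^sup>2) * L\<^sup>2)"
    have \<beta>: "0 \<le> \<beta>" using t by (simp add: \<beta>_def)
    have Zm: "Z u \<in> borel_measurable P" if "0 \<le> u" for u
    proof -
      note [measurable] = CP[OF that] measurable_F_P[OF XF(1)[OF that]] measurable_F_P[OF XF(2)[OF that]]
      show ?thesis unfolding Z_def by measurable
    qed
    have Zb: "0 \<le> Z u \<omega>" "Z u \<omega> \<le> (2 * R)\<^sup>2" if "0 \<le> u" for u \<omega>
    proof -
      have "norm (Y u \<omega> - X u \<omega>) \<le> 2 * R" if "\<omega> \<in> C R u"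
        using norm_triangle_ineq4[of "Y u \<omega>" "X u \<omega>"] CR[OF \<open>0 \<le> u\<close> that] by simp
      then show "0 \<le> Z u \<omega>" "Z u \<omega> \<le> (2 * R)\<^sup>2"
        using power_mono[of "norm (Y u \<omega> - X u \<omega>)" "2 * R" 2] by (auto simp: Z_def indicator_def)
    qed
    have Zi: "integrable P (Z u)" if "0 \<le> u" for u
      by (rule integrable_const_bound[OF _ Zm[OF that]], rule AE_I2) (use Zb[OF that] in \<open>simp add: abs_of_nonneg\<close>)
    have "expectation (Z t) \<le> 0"
    proof (rule riemann_sum_gronwall[where T=t and c="(2 * R)\<^sup>2" and \<beta>=\<beta> and \<phi>="\<lambda>u. expectation (Z u)"])
      show "expectation (Z u) \<le> (2 * R)\<^sup>2" if "0 \<le> u" for u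
        by (rule integral_le_const[OF Zi[OF that]]) (use Zb[OF that] in simp)
      have "AE \<omega> in P. Z 0 \<omega> = 0"
        using sde_solution_zero[OF X] sde_solution_zero[OF Y] by eventually_elim (simp add: Z_def)
      then have "expectation (Z 0) = 0" by (rule integral_eq_zero_AE)
      then show "expectation (Z 0) \<le> 0" by simp
      fix u M assume u: "0 < u" "u \<le> t" and M: "\<And>K. (\<Sum>l<2 ^ K. u / 2 ^ K * expectation (Z (real l * (u / 2 ^ K)))) \<le> M"
      have "expectation (Z u) \<le> real CARD('n) * (4 * (u + (real CARD('d))\<^sup>2) * L\<^sup>2) * M"
        unfolding Z_def
        by (rule sde_difference_second_moment_le[OF X Y C C_anti CR(1) CR(2) u(1) R M[unfolded Z_def[abs_def]]])
      also have "\<dots> \<le> \<beta> * M"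
      proof (rule mult_right_mono)
        show "real CARD('n) * (4 * (u + (real CARD('d))\<^sup>2) * L\<^sup>2) \<le> \<beta>"
          unfolding \<beta>_def using u by (intro mult_left_mono mult_right_mono add_right_mono) auto
        \<comment> \<open>The coarsest sum shows that \<open>M\<close> is nonnegative, so that the
          factor may be enlarged to \<open>\<beta>\<close>.\<close>
        have "0 \<le> (\<Sum>l<2 ^ 0. u / 2 ^ 0 * expectation (Z (real l * (u / 2 ^ 0))))"
          using u Zb(1)[of 0] by (simp add: integral_nonneg_AE)
        then show "0 \<le> M" using M[of 0] by linarith
      qed
      finally show "expectation (Z u) \<le> \<beta> * M" .
    qed (use t \<beta> in simp_all)
    moreover have "0 \<le> expectation (Z t)" by (rule Bochner_Integration.integral_nonneg) (rule Zb(1)[OF t])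
    ultimately have "AE \<omega> in P. Z t \<omega> = 0"
      using integral_nonneg_eq_0_iff_AE[OF Zi[OF t]] Zb(1)[OF t] by simp
    then show ?thesis by eventually_elim (simp add: Z_def indicator_def)
  qed
  have "AE \<omega> in P. \<forall>R j k::nat. \<omega> \<in> C (real R) (real k / 2 ^ j) \<longrightarrow> Y (real k / 2 ^ j) \<omega> = X (real k / 2 ^ j) \<omega>"
    unfolding AE_all_countable by (intro allI local) simp_all
  then show ?thesis using AE_space
  proof eventually_elim
    case (elim \<omega>)
    have dyadic: "Y s \<omega> = X s \<omega>" if s: "s = real k / 2 ^ j" for s and j k :: nat
    proof -
      have "bounded ((\<lambda>u. X u \<omega>) ` {0..s} \<union> (\<lambda>u. Y u \<omega>) ` {0..s})"
        by (intro bounded_Un[THEN iffD2] conjI compact_imp_bounded compact_continuous_image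
            continuous_on_subset[OF cont(1)[OF elim(2)]] continuous_on_subset[OF cont(2)[OF elim(2)]]) auto
      then obtain b where b: "\<forall>z\<in>(\<lambda>u. X u \<omega>) ` {0..s} \<union> (\<lambda>u. Y u \<omega>) ` {0..s}. norm z \<le> b"
        unfolding bounded_iff by (elim exE)
      obtain R :: nat where R: "b \<le> real R" using real_arch_simple[of b] by (elim exE)
      have "norm (X v \<omega>) \<le> real R \<and> norm (Y v \<omega>) \<le> real R" if "v \<in> {0..s}" for v
        using bspec[OF b, of "X v \<omega>"] bspec[OF b, of "Y v \<omega>"] that R by fastforce
      then have "\<omega> \<in> C (real R) s" using elim(2) by (simp add: C_def)
      then show ?thesis using elim(1) unfolding s by blast
    qed
    show ?case
    proof (intro allI impI)
      fix t :: real assume t: "0 \<le> t"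
      have d0: "0 \<le> dyadic_floor j t" for j using dyadic_floor_ge[of 0 t j] t by simp
      have "dyadic_floor j t = real (nat \<lfloor>t * 2 ^ j\<rfloor>) / 2 ^ j" for j using t by (simp add: dyadic_floor_def)
      from dyadic[OF this] have "(\<lambda>j. Y (dyadic_floor j t) \<omega>) = (\<lambda>j. X (dyadic_floor j t) \<omega>)" by (rule ext)
      moreover have "(\<lambda>j. X (dyadic_floor j t) \<omega>) \<longlonglongrightarrow> X t \<omega>"
        by (intro continuous_on_tendsto_compose[OF cont(1)[OF elim(2)] dyadic_floor_tendsto]) (use t d0 in auto)
      moreover have "(\<lambda>j. Y (dyadic_floor j t) \<omega>) \<longlonglongrightarrow> Y t \<omega>"
        by (intro continuous_on_tendsto_compose[OF cont(2)[OF elim(2)] dyadic_floor_tendsto]) (use t d0 in auto)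
      ultimately show "Y t \<omega> = X t \<omega>" using LIMSEQ_unique by metis
    qed
  qed
qed

end

theorem corollary3p4:
  fixes P :: "(real \<Rightarrow> real ^ 'd) measure"
    and f :: "real ^ 'n \<Rightarrow> real ^ 'n"
    and g :: "real ^ 'n \<Rightarrow> real ^ 'd ^ 'n"
  assumes "wiener_measure P"
    and "locally_bounded f" and "\<exists>L. L-lipschitz_on UNIV f"
    and "locally_bounded g" and "\<exists>L. L-lipschitz_on UNIV g"
  shows "\<exists>X :: real ^ 'n \<Rightarrow> real \<Rightarrow> (real \<Rightarrow> real ^ 'd) \<Rightarrow> real ^ 'n.
     (\<forall>x. sde_solution P f g x (X x) \<and>
          (\<forall>Y. sde_solution P f g x Y \<longrightarrow> (AE \<omega> in P. \<forall>t\<ge>0. Y t \<omega> = X x t \<omega>))) \<and>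
     (\<forall>t\<ge>0. flow_map X t \<in> measurable (borel \<Otimes>\<^sub>M P) (borel \<Otimes>\<^sub>M P)) \<and>
     (\<exists>N\<in>null_sets P. \<forall>\<omega>\<in>space P - N. \<forall>x. \<forall>s\<ge>0. \<forall>t\<ge>0.
        (flow_map X t \<circ> flow_map X s) (x, \<omega>) = flow_map X (s + t) (x, \<omega>) \<and>
        (flow_map X s \<circ> flow_map X t) (x, \<omega>) = flow_map X (s + t) (x, \<omega>))"
proof -
  obtain Lf Lg where L: "Lf-lipschitz_on UNIV f" "Lg-lipschitz_on UNIV g" using assms(3,5) by blast
  interpret sde_coeffs P f g "max Lf Lg"
  proof
    show "wiener_measure P" by (rule assms(1))
    show "0 \<le> max Lf Lg" using lipschitz_on_nonneg[OF L(1)] by simp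
    show "norm (f x - f y) \<le> max Lf Lg * norm (x - y)" for x y
      using lipschitz_on_normD[OF L(1), of x y] mult_right_mono[of Lf "max Lf Lg" "norm (x - y)"] by simp
    show "norm (g x - g y) \<le> max Lf Lg * norm (x - y)" for x y
      using lipschitz_on_normD[OF L(2), of x y] mult_right_mono[of Lg "max Lf Lg" "norm (x - y)"] by simp
  qed
  show ?thesis
  proof (intro exI[of _ flow] conjI allI impI bexI[of _ "space P - good"] ballI good_null)
    show "sde_solution P f g x (flow x)" for x by (rule flow_solution)
    show "AE \<omega> in P. \<forall>t\<ge>0. Y t \<omega> = flow x t \<omega>" if "sde_solution P f g x Y" for x Y
      by (rule sde_unique[OF flow_solution that])
    show "flow_map flow t \<in> measurable (borel \<Otimes>\<^sub>M P) (borel \<Otimes>\<^sub>M P)" if "0 \<le> t" for t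
      using that by (rule flow_map_measurable)
    fix \<omega> :: "real \<Rightarrow> real^'d" and x s t assume "\<omega> \<in> space P - (space P - good)" and st: "0 \<le> (s::real)" "0 \<le> (t::real)"
    then have \<omega>: "\<omega> \<in> good" by simp
    show "(flow_map flow t \<circ> flow_map flow s) (x, \<omega>) = flow_map flow (s + t) (x, \<omega>)"
      by (rule flow_map_cocycle[OF \<omega> st])
    show "(flow_map flow s \<circ> flow_map flow t) (x, \<omega>) = flow_map flow (s + t) (x, \<omega>)"
      unfolding add.commute[of s t] by (rule flow_map_cocycle[OF \<omega> st(2,1)])
  qed
qed

end
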